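(* Let $n\ge 1$ and let $\Omega\subsetneq\mathbb{C}^n$ be a domain. Then $\Omega$ is pseudoconvex (i.e. $\Omega$ is a domain of holomorphy, equivalently $\Omega$ is holomorphically convex) if and only if the function $z\mapsto -\log(d_{\partial\Omega}(z))$ is plurisubharmonic on the whole domain $\Omega$.
   Context: A domain is a nonempty connected open set. $d_{\partial\Omega}(z)=\inf_{w\in\partial\Omega}\|z-w\|$ is the Euclidean distance from $z$ to the boundary $\partial\Omega$. A domain $\Omega\subset\mathbb{C}^n$ is a domain of holomorphy if there are no open sets $\Omega_1,\Omega_2$ such that $\Omega_2$ is connected, $\Omega_2\not\subset\Omega$, $\varnothing\neq\Omega_1\subset\Omega_2\cap\Omega$, and for every holomorphic function $u$ on $\Omega$ there is a holomorphic function $u_2$ on $\Omega_2$ with $u=u_2$ on $\Omega_1$. A domain $\Omega\subset\mathbb{C}^n$ is holomorphically convex if for every compact set $K\subset\Omega$ the hull $\hat K=\{z\in\Omega : |f(z)|\le \sup_K|f| \text{ for all } f\in\mathcal{O}(\Omega)\}$ is a compact subset of $\Omega$, where $\mathcal{O}(\Omega)$ is the space of holomorphic functions on $\Omega$. It is a classical fact that these two notions are equivalent. *)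

theory Defs
  imports "HOL-Analysis.Analysis"
begin

definition is_domain :: "'a::topological_space set \<Rightarrow> bool"
  where "is_domain \<Omega> \<longleftrightarrow> \<Omega> \<noteq> {} \<and> open \<Omega> \<and> connected \<Omega>"

text \<open>
  Holomorphy on an open set in several variables: the real Frechet derivative exists
  at each point and is complex linear. (The library's \<open>holomorphic_on\<close> is restricted to
  functions of one complex variable.) Only used for open sets.
\<close>

definition holomorphic_on_Cn :: "(complex ^ 'n \<Rightarrow> complex) \<Rightarrow> (complex ^ 'n) set \<Rightarrow> bool"
    (infixl "holomorphic'_on'_Cn" 50)
  where "f holomorphic_on_Cn \<Omega> \<longleftrightarrow>
    (\<forall>z\<in>\<Omega>. \<exists>f'. (f has_derivative f') (at z) \<and> Vector_Spaces.linear (*s) (*) f')"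

definition domain_of_holomorphy :: "(complex ^ 'n) set \<Rightarrow> bool"
  where "domain_of_holomorphy \<Omega> \<longleftrightarrow> is_domain \<Omega> \<and>
    \<not> (\<exists>\<Omega>\<^sub>1 \<Omega>\<^sub>2. open \<Omega>\<^sub>1 \<and> open \<Omega>\<^sub>2 \<and> connected \<Omega>\<^sub>2 \<and> \<not> \<Omega>\<^sub>2 \<subseteq> \<Omega> \<and>
         \<Omega>\<^sub>1 \<noteq> {} \<and> \<Omega>\<^sub>1 \<subseteq> \<Omega>\<^sub>2 \<inter> \<Omega> \<and>
         (\<forall>u. u holomorphic_on_Cn \<Omega> \<longrightarrow>
            (\<exists>u\<^sub>2. u\<^sub>2 holomorphic_on_Cn \<Omega>\<^sub>2 \<and> (\<forall>z\<in>\<Omega>\<^sub>1. u z = u\<^sub>2 z))))"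

text \<open>
  The supremum is taken in the extended reals, so that the hull of the empty set is empty.
\<close>

definition holomorphic_hull :: "(complex ^ 'n) set \<Rightarrow> (complex ^ 'n) set \<Rightarrow> (complex ^ 'n) set"
  where "holomorphic_hull \<Omega> K =
    {z\<in>\<Omega>. \<forall>f. f holomorphic_on_Cn \<Omega> \<longrightarrow> ereal (norm (f z)) \<le> (SUP w\<in>K. ereal (norm (f w)))}"

definition holomorphically_convex :: "(complex ^ 'n) set \<Rightarrow> bool"
  where "holomorphically_convex \<Omega> \<longleftrightarrow> is_domain \<Omega> \<and>
    (\<forall>K. compact K \<and> K \<subseteq> \<Omega> \<longrightarrow> compact (holomorphic_hull \<Omega> K))"

definition usc_on :: "'a::topological_space set \<Rightarrow> ('a \<Rightarrow> ereal) \<Rightarrow> bool"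
  where "usc_on S u \<longleftrightarrow> (\<forall>c. openin (top_of_set S) {x\<in>S. u x < c})"

text \<open>
  The mean of an extended-real function over the circle with centre \<open>a\<close> and radius \<open>r\<close>,
  as the difference of the integrals of the positive and the negative part
  (\<open>e2ennreal\<close> maps negative arguments to 0). For an upper semicontinuous function with values
  below \<open>\<infinity>\<close> the first integral is finite, so the mean is well-defined, possibly \<open>-\<infinity>\<close>.
\<close>

definition circle_mean :: "(complex \<Rightarrow> ereal) \<Rightarrow> complex \<Rightarrow> real \<Rightarrow> ereal"
  where "circle_mean u a r =
    (enn2ereal (\<integral>\<^sup>+\<theta>\<in>{0..2 * pi}. e2ennreal (u (a + of_real r * cis \<theta>)) \<partial>lborel)
     - enn2ereal (\<integral>\<^sup>+\<theta>\<in>{0..2 * pi}. e2ennreal (- u (a + of_real r * cis \<theta>)) \<partial>lborel))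
    / ereal (2 * pi)"

text \<open>
  Subharmonic and plurisubharmonic functions take values in \<open>[-\<infinity>, \<infinity>)\<close>;
  the constant \<open>-\<infinity>\<close> is admitted.
\<close>

definition subharmonic_on :: "complex set \<Rightarrow> (complex \<Rightarrow> ereal) \<Rightarrow> bool"
  where "subharmonic_on U u \<longleftrightarrow>
    usc_on U u \<and> (\<forall>a\<in>U. u a < \<infinity>) \<and>
    (\<forall>a r. 0 < r \<and> cball a r \<subseteq> U \<longrightarrow> u a \<le> circle_mean u a r)"

definition plurisubharmonic_on :: "(complex ^ 'n) set \<Rightarrow> (complex ^ 'n \<Rightarrow> ereal) \<Rightarrow> bool"
  where "plurisubharmonic_on \<Omega> u \<longleftrightarrow>
    usc_on \<Omega> u \<and> (\<forall>z\<in>\<Omega>. u z < \<infinity>) \<and>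
    (\<forall>z w. subharmonic_on {\<tau>. z + \<tau> *s w \<in> \<Omega>} (\<lambda>\<tau>. u (z + \<tau> *s w)))"

definition boundary_dist :: "'a::metric_space set \<Rightarrow> 'a \<Rightarrow> real"
  where "boundary_dist \<Omega> z = infdist z (frontier \<Omega>)"

end

theory Submission
  imports Defs "HOL-Complex_Analysis.Complex_Analysis"
begin

text \<open>The three properties are shown to imply each other in a circle. In a domain of holomorphy all holomorphic
  functions extend from the boundary of an analytic disc to a neighbourhood of the disc of the same width
  (maximum principle for Taylor coefficients), which bounds \<open>- ln d\<close> on the disc by harmonic majorants of its
  boundary values. If \<open>- ln d\<close> is plurisubharmonic, weighted \<open>L\<^sup>2\<close> estimates of Hoermander type (the
  Morrey--Kohn--Hoermander inequality on sublevel sets of smoothed exhaustions, and Riesz representation)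
  solve the \<open>\<partial>\<close>-bar equation and give holomorphic functions peaking at any point where the exhaustion
  \<open>- ln d + |z|\<^sup>2\<close> exceeds its maximum on a compact set; hence hulls are compact. Finally, holomorphic
  convexity gives a function that is unbounded near every boundary point.\<close>

text \<open>The obstacle is regularity. The function - ln d is merely continuous, whereas the
  estimates for the \<partial>-bar equation ask for a C2 weight and for forms of compact support. A
  C2 weight is obtained by truncating and mollifying the exhaustion near the supports of the data;
  the resulting bound contains neither derivatives of the weight nor the auxiliary open set, so the
  smoothing can be removed afterwards. Compact support is obtained by cutting off along the
  exhaustion, and an extra weight that vanishes where the data live pays for the gradient of the
  cutoff. Kernels, cutoffs and growing weights are powers of positive parts: no more than two
  derivatives ever occur, and second derivatives of test functions are exchanged only under the
  integral. The Hilbert space is real; a complex identity is recovered from its real part by testing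
  with \<i> times the test function as well. A weak solution is evaluated through its means over
  small balls alone, because these do not depend on the radius.\<close>

section \<open>Complex scaling, complex linearity and restriction to lines\<close>

lemma norm_vector_scalar_mult: "norm (c *s (x::complex^'n)) = cmod c * norm x"
 by (simp add: norm_vec_def L2_set_def norm_mult power_mult_distrib sum_distrib_left[symmetric] real_sqrt_mult)

lemma bounded_linear_vector_scalar_mult_left: "bounded_linear (%c. c *s (w::complex^'n))"
proof (rule bounded_linear_intro[where K="norm w"])
 show "norm (c *s w) <= norm c * norm w" for c by (simp add: norm_vector_scalar_mult)
qed (auto simp: vec_eq_iff algebra_simps)

lemma bounded_linear_vector_scalar_mult_right: "bounded_linear (%w. c *s (w::complex^'n))"
proof (rule bounded_linear_intro[where K="cmod c"])
 show "norm (c *s w) <= norm w * cmod c" for w :: "complex^'n" by (simp add: norm_vector_scalar_mult)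
qed (auto simp: vec_eq_iff algebra_simps)

lemma continuous_on_vector_scalar_mult [continuous_intros]:
 "continuous_on S f ==> continuous_on S g ==> continuous_on S (%x. f x *s (g x::complex^'n))"
 unfolding vector_scalar_mult_def by (intro continuous_intros)

lemma clinear_iff:
 "Vector_Spaces.linear (*s) (*) (f::complex^'n => complex) \<longleftrightarrow>
 (\<forall>x y. f (x + y) = f x + f y) \<and> (\<forall>c x. f (c *s x) = c * f x)"
 by (auto simp: Vector_Spaces.linear_def module_hom_def module_hom_axioms_def vec.vector_space_axioms
 vec.module_axioms vector_space_over_itself.vector_space_axioms vector_space_over_itself.module_axioms)

lemma open_line_preimage:
 "open Om ==> open {ta. (z::complex^'n) + ta *s w : Om}"
proof -
 assume "open Om"
 then have "open ((%ta. z + ta *s w) -` Om)"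
 by (intro open_vimage) (auto intro!: continuous_intros)
 then show ?thesis by (simp add: vimage_def)
qed

lemma holomorphic_on_Cn_imp_continuous_on: "f holomorphic_on_Cn Om ==> continuous_on Om f"
 unfolding holomorphic_on_Cn_def
 by (meson continuous_at_imp_continuous_on has_derivative_continuous)

lemma holomorphic_on_Cn_subset: "f holomorphic_on_Cn Om ==> S \<subseteq> Om ==> f holomorphic_on_Cn S"
 unfolding holomorphic_on_Cn_def by blast

text \<open>Chain rule. A derivative of the form \<open>%h. h *s a\<close> is a complex linear map
  from the complex numbers, so one-variable theory becomes available along every analytic
  disc.\<close>

lemma holomorphic_on_Cn_compose_curve:
 fixes f :: "complex^'n => complex"
 assumes f: "f holomorphic_on_Cn Om"
 and A: "!!ta. ta : S ==> A ta : Om \<and> (\<exists>a. (A has_derivative (%h. h *s a)) (at ta))"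
 shows "(%ta. f (A ta)) holomorphic_on S"
proof -
 have "(%ta. f (A ta)) field_differentiable (at ta within S)" if taS: "ta : S" for ta
 proof -
 obtain a where a: "(A has_derivative (%h. h *s a)) (at ta)" and inOm: "A ta : Om"
 using A[of ta] taS by blast
 obtain f' where f': "(f has_derivative f') (at (A ta))" and lin: "Vector_Spaces.linear (*s) (*) f'"
 using f inOm unfolding holomorphic_on_Cn_def by blast
 have "((%ta. f (A ta)) has_derivative (%h. f' (h *s a))) (at ta)"
 by (rule has_derivative_compose[OF a f'])
 moreover have "(%h. f' (h *s a)) = (*) (f' a)"
 using lin by (auto simp: clinear_iff mult.commute)
 ultimately have "((%ta. f (A ta)) has_field_derivative f' a) (at ta)"
 by (simp add: has_field_derivative_def)
 then show ?thesis
 using field_differentiable_at_within field_differentiable_def by blast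
 qed
 then show ?thesis by (simp add: holomorphic_on_def)
qed

lemma holomorphic_on_Cn_line:
 fixes f :: "complex^'n => complex"
 assumes f: "f holomorphic_on_Cn Om"
 shows "(%ta. f (z + ta *s w)) holomorphic_on {ta. z + ta *s w : Om}"
proof (rule holomorphic_on_Cn_compose_curve[OF f])
 fix ta assume "ta : {ta. z + ta *s w : Om}"
 moreover have "((%ta. z + ta *s w) has_derivative (%h. 0 + h *s w)) (at ta)"
 by (intro has_derivative_add has_derivative_const
 bounded_linear.has_derivative[OF bounded_linear_vector_scalar_mult_left] has_derivative_ident)
 ultimately show "z + ta *s w : Om \<and> (\<exists>a. ((%ta. z + ta *s w) has_derivative (%h. h *s a)) (at ta))"
 by auto
qed

section \<open>Taylor coefficients of one-variable functions that depend on a parameter\<close>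

text \<open>Cauchy's inequality bounds the j-th coefficient by M / r^j, so the tail is dominated by
  a geometric series with ratio q = |ta| / r <= 1/2, and 1 / (1 - q) <= 2.\<close>

lemma taylor_remainder_bound:
 assumes hol: "g holomorphic_on S" and S: "open S" "cball 0 r \<subseteq> S" and r: "0 < r"
 and M: "!!ta. cmod ta <= r ==> cmod (g ta) <= M" and ta: "cmod ta <= r / 2"
 shows "cmod (g ta - (\<Sum>j<k. (deriv ^^ j) g 0 / fact j * ta ^ j)) <= 2 * M * (cmod ta / r) ^ k"
proof -
 define a where "a j = (deriv ^^ j) g 0 / fact j" for j
 define q where "q = cmod ta / r"
 have q: "0 <= q" "q <= 1/2" using ta r by (auto simp: q_def field_simps)
 have M0: "0 <= M" using M[of 0] r norm_ge_zero[of "g 0"] by (simp del: norm_ge_zero)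
 have holb: "g holomorphic_on ball 0 r" using hol S by (meson ball_subset_cball holomorphic_on_subset order_trans)
 have cont: "continuous_on (cball 0 r) g"
 using hol S by (meson continuous_on_subset holomorphic_on_imp_continuous_on)
 have ab: "cmod (a j) <= M / r ^ j" for j
 proof -
 have "cmod ((deriv ^^ j) g 0) <= fact j * M / r ^ j"
 by (rule Cauchy_inequality[OF holb cont r]) (simp add: M)
 then show ?thesis by (simp add: a_def norm_divide field_simps)
 qed
 have sums: "(%j. a j * ta ^ j) sums g ta"
 using holomorphic_power_series[OF holb, of ta] ta r by (simp add: a_def)
 have sums': "(%j. a (j + k) * ta ^ (j + k)) sums (g ta - (\<Sum>j<k. a j * ta ^ j))"
 by (rule sums_split_initial_segment[OF sums])
 have bnd: "cmod (a (j + k) * ta ^ (j + k)) <= M * q ^ k * q ^ j" for j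
 proof -
 have "cmod (a (j + k) * ta ^ (j + k)) <= M / r ^ (j+k) * cmod ta ^ (j+k)"
 unfolding norm_mult norm_power by (rule mult_right_mono[OF ab]) simp
 also have "... = M * q ^ k * q ^ j" by (simp add: q_def power_divide power_add ac_simps)
 finally show ?thesis .
 qed
 have geo: "(%j. M * q ^ k * q ^ j) sums (M * q ^ k * (1 / (1 - q)))"
 using q by (intro sums_mult geometric_sums) auto
 have "cmod (g ta - (\<Sum>j<k. a j * ta ^ j)) <= M * q ^ k * (1 / (1 - q))"
 using norm_suminf_le[OF bnd sums_summable[OF geo]] sums_unique[OF sums'] sums_unique[OF geo] by simp
 also have "... <= M * q ^ k * 2"
 using q M0 by (intro mult_left_mono) (auto simp: field_simps)
 finally show ?thesis by (simp add: a_def q_def)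
qed

text \<open>Subtracting the terms below k and dividing by the k-th power leaves the k-th coefficient
  up to an error of first order, by the remainder bound for k + 1. The points r / (n + 2) tend to 0
  and stay within r / 2, where that bound holds. Coefficients thus are uniform limits in the
  parameter, and nothing has to be differentiated under an integral sign.\<close>

lemma taylor_coeff_uniform_limit:
 fixes F :: "'s => complex => complex"
 assumes r: "0 < r"
 and hol: "!!s. s : S ==> \<exists>U. open U \<and> cball 0 r \<subseteq> U \<and> F s holomorphic_on U"
 and M: "!!s ta. s : S ==> cmod ta <= r ==> cmod (F s ta) <= M"
 shows "uniform_limit S
 (%n s. (F s (of_real (r / real (n + 2))) - (\<Sum>j<k. (deriv ^^ j) (F s) 0 / fact j * of_real (r / real (n + 2)) ^ j))
 / of_real (r / real (n + 2)) ^ k)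
 (%s. (deriv ^^ k) (F s) 0 / fact k) sequentially"
proof (rule uniform_limitI)
 fix e :: real assume e: "e > 0"
 define l where "l n = r / real (n + 2)" for n
 have l: "l n > 0" "l n <= r / 2" for n using r by (auto simp: l_def field_simps)
 have "(%n. 2 * M * l n / r ^ (k+1)) \<longlonglongrightarrow> 0"
 proof -
 have "(%n. 2 * M * r / r ^ (k+1) * inverse (real (Suc (Suc n)))) \<longlonglongrightarrow> 2 * M * r / r ^ (k+1) * 0"
 by (intro tendsto_intros LIMSEQ_Suc[OF LIMSEQ_inverse_real_of_nat])
 moreover have "2 * M * r / r ^ (k+1) * inverse (real (Suc (Suc n))) = 2 * M * l n / r ^ (k+1)" for n
 by (simp add: l_def divide_inverse ac_simps)
 ultimately show ?thesis by simp
 qed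
 then have "\<forall>\<^sub>F n in sequentially. 2 * M * l n / r ^ (k+1) < e"
 using e by (rule order_tendstoD)
 then show "\<forall>\<^sub>F n in sequentially. \<forall>s\<in>S.
 dist ((F s (of_real (r / real (n + 2))) - (\<Sum>j<k. (deriv ^^ j) (F s) 0 / fact j * of_real (r / real (n + 2)) ^ j))
 / of_real (r / real (n + 2)) ^ k) ((deriv ^^ k) (F s) 0 / fact k) < e"
 proof eventually_elim
 case (elim n)
 show ?case
 proof
 fix s assume s: "s : S"
 obtain U where U: "open U" "cball 0 r \<subseteq> U" "F s holomorphic_on U" using hol[OF s] by blast
 let ?ta = "complex_of_real (l n)"
 let ?a = "%j. (deriv ^^ j) (F s) 0 / fact j"
 have tau: "cmod ?ta = l n" using l[of n] by simp
 have "cmod (F s ?ta - (\<Sum>j<Suc k. ?a j * ?ta ^ j)) <= 2 * M * (cmod ?ta / r) ^ Suc k"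
 using tau l by (intro taylor_remainder_bound[OF U(3,1,2) r]) (auto intro: M[OF s])
 then have *: "cmod (F s ?ta - (\<Sum>j<k. ?a j * ?ta ^ j) - ?a k * ?ta ^ k) <= 2 * M * (l n / r) ^ Suc k"
 using l(1)[of n] by (simp add: tau algebra_simps)
 have "(F s ?ta - (\<Sum>j<k. ?a j * ?ta ^ j)) / ?ta ^ k - ?a k
 = (F s ?ta - (\<Sum>j<k. ?a j * ?ta ^ j) - ?a k * ?ta ^ k) / ?ta ^ k"
 using l[of n] by (simp add: diff_divide_distrib)
 then have "dist ((F s ?ta - (\<Sum>j<k. ?a j * ?ta ^ j)) / ?ta ^ k) (?a k)
 = cmod (F s ?ta - (\<Sum>j<k. ?a j * ?ta ^ j) - ?a k * ?ta ^ k) / l n ^ k"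
 using l(1)[of n] by (simp add: dist_norm norm_divide norm_power)
 also have "... <= 2 * M * (l n / r) ^ Suc k / l n ^ k"
 using * l[of n] by (intro divide_right_mono) auto
 also have "... = 2 * M * l n / r ^ (k+1)"
 using l[of n] by (simp add: power_divide field_simps)
 also have "... < e" by fact
 finally show "dist ((F s (of_real (r / real (n + 2))) - (\<Sum>j<k. (deriv ^^ j) (F s) 0 / fact j * of_real (r / real (n + 2)) ^ j))
 / of_real (r / real (n + 2)) ^ k) (?a k) < e"
 by (simp add: l_def)
 qed
 qed
qed

text \<open>Strong induction on k: the approximants of the k-th coefficient involve only values of
  \<open>F s\<close> and lower coefficients, and uniform limits preserve continuity.\<close>

lemma taylor_coeff_continuous_on:
 fixes F :: "'s::topological_space => complex => complex"
 assumes r: "0 < r"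
 and hol: "!!s. s : S ==> \<exists>U. open U \<and> cball 0 r \<subseteq> U \<and> F s holomorphic_on U"
 and M: "!!s ta. s : S ==> cmod ta <= r ==> cmod (F s ta) <= M"
 and cont: "!!ta. cmod ta <= r ==> continuous_on S (%s. F s ta)"
 shows "continuous_on S (%s. (deriv ^^ k) (F s) 0 / fact k)"
proof (induction k rule: less_induct)
 case (less k)
 have ul: "uniform_limit S
 (%n s. (F s (of_real (r / real (n + 2))) - (\<Sum>j<k. (deriv ^^ j) (F s) 0 / fact j * of_real (r / real (n + 2)) ^ j))
 / of_real (r / real (n + 2)) ^ k)
 (%s. (deriv ^^ k) (F s) 0 / fact k) sequentially"
 by (rule taylor_coeff_uniform_limit[OF r hol M])
 have small: "cmod (of_real (r / real (n + 2))) <= r" for n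
 proof -
 have "cmod (of_real (r / real (n + 2))) = r / real (n + 2)" using r by (simp only: norm_of_real) simp
 moreover have "r / real (n + 2) <= r / 1" using r by (intro divide_left_mono) auto
 ultimately show ?thesis by simp
 qed
 have nz: "complex_of_real (r / real (n + 2)) ~= 0" for n
 using r by (simp only: of_real_eq_0_iff) simp
 show ?case
 proof (rule uniform_limit_theorem[OF _ ul])
 show "\<forall>\<^sub>F n in sequentially. continuous_on S
 (%s. (F s (of_real (r / real (n + 2))) - (\<Sum>j<k. (deriv ^^ j) (F s) 0 / fact j * of_real (r / real (n + 2)) ^ j))
 / of_real (r / real (n + 2)) ^ k)"
 by (rule always_eventually, rule allI, rule continuous_on_divide[OF continuous_on_diff[OF cont[OF small]
 continuous_on_sum[OF continuous_on_mult[OF less continuous_on_const]]] continuous_on_const])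
 (use nz in auto)
 qed auto
qed

text \<open>The same induction, with Weierstrass' theorem on uniform limits of holomorphic
  functions.\<close>

lemma taylor_coeff_holomorphic_on:
 fixes F :: "complex => complex => complex"
 assumes r: "0 < r" and S: "open S"
 and hol: "!!s. s : S ==> \<exists>U. open U \<and> cball 0 r \<subseteq> U \<and> F s holomorphic_on U"
 and M: "!!s ta. s : S ==> cmod ta <= r ==> cmod (F s ta) <= M"
 and hols: "!!ta. cmod ta <= r ==> (%s. F s ta) holomorphic_on S"
 shows "(%s. (deriv ^^ k) (F s) 0 / fact k) holomorphic_on S"
proof (induction k rule: less_induct)
 case (less k)
 have ul: "uniform_limit S
 (%n s. (F s (of_real (r / real (n + 2))) - (\<Sum>j<k. (deriv ^^ j) (F s) 0 / fact j * of_real (r / real (n + 2)) ^ j))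
 / of_real (r / real (n + 2)) ^ k)
 (%s. (deriv ^^ k) (F s) 0 / fact k) sequentially"
 by (rule taylor_coeff_uniform_limit[OF r hol M])
 have small: "cmod (of_real (r / real (n + 2))) <= r" for n
 proof -
 have "cmod (of_real (r / real (n + 2))) = r / real (n + 2)" using r by (simp only: norm_of_real) simp
 moreover have "r / real (n + 2) <= r / 1" using r by (intro divide_left_mono) auto
 ultimately show ?thesis by simp
 qed
 have nz: "complex_of_real (r / real (n + 2)) ~= 0" for n
 using r by (simp only: of_real_eq_0_iff) simp
 show ?case
 proof (rule holomorphic_uniform_sequence[OF S])
 show "(%s. (F s (of_real (r / real (n + 2))) - (\<Sum>j<k. (deriv ^^ j) (F s) 0 / fact j * of_real (r / real (n + 2)) ^ j))
 / of_real (r / real (n + 2)) ^ k) holomorphic_on S" for n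
 by (rule holomorphic_on_divide[OF holomorphic_on_diff[OF hols[OF small]
 holomorphic_on_sum[OF holomorphic_on_mult[OF less holomorphic_on_const]]] holomorphic_on_const])
 (use nz in auto)
 show "\<exists>d>0. cball x d \<subseteq> S \<and> uniform_limit (cball x d) (%n s. (F s (of_real (r / real (n + 2))) - (\<Sum>j<k. (deriv ^^ j) (F s) 0 / fact j * of_real (r / real (n + 2)) ^ j))
 / of_real (r / real (n + 2)) ^ k) (%s. (deriv ^^ k) (F s) 0 / fact k) sequentially" if "x : S" for x
 proof -
 obtain d where "d > 0" "cball x d \<subseteq> S" using S \<open>x : S\<close> open_contains_cball by blast
 then show ?thesis using uniform_limit_on_subset[OF ul] by blast
 qed
 qed
qed

section \<open>Holomorphic functions of several variables: Osgood's lemma and closure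
  properties\<close>

text \<open>Osgood's lemma, in the form that continuity and holomorphy on all complex lines suffice.\<close>

lemma holomorphic_on_CnI:
 fixes f :: "complex^'n => complex"
 assumes Om: "open Om" and cont: "continuous_on Om f"
 and hol: "!!z w. (%ta. f (z + ta *s w)) holomorphic_on {ta. z + ta *s w : Om}"
 shows "f holomorphic_on_Cn Om"
 unfolding holomorphic_on_Cn_def
proof
 fix z assume z: "z : Om"
 obtain R0 where R0: "R0 > 0" "cball z R0 \<subseteq> Om" using Om z open_contains_cball by blast
 \<comment> \<open>Half the radius: a base point in \<open>cball z R\<close> and a further
   displacement of size at most R together stay in \<open>cball z R0\<close>, where f is bounded by
   M.\<close>
 define R where "R = R0 / 2"
 have R: "R > 0" using R0 by (simp add: R_def)
 have "compact (f ` cball z R0)"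
 using cont R0 by (intro compact_continuous_image continuous_on_subset[OF cont]) auto
 then obtain M where M: "!!x. x : cball z R0 ==> cmod (f x) <= M"
 by (meson bounded_iff compact_imp_bounded imageI)
 have M0: "0 <= M" using M[of z] R0 by (meson centre_in_cball less_imp_le norm_ge_zero order_trans)
 define D where "D c w = deriv (%ta. f (c + ta *s w)) 0" for c w
 have inR: "c + ta *s w : cball z R0" if "c : cball z R" "cmod ta * norm w <= R" for c ta w
 proof -
 have "dist z (c + ta *s w) <= dist z c + norm (ta *s w)"
 using norm_triangle_ineq[of "c - z" "ta *s w"] by (simp add: dist_norm norm_minus_commute algebra_simps)
 then show ?thesis using that by (simp add: norm_vector_scalar_mult R_def)
 qed
 have rem: "cmod (f (c + ta *s w) - (\<Sum>j<k. (deriv ^^ j) (%ta. f (c + ta *s w)) 0 / fact j * ta ^ j))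
 <= 2 * M * (cmod ta * norm w / R) ^ k"
 if c: "c : cball z R" and t: "cmod ta * norm w <= R / 2" and w: "w ~= 0" for c ta w k
 proof -
 have "cmod (f (c + ta *s w) - (\<Sum>j<k. (deriv ^^ j) (%ta. f (c + ta *s w)) 0 / fact j * ta ^ j))
 <= 2 * M * (cmod ta / (R / norm w)) ^ k"
 proof (rule taylor_remainder_bound[OF hol open_line_preimage[OF Om]])
 show "cball 0 (R / norm w) \<subseteq> {ta. c + ta *s w : Om}"
 using inR[OF c] R0(2) w by (auto simp: field_simps subset_iff)
 show "cmod (f (c + ta *s w)) <= M" if "cmod ta <= R / norm w" for ta
 using that inR[OF c] w by (intro M) (auto simp: field_simps)
 qed (use R t w in \<open>auto simp: field_simps\<close>)
 then show ?thesis by simp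
 qed
 have rem2: "cmod (f (c + ta *s w) - f c - ta * D c w) <= 2 * M * (cmod ta * norm w / R)^2"
 if "c : cball z R" "cmod ta * norm w <= R / 2" "w ~= 0" for c ta w
 using rem[OF that, of 2] by (simp add: D_def numeral_2_eq_2 algebra_simps)
 have Dlim: "((%ta. (f (z + ta *s w) - f z) / ta) \<longlongrightarrow> D z w) (at 0)" for w
 proof -
 have "(%ta. f (z + ta *s w)) field_differentiable (at 0)"
 using hol[of z w] open_line_preimage[OF Om, of z w] z
 by (simp add: holomorphic_on_open field_differentiable_def)
 then have "((%ta. f (z + ta *s w)) has_field_derivative D z w) (at 0)"
 by (simp add: D_def field_differentiable_derivI)
 then show ?thesis by (simp add: has_field_derivative_iff)
 qed
 have Dcont: "continuous_on (cball z R) (%c. D c w)" for w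
 proof (cases "w = 0")
 case False
 have "continuous_on (cball z R) (%c. (deriv ^^ 1) (%ta. f (c + ta *s w)) 0 / fact 1)"
 proof (rule taylor_coeff_continuous_on)
 show "0 < R / norm w" using R False by simp
 show "\<exists>U. open U \<and> cball 0 (R / norm w) \<subseteq> U \<and> (%ta. f (c + ta *s w)) holomorphic_on U"
 if "c : cball z R" for c
 using inR[OF that] R0(2) False
 by (intro exI[of _ "{ta. c + ta *s w : Om}"] conjI hol open_line_preimage[OF Om])
 (auto simp: field_simps subset_iff)
 show "cmod (f (c + ta *s w)) <= M" if "c : cball z R" "cmod ta <= R / norm w" for c ta
 using that inR False by (intro M) (auto simp: field_simps)
 show "continuous_on (cball z R) (%c. f (c + ta *s w))" if "cmod ta <= R / norm w" for ta
 using inR that False R0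
 by (intro continuous_on_compose2[OF cont] continuous_intros) (fastforce simp: field_simps subset_iff)
 qed
 then show ?thesis by (simp add: D_def)
 qed (simp add: D_def)
 have Dscale: "D z (s *s w) = s * D z w" for s w
 proof (cases "s = 0")
 case False
 have "((%ta. (f (z + (ta * s) *s w) - f z) / (ta * s)) \<longlongrightarrow> D z w) (at 0)"
 proof (rule filterlim_compose[OF Dlim])
 show "filterlim (%ta. ta * s) (at 0) (at 0)"
 using False by (auto simp: filterlim_at eventually_at intro!: tendsto_eq_intros exI[of _ 1])
 qed
 then have "((%ta. s * ((f (z + (ta * s) *s w) - f z) / (ta * s))) \<longlongrightarrow> s * D z w) (at 0)"
 by (intro tendsto_intros)
 then have "((%ta. (f (z + ta *s (s *s w)) - f z) / ta) \<longlongrightarrow> s * D z w) (at 0)"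
 using False by (simp add: vec.scale_scale)
 then show ?thesis using Dlim LIM_unique by blast
 qed (simp add: D_def)
 \<comment> \<open>The increment to z + ta (v + w) is split at z + ta v. The second piece is ta
   times the derivative at the moved base point, with a quadratic error that is uniform in the base
   point; continuity of \<open>D\<close> in the base point gives the limit.\<close>
 have Dadd: "D z (v + w) = D z v + D z w" for v w
 proof (cases "w = 0")
 case False
 have dz: "((%ta. D (z + ta *s v) w) \<longlongrightarrow> D z w) (at 0)"
 proof -
 have "isCont (%c. D c w) z"
 using continuous_on_interior[OF Dcont, of z w] R by simp
 moreover have "((%ta. z + ta *s v) \<longlongrightarrow> z + 0 *s v) (at 0)"
 by (intro tendsto_intros bounded_linear.tendsto[OF bounded_linear_vector_scalar_mult_left])
 ultimately show ?thesis
 using isCont_tendsto_compose by fastforce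
 qed
 have err: "((%ta. (f (z + ta *s v + ta *s w) - f (z + ta *s v)) / ta - D (z + ta *s v) w) \<longlongrightarrow> 0) (at 0)"
 proof (rule Lim_null_comparison)
 define d where "d = R / (2 * (norm v + norm w))"
 have d: "d > 0" using R False by (auto simp: d_def intro!: divide_pos_pos add_nonneg_pos)
 have "norm ((f (z + ta *s v + ta *s w) - f (z + ta *s v)) / ta - D (z + ta *s v) w)
 <= 2 * M * (norm w / R)^2 * cmod ta" if "ta ~= 0" "cmod ta < d" for ta
 proof -
 have "cmod ta * (norm v + norm w) <= R / 2"
 using that False by (simp add: d_def field_simps add_nonneg_pos)
 then have le: "cmod ta * norm v + cmod ta * norm w <= R / 2" by (simp add: algebra_simps)
 have n: "0 <= cmod ta * norm v" "0 <= cmod ta * norm w" by auto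
 have "cmod (f ((z + ta *s v) + ta *s w) - f (z + ta *s v) - ta * D (z + ta *s v) w) <= 2 * M * (cmod ta * norm w / R)^2"
 proof (rule rem2)
 have "cmod ta * norm v <= R" using le n R by linarith
 then show "z + ta *s v : cball z R" by (simp add: dist_norm norm_vector_scalar_mult)
 show "cmod ta * norm w <= R / 2" using le n by linarith
 qed (use False in auto)
 moreover have "(f (z + ta *s v + ta *s w) - f (z + ta *s v)) / ta - D (z + ta *s v) w
 = (f ((z + ta *s v) + ta *s w) - f (z + ta *s v) - ta * D (z + ta *s v) w) / ta"
 using that by (simp add: field_simps)
 ultimately have "cmod ((f (z + ta *s v + ta *s w) - f (z + ta *s v)) / ta - D (z + ta *s v) w) <= 2 * M * (cmod ta * norm w / R)^2 / cmod ta"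
 by (simp add: norm_divide divide_right_mono)
 also have "... = 2 * M * (norm w / R)^2 * cmod ta"
 using that by (simp add: power2_eq_square field_simps)
 finally show ?thesis .
 qed
 then show "\<forall>\<^sub>F ta in at 0. norm ((f (z + ta *s v + ta *s w) - f (z + ta *s v)) / ta - D (z + ta *s v) w)
 <= 2 * M * (norm w / R)^2 * cmod ta"
 unfolding eventually_at using d by (intro exI[of _ d]) (auto simp: dist_norm)
 show "((%ta. 2 * M * (norm w / R)\<^sup>2 * cmod ta) \<longlongrightarrow> 0) (at 0)"
 by (auto intro!: tendsto_eq_intros)
 qed
 have "((%ta. ((f (z + ta *s v + ta *s w) - f (z + ta *s v)) / ta - D (z + ta *s v) w) + D (z + ta *s v) w
 + (f (z + ta *s v) - f z) / ta) \<longlongrightarrow> 0 + D z w + D z v) (at 0)"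
 by (intro tendsto_add err dz Dlim)
 moreover have "((f (z + ta *s v + ta *s w) - f (z + ta *s v)) / ta - D (z + ta *s v) w) + D (z + ta *s v) w
 + (f (z + ta *s v) - f z) / ta = (f (z + ta *s (v + w)) - f z) / ta" for ta
 by (simp add: vec.scale_right_distrib diff_divide_distrib add.assoc)
 ultimately have "((%ta. (f (z + ta *s (v + w)) - f z) / ta) \<longlongrightarrow> D z w + D z v) (at 0)"
 by simp
 from LIM_unique[OF this Dlim[of "v + w"]] show ?thesis by (simp add: add.commute)
 qed (simp add: D_def)
 have lin: "Vector_Spaces.linear (*s) (*) (D z)"
 using Dadd Dscale by (simp add: clinear_iff)
 have "D z (c *\<^sub>R x) = c *\<^sub>R D z x" for c x
 proof -
 have "c *\<^sub>R x = complex_of_real c *s x"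
 unfolding vec_eq_iff vector_scaleR_component vector_smult_component by (simp add: scaleR_conv_of_real)
 then show ?thesis using Dscale[of "of_real c" x] by (simp add: scaleR_conv_of_real)
 qed
 then have "linear (D z)" using Dadd by (intro linearI)
 then have bl: "bounded_linear (D z)" by (simp add: linear_conv_bounded_linear)
 have "(f has_derivative D z) (at z)"
 proof (rule has_derivativeI_sandwich[OF R bl[unfolded at_within_open]])
 fix y assume y: "y : UNIV" "y ~= z" "dist y z < R"
 show "norm (f y - f z - D z (y - z)) / norm (y - z) <= (if dist y z <= R/2 then 2 * M / R\<^sup>2 * norm (y - z) else (norm (f y - f z - D z (y - z)) / norm (y - z)))"
 proof (cases "dist y z <= R / 2")
 case True
 have "cmod (f (z + 1 *s (y - z)) - f z - 1 * D z (y - z)) <= 2 * M * (cmod 1 * norm (y - z) / R)^2"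
 using y True R by (intro rem2) (auto simp: dist_norm)
 then have "cmod (f y - f z - D z (y - z)) <= 2 * M * (norm (y - z) / R)^2" by simp
 then have "cmod (f y - f z - D z (y - z)) / norm (y - z) <= 2 * M * (norm (y - z) / R)^2 / norm (y - z)"
 by (rule divide_right_mono) auto
 also have "... = 2 * M / R\<^sup>2 * norm (y - z)" using y by (simp add: power2_eq_square)
 finally show ?thesis using True by simp
 qed auto
 next
 show "((%y. if dist y z <= R/2 then 2 * M / R\<^sup>2 * norm (y - z) else (norm (f y - f z - D z (y - z)) / norm (y - z))) \<longlongrightarrow> 0) (at z)"
 proof (rule Lim_transform_eventually[where f="%y. 2 * M / R\<^sup>2 * norm (y - z)"])
 show "((%y. 2 * M / R\<^sup>2 * norm (y - z)) \<longlongrightarrow> 0) (at z)"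
 using R by (auto intro!: tendsto_eq_intros)
 show "\<forall>\<^sub>F y in at z. 2 * M / R\<^sup>2 * norm (y - z) = (if dist y z <= R/2 then 2 * M / R\<^sup>2 * norm (y - z) else (norm (f y - f z - D z (y - z)) / norm (y - z)))"
 unfolding eventually_at using R by (intro exI[of _ "R/2"]) auto
 qed
 qed
 with lin show "\<exists>f'. (f has_derivative f') (at z) \<and> Vector_Spaces.linear (*s) (*) f'" by blast
qed

lemma holomorphic_on_Cn_const: "(%z. c) holomorphic_on_Cn Om"
 unfolding holomorphic_on_Cn_def
 by (auto intro!: exI[of _ "%_. 0"] simp: clinear_iff)

lemma holomorphic_on_Cn_power:
 assumes "open Om" "f holomorphic_on_Cn Om" shows "(%z. f z ^ k) holomorphic_on_Cn Om"
 by (rule holomorphic_on_CnI[OF assms(1)])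
 (intro holomorphic_intros continuous_intros holomorphic_on_Cn_line holomorphic_on_Cn_imp_continuous_on assms; assumption)+

lemma holomorphic_on_Cn_cmult:
 assumes "open Om" "f holomorphic_on_Cn Om" shows "(%z. c * f z) holomorphic_on_Cn Om"
 by (rule holomorphic_on_CnI[OF assms(1)])
 (intro holomorphic_intros continuous_intros holomorphic_on_Cn_line holomorphic_on_Cn_imp_continuous_on assms; assumption)+

lemma holomorphic_on_Cn_diff:
 assumes "open Om" "f holomorphic_on_Cn Om" "g holomorphic_on_Cn Om"
 shows "(%z. f z - g z) holomorphic_on_Cn Om"
 by (rule holomorphic_on_CnI[OF assms(1)])
 (intro holomorphic_intros continuous_intros holomorphic_on_Cn_line holomorphic_on_Cn_imp_continuous_on assms; assumption)+

lemma holomorphic_on_Cn_sum: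
 assumes "open Om" "!!i. i : I ==> f i holomorphic_on_Cn Om"
 shows "(%z. \<Sum>i\<in>I. f i z) holomorphic_on_Cn Om"
 by (rule holomorphic_on_CnI[OF assms(1)])
 (intro holomorphic_intros continuous_intros holomorphic_on_Cn_line holomorphic_on_Cn_imp_continuous_on assms; assumption)+

text \<open>Locally uniform convergence passes to every complex line, where Weierstrass' theorem
  applies; together with continuity of the limit this suffices by Osgood's lemma.\<close>

lemma holomorphic_on_Cn_uniform_limit:
 fixes f :: "complex^'n => complex"
 assumes Om: "open Om" and hol: "!!k. F k holomorphic_on_Cn Om"
 and ul: "!!x. x : Om ==> \<exists>d>0. cball x d \<subseteq> Om \<and> uniform_limit (cball x d) F f sequentially"
 shows "f holomorphic_on_Cn Om"
proof (rule holomorphic_on_CnI[OF Om])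
 have "isCont f x" if x: "x : Om" for x
 proof -
 obtain d where d: "d > 0" "cball x d \<subseteq> Om" "uniform_limit (cball x d) F f sequentially"
 using ul[OF x] by blast
 have "continuous_on (cball x d) f"
 by (rule uniform_limit_theorem[OF _ d(3)])
 (auto intro!: always_eventually continuous_on_subset[OF holomorphic_on_Cn_imp_continuous_on[OF hol]] d(2))
 then show ?thesis using continuous_on_interior[of "cball x d" f x] d(1) by simp
 qed
 then show "continuous_on Om f" by (simp add: continuous_at_imp_continuous_on)
 fix z w
 show "(%ta. f (z + ta *s w)) holomorphic_on {ta. z + ta *s w : Om}"
 proof (rule holomorphic_uniform_sequence[OF open_line_preimage[OF Om] holomorphic_on_Cn_line[OF hol]])
 fix t assume "t : {ta. z + ta *s w : Om}"
 then obtain d where d: "d > 0" "cball (z + t *s w) d \<subseteq> Om" "uniform_limit (cball (z + t *s w) d) F f sequentially"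
 using ul by blast
 define e where "e = d / (norm w + 1)"
 have e: "e > 0" using d(1) by (simp add: e_def add_nonneg_pos)
 have in_ball: "z + ta *s w : cball (z + t *s w) d" if "ta : cball t e" for ta
 proof -
 have "dist (z + t *s w) (z + ta *s w) = norm ((t - ta) *s w)"
 by (simp add: dist_norm vec.scale_left_diff_distrib)
 also have "... = cmod (t - ta) * norm w" by (rule norm_vector_scalar_mult)
 also have "... <= e * norm w" using that by (intro mult_right_mono) (auto simp: dist_norm)
 also have "... <= e * (norm w + 1)" using e by (intro mult_left_mono) auto
 also have "... = d" by (simp add: e_def add_nonneg_pos less_imp_neq[symmetric])
 finally show ?thesis by simp
 qed
 have "uniform_limit (cball t e) (%n x. F n (z + x *s w)) (%ta. f (z + ta *s w)) sequentially"
 using uniform_limit_compose'[OF d(3), of "%ta. z + ta *s w" "cball t e"] in_ball by blast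
 then show "\<exists>e>0. cball t e \<subseteq> {ta. z + ta *s w : Om} \<and>
 uniform_limit (cball t e) (%n x. F n (z + x *s w)) (%ta. f (z + ta *s w)) sequentially"
 using e in_ball d(2) by blast
 qed
qed

section \<open>Homogeneous expansions and extension to larger balls\<close>

text \<open>The value at w of the homogeneous part of degree k in the Taylor expansion of f at c.
  Reading it off from the line through c in direction w avoids multi-indices.\<close>

definition line_coeff :: "(complex^'n => complex) => nat => complex^'n => complex^'n => complex"
 where "line_coeff f k c w = (deriv ^^ k) (%ta. f (c + ta *s w)) 0 / fact k"

lemma line_coeff_bound:
 assumes "f holomorphic_on_Cn Om" "open Om" and c: "!!ta. cmod ta <= 1 ==> c + ta *s w : Om"
 and M: "!!ta. cmod ta = 1 ==> cmod (f (c + ta *s w)) <= M"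
 shows "cmod (line_coeff f k c w) <= M"
proof -
 let ?g = "%ta. f (c + ta *s w)"
 have hol: "?g holomorphic_on {ta. c + ta *s w : Om}" by (rule holomorphic_on_Cn_line[OF assms(1)])
 have "cmod ((deriv ^^ k) ?g 0) <= fact k * M / 1 ^ k"
 proof (rule Cauchy_inequality)
 show "?g holomorphic_on ball 0 1" by (rule holomorphic_on_subset[OF hol]) (auto intro: c)
 show "continuous_on (cball 0 1) ?g"
 by (rule holomorphic_on_imp_continuous_on[OF holomorphic_on_subset[OF hol]]) (auto intro: c)
 qed (auto intro: M)
 then show ?thesis by (simp add: line_coeff_def norm_divide field_simps)
qed

lemma line_coeff_scale:
 assumes f: "f holomorphic_on_Cn Om" and Om: "open Om" "c : Om"
 shows "line_coeff f k c (s *s w) = s ^ k * line_coeff f k c w"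
proof -
 have "(deriv ^^ k) (%ta. (%\<sigma>. f (c + \<sigma> *s w)) (s * ta)) 0 = s ^ k * (deriv ^^ k) (%\<sigma>. f (c + \<sigma> *s w)) (s * 0)"
 by (rule higher_deriv_compose_linear[OF holomorphic_on_Cn_line[OF f]
 open_line_preimage[OF Om(1), of c "s *s w"] open_line_preimage[OF Om(1), of c w]])
 (use Om(2) in \<open>auto simp: vec.scale_scale mult.commute\<close>)
 then show ?thesis by (simp add: line_coeff_def vec.scale_scale mult.commute)
qed

text \<open>For fixed ta the function f (A \<sigma> + ta B \<sigma>) is holomorphic in \<sigma>, and
  near each \<sigma> a single radius of the ta-disc works, so the parametric Taylor lemma applies
  locally. Both centre and direction may vary because there are two uses: the centre runs through an
  analytic disc, or the direction runs through a line.\<close>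

lemma line_coeff_holomorphic_curve:
 fixes f :: "complex^'n => complex"
 assumes f: "f holomorphic_on_Cn Om" and Om: "open Om" and S: "open S"
 and A: "!!\<sigma>. \<sigma> : S ==> A \<sigma> : Om" "!!\<sigma>. \<sigma> : S ==> \<exists>a. (A has_derivative (%h. h *s a)) (at \<sigma>)"
 and B: "!!\<sigma>. \<sigma> : S ==> \<exists>a. (B has_derivative (%h. h *s a)) (at \<sigma>)"
 shows "(%\<sigma>. line_coeff f k (A \<sigma>) (B \<sigma>)) holomorphic_on S"
proof -
 have contA: "continuous_on S A" and contB: "continuous_on S B"
 using A(2) B by (meson continuous_at_imp_continuous_on has_derivative_continuous)+
 have "\<exists>e>0. (%\<sigma>. line_coeff f k (A \<sigma>) (B \<sigma>)) holomorphic_on ball x e" if x: "x : S" for x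
 proof -
 obtain R where R: "R > 0" "cball (A x) R \<subseteq> Om" using A(1)[OF x] Om open_contains_cball by blast
 obtain e1 where e1: "e1 > 0" "ball x e1 \<subseteq> S" using S x open_contains_ball by blast
 obtain e2 where e2: "e2 > 0" "!!y. y : S ==> dist y x < e2 ==> dist (A y) (A x) < R / 2"
 using contA x R(1) unfolding continuous_on_iff by (meson half_gt_zero)
 obtain e3 where e3: "e3 > 0" "!!y. y : S ==> dist y x < e3 ==> dist (B y) (B x) < 1"
 using contB x unfolding continuous_on_iff by (meson zero_less_one)
 define e where "e = Min {e1, e2, e3}"
 have e: "e > 0" using e1 e2 e3 by (auto simp: e_def)
 \<comment> \<open>Near x the norm of B is at most \<open>norm (B x) + 1\<close>, so ta B moves a
   point by at most R / 2; the other half of R is left to the motion of A.\<close>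
 define r where "r = R / (2 * (norm (B x) + 1))"
 have r: "r > 0" using R by (auto simp: r_def intro!: divide_pos_pos add_nonneg_pos)
 have inS: "ball x e \<subseteq> S" using e1 by (auto simp: e_def)
 have inR: "A \<sigma> + ta *s B \<sigma> : cball (A x) R" if "\<sigma> : ball x e" "cmod ta <= r" for \<sigma> ta
 proof -
 have \<sigma>S: "\<sigma> : S" using that inS by blast
 have a: "dist (A x) (A \<sigma>) < R / 2" using e2(2)[OF \<sigma>S] that by (simp add: e_def dist_commute)
 have "norm (B \<sigma>) <= norm (B x) + 1"
 using e3(2)[OF \<sigma>S] that norm_triangle_ineq2[of "B \<sigma>" "B x"] by (simp add: e_def dist_commute dist_norm)
 then have "norm (ta *s B \<sigma>) <= r * (norm (B x) + 1)"
 unfolding norm_vector_scalar_mult using that r by (intro mult_mono) auto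
 also have "... = R / 2" using add_nonneg_pos[OF norm_ge_zero[of "B x"] zero_less_one] by (simp add: r_def field_simps)
 finally have b: "norm (ta *s B \<sigma>) <= R / 2" .
 have "dist (A x) (A \<sigma> + ta *s B \<sigma>) <= dist (A x) (A \<sigma>) + norm (ta *s B \<sigma>)"
 using norm_triangle_ineq4[of "A x - A \<sigma>" "ta *s B \<sigma>"] by (simp add: dist_norm diff_diff_eq)
 then show ?thesis using a b by simp
 qed
 have "compact (f ` cball (A x) R)"
 using R by (intro compact_continuous_image continuous_on_subset[OF holomorphic_on_Cn_imp_continuous_on[OF f]]) auto
 then obtain M where M: "!!x'. x' : cball (A x) R ==> cmod (f x') <= M"
 by (meson bounded_iff compact_imp_bounded imageI)
 have "(%\<sigma>. (deriv ^^ k) (%ta. f (A \<sigma> + ta *s B \<sigma>)) 0 / fact k) holomorphic_on ball x e"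
 proof (rule taylor_coeff_holomorphic_on[OF r])
 show "\<exists>U. open U \<and> cball 0 r \<subseteq> U \<and> (%ta. f (A \<sigma> + ta *s B \<sigma>)) holomorphic_on U" if "\<sigma> : ball x e" for \<sigma>
 using inR[OF that] R(2)
 by (intro exI[of _ "{ta. A \<sigma> + ta *s B \<sigma> : Om}"] conjI open_line_preimage[OF Om] holomorphic_on_Cn_line[OF f]) auto
 show "cmod (f (A \<sigma> + ta *s B \<sigma>)) <= M" if "\<sigma> : ball x e" "cmod ta <= r" for \<sigma> ta
 by (rule M[OF inR[OF that]])
 show "(%s. f (A s + ta *s B s)) holomorphic_on ball x e" if "cmod ta <= r" for ta
 proof (rule holomorphic_on_Cn_compose_curve[OF f])
 fix s assume s: "s : ball x e"
 then have "s : S" using inS by blast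
 then obtain a b where a: "(A has_derivative (%h. h *s a)) (at s)" and b: "(B has_derivative (%h. h *s b)) (at s)"
 using A B by blast
 have "((%s. A s + ta *s B s) has_derivative (%h. h *s a + ta *s (h *s b))) (at s)"
 by (intro has_derivative_add a bounded_linear.has_derivative[OF bounded_linear_vector_scalar_mult_right] b)
 moreover have "(%h. h *s a + ta *s (h *s b)) = (%h. h *s (a + ta *s b))"
 by (simp add: vec_eq_iff algebra_simps)
 ultimately have "((%s. A s + ta *s B s) has_derivative (%h. h *s (a + ta *s b))) (at s)"
 by (simp only:)
 then show "A s + ta *s B s : Om \<and> (\<exists>a. ((%s. A s + ta *s B s) has_derivative (%h. h *s a)) (at s))"
 using inR[OF s that] R(2) by blast
 qed
 qed auto
 then show ?thesis using e by (auto simp: line_coeff_def)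
 qed
 then show ?thesis
 unfolding holomorphic_on_def[of _ S]
 by (meson centre_in_ball field_differentiable_at_within holomorphic_on_imp_differentiable_at open_ball)
qed

lemma line_coeff_continuous_on:
 fixes f :: "complex^'n => complex"
 assumes f: "f holomorphic_on_Cn Om" and Om: "open Om" and c: "c : Om"
 shows "continuous_on UNIV (line_coeff f k c)"
proof -
 have "isCont (line_coeff f k c) x" for x
 proof -
 obtain R where R: "R > 0" "cball c R \<subseteq> Om" using c Om open_contains_cball by blast
 define r where "r = R / (norm x + 1)"
 have x1: "0 < norm x + 1" by (rule add_nonneg_pos) auto
 have r: "r > 0" using R x1 by (simp add: r_def)
 have inR: "c + ta *s y : cball c R" if "y : ball x 1" "cmod ta <= r" for y ta
 proof -
 have "norm y <= norm x + 1" using that norm_triangle_ineq2[of y x] by (simp add: dist_norm norm_minus_commute)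
 then have "norm (ta *s y) <= r * (norm x + 1)"
 unfolding norm_vector_scalar_mult using that r by (intro mult_mono) auto
 also have "... = R" using x1 by (simp add: r_def)
 finally show ?thesis by (simp add: dist_norm)
 qed
 have "compact (f ` cball c R)"
 using R by (intro compact_continuous_image continuous_on_subset[OF holomorphic_on_Cn_imp_continuous_on[OF f]]) auto
 then obtain M where M: "!!x'. x' : cball c R ==> cmod (f x') <= M"
 by (meson bounded_iff compact_imp_bounded imageI)
 have "continuous_on (ball x 1) (%y. (deriv ^^ k) (%ta. f (c + ta *s y)) 0 / fact k)"
 proof (rule taylor_coeff_continuous_on[OF r])
 show "\<exists>U. open U \<and> cball 0 r \<subseteq> U \<and> (%ta. f (c + ta *s y)) holomorphic_on U" if "y : ball x 1" for y
 using inR[OF that] R(2)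
 by (intro exI[of _ "{ta. c + ta *s y : Om}"] conjI open_line_preimage[OF Om] holomorphic_on_Cn_line[OF f]) auto
 show "cmod (f (c + ta *s y)) <= M" if "y : ball x 1" "cmod ta <= r" for y ta
 by (rule M[OF inR[OF that]])
 show "continuous_on (ball x 1) (%s. f (c + ta *s s))" if "cmod ta <= r" for ta
 using inR[OF _ that] R(2)
 by (intro continuous_on_compose2[OF holomorphic_on_Cn_imp_continuous_on[OF f]] continuous_intros) blast
 qed
 then show ?thesis by (simp add: line_coeff_def[abs_def] continuous_on_eq_continuous_at)
 qed
 then show ?thesis by (simp add: continuous_at_imp_continuous_on)
qed

lemma line_coeff_holomorphic:
 fixes f :: "complex^'n => complex"
 assumes f: "f holomorphic_on_Cn Om" and Om: "open Om" and c: "c : Om"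
 shows "line_coeff f k c holomorphic_on_Cn UNIV"
proof (rule holomorphic_on_CnI[OF open_UNIV line_coeff_continuous_on[OF f Om c]])
 fix z w
 have "(%ta. line_coeff f k c (z + ta *s w)) holomorphic_on UNIV"
 proof (rule line_coeff_holomorphic_curve[OF f Om open_UNIV c])
 show "\<exists>a. ((%ta. c) has_derivative (%h. h *s a)) (at \<sigma>)" for \<sigma> :: complex
 by (rule exI[of _ 0]) simp
 have "((%ta. z + ta *s w) has_derivative (%h. 0 + h *s w)) (at \<sigma>)" for \<sigma>
 by (intro has_derivative_add has_derivative_const
 bounded_linear.has_derivative[OF bounded_linear_vector_scalar_mult_left] has_derivative_ident)
 then show "\<exists>a. ((%ta. z + ta *s w) has_derivative (%h. h *s a)) (at \<sigma>)" for \<sigma> by auto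
 qed
 then show "(%ta. line_coeff f k c (z + ta *s w)) holomorphic_on {ta. z + ta *s w : UNIV}" by simp
qed

text \<open>The homogeneous expansion at c converges on the larger ball: a bound M for all degrees
  where norm w < R improves, by homogeneity, to M q^k on smaller balls, and the Weierstrass test
  applies. On the small ball the sum is f by the power series on each line through c.\<close>

lemma holomorphic_extension_ball:
 fixes f :: "complex^'n => complex"
 assumes f: "f holomorphic_on_Cn Om" and Om: "open Om" and r: "0 < r" "ball c r \<subseteq> Om"
 and M: "!!k w. norm w < R ==> cmod (line_coeff f k c w) <= M" and R: "r <= R"
 shows "\<exists>g. g holomorphic_on_Cn ball c R \<and> (\<forall>z\<in>ball c r. f z = g z)"
proof -
 have c: "c : Om" using r by auto
 have M0: "0 <= M" using M[of 0] R r norm_ge_zero order_trans by (metis norm_zero less_le_trans)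
 define P where "P m z = (\<Sum>k<m. line_coeff f k c (z - c))" for m z
 define g where "g z = (\<Sum>k. line_coeff f k c (z - c))" for z
 have "g holomorphic_on_Cn ball c R"
 proof (rule holomorphic_on_Cn_uniform_limit[OF open_ball])
 show "P m holomorphic_on_Cn ball c R" for m
 unfolding P_def
 proof (rule holomorphic_on_Cn_sum[OF open_ball])
 fix k
 show "(%z. line_coeff f k c (z - c)) holomorphic_on_Cn ball c R"
 proof (rule holomorphic_on_CnI[OF open_ball])
 show "continuous_on (ball c R) (%z. line_coeff f k c (z - c))"
 by (intro continuous_on_compose2[OF line_coeff_continuous_on[OF f Om c]] continuous_intros) auto
 show "(%ta. line_coeff f k c (z + ta *s w - c)) holomorphic_on {ta. z + ta *s w : ball c R}" for z w
 proof -
 have "(%ta. line_coeff f k c ((z - c) + ta *s w)) holomorphic_on UNIV"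
 using holomorphic_on_Cn_line[OF line_coeff_holomorphic[OF f Om c]] by simp
 moreover have "(z - c) + ta *s w = z + ta *s w - c" for ta by simp
 ultimately show ?thesis by (metis (no_types, lifting) ext holomorphic_on_subset subset_UNIV)
 qed
 qed
 qed
 fix x assume x: "x : ball c R"
 define rh where "rh = (norm (x - c) + R) / 2"
 define d where "d = (R - norm (x - c)) / 2"
 have d: "d > 0" "d + norm (x - c) = rh" "rh < R" using x by (auto simp: d_def rh_def dist_norm norm_minus_commute field_simps)
 then have rh0: "0 < rh" by (metis add_pos_nonneg norm_ge_zero)
 \<comment> \<open>The ratio of rh to the midpoint of rh and R: a vector of norm at most rh still
   has norm below R after division by q.\<close>
 define q where "q = rh / ((rh + R) / 2)"
 have q: "0 < q" "q < 1" using d rh0 by (auto simp: q_def field_simps)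
 have sub: "cball x d \<subseteq> ball c R"
 proof
 fix y assume "y : cball x d"
 then have "norm (y - x) <= d" by (simp add: dist_norm norm_minus_commute)
 then have "norm (y - c) <= rh" using norm_triangle_ineq[of "y - x" "x - c"] d by simp
 then show "y : ball c R" using d by (simp add: dist_norm norm_minus_commute)
 qed
 have "uniform_limit (cball x d) (%m z. \<Sum>k<m. line_coeff f k c (z - c)) (%z. \<Sum>k. line_coeff f k c (z - c)) sequentially"
 proof (rule Weierstrass_m_test)
 show "summable (%k. M * q ^ k)" using q by (intro summable_mult summable_geometric) auto
 fix k y assume "y : cball x d"
 then have "norm (y - x) <= d" by (simp add: dist_norm norm_minus_commute)
 then have y: "norm (y - c) <= rh" using norm_triangle_ineq[of "y - x" "x - c"] d by simp
 have "norm (complex_of_real (1/q) *s (y - c)) = norm (y - c) / q"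
 unfolding norm_vector_scalar_mult using q by (simp add: norm_divide)
 also have "... <= rh / q" using y q by (intro divide_right_mono) auto
 also have "... < R" using rh0 d by (simp add: q_def)
 finally have lt: "norm (complex_of_real (1/q) *s (y - c)) < R" .
 have "cmod (line_coeff f k c (of_real q *s (complex_of_real (1/q) *s (y - c)))) <= q ^ k * M"
 unfolding line_coeff_scale[OF f Om c, of k "of_real q" "complex_of_real (1/q) *s (y - c)"]
 norm_mult norm_power norm_of_real abs_of_pos[OF q(1)]
 using q by (intro mult_left_mono M[OF lt]) auto
 moreover have "of_real q *s (complex_of_real (1/q) *s (y - c)) = y - c"
 using q by (simp add: vec.scale_scale flip: of_real_mult)
 ultimately show "norm (line_coeff f k c (y - c)) <= M * q ^ k" by (simp add: mult.commute)
 qed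
 then show "\<exists>d>0. cball x d \<subseteq> ball c R \<and> uniform_limit (cball x d) P g sequentially"
 using d sub by (auto simp: P_def[abs_def] g_def[abs_def])
 qed
 moreover have "f z = g z" if z: "z : ball c r" for z
 proof (cases "z = c")
 case True
 have "line_coeff f k c 0 = 0" if "k > 0" for k
 using line_coeff_scale[OF f Om c, of k 0 0] that by (auto simp: zero_power)
 then have "(\<Sum>k. line_coeff f k c 0) = (\<Sum>k\<in>{0}. line_coeff f k c 0)"
 by (intro suminf_finite) auto
 then show ?thesis using True by (simp add: g_def line_coeff_def)
 next
 case False
 define w where "w = z - c"
 define rh where "rh = r / norm w"
 have w: "norm w > 0" "norm w < r" using False z by (auto simp: w_def dist_norm norm_minus_commute)
 have "(%ta. f (c + ta *s w)) holomorphic_on ball 0 rh"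
 proof (rule holomorphic_on_subset[OF holomorphic_on_Cn_line[OF f]])
 have "c + ta *s w : ball c r" if "cmod ta < rh" for ta
 using that w by (simp add: dist_norm norm_vector_scalar_mult rh_def field_simps)
 then show "ball 0 rh \<subseteq> {ta. c + ta *s w : Om}" using r by auto
 qed
 moreover have "1 : ball (0::complex) rh" using w by (simp add: rh_def field_simps)
 ultimately have "(%k. (deriv ^^ k) (%ta. f (c + ta *s w)) 0 / fact k * (1 - 0) ^ k) sums f (c + 1 *s w)"
 by (rule holomorphic_power_series)
 then show ?thesis by (simp add: g_def w_def line_coeff_def sums_iff)
 qed
 ultimately show ?thesis by blast
qed

section \<open>The distance to the boundary\<close>

text \<open>A ball is connected, so a ball meeting both Om and its complement would meet the
  frontier.\<close>

lemma in_if_dist_less_boundary_dist: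
 fixes Om :: "'a::real_normed_vector set"
 assumes "x : Om" "dist x y < boundary_dist Om x"
 shows "y : Om"
proof (rule ccontr)
 assume y: "y \<notin> Om"
 have "ball x (boundary_dist Om x) \<inter> frontier Om ~= {}"
 proof (rule connected_Int_frontier[OF connected_ball])
 have "x : ball x (boundary_dist Om x)"
 using assms(2) zero_le_dist[of x y] by (simp del: zero_le_dist)
 then show "ball x (boundary_dist Om x) \<inter> Om ~= {}" using assms(1) by blast
 show "ball x (boundary_dist Om x) - Om ~= {}" using assms(2) y by auto
 qed
 then obtain b where "b : frontier Om" "dist x b < boundary_dist Om x" by auto
 then show False using infdist_le[of b "frontier Om" x] by (simp add: boundary_dist_def)
qed

text \<open>The frontier has to be nonempty since \<open>infdist\<close> to the empty set is 0; here
  the assumption that Om is not the whole space makes itself felt.\<close>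

lemma boundary_dist_geI:
 assumes "open Om" "frontier Om ~= {}" "!!y. dist x y < rh ==> y : Om"
 shows "rh <= boundary_dist Om x"
proof -
 have "rh <= dist x b" if "b : frontier Om" for b
 proof (rule ccontr)
 assume "\<not> rh <= dist x b"
 then have "b : Om" using assms(3) by auto
 then show False using that assms(1) by (simp add: frontier_def interior_open)
 qed
 then show ?thesis unfolding boundary_dist_def infdist_def using assms(2) by (auto intro: cINF_greatest)
qed

lemma boundary_dist_pos:
 assumes "open Om" "frontier Om ~= {}" "x : Om"
 shows "0 < boundary_dist Om x"
proof -
 obtain e where "e > 0" "ball x e \<subseteq> Om" using assms open_contains_ball by blast
 then have "e <= boundary_dist Om x" by (intro boundary_dist_geI assms) auto
 then show ?thesis using \<open>e > 0\<close> by simp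
qed

lemma continuous_on_boundary_dist [continuous_intros]:
 "continuous_on S f ==> continuous_on S (%x. boundary_dist Om (f x))"
 unfolding boundary_dist_def by (rule continuous_on_infdist)

section \<open>From domains of holomorphy to plurisubharmonicity: the continuity principle\<close>

text \<open>The Taylor coefficients along lines of every holomorphic function obey the maximum principle
 on the analytic disc, so every function extends to balls of a fixed radius around its points.\<close>

lemma domain_of_holomorphy_disc:
 fixes Om :: "(complex^'n) set"
 assumes doh: "domain_of_holomorphy Om" and S: "open S" "cball a r \<subseteq> S"
 and A: "!!ta. ta : S ==> \<exists>v. (A has_derivative (%h. h *s v)) (at ta)"
 and disc: "!!ta. ta : cball a r ==> A ta : Om"
 and L: "compact L" "!!ta. ta : sphere a r ==> cball (A ta) R \<subseteq> L" "L \<subseteq> Om"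
 and R: "0 < R" and ta: "ta : cball a r"
 shows "ball (A ta) R \<subseteq> Om"
proof -
 have Om: "open Om" using doh by (simp add: domain_of_holomorphy_def is_domain_def)
 have contA: "continuous_on S A"
 using A by (meson continuous_at_imp_continuous_on has_derivative_continuous)
 define S0 where "S0 = S \<inter> A -` Om"
 \<comment> \<open>Holomorphy of the Taylor parts is needed on a neighbourhood of the closed disc,
   namely for all parameters whose centre still lies in Om.\<close>
 have S0: "open S0" unfolding S0_def by (rule continuous_open_preimage[OF contA S(1) Om])
 have sub: "cball a r \<subseteq> S0" using disc S by (auto simp: S0_def)
 let ?c = "A ta"
 obtain r1 where r1: "r1 > 0" "ball ?c r1 \<subseteq> Om" using disc[OF ta] Om open_contains_ball by blast
 define r0 where "r0 = min r1 R"
 have r0: "r0 > 0" "ball ?c r0 \<subseteq> Om" "r0 <= R" using r1 R by (auto simp: r0_def)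
 have ext: "\<exists>g. g holomorphic_on_Cn ball ?c R \<and> (\<forall>z\<in>ball ?c r0. f z = g z)" if f: "f holomorphic_on_Cn Om" for f
 proof -
 have "compact (f ` L)"
 using L by (intro compact_continuous_image continuous_on_subset[OF holomorphic_on_Cn_imp_continuous_on[OF f]]) auto
 then obtain M where M: "!!x'. x' : L ==> cmod (f x') <= M"
 by (meson bounded_iff compact_imp_bounded imageI)
 have "cmod (line_coeff f k ?c u) <= M" if u: "norm u < R" for k u
 proof (rule maximum_modulus_frontier[of "%ta. line_coeff f k (A ta) u" "cball a r"])
 have hol: "(%ta. line_coeff f k (A ta) u) holomorphic_on S0"
 proof (rule line_coeff_holomorphic_curve[OF f Om S0])
 show "\<exists>v. ((%ta. u) has_derivative (%h. h *s v)) (at \<sigma>)" for \<sigma> :: complex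
 by (rule exI[of _ 0]) simp
 qed (auto simp: S0_def intro: A)
 show "(%ta. line_coeff f k (A ta) u) holomorphic_on interior (cball a r)"
 by (rule holomorphic_on_subset[OF hol]) (use sub interior_subset in blast)
 show "continuous_on (closure (cball a r)) (%ta. line_coeff f k (A ta) u)"
 by (rule holomorphic_on_imp_continuous_on[OF holomorphic_on_subset[OF hol]]) (use sub in simp)
 show "ta : cball a r" by (rule ta)
 show "cmod (line_coeff f k (A t) u) <= M" if "t : frontier (cball a r)" for t
 proof (rule line_coeff_bound[OF f Om])
 have t: "t : sphere a r" using that by (simp add: frontier_cball)
 have inL: "A t + \<sigma> *s u : L" if "cmod \<sigma> <= 1" for \<sigma>
 proof -
 have "norm (\<sigma> *s u) <= 1 * R" unfolding norm_vector_scalar_mult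
 using that u by (intro mult_mono) auto
 then show ?thesis using L(2)[OF t] by (auto simp: dist_norm subset_iff)
 qed
 show "A t + \<sigma> *s u : Om" if "cmod \<sigma> <= 1" for \<sigma> using inL[OF that] L(3) by blast
 show "cmod (f (A t + \<sigma> *s u)) <= M" if "cmod \<sigma> = 1" for \<sigma> using inL[of \<sigma>] that M by auto
 qed
 qed auto
 then show ?thesis using holomorphic_extension_ball[OF f Om r0(1,2) _ r0(3)] by blast
 qed
 show ?thesis
 proof (rule ccontr)
 assume "\<not> ball ?c R \<subseteq> Om"
 moreover have "ball ?c r0 \<subseteq> ball ?c R \<inter> Om" "ball ?c r0 ~= {}" using r0 by auto
 ultimately show False
 using doh ext unfolding domain_of_holomorphy_def
 by (metis connected_ball open_ball)
 qed
qed

text \<open>The discs z + ta w + s h(ta) et are deformed from s = 0 to s = 1. Since |s h et| stays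
  below the distance to the boundary on the circle, all their boundaries lie in one compact subset L
  of Om, so one width R serves for every s: a disc inside Om carries a tube of width R inside Om,
  and that tube contains the next disc.\<close>

lemma domain_of_holomorphy_continuity_principle:
 fixes Om :: "(complex^'n) set"
 assumes doh: "domain_of_holomorphy Om" and h: "h holomorphic_on UNIV"
 and disc: "!!ta. ta : cball a r ==> z + ta *s w : Om"
 and bd: "!!ta. ta : sphere a r ==> cmod (h ta) < boundary_dist Om (z + ta *s w)"
 and et: "norm et <= 1" and t: "ta : cball a r"
 shows "z + ta *s w + h ta *s et : Om"
proof -
 have Om: "open Om" using doh by (simp add: domain_of_holomorphy_def is_domain_def)
 define A where "A s ta = z + ta *s w + (of_real s * h ta) *s et" for s ta
 have hc: "continuous_on S h" for S using h holomorphic_on_imp_continuous_on continuous_on_subset by blast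
 have Ader: "\<exists>v. (A s has_derivative (%h. h *s v)) (at ta)" for s ta
 proof -
 obtain h' where h': "(h has_field_derivative h') (at ta)"
 using h by (meson UNIV_I field_differentiable_def holomorphic_on_imp_differentiable_at open_UNIV)
 have 1: "((%ta. of_real s * h ta) has_derivative (%x. of_real s * (h' * x))) (at ta)"
 using h' by (auto simp: has_field_derivative_def intro!: derivative_eq_intros)
 have "(A s has_derivative (%x. (0 + x *s w) + (of_real s * (h' * x)) *s et)) (at ta)"
 unfolding A_def
 by (intro has_derivative_add has_derivative_const 1 has_derivative_ident
 bounded_linear.has_derivative[OF bounded_linear_vector_scalar_mult_left])
 moreover have "(%x. (0 + x *s w) + (of_real s * (h' * x)) *s et) = (%x. x *s (w + (of_real s * h') *s et))"
 by (simp add: fun_eq_iff vec_eq_iff algebra_simps)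
 ultimately have "(A s has_derivative (%x. x *s (w + (of_real s * h') *s et))) (at ta)" by (simp only:)
 then show ?thesis by blast
 qed
 define L where "L = (%(s, ta). A s ta) ` ({0..1} \<times> sphere a r)"
 have "compact L" unfolding L_def
 proof (rule compact_continuous_image)
 show "continuous_on ({0..1} \<times> sphere a r) (%(s, ta). A s ta)"
 unfolding A_def case_prod_unfold
 by (intro continuous_intros continuous_on_compose2[OF hc[of UNIV]]) auto
 qed (intro compact_Times compact_Icc compact_sphere)
 moreover have "L \<subseteq> Om"
 proof
 fix x assume "x : L"
 then obtain s ta where st: "0 <= s" "s <= 1" "ta : sphere a r" "x = A s ta" by (auto simp: L_def)
 show "x : Om"
 proof (rule in_if_dist_less_boundary_dist)
 show "z + ta *s w : Om" using st by (intro disc) auto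
 have "dist (z + ta *s w) x = norm ((of_real s * h ta) *s et)"
 by (simp add: st A_def dist_norm)
 also have "... = (s * norm et) * cmod (h ta)" using st by (simp add: norm_vector_scalar_mult norm_mult)
 also have "... <= 1 * cmod (h ta)" using st et by (intro mult_right_mono mult_le_one) auto
 also have "... < boundary_dist Om (z + ta *s w)" using bd st by simp
 finally show "dist (z + ta *s w) x < boundary_dist Om (z + ta *s w)" .
 qed
 qed
 ultimately obtain R where R: "R > 0" "(\<Union>x\<in>L. cball x R) \<subseteq> Om"
 using compact_subset_open_imp_cball_epsilon_subset Om by metis
 define LR where "LR = {x + y |x y. x : L \<and> y : cball 0 R}"
 have LR: "compact LR" unfolding LR_def by (rule compact_sums[OF \<open>compact L\<close> compact_cball])
 have LR_ball: "cball x R \<subseteq> LR" if "x : L" for x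
 proof
 fix y assume "y : cball x R"
 then have "y = x + (y - x)" "y - x : cball 0 R" by (auto simp: dist_norm norm_minus_commute)
 then show "y : LR" using that unfolding LR_def by blast
 qed
 have LR_sub: "LR \<subseteq> Om"
 proof
 fix y assume "y : LR"
 then obtain x u where "x : L" "u : cball 0 R" "y = x + u" by (auto simp: LR_def)
 then have "y : cball x R" by (simp add: dist_norm)
 then show "y : Om" using R(2) \<open>x : L\<close> by blast
 qed
 have step: "ball (A s ta) R \<subseteq> Om"
 if "!!ta. ta : cball a r ==> A s ta : Om" "0 <= s" "s <= 1" "ta : cball a r" for s ta
 proof (rule domain_of_holomorphy_disc[OF doh open_UNIV subset_UNIV Ader that(1) LR _ LR_sub R(1) that(4)])
 show "cball (A s ta) R \<subseteq> LR" if "ta : sphere a r" for ta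
 using that \<open>0 <= s\<close> \<open>s <= 1\<close> by (intro LR_ball) (force simp: L_def)
 qed
 have "compact (h ` cball a r)" by (intro compact_continuous_image hc) auto
 then obtain H where H: "!!ta. ta : cball a r ==> cmod (h ta) <= H"
 by (meson bounded_iff compact_imp_bounded imageI)
 have H0: "0 <= H" using H[OF t] norm_ge_zero order_trans by blast
 \<comment> \<open>H bounds |h| on the disc, so a step of length de in s moves every point by less
   than R.\<close>
 define de where "de = R / (H + 1)"
 have de: "de > 0" using R H0 by (simp add: de_def)
 have "\<forall>ta\<in>cball a r. A (min 1 (real m * de)) ta : Om" for m
 proof (induction m)
 case 0
 then show ?case using disc by (simp add: A_def)
 next
 case (Suc m)
 let ?s = "min 1 (real m * de)" and ?s' = "min 1 (real (Suc m) * de)"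
 have s: "0 <= ?s" "?s <= 1" "\<bar>?s - ?s'\<bar> <= de" using de by (auto simp: min_def algebra_simps)
 show ?case
 proof
 fix ta assume ta: "ta : cball a r"
 have "dist (A ?s ta) (A ?s' ta) = norm ((of_real (?s - ?s') * h ta) *s et)"
 by (simp add: A_def dist_norm algebra_simps vec.scale_left_diff_distrib)
 also have "... = \<bar>?s - ?s'\<bar> * (cmod (h ta) * norm et)"
 unfolding norm_vector_scalar_mult norm_mult norm_of_real by simp
 also have "... <= de * (H * 1)"
 using s et H[OF ta] H0 de by (intro mult_mono) auto
 also have "... < de * (H + 1)" using de by simp
 also have "... = R" using H0 by (simp add: de_def)
 finally have "A ?s' ta : ball (A ?s ta) R" by simp
 then show "A ?s' ta : Om" using step[OF _ s(1,2) ta] Suc.IH by blast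
 qed
 qed
 moreover obtain m :: nat where "1 < real m * de" using de ex_less_of_nat_mult by blast
 ultimately have "A 1 ta : Om" using t by (metis less_imp_le min.absorb1)
 then show ?thesis by (simp add: A_def)
qed

lemma mean_value_circle:
 assumes f: "f holomorphic_on UNIV" and r: "0 < r"
 shows "((%th. f (a + of_real r * cis th)) has_integral (of_real (2 * pi) * f a)) {0..2 * pi}"
proof -
 have "((%u. f u / (u - a)) has_contour_integral 2 * of_real pi * \<i> * f a) (circlepath a r)"
 using Cauchy_integral_circlepath_simple[of f a r a] f r holomorphic_on_subset by fastforce
 then have "((%th. f (a + r * cis th) / (a + r * cis th - a) * r * \<i> * cis th) has_integral 2 * of_real pi * \<i> * f a) {0..2*pi}"
 unfolding circlepath_def by (subst (asm) has_contour_integral_part_circlepath_iff) auto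
 then have "((%th. - \<i> * (f (a + r * cis th) / (a + r * cis th - a) * r * \<i> * cis th)) has_integral - \<i> * (2 * of_real pi * \<i> * f a)) {0..2*pi}"
 by (rule has_integral_mult_right)
 then show ?thesis using r by (simp add: field_simps)
qed

text \<open>Real parts of polynomials form an algebra of functions on a circle: on the unit circle
  cnj u = 1 / u, hence the real part of p cnj q is again that of a polynomial, and Re p Re q = Re (p
  q + p cnj q) / 2. The Stone-Weierstrass theorem then stands in for the solution of a Dirichlet
  problem on the disc.\<close>

lemma approx_Re_poly_sphere:
 fixes g :: "complex => real"
 assumes g: "continuous_on (sphere a r) g" and r: "0 < r" and e: "0 < e"
 shows "\<exists>P. P holomorphic_on UNIV \<and> (\<forall>ta\<in>sphere a r. \<bar>g ta - Re (P ta)\<bar> < e)"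
proof -
 define rep where "rep f \<longleftrightarrow> (\<exists>p::complex poly. \<forall>ta\<in>sphere a r. f ta = Re (poly p ((ta - a) / of_real r)))" for f
 have unit: "cmod ((ta - a) / of_real r) = 1" if "ta : sphere a r" for ta
 using that r by (simp add: norm_divide dist_norm norm_minus_commute)
 \<comment> \<open>Simultaneous induction on both polynomials. The product of the two higher parts
   loses the factor u cnj u = 1, and the mixed terms become polynomials after conjugation inside the
   real part.\<close>
 have prod: "\<exists>s. \<forall>u. cmod u = 1 \<longrightarrow> Re (poly p u * cnj (poly q u)) = Re (poly s u)" for p q
 proof (induction p q rule: poly_induct2)
 case 0
 then show ?case by (rule exI[of _ 0]) simp
 next
 case (pCons c p d q)
 then obtain s where s: "!!u. cmod u = 1 ==> Re (poly p u * cnj (poly q u)) = Re (poly s u)" by blast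
 have "Re (poly (pCons c p) u * cnj (poly (pCons d q) u)) =
 Re (poly (smult (cnj c) (pCons d q) + smult (cnj d) (pCons 0 p) + s) u)" if u: "cmod u = 1" for u
 proof -
 have uu: "u * cnj u = 1" using u by (simp add: complex_norm_square[symmetric])
 have "poly (pCons c p) u * cnj (poly (pCons d q) u) =
 c * cnj (poly (pCons d q) u) + cnj d * (u * poly p u) + (u * cnj u) * (poly p u * cnj (poly q u))"
 by (simp add: algebra_simps)
 moreover have "Re (c * cnj (poly (pCons d q) u)) = Re (cnj c * poly (pCons d q) u)"
 by (simp add: algebra_simps)
 ultimately show ?thesis using s[OF u] uu by (simp, simp add: algebra_simps)
 qed
 then show ?case by blast
 qed
 have "\<exists>f. rep f \<and> (\<forall>x\<in>sphere a r. \<bar>g x - f x\<bar> < e)"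
 proof (rule Stone_Weierstrass_HOL)
 show "rep (%x. c)" for c unfolding rep_def by (rule exI[of _ "[:of_real c:]"]) simp
 show "continuous_on (sphere a r) f" if rf: "rep f" for f
 proof -
 obtain p where p: "\<forall>ta\<in>sphere a r. f ta = Re (poly p ((ta - a) / of_real r))" using rf unfolding rep_def by blast
 have "continuous_on (sphere a r) (%ta. Re (poly p ((ta - a) / of_real r)))"
 by (intro continuous_intros) (use r in auto)
 then show ?thesis by (rule continuous_on_eq) (use p in simp)
 qed
 show "rep (%x. f x + f' x)" if rf: "rep f \<and> rep f'" for f f'
 proof -
 obtain p q where "\<forall>ta\<in>sphere a r. f ta = Re (poly p ((ta - a) / of_real r))"
 "\<forall>ta\<in>sphere a r. f' ta = Re (poly q ((ta - a) / of_real r))" using rf unfolding rep_def by blast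
 then show ?thesis unfolding rep_def by (intro exI[of _ "p + q"]) simp
 qed
 show "rep (%x. f x * f' x)" if rf: "rep f \<and> rep f'" for f f'
 proof -
 obtain p q where pq: "\<forall>ta\<in>sphere a r. f ta = Re (poly p ((ta - a) / of_real r))"
 "\<forall>ta\<in>sphere a r. f' ta = Re (poly q ((ta - a) / of_real r))" using rf unfolding rep_def by blast
 obtain s where s: "!!u. cmod u = 1 ==> Re (poly p u * cnj (poly q u)) = Re (poly s u)" using prod by blast
 have "Re (poly p u) * Re (poly q u) = Re (poly (smult (1/2) (p * q + s)) u)" if "cmod u = 1" for u
 using s[OF that] by (simp add: field_simps)
 then have "\<forall>ta\<in>sphere a r. f ta * f' ta = Re (poly (smult (1/2) (p * q + s)) ((ta - a) / of_real r))"
 using pq unit by simp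
 then show ?thesis unfolding rep_def by blast
 qed
 show "\<exists>f. rep f \<and> f x ~= f y" if "x : sphere a r \<and> y : sphere a r \<and> x ~= y" for x y
 proof -
 let ?u = "(x - a) / of_real r" and ?v = "(y - a) / of_real r"
 have "?u ~= ?v" using that r by simp
 then have "Re (poly [:0, 1:] ?u) ~= Re (poly [:0, 1:] ?v) \<or> Re (poly [:0, \<i>:] ?u) ~= Re (poly [:0, \<i>:] ?v)"
 by (simp add: complex_eq_iff)
 moreover have "rep (%ta. Re (poly p ((ta - a) / of_real r)))" for p unfolding rep_def by blast
 ultimately show ?thesis by meson
 qed
 qed (use g e in auto)
 then obtain f p where "\<forall>x\<in>sphere a r. \<bar>g x - f x\<bar> < e" "\<forall>ta\<in>sphere a r. f ta = Re (poly p ((ta - a) / of_real r))"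
 unfolding rep_def by blast
 moreover have "(%ta. poly p ((ta - a) / of_real r)) holomorphic_on UNIV"
 using r by (intro holomorphic_intros) auto
 ultimately show ?thesis by (intro exI[of _ "%ta. poly p ((ta - a) / of_real r)"]) auto
qed

lemma circle_param_continuous:
 assumes "continuous_on (sphere a r) g" "0 < r"
 shows "continuous_on {0..2*pi} (%th. g (a + of_real r * cis th))"
 by (intro continuous_on_compose2[OF assms(1)] continuous_intros) (use assms(2) in \<open>auto simp: dist_norm norm_mult\<close>)

text \<open>For a continuous real function the integrals of the positive and of the negative part
  are both finite, so the extended-real definition reduces to an ordinary integral.\<close>

lemma circle_mean_real:
 fixes g :: "complex => real"
 assumes g: "continuous_on (sphere a r) g" and r: "0 < r"
 shows "circle_mean (%ta. ereal (g ta)) a r = ereal (integral {0..2*pi} (%th. g (a + of_real r * cis th)) / (2 * pi))"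
proof -
 define G where "G th = g (a + of_real r * cis th)" for th
 have G: "continuous_on {0..2*pi} G" unfolding G_def by (rule circle_param_continuous[OF assms])
 define p where "p F = integral {0..2*pi} (%th. max 0 (F th))" for F :: "real => real"
 have nn: "enn2ereal (\<integral>\<^sup>+th\<in>{0..2*pi}. ennreal (F th) \<partial>lborel) = ereal (p F)" if F: "continuous_on {0..2*pi} F" for F
 proof -
 have si: "set_integrable lborel {0..2*pi} (%th. max 0 (F th))"
 by (rule borel_integrable_atLeastAtMost') (intro continuous_intros F)
 have "(\<integral>\<^sup>+th\<in>{0..2*pi}. ennreal (F th) \<partial>lborel) = (\<integral>\<^sup>+th. ennreal (indicator {0..2*pi} th *\<^sub>R max 0 (F th)) \<partial>lborel)"
 by (intro nn_integral_cong) (auto simp: indicator_def max_def ennreal_neg)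
 also have "... = ennreal (LINT th:{0..2*pi}|lborel. max 0 (F th))"
 unfolding set_lebesgue_integral_def
 by (rule nn_integral_eq_integral) (use si in \<open>auto simp: set_integrable_def\<close>)
 also have "(LINT th:{0..2*pi}|lborel. max 0 (F th)) = p F"
 unfolding p_def using set_borel_integral_eq_integral(2)[OF si] .
 finally have eq: "(\<integral>\<^sup>+th\<in>{0..2*pi}. ennreal (F th) \<partial>lborel) = ennreal (p F)" .
 have "0 <= p F" unfolding p_def
 by (intro Henstock_Kurzweil_Integration.integral_nonneg integrable_continuous_interval continuous_intros F) auto
 then show ?thesis by (simp add: eq enn2ereal_ennreal)
 qed
 have "integral {0..2*pi} G = p G - p (%th. - G th)"
 proof -
 have "p G - p (%th. - G th) = integral {0..2*pi} (%th. max 0 (G th) - max 0 (- G th))"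
 unfolding p_def
 by (intro Henstock_Kurzweil_Integration.integral_diff[symmetric] integrable_continuous_interval continuous_intros G)
 also have "(%th. max 0 (G th) - max 0 (- G th)) = G" by (auto simp: max_def)
 finally show ?thesis by simp
 qed
 moreover have "circle_mean (%ta. ereal (g ta)) a r = (ereal (p G) - ereal (p (%th. - G th))) / ereal (2 * pi)"
 unfolding circle_mean_def using nn[OF G] nn[OF continuous_on_minus[OF G]]
 by (simp add: G_def e2ennreal_ereal)
 ultimately show ?thesis by (simp add: G_def[abs_def])
qed

lemma frontier_domain_nonempty:
 "is_domain (Om::(complex^'n) set) ==> Om ~= UNIV ==> frontier Om ~= {}"
 by (rule frontier_not_empty) (simp_all add: is_domain_def)

lemma usc_on_continuous:
 assumes "continuous_on S (g::'a::topological_space => real)"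
 shows "usc_on S (%x. ereal (g x))"
 unfolding usc_on_def
proof
 fix c
 have "openin (top_of_set S) (S \<inter> (%x. ereal (g x)) -` {..<c})"
 by (rule continuous_openin_preimage_gen) (auto intro!: continuous_intros assms)
 moreover have "S \<inter> (%x. ereal (g x)) -` {..<c} = {x : S. ereal (g x) < c}" by auto
 ultimately show "openin (top_of_set S) {x : S. ereal (g x) < c}" by simp
qed

text \<open>On a circle, g = - ln d is approximated from above by the real part of a polynomial P.
  Then h = exp (- P) satisfies |h| < d there, the continuity principle gives |h| <= d at the centre,
  which is g <= Re P, and the mean value property of Re P yields the submean inequality up to
  e.\<close>

theorem domain_of_holomorphy_imp_plurisubharmonic:
 fixes Om :: "(complex^'n) set"
 assumes doh: "domain_of_holomorphy Om" and ne: "Om ~= UNIV"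
 shows "plurisubharmonic_on Om (%z. ereal (- ln (boundary_dist Om z)))"
proof -
 have dom: "is_domain Om" and Om: "open Om" using doh by (auto simp: domain_of_holomorphy_def is_domain_def)
 have fr: "frontier Om ~= {}" by (rule frontier_domain_nonempty[OF dom ne])
 have cont: "continuous_on Om (%z. - ln (boundary_dist Om z))"
 using boundary_dist_pos[OF Om fr] by (intro continuous_intros) fastforce
 have "subharmonic_on {ta. z + ta *s w : Om} (%ta. ereal (- ln (boundary_dist Om (z + ta *s w))))" for z w
 unfolding subharmonic_on_def
 proof (intro conjI allI impI)
 let ?U = "{ta. z + ta *s w : Om}"
 define g where "g ta = - ln (boundary_dist Om (z + ta *s w))" for ta
 have g: "continuous_on ?U g"
 unfolding g_def by (intro continuous_on_compose2[OF cont] continuous_intros) auto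
 show "usc_on ?U (%ta. ereal (- ln (boundary_dist Om (z + ta *s w))))"
 using usc_on_continuous[OF g] by (simp add: g_def)
 fix a r assume "0 < r \<and> cball a r \<subseteq> ?U"
 then have r: "0 < r" and sub: "cball a r \<subseteq> ?U" by auto
 have gs: "continuous_on (sphere a r) g"
 by (rule continuous_on_subset[OF g]) (use sub in auto)
 have pos: "0 < boundary_dist Om (z + ta *s w)" if "ta : cball a r" for ta
 using that sub by (intro boundary_dist_pos[OF Om fr]) auto
 let ?I = "integral {0..2*pi} (%th. g (a + of_real r * cis th))"
 have "g a <= ?I / (2 * pi) + e" if e: "e > 0" for e
 proof -
 \<comment> \<open>Approximating g + e / 2 within e / 2 gives g < Re P < g + e on the
   circle.\<close>
 obtain P where P: "P holomorphic_on UNIV" and ap: "!!ta. ta : sphere a r ==> \<bar>(g ta + e / 2) - Re (P ta)\<bar> < e / 2"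
 using approx_Re_poly_sphere[OF continuous_on_add[OF gs continuous_on_const[of _ "e/2"]] r half_gt_zero[OF e]]
 by blast
 define h where "h ta = exp (- P ta)" for ta
 have h: "h holomorphic_on UNIV" unfolding h_def by (intro holomorphic_intros P)
 have bd: "cmod (h ta) < boundary_dist Om (z + ta *s w)" if ta: "ta : sphere a r" for ta
 proof -
 have "- Re (P ta) < - g ta" using ap[OF ta] by linarith
 also have "- g ta = ln (boundary_dist Om (z + ta *s w))" by (simp add: g_def)
 finally have lt: "exp (- Re (P ta)) < exp (ln (boundary_dist Om (z + ta *s w)))" by simp
 have "0 < boundary_dist Om (z + ta *s w)" using pos[of ta] ta by simp
 from lt[unfolded exp_ln[OF this]] show ?thesis by (simp add: h_def)
 qed
 have ina: "a : cball a r" using r by simp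
 have "cmod (h a) <= boundary_dist Om (z + a *s w)"
 proof (rule boundary_dist_geI[OF Om fr])
 fix y assume y: "dist (z + a *s w) y < cmod (h a)"
 \<comment> \<open>Every y closer to the centre point than |h a| has the form z + a w + h(a) et with
   et of norm at most 1, as the continuity principle requires.\<close>
 define et where "et = inverse (h a) *s (y - (z + a *s w))"
 have ha: "h a ~= 0" by (simp add: h_def)
 have "norm et = norm (y - (z + a *s w)) / cmod (h a)"
 unfolding et_def norm_vector_scalar_mult by (simp add: norm_inverse divide_inverse mult.commute)
 then have "norm et <= 1" using y ha by (simp add: dist_norm norm_minus_commute)
 then have "z + a *s w + h a *s et : Om"
 by (intro domain_of_holomorphy_continuity_principle[OF doh h _ bd _ ina]) (use sub in auto)
 moreover have "h a *s et = y - (z + a *s w)"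
 unfolding et_def by (simp only: vec.scale_scale right_inverse[OF ha] vec.scale_one)
 ultimately show "y : Om" by simp
 qed
 then have "ln (cmod (h a)) <= ln (boundary_dist Om (z + a *s w))"
 using pos[OF ina] by (subst ln_le_cancel_iff) (auto simp: h_def)
 then have gP: "g a <= Re (P a)" by (simp add: h_def g_def)
 have int: "((%th. Re (P (a + of_real r * cis th))) has_integral (2 * pi * Re (P a))) {0..2*pi}"
 using has_integral_Re[OF mean_value_circle[OF P r, of a]] by simp
 have "2 * pi * Re (P a) <= integral {0..2*pi} (%th. g (a + of_real r * cis th) + e)"
 proof (rule has_integral_le[OF int integrable_integral])
 show "(%th. g (a + of_real r * cis th) + e) integrable_on {0..2*pi}"
 by (intro integrable_continuous_interval continuous_intros circle_param_continuous[OF gs r])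
 show "Re (P (a + of_real r * cis th)) <= g (a + of_real r * cis th) + e" for th
 proof -
 have "a + of_real r * cis th : sphere a r" using r by (simp add: dist_norm norm_mult)
 from ap[OF this] show ?thesis using e by linarith
 qed
 qed
 also have "... = ?I + 2 * pi * e"
 by (subst Henstock_Kurzweil_Integration.integral_add)
 (auto intro!: integrable_continuous_interval circle_param_continuous[OF gs r])
 finally have "Re (P a) <= ?I / (2 * pi) + e" by (simp add: field_simps)
 with gP show ?thesis by linarith
 qed
 then have "g a <= ?I / (2 * pi)" by (rule field_le_epsilon)
 then show "ereal (- ln (boundary_dist Om (z + a *s w))) <= circle_mean (%ta. ereal (- ln (boundary_dist Om (z + ta *s w)))) a r"
 using circle_mean_real[OF gs r] by (simp add: g_def)
 qed auto
 then show ?thesis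
 unfolding plurisubharmonic_on_def using usc_on_continuous[OF cont] by auto
qed

section \<open>From holomorphic convexity to domains of holomorphy\<close>

text \<open>The interior of the coincidence set is closed in W: a ball around a limit point contains
  a point y of this interior, each point p of the ball lies on a complex line through y, and the
  part of this line in the ball is convex, so the one-variable identity theorem applies to
  it.\<close>

lemma holomorphic_on_Cn_identity:
 fixes f g :: "complex^'n => complex"
 assumes f: "f holomorphic_on_Cn W" and g: "g holomorphic_on_Cn W" and W: "open W" "connected W"
 and U: "open U" "U ~= {}" "U \<subseteq> W" "!!z. z : U ==> f z = g z" and z: "z : W"
 shows "f z = g z"
proof -
 define Z where "Z = interior {z : W. f z = g z}"
 have "Z \<subseteq> W" using interior_subset unfolding Z_def by blast
 have "U \<subseteq> Z" unfolding Z_def using U by (intro interior_maximal) auto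
 have "openin (top_of_set W) Z" using \<open>Z \<subseteq> W\<close> by (simp add: Z_def openin_open_eq W)
 moreover have "closedin (top_of_set W) Z"
 unfolding closedin_limpt
 proof (intro conjI allI impI)
 fix x assume x: "x islimpt Z \<and> x : W"
 then obtain r where r: "r > 0" "ball x r \<subseteq> W" using W open_contains_ball by blast
 obtain y where y: "y : Z" "y : ball x r"
 using x r(1) unfolding islimpt_approachable by (metis dist_commute mem_ball)
 have "f p = g p" if p: "p : ball x r" for p
 proof -
 let ?S = "{ta. y + ta *s (p - y) : ball x r}" and ?SZ = "{ta. y + ta *s (p - y) : Z \<inter> ball x r}"
 have conv: "convex ?S"
 proof (rule convexI)
 fix s t :: complex and u v :: real assume st: "s : ?S" "t : ?S" "0 <= u" "0 <= v" "u + v = 1"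
 have "y + (u *\<^sub>R s + v *\<^sub>R t) *s (p - y) = u *\<^sub>R (y + s *s (p - y)) + v *\<^sub>R (y + t *s (p - y))"
 proof -
 have "y = u *\<^sub>R y + v *\<^sub>R y" using st by (metis scaleR_add_left scaleR_one)
 moreover have "(u *\<^sub>R s + v *\<^sub>R t) *s (p - y) = u *\<^sub>R (s *s (p - y)) + v *\<^sub>R (t *s (p - y))"
 by (simp add: vec_eq_iff algebra_simps)
 ultimately show ?thesis by (simp add: algebra_simps)
 qed
 then show "u *\<^sub>R s + v *\<^sub>R t : ?S"
 using st convexD[OF convex_ball, of "y + s *s (p - y)" x r "y + t *s (p - y)" u v] by simp
 qed
 have "(%ta. f (y + ta *s (p - y))) 1 = (%ta. g (y + ta *s (p - y))) 1"
 proof (rule analytic_continuation_open[of ?SZ ?S "%ta. f (y + ta *s (p - y))" "%ta. g (y + ta *s (p - y))" 1])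
 show "open ?SZ" by (rule open_line_preimage) (auto simp: Z_def)
 show "open ?S" by (rule open_line_preimage) auto
 show "?SZ ~= {}" using y by (auto intro!: exI[of _ 0])
 show "connected ?S" by (rule convex_connected[OF conv])
 show "(%ta. f (y + ta *s (p - y))) holomorphic_on ?S" "(%ta. g (y + ta *s (p - y))) holomorphic_on ?S"
 using holomorphic_on_Cn_line f g r(2) holomorphic_on_Cn_subset by blast+
 show "1 : ?S" using p by simp
 show "f (y + ta *s (p - y)) = g (y + ta *s (p - y))" if "ta : ?SZ" for ta
 using that interior_subset unfolding Z_def by blast
 qed auto
 then show ?thesis by simp
 qed
 then have "ball x r \<subseteq> Z" unfolding Z_def using r by (intro interior_maximal) auto
 then show "x : Z" using r by auto
 qed (rule \<open>Z \<subseteq> W\<close>)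
 ultimately have "Z = {} \<or> Z = W" using W(2) by (auto simp: connected_clopen)
 then have "z : Z" using U(2) \<open>U \<subseteq> Z\<close> z by auto
 then show ?thesis using interior_subset unfolding Z_def by blast
qed

lemma geometric_convergence:
 fixes s :: "nat => complex"
 assumes "!!k. N <= k ==> dist (s (Suc k)) (s k) <= (1/2) ^ k"
 shows "convergent s" "!!k. N <= k ==> dist (s k) (lim s) <= 2 * (1/2) ^ k"
proof -
 have b: "dist (s (k + d)) (s k) <= 2 * (1/2) ^ k" if k: "N <= k" for k d
 proof -
 have "dist (s (k + d)) (s k) <= 2 * (1/2) ^ k * (1 - (1/2) ^ d)"
 proof (induction d)
 case (Suc d)
 have "dist (s (k + Suc d)) (s k) <= dist (s (Suc (k + d))) (s (k + d)) + dist (s (k + d)) (s k)"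
 using dist_triangle by simp
 also have "... <= (1/2) ^ (k + d) + 2 * (1/2) ^ k * (1 - (1/2) ^ d)"
 by (intro add_mono Suc assms) (use k in auto)
 also have "... = 2 * (1/2) ^ k * (1 - (1/2) ^ Suc d)" by (simp add: power_add field_simps)
 finally show ?case .
 qed simp
 also have "... <= 2 * (1/2) ^ k * 1" by (intro mult_left_mono) auto
 finally show ?thesis by simp
 qed
 have "Cauchy s"
 proof (rule metric_CauchyI)
 fix e :: real assume "e > 0"
 moreover have "(%k. 4 * (1/2::real) ^ k) \<longlonglongrightarrow> 4 * 0" by (intro tendsto_intros) auto
 ultimately have "\<forall>\<^sub>F k in sequentially. 4 * (1/2::real) ^ k < e" by (intro order_tendstoD(2)) auto
 then obtain K where K: "!!k. k \<ge> K ==> 4 * (1/2::real) ^ k < e" by (auto simp: eventually_sequentially)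
 define M where "M = max K N"
 have "dist (s m) (s n) < e" if "m \<ge> M" "n \<ge> M" for m n
 proof -
 have "dist (s m) (s n) <= dist (s m) (s M) + dist (s n) (s M)" by (rule dist_triangle2)
 also have "... <= 2 * (1/2) ^ M + 2 * (1/2) ^ M"
 using b[of M "m - M"] b[of M "n - M"] that by (intro add_mono) (auto simp: M_def)
 also have "... < e" using K[of M] by (simp add: M_def)
 finally show ?thesis .
 qed
 then show "\<exists>M. \<forall>m\<ge>M. \<forall>n\<ge>M. dist (s m) (s n) < e" by blast
 qed
 then show conv: "convergent s" by (rule Cauchy_convergent)
 fix k assume k: "N <= k"
 have "(%d. dist (s (k + d)) (s k)) \<longlonglongrightarrow> dist (lim s) (s k)"
 using LIMSEQ_ignore_initial_segment[OF conv[unfolded convergent_LIMSEQ_iff], of k]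
 by (intro tendsto_intros) (simp add: add.commute)
 then have "dist (lim s) (s k) <= 2 * (1/2) ^ k"
 by (rule LIMSEQ_le_const2) (use b[OF k] in auto)
 then show "dist (s k) (lim s) <= 2 * (1/2) ^ k" by (simp add: dist_commute)
qed

text \<open>Some g has |g p| above its supremum on K. The quotient g / g p is 1 at p and bounded by
  some q < 1 on K, so a high power of it, multiplied by A, is A at p and small on K.\<close>

lemma not_in_hull_peak:
 fixes Om :: "(complex^'n) set"
 assumes Om: "open Om" and K: "K ~= {}" and p: "p : Om" "p \<notin> holomorphic_hull Om K" and e: "0 < e"
 shows "\<exists>h. h holomorphic_on_Cn Om \<and> h p = of_real A \<and> (\<forall>z\<in>K. cmod (h z) <= e)"
proof -
 obtain g where g: "g holomorphic_on_Cn Om" "(SUP w\<in>K. ereal (cmod (g w))) < ereal (cmod (g p))"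
 using p unfolding holomorphic_hull_def by (auto simp: not_le)
 then obtain s0 where s0: "(SUP w\<in>K. ereal (cmod (g w))) < ereal s0" "s0 < cmod (g p)"
 using ereal_dense2 by (metis ereal_less_eq(3) less_ereal.simps(1) not_le)
 have le: "cmod (g w) <= s0" if "w : K" for w
 proof -
 have "ereal (cmod (g w)) <= (SUP w\<in>K. ereal (cmod (g w)))" using that by (rule SUP_upper)
 then have "ereal (cmod (g w)) < ereal s0" using s0(1) by (rule le_less_trans)
 then show ?thesis by simp
 qed
 have s00: "0 <= s0" using K le norm_ge_zero order_trans by (metis ex_in_conv)
 have gp: "cmod (g p) > 0" using s0 s00 by linarith
 define q where "q = s0 / cmod (g p)"
 have q: "0 <= q" "q < 1" using s0 s00 gp by (auto simp: q_def)
 have "(%N. \<bar>A\<bar> * q ^ N) \<longlonglongrightarrow> \<bar>A\<bar> * 0" using q by (intro tendsto_intros LIMSEQ_power_zero) auto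
 then have "\<forall>\<^sub>F N in sequentially. \<bar>A\<bar> * q ^ N < e" using e by (intro order_tendstoD(2)) auto
 then obtain N where N: "\<bar>A\<bar> * q ^ N < e" by (auto simp: eventually_sequentially)
 define h where "h z = of_real A * (inverse (g p) * g z) ^ N" for z
 have "h holomorphic_on_Cn Om" unfolding h_def
 by (intro holomorphic_on_Cn_cmult holomorphic_on_Cn_power Om g)
 moreover have "h p = of_real A" using gp by (simp add: h_def)
 moreover have "cmod (h z) <= e" if "z : K" for z
 proof -
 have "cmod (inverse (g p) * g z) <= q"
 using le[OF that] gp by (simp add: q_def norm_mult norm_inverse divide_inverse mult.commute mult_right_mono)
 then have "cmod (h z) <= \<bar>A\<bar> * q ^ N"
 by (simp add: h_def norm_mult norm_power norm_inverse mult_left_mono power_mono del: power_mult_distrib)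
 then show ?thesis using N by simp
 qed
 ultimately show ?thesis by blast
qed

text \<open>The function is a series of peak functions. Each term is at most (1/2)^k on the current
  compact set, but so large at a new point of the sequence outside the hull of that set that the
  partial sum is large there. The following compact sets contain this point, so the remaining terms
  cannot undo the growth.\<close>

lemma holomorphically_convex_unbounded:
 fixes Om :: "(complex^'n) set" and x :: "nat => complex^'n"
 assumes hc: "holomorphically_convex Om" and x: "!!n. x n : Om"
 and esc: "!!C. compact C ==> C \<subseteq> Om ==> \<exists>n. x n \<notin> C"
 shows "\<exists>f. f holomorphic_on_Cn Om \<and> (\<forall>M. \<exists>n. cmod (f (x n)) > M)"
proof -
 have Om: "open Om" using hc by (simp add: holomorphically_convex_def is_domain_def)
 obtain C where C: "!!n. compact (C n)" "!!n. C n \<subseteq> Om" "!!n. C n \<subseteq> interior (C (Suc n))"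
 "\<Union>(range C) = Om" "!!K. compact K ==> K \<subseteq> Om ==> \<exists>N. \<forall>n\<ge>N. K \<subseteq> C n"
 using open_Union_compact_subsets[OF Om] by blast
 have Cmono: "C m \<subseteq> C n" if "m <= n" for m n
 using that by (rule lift_Suc_mono_le[rotated]) (use C(3) interior_subset in blast)
 \<comment> \<open>A state consists of the index m of the current compact set, the point p chosen
   last, and the partial sum S.\<close>
 define P where "P k s \<longleftrightarrow> (case s of (m, p, S) => k <= m \<and> p : range x \<and> S holomorphic_on_Cn Om \<and> cmod (S p) \<ge> real k)"
 for k :: nat and s :: "nat \<times> (complex^'n) \<times> (complex^'n => complex)"
 define Q where "Q k s s' \<longleftrightarrow> (case s of (m, p, S) => case s' of (m', p', S') =>
 m < m' \<and> p : C m' \<and> (\<forall>z\<in>C m'. dist (S' z) (S z) <= (1/2) ^ k))"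
 for k :: nat and s s' :: "nat \<times> (complex^'n) \<times> (complex^'n => complex)"
 have "\<exists>F. \<forall>n. P n (F n) \<and> Q n (F n) (F (Suc n))"
 proof (rule dependent_nat_choice)
 show "\<exists>s. P 0 s" unfolding P_def by (rule exI[of _ "(0, x 0, %_. 0)"]) (auto simp: holomorphic_on_Cn_const)
 fix s k assume "P k s"
 then obtain m p S where s: "s = (m, p, S)" "k <= m" "p : range x" "S holomorphic_on_Cn Om"
 by (auto simp: P_def)
 have "compact {p}" "{p} \<subseteq> Om" using s x by auto
 then obtain N where N: "!!n. n \<ge> N ==> {p} \<subseteq> C n" using C(5) by meson
 define m' where "m' = max N (Suc m)"
 have m': "m < m'" "p : C m'" using N by (auto simp: m'_def)
 have "compact (holomorphic_hull Om (C m'))" "holomorphic_hull Om (C m') \<subseteq> Om"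
 using hc C by (auto simp: holomorphically_convex_def holomorphic_hull_def)
 then obtain j where j: "x j \<notin> holomorphic_hull Om (C m')" using esc by blast
 \<comment> \<open>The value prescribed at \<open>x j\<close> outweighs \<open>S (x j)\<close>, so
   that the new partial sum has modulus at least k + 1 there.\<close>
 obtain h where h: "h holomorphic_on_Cn Om" "h (x j) = of_real (real (Suc k) + cmod (S (x j)))"
 "!!z. z : C m' ==> cmod (h z) <= (1/2) ^ k"
 using not_in_hull_peak[OF Om _ x j, of "(1/2) ^ k"] m'(2) by (metis empty_iff zero_less_power half_gt_zero_iff zero_less_one)
 define S' where "S' z = S z - (-1) * h z" for z
 have S': "S' holomorphic_on_Cn Om" unfolding S'_def
 by (intro holomorphic_on_Cn_diff holomorphic_on_Cn_cmult h s Om)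
 have "cmod (S' (x j)) \<ge> cmod (h (x j)) - cmod (S (x j))"
 using norm_diff_ineq[of "h (x j)" "S (x j)"] by (simp add: S'_def add.commute)
 moreover have "cmod (h (x j)) = real (Suc k) + cmod (S (x j))"
 unfolding h norm_of_real by simp
 ultimately have "P (Suc k) (m', x j, S')" using S' s(2) m' by (auto simp: P_def)
 moreover have "Q k s (m', x j, S')" using m' h(3) by (auto simp: Q_def s S'_def dist_norm)
 ultimately show "\<exists>s'. P (Suc k) s' \<and> Q k s s'" by blast
 qed
 then obtain F where F: "!!n. P n (F n)" "!!n. Q n (F n) (F (Suc n))" by blast
 define m where "m n = fst (F n)" for n
 define p where "p n = fst (snd (F n))" for n
 define S where "S n = snd (snd (F n))" for n
 have m: "n <= m n" and p: "p n : range x" and S: "S n holomorphic_on_Cn Om" "cmod (S n (p n)) \<ge> real n" for n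
 using F(1)[of n] by (auto simp: P_def m_def p_def S_def case_prod_unfold)
 have step: "m n < m (Suc n)" "p n : C (m (Suc n))" "!!z. z : C (m (Suc n)) ==> dist (S (Suc n) z) (S n z) <= (1/2) ^ n" for n
 using F(2)[of n] by (auto simp: Q_def m_def p_def S_def case_prod_unfold)
 have mmono: "m i <= m j" if "i <= j" for i j
 using that by (rule lift_Suc_mono_le[rotated]) (use step(1) less_imp_le in blast)
 define f where "f z = lim (%n. S n z)" for z
 have conv: "dist (S k z) (f z) <= 2 * (1/2) ^ k" if "z : C (m (Suc N))" "N <= k" for z N k
 unfolding f_def
 proof (rule geometric_convergence(2)[OF _ that(2)])
 show "dist (S (Suc k) z) (S k z) <= (1 / 2) ^ k" if "N <= k" for k
 using step(3)[of z k] Cmono[OF mmono[of "Suc N" "Suc k"]] that \<open>z : C (m (Suc N))\<close> by auto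
 qed
 have "f holomorphic_on_Cn Om"
 proof (rule holomorphic_on_Cn_uniform_limit[OF Om S(1)])
 fix y assume "y : Om"
 then obtain d where d: "d > 0" "cball y d \<subseteq> Om" using Om open_contains_cball by blast
 obtain N where N: "!!n. n \<ge> N ==> cball y d \<subseteq> C n" using C(5)[OF compact_cball d(2)] by blast
 have "N <= m (Suc N)" using m[of "Suc N"] by simp
 then have in_C: "cball y d \<subseteq> C (m (Suc N))" by (rule N)
 have "uniform_limit (cball y d) S f sequentially"
 proof (rule uniform_limitI)
 fix e :: real assume "e > 0"
 moreover have "(%k. 2 * (1/2::real) ^ k) \<longlonglongrightarrow> 2 * 0" by (intro tendsto_intros) auto
 ultimately have "\<forall>\<^sub>F k in sequentially. 2 * (1/2::real) ^ k < e" by (intro order_tendstoD(2)) auto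
 then show "\<forall>\<^sub>F n in sequentially. \<forall>z\<in>cball y d. dist (S n z) (f z) < e"
 using eventually_ge_at_top[of N]
 proof eventually_elim
 case (elim n)
 then show ?case using conv[OF _ elim(2)] in_C by (meson le_less_trans subsetD)
 qed
 qed
 then show "\<exists>d>0. cball y d \<subseteq> Om \<and> uniform_limit (cball y d) S f sequentially" using d by blast
 qed
 moreover have "\<exists>n. cmod (f (x n)) > M" for M
 proof -
 obtain k :: nat where k: "real k > M + 2" using reals_Archimedean2 by blast
 have "dist (S k (p k)) (f (p k)) <= 2 * (1/2) ^ k" by (rule conv[OF step(2) order_refl])
 also have "... <= 2 * 1" by (intro mult_left_mono power_le_one) auto
 finally have "cmod (f (p k)) \<ge> real k - 2"
 using S(2)[of k] norm_triangle_ineq2[of "S k (p k)" "f (p k)"] by (simp add: dist_norm)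
 then have "cmod (f (p k)) > M" using k by linarith
 then show ?thesis using p[of k] by auto
 qed
 ultimately show ?thesis by blast
qed

text \<open>Suppose all functions continue from Om1 to Om2, and let W be the component of the
  intersection of Om and Om2 that contains a point of Om1. Since Om2 is connected and leaves Om, it
  contains a frontier point b of W, and b is not in Om because W is a full component. A function
  unbounded along a sequence in W tending to b cannot agree on W with a function continuous at
  b.\<close>

theorem holomorphically_convex_imp_domain_of_holomorphy:
 fixes Om :: "(complex^'n) set"
 assumes hc: "holomorphically_convex Om"
 shows "domain_of_holomorphy Om"
proof (rule ccontr)
 assume not: "\<not> domain_of_holomorphy Om"
 have dom: "is_domain Om" and Om: "open Om" using hc by (auto simp: holomorphically_convex_def is_domain_def)
 obtain Om1 Om2 where o: "open Om1" "open Om2" "connected Om2" "\<not> Om2 \<subseteq> Om" "Om1 ~= {}" "Om1 \<subseteq> Om2 \<inter> Om"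
 and ext: "!!u. u holomorphic_on_Cn Om ==> \<exists>u2. u2 holomorphic_on_Cn Om2 \<and> (\<forall>z\<in>Om1. u z = u2 z)"
 using not dom unfolding domain_of_holomorphy_def by metis
 obtain x0 where x0: "x0 : Om1" using o by blast
 define W where "W = connected_component_set (Om \<inter> Om2) x0"
 have W: "open W" "connected W" "W \<subseteq> Om \<inter> Om2" "x0 : W"
 using x0 o Om connected_component_subset[of "Om \<inter> Om2" x0]
 by (auto simp: W_def open_connected_component open_Int simp del: connected_component_subset)
 have "Om2 \<inter> frontier W ~= {}"
 using W o x0 by (intro connected_Int_frontier) auto
 then obtain b where b: "b : Om2" "b : frontier W" by blast
 have bW: "b \<notin> W" "b : closure W" using b W(1) by (auto simp: frontier_def interior_open)
 have "b \<notin> Om"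
 proof
 assume "b : Om"
 then obtain e where e: "e > 0" "ball b e \<subseteq> Om \<inter> Om2" using b Om o open_Int open_contains_ball by (metis IntI)
 have "W \<inter> ball b e ~= {}" using bW(2) e(1) by (metis centre_in_ball closure_iff_nhds_not_empty disjoint_iff open_ball order_refl inf_commute)
 then have "connected (W \<union> ball b e)" using W by (intro connected_Un) auto
 then have "W \<union> ball b e \<subseteq> W"
 unfolding W_def using W e by (intro connected_component_maximal) (auto simp: W_def)
 moreover have "b : ball b e" using e(1) by simp
 ultimately show False using bW(1) by blast
 qed
 obtain x where x: "!!n::nat. x n : W" "x \<longlonglongrightarrow> b" using bW(2) unfolding closure_sequential by blast
 have "\<exists>n. x n \<notin> C" if "compact C" "C \<subseteq> Om" for C
 proof (rule ccontr)
 assume "\<nexists>n. x n \<notin> C"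
 then have "b : C" using x(2) compact_imp_closed[OF that(1)] closed_sequentially by blast
 then show False using that \<open>b \<notin> Om\<close> by blast
 qed
 moreover have "x n : Om" for n using x(1) W(3) by blast
 ultimately obtain f where f: "f holomorphic_on_Cn Om" "!!M. \<exists>n. cmod (f (x n)) > M"
 using holomorphically_convex_unbounded[OF hc] by metis
 obtain u where u: "u holomorphic_on_Cn Om2" "!!z. z : Om1 ==> f z = u z" using ext[OF f(1)] by blast
 have eq: "f z = u z" if "z : W" for z
 proof (rule holomorphic_on_Cn_identity[OF _ _ W(1,2) _ _ _ _ that, of f u "Om1 \<inter> W"])
 show "f holomorphic_on_Cn W" "u holomorphic_on_Cn W"
 using f u W(3) by (auto intro: holomorphic_on_Cn_subset)
 qed (use W o x0 u(2) in auto)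
 have "isCont u b"
 using holomorphic_on_Cn_imp_continuous_on[OF u(1)] o(2) b(1) by (simp add: continuous_on_eq_continuous_at)
 then have "(%n. u (x n)) \<longlonglongrightarrow> u b" using x(2) by (rule isCont_tendsto_compose)
 then have "Bseq (%n. u (x n))" by (intro convergent_imp_Bseq convergentI)
 then obtain M where "!!n. cmod (u (x n)) <= M" by (auto simp: Bseq_def)
 moreover obtain n where "cmod (f (x n)) > M" using f(2) by blast
 ultimately show False using eq[OF x(1)[of n]] by (simp add: not_le[symmetric])
qed

section \<open>Square integrable functions and the Riesz representation theorem\<close>

text \<open>Actual functions, not classes, with values in any Euclidean space and with a real inner
  product: scalar functions and forms are treated alike.\<close>

definition L2 :: "('a::euclidean_space => 'b::euclidean_space) set"
 where "L2 = {f : borel_measurable borel. integrable lborel (%x. (norm (f x))\<^sup>2)}"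

definition L2_inner :: "('a::euclidean_space => 'b::euclidean_space) => ('a => 'b) => real"
 where "L2_inner f g = (LBINT x. f x \<bullet> g x)"

definition L2_sq :: "('a::euclidean_space => 'b::euclidean_space) => real"
 where "L2_sq f = (LBINT x. (norm (f x))\<^sup>2)"

lemma L2_measurable [measurable_dest]: "f : L2 ==> f : borel_measurable borel"
 by (simp add: L2_def)

lemma L2_integrable: "f : L2 ==> integrable lborel (%x. (norm (f x))\<^sup>2)"
 by (simp add: L2_def)

lemma inner_le_squares: "\<bar>u \<bullet> v\<bar> <= (norm u)\<^sup>2 + (norm (v::'b::real_inner))\<^sup>2"
proof -
 have "\<bar>u \<bullet> v\<bar> <= norm u * norm v" by (rule Cauchy_Schwarz_ineq2)
 also have "... <= (norm u)\<^sup>2 + (norm v)\<^sup>2"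
 proof -
 have "0 <= norm u * norm v" by simp
 moreover have "2 * (norm u * norm v) <= (norm u)\<^sup>2 + (norm v)\<^sup>2"
 using sum_squares_bound[of "norm u" "norm v"] by (simp add: mult.assoc)
 ultimately show ?thesis by linarith
 qed
 finally show ?thesis .
qed

lemma L2_inner_integrable:
 assumes "f : L2" "g : L2"
 shows "integrable lborel (%x. f x \<bullet> g x)"
proof (rule Bochner_Integration.integrable_bound)
 show "integrable lborel (%x. (norm (f x))\<^sup>2 + (norm (g x))\<^sup>2)"
 using assms by (intro Bochner_Integration.integrable_add L2_integrable)
 show "(%x. f x \<bullet> g x) : borel_measurable lborel" using assms[THEN L2_measurable] by measurable
 show "AE x in lborel. norm (f x \<bullet> g x) <= norm ((norm (f x))\<^sup>2 + (norm (g x))\<^sup>2)"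
 using inner_le_squares by (auto intro!: AE_I2 order_trans[OF inner_le_squares])
qed

lemma L2_zero: "(%x. 0) : L2" by (simp add: L2_def)

lemma L2_scaleR: "f : L2 ==> (%x. c *\<^sub>R f x) : L2"
 by (auto simp: L2_def power_mult_distrib)

lemma norm_add_sq: "(norm (u + v))\<^sup>2 = (norm u)\<^sup>2 + 2 * (u \<bullet> v) + (norm (v::'b::real_inner))\<^sup>2"
 by (simp add: power2_norm_eq_inner inner_add_left inner_add_right inner_commute)

lemma L2_add:
 assumes "f : L2" "g : L2" shows "(%x. f x + g x) : L2"
proof -
 have "integrable lborel (%x. (norm (f x))\<^sup>2 + 2 * (f x \<bullet> g x) + (norm (g x))\<^sup>2)"
 using assms by (intro Bochner_Integration.integrable_add Bochner_Integration.integrable_mult_right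
 L2_integrable L2_inner_integrable)
 moreover have "(%x. f x + g x) : borel_measurable borel" using assms[THEN L2_measurable] by measurable
 ultimately show ?thesis by (simp add: L2_def norm_add_sq)
qed

lemma L2_diff:
 assumes "f : L2" "g : L2" shows "(%x. f x - g x) : L2"
 using L2_add[OF assms(1) L2_scaleR[OF assms(2), of "-1"]] by simp

lemma L2_inner_commute: "L2_inner f g = L2_inner g f"
 by (simp add: L2_inner_def inner_commute)

lemma L2_inner_add_left:
 assumes "f : L2" "g : L2" "h : L2"
 shows "L2_inner (%x. f x + g x) h = L2_inner f h + L2_inner g h"
 unfolding L2_inner_def inner_add_left
 by (rule Bochner_Integration.integral_add) (intro L2_inner_integrable assms)+

lemma L2_inner_scaleR_left: "L2_inner (%x. c *\<^sub>R f x) h = c * L2_inner f h"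
 by (simp add: L2_inner_def)

lemma L2_inner_diff_left:
 assumes "f : L2" "g : L2" "h : L2"
 shows "L2_inner (%x. f x - g x) h = L2_inner f h - L2_inner g h"
 unfolding L2_inner_def inner_diff_left
 by (rule Bochner_Integration.integral_diff) (intro L2_inner_integrable assms)+

lemma L2_sq_inner: "L2_sq f = L2_inner f f"
 by (simp add: L2_sq_def L2_inner_def power2_norm_eq_inner)

lemma L2_sq_nonneg: "0 <= L2_sq f" by (simp add: L2_sq_def)

lemma L2_sq_scaleR: "L2_sq (%x. c *\<^sub>R f x) = c\<^sup>2 * L2_sq f"
 by (simp add: L2_sq_def power_mult_distrib)

lemma L2_sq_add:
 assumes "f : L2" "g : L2"
 shows "L2_sq (%x. f x + g x) = L2_sq f + 2 * L2_inner f g + L2_sq g"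
 unfolding L2_sq_def L2_inner_def norm_add_sq
 using assms by (simp add: L2_integrable L2_inner_integrable)

lemma L2_sq_diff:
 assumes "f : L2" "g : L2"
 shows "L2_sq (%x. f x - g x) = L2_sq f - 2 * L2_inner f g + L2_sq g"
 using L2_sq_add[OF assms(1) L2_scaleR[OF assms(2), of "-1"]]
 using L2_inner_scaleR_left[of "-1" g f] L2_sq_scaleR[of "-1" g]
 by (simp add: L2_inner_commute[of f])

lemma L2_sq_diff_commute: "L2_sq (%x. f x - g x) = L2_sq (%x. g x - f x)"
 by (simp add: L2_sq_def norm_minus_commute)

lemma L2_sq_add_le:
 assumes "f : L2" "g : L2"
 shows "L2_sq (%x. f x + g x) <= 2 * L2_sq f + 2 * L2_sq g"
 using L2_sq_add[OF assms] L2_sq_diff[OF assms] L2_sq_nonneg[of "%x. f x - g x"] by linarith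

lemma discriminant_le:
 fixes A B C :: real
 assumes "!!t. 0 <= A + 2 * t * B + t\<^sup>2 * C"
 shows "B\<^sup>2 <= A * C"
proof (cases "C = 0")
 case True
 have "B = 0"
 proof (rule ccontr)
 assume "B ~= 0"
 then show False using assms[of "- (A + 1) / (2 * B)"] True by (simp add: field_simps)
 qed
 then show ?thesis using True by simp
next
 case False
 have "0 <= C"
 proof (rule ccontr)
 assume C: "\<not> 0 <= C"
 \<comment> \<open>For C < 0 this t is at least 1 and makes the quadratic term outweigh both
   others.\<close>
 define t where "t = 1 + (A + 2 * \<bar>B\<bar>) / (-C)"
 have A: "0 <= A" using assms[of 0] by simp
 have "0 <= (A + 2 * \<bar>B\<bar>) / (-C)" using C A by (intro divide_nonneg_pos) auto
 then have t1: "1 <= t" unfolding t_def by linarith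
 have "t * C = C - (A + 2 * \<bar>B\<bar>)" using C by (simp add: t_def field_simps)
 then have "t\<^sup>2 * C = t * (C - (A + 2 * \<bar>B\<bar>))" by (simp add: power2_eq_square mult.assoc)
 moreover have "2 * t * B <= 2 * t * \<bar>B\<bar>" using t1 by (intro mult_left_mono) auto
 ultimately have "A + 2 * t * B + t\<^sup>2 * C <= A - t * A + t * C" by (simp add: algebra_simps)
 also have "... < 0"
 proof -
 have "A <= t * A" using A t1 by (simp add: mult_le_cancel_right1)
 moreover have "t * C < 0" using C t1 by (simp add: mult_pos_neg)
 ultimately show ?thesis by linarith
 qed
 finally show False using assms[of t] by linarith
 qed
 then have C: "0 < C" using False by simp
 have "0 <= A + 2 * (- B / C) * B + (- B / C)\<^sup>2 * C" by (rule assms)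
 also have "... = A - B\<^sup>2 / C" using C by (simp add: power2_eq_square field_simps)
 finally have "B\<^sup>2 / C <= A" by simp
 then show ?thesis using C by (simp add: field_simps)
qed

lemma L2_Cauchy_Schwarz:
 assumes "f : L2" "g : L2"
 shows "(L2_inner f g)\<^sup>2 <= L2_sq f * L2_sq g"
proof (rule discriminant_le)
 fix t :: real
 have "0 <= L2_sq (%x. f x + t *\<^sub>R g x)" by (rule L2_sq_nonneg)
 also have "... = L2_sq f + 2 * t * L2_inner f g + t\<^sup>2 * L2_sq g"
 using L2_sq_add[OF assms(1) L2_scaleR[OF assms(2), of t]]
 by (simp add: L2_sq_scaleR L2_inner_commute[of f] L2_inner_scaleR_left)
 finally show "0 <= L2_sq f + 2 * t * L2_inner f g + t\<^sup>2 * L2_sq g" .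
qed

lemma L2_inner_tendsto:
 assumes s: "!!n. s n : L2" and U: "U : L2" and g: "g : L2"
 and lim: "(%n. L2_sq (%x. s n x - U x)) \<longlonglongrightarrow> 0"
 shows "(%n. L2_inner (s n) g) \<longlonglongrightarrow> L2_inner U g"
proof -
 have "(%n. L2_inner (s n) g - L2_inner U g) \<longlonglongrightarrow> 0"
 proof (rule Lim_null_comparison)
 show "\<forall>\<^sub>F n in sequentially. norm (L2_inner (s n) g - L2_inner U g) <= sqrt (L2_sq (%x. s n x - U x) * L2_sq g)"
 proof (intro always_eventually allI)
 fix n
 have "(L2_inner (s n) g - L2_inner U g)\<^sup>2 <= L2_sq (%x. s n x - U x) * L2_sq g"
 using L2_Cauchy_Schwarz[OF L2_diff[OF s U] g, of n] by (simp add: L2_inner_diff_left[OF s U g])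
 then show "norm (L2_inner (s n) g - L2_inner U g) <= sqrt (L2_sq (%x. s n x - U x) * L2_sq g)"
 using real_le_rsqrt by (metis power2_abs real_norm_def)
 qed
 have "(%n. sqrt (L2_sq (%x. s n x - U x) * L2_sq g)) \<longlonglongrightarrow> sqrt (0 * L2_sq g)"
 by (intro tendsto_intros lim)
 then show "(%n. sqrt (L2_sq (%x. s n x - U x) * L2_sq g)) \<longlonglongrightarrow> 0" by simp
 qed
 then show ?thesis by (simp add: LIM_zero_iff)
qed

lemma L2_sq_tendsto:
 assumes s: "!!n. s n : L2" and U: "U : L2"
 and lim: "(%n. L2_sq (%x. s n x - U x)) \<longlonglongrightarrow> 0"
 shows "(%n. L2_sq (s n)) \<longlonglongrightarrow> L2_sq U"
proof -
 have "(%n. L2_sq (%x. s n x - U x) + 2 * L2_inner (s n) U - L2_sq U) \<longlonglongrightarrow> 0 + 2 * L2_inner U U - L2_sq U"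
 by (intro tendsto_intros lim L2_inner_tendsto s U)
 then show ?thesis by (simp add: L2_sq_diff[OF s U] L2_sq_inner)
qed

text \<open>Riesz-Fischer. Along a subsequence with squared distances below (1/4)^k, the sum of 2^k
  |d k|^2 has a finite integral and so is finite almost everywhere; this bounds |d k| by a geometric
  sequence and gives pointwise convergence. Fatou's lemma then yields convergence in mean of the
  whole sequence.\<close>

lemma L2_complete:
 fixes f :: "nat => 'a::euclidean_space => 'b::euclidean_space"
 assumes f: "!!n. f n : L2"
 and cau: "!!e. e > 0 ==> \<exists>N. \<forall>m\<ge>N. \<forall>n\<ge>N. L2_sq (%x. f m x - f n x) < e"
 shows "\<exists>U\<in>L2. (%n. L2_sq (%x. f n x - U x)) \<longlonglongrightarrow> 0"
proof -
 have [measurable]: "f n : borel_measurable borel" for n by (rule L2_measurable[OF f])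
 have "\<exists>r. \<forall>k. (\<forall>m\<ge>r k. \<forall>n\<ge>r k. L2_sq (%x. f m x - f n x) < (1/4) ^ k) \<and> r k < r (Suc k)"
 proof (rule dependent_nat_choice)
 show "\<exists>N. \<forall>m\<ge>N. \<forall>n\<ge>N. L2_sq (%x. f m x - f n x) < (1/4) ^ 0" by (rule cau) simp
 fix r k
 obtain N where N: "\<forall>m\<ge>N. \<forall>n\<ge>N. L2_sq (%x. f m x - f n x) < (1/4) ^ Suc k"
 using cau[of "(1/4) ^ Suc k"] by auto
 then show "\<exists>y. (\<forall>m\<ge>y. \<forall>n\<ge>y. L2_sq (%x. f m x - f n x) < (1/4) ^ Suc k) \<and> r < y"
 by (intro exI[of _ "max N (Suc r)"]) auto
 qed
 then obtain r where r: "!!k m n. m \<ge> r k ==> n \<ge> r k ==> L2_sq (%x. f m x - f n x) < (1/4) ^ k"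
 and rs: "!!k. r k < r (Suc k)" by blast
 have sm: "strict_mono r" using rs by (simp add: strict_mono_Suc_iff)
 define d where "d k x = f (r (Suc k)) x - f (r k) x" for k x
 have dL2: "d k : L2" for k unfolding d_def by (intro L2_diff f)
 have [measurable]: "d k : borel_measurable borel" for k by (rule L2_measurable[OF dL2])
 have nn: "(\<integral>\<^sup>+x. ennreal ((norm (h x))\<^sup>2) \<partial>lborel) = ennreal (L2_sq h)" if "h : L2" for h :: "'a => 'b"
 unfolding L2_sq_def by (rule nn_integral_eq_integral[OF L2_integrable[OF that]]) simp
 have "(\<integral>\<^sup>+x. (\<Sum>k. ennreal (2 ^ k * (norm (d k x))\<^sup>2)) \<partial>lborel) = (\<Sum>k. \<integral>\<^sup>+x. ennreal (2 ^ k * (norm (d k x))\<^sup>2) \<partial>lborel)"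
 by (rule nn_integral_suminf) measurable
 also have "... <= (\<Sum>k. ennreal ((1/2) ^ k))"
 proof (rule suminf_le)
 fix k
 have "(\<integral>\<^sup>+x. ennreal (2 ^ k * (norm (d k x))\<^sup>2) \<partial>lborel) = ennreal (2 ^ k) * (\<integral>\<^sup>+x. ennreal ((norm (d k x))\<^sup>2) \<partial>lborel)"
 by (subst nn_integral_cmult[symmetric]) (auto simp: ennreal_mult)
 also have "... = ennreal (2 ^ k * L2_sq (d k))"
 by (simp add: nn[OF dL2] ennreal_mult L2_sq_nonneg)
 also have "... <= ennreal (2 ^ k * (1/4) ^ k)"
 using r[of k "r (Suc k)" "r k"] rs[of k] by (intro ennreal_leI mult_left_mono) (auto simp: d_def[abs_def])
 also have "2 ^ k * (1/4) ^ k = (1/2::real) ^ k" by (simp add: power_mult_distrib[symmetric])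
 finally show "(\<integral>\<^sup>+x. ennreal (2 ^ k * (norm (d k x))\<^sup>2) \<partial>lborel) <= ennreal ((1/2) ^ k)" .
 qed auto
 also have "(\<Sum>k. ennreal ((1/2) ^ k)) = ennreal (\<Sum>k. (1/2) ^ k)"
 by (rule suminf_ennreal2) (auto intro: summable_geometric)
 also have "... < \<infinity>" by simp
 finally have fin: "(\<integral>\<^sup>+x. (\<Sum>k. ennreal (2 ^ k * (norm (d k x))\<^sup>2)) \<partial>lborel) < \<infinity>" .
 have "AE x in lborel. (\<Sum>k. ennreal (2 ^ k * (norm (d k x))\<^sup>2)) ~= \<infinity>"
 by (rule nn_integral_PInf_AE) (use fin in \<open>auto simp: less_top\<close>)
 then have conv: "AE x in lborel. convergent (%k. f (r k) x)"
 proof eventually_elim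
 case (elim x)
 define T where "T = (\<Sum>k. ennreal (2 ^ k * (norm (d k x))\<^sup>2))"
 obtain c where c: "T = ennreal c" "0 <= c" using elim by (cases T) (auto simp: T_def top_ennreal_def)
 have "2 ^ k * (norm (d k x))\<^sup>2 <= c" for k
 proof -
 have "ennreal (2 ^ k * (norm (d k x))\<^sup>2) <= T"
 proof -
 have "(\<Sum>j\<in>{k}. ennreal (2 ^ j * (norm (d j x))\<^sup>2)) <= T"
 unfolding T_def by (rule sum_le_suminf) (rule summableI, simp_all)
 then show ?thesis by simp
 qed
 then show ?thesis using c by simp
 qed
 then have "(norm (d k x))\<^sup>2 <= c * (1/2) ^ k" for k
 by (simp add: field_simps power_divide)
 then have "norm (d k x) <= sqrt (c * (1/2) ^ k)" for k by (rule real_le_rsqrt)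
 then have le: "norm (d k x) <= sqrt c * (sqrt (1/2)) ^ k" for k
 by (simp add: real_sqrt_mult real_sqrt_power)
 have "summable (%k. sqrt c * (sqrt (1/2)) ^ k)"
 by (intro summable_mult summable_geometric) (simp add: real_sqrt_divide)
 then have "summable (%k. d k x)" by (rule summable_comparison_test'[of _ 0]) (rule le)
 then have "convergent (%k. \<Sum>i<k. d i x)" by (simp add: summable_iff_convergent)
 then have "convergent (%k. f (r 0) x + (\<Sum>i<k. d i x))" by (intro convergent_add convergent_const)
 moreover have "f (r 0) x + (\<Sum>i<k. d i x) = f (r k) x" for k
 by (induction k) (auto simp: d_def algebra_simps)
 ultimately show ?case by simp
 qed
 define U where "U x = lim (%k. f (r k) x)" for x
 have Um[measurable]: "U : borel_measurable borel" unfolding U_def by measurable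
 have conv': "AE x in lborel. (%k. f (r k) x) \<longlonglongrightarrow> U x"
 using conv by eventually_elim (simp add: U_def convergent_LIMSEQ_iff)
 have bound: "(\<integral>\<^sup>+x. ennreal ((norm (f m x - U x))\<^sup>2) \<partial>lborel) <= ennreal ((1/4) ^ k)" if "m \<ge> r k" for m k
 proof -
 have "(\<integral>\<^sup>+x. ennreal ((norm (f m x - U x))\<^sup>2) \<partial>lborel)
 = (\<integral>\<^sup>+x. liminf (%j. ennreal ((norm (f m x - f (r j) x))\<^sup>2)) \<partial>lborel)"
 proof (rule nn_integral_cong_AE, use conv' in eventually_elim)
 case (elim x)
 have "(%j. ennreal ((norm (f m x - f (r j) x))\<^sup>2)) \<longlonglongrightarrow> ennreal ((norm (f m x - U x))\<^sup>2)"
 by (intro tendsto_intros elim)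
 then show ?case by (rule lim_imp_Liminf[symmetric, rotated]) simp
 qed
 also have "... <= liminf (%j. \<integral>\<^sup>+x. ennreal ((norm (f m x - f (r j) x))\<^sup>2) \<partial>lborel)"
 by (rule nn_integral_liminf) measurable
 also have "... <= ennreal ((1/4) ^ k)"
 proof (rule Liminf_le)
 show "\<forall>\<^sub>F j in sequentially. (\<integral>\<^sup>+x. ennreal ((norm (f m x - f (r j) x))\<^sup>2) \<partial>lborel) <= ennreal ((1/4) ^ k)"
 using eventually_ge_at_top[of k]
 proof eventually_elim
 case (elim j)
 then have "r k <= r j" using sm by (simp add: strict_mono_less_eq)
 then show ?case using r[OF that, of "r j"] by (simp add: nn[OF L2_diff[OF f f]] ennreal_leI)
 qed
 qed simp
 finally show ?thesis .
 qed
 have diffL2: "(%x. f (r 0) x - U x) : L2"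
 proof -
 have "integrable lborel (%x. (norm (f (r 0) x - U x))\<^sup>2)"
 proof (rule integrableI_nonneg)
 have "(\<integral>\<^sup>+x. ennreal ((norm (f (r 0) x - U x))\<^sup>2) \<partial>lborel) <= 1" using bound[of 0 "r 0"] by simp
 also have "... < \<infinity>" by simp
 finally show "(\<integral>\<^sup>+x. ennreal ((norm (f (r 0) x - U x))\<^sup>2) \<partial>lborel) < \<infinity>" .
 qed auto
 then show ?thesis by (simp add: L2_def)
 qed
 have UL2: "U : L2" using L2_diff[OF f diffL2, of "r 0"] by simp
 have "(%n. L2_sq (%x. f n x - U x)) \<longlonglongrightarrow> 0"
 proof (rule LIMSEQ_I)
 fix e :: real assume "e > 0"
 then obtain k where k: "(1/4) ^ k < e" using real_arch_pow_inv[of e "1/4"] by auto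
 have "norm (L2_sq (%x. f n x - U x) - 0) < e" if "n \<ge> r k" for n
 proof -
 have "ennreal (L2_sq (%x. f n x - U x)) <= ennreal ((1/4) ^ k)"
 using bound[OF that] by (simp add: nn[OF L2_diff[OF f UL2]])
 then have "L2_sq (%x. f n x - U x) <= (1/4) ^ k" by simp
 then show ?thesis using k L2_sq_nonneg[of "%x. f n x - U x"] by simp
 qed
 then show "\<exists>no. \<forall>n\<ge>no. norm (L2_sq (%x. f n x - U x) - 0) < e" by blast
 qed
 then show ?thesis using UL2 by blast
qed

text \<open>The subspace \<open>M\<close> need not be closed; the representing element is a limit of elements of \<open>M\<close>.\<close>

lemma L2_riesz:
 fixes M :: "('a::euclidean_space => 'b::euclidean_space) set"
 assumes M: "M \<subseteq> L2" "M ~= {}"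
 and add: "!!f g. f : M ==> g : M ==> (%x. f x + g x) : M"
 and sc: "!!c f. f : M ==> (%x. c *\<^sub>R f x) : M"
 and ladd: "!!f g. f : M ==> g : M ==> l (%x. f x + g x) = l f + l g"
 and lsc: "!!c f. f : M ==> l (%x. c *\<^sub>R f x) = c * l f"
 and bd: "!!f. f : M ==> (l f)\<^sup>2 <= C * L2_sq f" and C: "0 <= C"
 shows "\<exists>U s. U : L2 \<and> L2_sq U <= C \<and> (\<forall>m\<in>M. L2_inner U m = l m) \<and>
 (\<forall>n::nat. s n : M) \<and> (%n. L2_sq (%x. s n x - U x)) \<longlonglongrightarrow> 0"
proof -
 \<comment> \<open>Up to an additive constant this is the squared distance to the element sought;
   minimising it takes the place of an orthogonal projection.\<close>
 define J where "J m = L2_sq m - 2 * l m" for m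
 have Jlow: "- C <= J m" if "m : M" for m
 proof -
 have "(l m)\<^sup>2 <= C * L2_sq m" by (rule bd[OF that])
 also have "... <= ((C + L2_sq m) / 2)\<^sup>2"
 using sum_squares_bound[of C "L2_sq m"] by (simp add: power2_eq_square field_simps)
 finally have "\<bar>l m\<bar> <= (C + L2_sq m) / 2"
 using C L2_sq_nonneg[of m] abs_le_square_iff[of "l m" "(C + L2_sq m) / 2"] by simp
 then have "l m <= (C + L2_sq m) / 2" by (rule abs_le_D1)
 then show ?thesis unfolding J_def by (simp add: field_simps)
 qed
 define I where "I = Inf (J ` M)"
 have bdd: "bdd_below (J ` M)" using Jlow by (intro bdd_belowI2)
 have IJ: "I <= J m" if "m : M" for m unfolding I_def by (rule cINF_lower[OF bdd that])
 have "\<exists>m\<in>M. J m < I + 1 / real (Suc n)" for n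
 proof (rule ccontr)
 assume "\<not> ?thesis"
 then have "I + 1 / real (Suc n) <= I" unfolding I_def using M(2) by (intro cINF_greatest) auto
 then show False by simp
 qed
 then obtain s where s: "!!n. s n : M" "!!n. J (s n) < I + 1 / real (Suc n)" by metis
 have sL2: "s n : L2" for n using s M by blast
 \<comment> \<open>Parallelogram law: the midpoint of two members lies in M, so J is at least the
   infimum there, and a minimising sequence is Cauchy.\<close>
 have par: "L2_sq (%x. s m x - s n x) <= 2 / real (Suc m) + 2 / real (Suc n)" for m n
 proof -
 let ?mid = "%x. (1/2) *\<^sub>R (s m x + s n x)"
 have mid: "?mid : M" by (intro sc add s)
 have "L2_sq ?mid = (L2_sq (s m) + 2 * L2_inner (s m) (s n) + L2_sq (s n)) / 4"
 using L2_sq_add[OF sL2 sL2] by (simp add: L2_sq_scaleR power2_eq_square)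
 moreover have "l ?mid = (l (s m) + l (s n)) / 2" by (simp add: lsc[OF add[OF s(1) s(1)]] ladd s)
 ultimately have "L2_sq (%x. s m x - s n x) = 2 * J (s m) + 2 * J (s n) - 4 * J ?mid"
 by (simp add: L2_sq_diff[OF sL2 sL2] J_def field_simps)
 also have "... <= 2 * (I + 1 / real (Suc m)) + 2 * (I + 1 / real (Suc n)) - 4 * I"
 proof -
 have "2 * a + 2 * b - 4 * c <= 2 * (i + p) + 2 * (i + q) - 4 * i"
 if "a < i + p" "b < i + q" "i <= c" for a b c i p q :: real using that by simp
 then show ?thesis using s(2)[of m] s(2)[of n] IJ[OF mid] by blast
 qed
 finally show ?thesis by (simp add: algebra_simps)
 qed
 have "\<exists>U\<in>L2. (%n. L2_sq (%x. s n x - U x)) \<longlonglongrightarrow> 0"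
 proof (rule L2_complete[OF sL2])
 fix e :: real assume e: "e > 0"
 obtain N where N: "inverse (real (Suc N)) < e / 4" using reals_Archimedean[of "e/4"] e by auto
 have "L2_sq (%x. s m x - s n x) < e" if "m \<ge> N" "n \<ge> N" for m n
 proof -
 have "1 / real (Suc m) <= 1 / real (Suc N)" "1 / real (Suc n) <= 1 / real (Suc N)"
 using that by (auto intro!: divide_left_mono)
 then show ?thesis using par[of m n] N by (simp add: inverse_eq_divide)
 qed
 then show "\<exists>N. \<forall>m\<ge>N. \<forall>n\<ge>N. L2_sq (%x. s m x - s n x) < e" by blast
 qed
 then obtain U where U: "U : L2" "(%n. L2_sq (%x. s n x - U x)) \<longlonglongrightarrow> 0" by blast
 have rep: "L2_inner U m = l m" if m: "m : M" for m
 proof -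
 have mL2: "m : L2" using m M by blast
 \<comment> \<open>First variation: J at s n + t m is at least the infimum, and the excess of J (s
   n) over it tends to 0. A quadratic in t that is nonnegative and has constant term 0 has no linear
   term.\<close>
 have "0 <= 0 + 2 * t * (L2_inner U m - l m) + t\<^sup>2 * L2_sq m" for t
 proof -
 have IJ': "I - J (s n) <= 2 * t * (L2_inner (s n) m - l m) + t\<^sup>2 * L2_sq m" for n
 proof -
 have "I <= J (%x. s n x + t *\<^sub>R m x)" by (intro IJ add sc s m)
 also have "... = J (s n) + 2 * t * (L2_inner (s n) m - l m) + t\<^sup>2 * L2_sq m"
 unfolding J_def L2_sq_add[OF sL2 L2_scaleR[OF mL2]] ladd[OF s(1) sc[OF m]] lsc[OF m] L2_sq_scaleR
 by (simp add: L2_inner_commute[of "s n"] L2_inner_scaleR_left algebra_simps)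
 finally show ?thesis by simp
 qed
 then have *: "- 1 / real (Suc n) <= 2 * t * (L2_inner (s n) m - l m) + t\<^sup>2 * L2_sq m" for n
 proof -
 have "- 1 / real (Suc n) <= I - J (s n)" using s(2)[of n] by (simp add: algebra_simps)
 then show ?thesis using IJ'[of n] by (rule order_trans)
 qed
 have "(%n. - 1 / real (Suc n)) \<longlonglongrightarrow> 0"
 using tendsto_minus[OF LIMSEQ_inverse_real_of_nat] by (simp add: inverse_eq_divide)
 moreover have "(%n. 2 * t * (L2_inner (s n) m - l m) + t\<^sup>2 * L2_sq m) \<longlonglongrightarrow> 2 * t * (L2_inner U m - l m) + t\<^sup>2 * L2_sq m"
 by (intro tendsto_intros L2_inner_tendsto sL2 U mL2)
 ultimately have "0 <= 2 * t * (L2_inner U m - l m) + t\<^sup>2 * L2_sq m"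
 by (rule LIMSEQ_le) (use * in blast)
 then show ?thesis by simp
 qed
 then have "(L2_inner U m - l m)\<^sup>2 <= 0 * L2_sq m" by (rule discriminant_le)
 then show ?thesis by simp
 qed
 \<comment> \<open>On the members s n of M the functional is the inner product with U; its bound
   passes to the limit s n -> U and becomes a bound for U itself.\<close>
 have "(L2_sq U)\<^sup>2 <= C * L2_sq U"
 proof (rule LIMSEQ_le)
 show "(%n. (L2_inner (s n) U)\<^sup>2) \<longlonglongrightarrow> (L2_sq U)\<^sup>2"
 unfolding L2_sq_inner by (intro tendsto_intros L2_inner_tendsto sL2 U)
 show "(%n. C * L2_sq (s n)) \<longlonglongrightarrow> C * L2_sq U"
 by (intro tendsto_intros L2_sq_tendsto sL2 U)
 show "\<exists>N. \<forall>n\<ge>N. (L2_inner (s n) U)\<^sup>2 <= C * L2_sq (s n)"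
 using bd[OF s(1)] rep[OF s(1)] by (simp add: L2_inner_commute[of _ U])
 qed
 then have "L2_sq U <= C"
 using C L2_sq_nonneg[of U] by (cases "L2_sq U = 0") (auto simp: power2_eq_square)
 then show ?thesis using U rep s(1) by blast
qed

section \<open>Continuously differentiable functions: supports, translations and integration by
  parts\<close>

definition dd :: "('a::real_normed_vector => 'b::real_normed_vector) => 'a => 'a => 'b"
 where "dd h v x = frechet_derivative h (at x) v"

definition C1 :: "('a::real_normed_vector => 'b::real_normed_vector) => bool"
 where "C1 h \<longleftrightarrow> (\<forall>x. h differentiable (at x)) \<and> (\<forall>v. continuous_on UNIV (dd h v))"

text \<open>Any compact subset of D outside which h vanishes will do. This avoids closures and
  passes at once to sums, products and derivatives.\<close>

definition supported :: "'a::topological_space set => ('a => 'b::zero) => bool"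
 where "supported D h \<longleftrightarrow> (\<exists>K. compact K \<and> K \<subseteq> D \<and> (\<forall>x. x \<notin> K \<longrightarrow> h x = 0))"

lemma dd_eqI: "(h has_derivative g) (at x) ==> dd h v x = g v"
 by (simp add: dd_def frechet_derivative_at[symmetric])

lemma C1I:
 assumes "!!x. (h has_derivative g x) (at x)" "!!v. continuous_on UNIV (%x. g x v)"
 shows "C1 h"
proof -
 have "dd h v = (%x. g x v)" for v by (rule ext, rule dd_eqI[OF assms(1)])
 then show ?thesis using assms unfolding C1_def by (auto simp: differentiable_def)
qed

lemma C1_has_derivative: "C1 h ==> (h has_derivative (%v. dd h v x)) (at x)"
 unfolding C1_def dd_def by (metis (no_types) eta_contract_eq frechet_derivative_works)

lemma C1_dd_continuous: "C1 h ==> continuous_on S (dd h v)"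
 unfolding C1_def using continuous_on_subset by blast

lemma C1_continuous: "C1 h ==> continuous_on S h"
 by (meson C1_has_derivative continuous_at_imp_continuous_on has_derivative_continuous)

lemma C1_measurable: "C1 h ==> h : borel_measurable borel"
 by (rule borel_measurable_continuous_onI[OF C1_continuous])

lemma C1_dd_measurable: "C1 h ==> dd h v : borel_measurable borel"
 by (rule borel_measurable_continuous_onI[OF C1_dd_continuous])

lemma C1_dd_linear: "C1 h ==> linear (%v. dd h v x)"
 using C1_has_derivative has_derivative_bounded_linear bounded_linear.linear by blast

lemma C1_const: "C1 (%x. c)" by (rule C1I[where g="%_ _. 0"]) auto

lemma dd_add: "C1 f ==> C1 g ==> dd (%x. f x + g x) v x = dd f v x + dd g v x"
 by (rule dd_eqI) (intro has_derivative_add C1_has_derivative)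

lemma C1_add: "C1 f ==> C1 g ==> C1 (%x. f x + g x)"
 by (rule C1I, rule has_derivative_add, erule C1_has_derivative, erule C1_has_derivative)
 (intro continuous_intros C1_dd_continuous[unfolded eta_contract_eq])

lemma dd_diff: "C1 f ==> C1 g ==> dd (%x. f x - g x) v x = dd f v x - dd g v x"
 by (rule dd_eqI) (intro has_derivative_diff C1_has_derivative)

lemma C1_diff: "C1 f ==> C1 g ==> C1 (%x. f x - g x)"
 by (rule C1I, rule has_derivative_diff, erule C1_has_derivative, erule C1_has_derivative)
 (intro continuous_intros C1_dd_continuous[unfolded eta_contract_eq])

lemma dd_bounded_linear: "bounded_linear L ==> C1 f ==> dd (%x. L (f x)) v x = L (dd f v x)"
 by (rule dd_eqI) (rule bounded_linear.has_derivative[OF _ C1_has_derivative])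

lemma C1_bounded_linear: "bounded_linear L ==> C1 f ==> C1 (%x. L (f x))"
 by (rule C1I, erule bounded_linear.has_derivative[OF _ C1_has_derivative], assumption)
 (rule bounded_linear.continuous_on[OF _ C1_dd_continuous])

lemma dd_mult:
 fixes f g :: "'a::real_normed_vector => 'b::real_normed_algebra"
 shows "C1 f ==> C1 g ==> dd (%x. f x * g x) v x = f x * dd g v x + dd f v x * g x"
 by (rule dd_eqI) (intro has_derivative_mult C1_has_derivative)

lemma C1_mult:
 fixes f g :: "'a::real_normed_vector => 'b::real_normed_algebra"
 assumes "C1 f" "C1 g" shows "C1 (%x. f x * g x)"
proof (rule C1I)
 show "((%x. f x * g x) has_derivative (%v. f x * dd g v x + dd f v x * g x)) (at x)" for x
 by (intro has_derivative_mult C1_has_derivative assms)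
 show "continuous_on UNIV (%x. f x * dd g v x + dd f v x * g x)" for v
 by (intro continuous_on_add continuous_on_mult C1_continuous[OF assms(1)] C1_continuous[OF assms(2)]
 C1_dd_continuous[OF assms(1), unfolded eta_contract_eq] C1_dd_continuous[OF assms(2), unfolded eta_contract_eq])
qed

lemma C1_shift: assumes "C1 f" shows "C1 (%x. f (x + c))" "dd (%x. f (x + c)) v x = dd f v (x + c)"
proof -
 have *: "((%x. f (x + c)) has_derivative (%v. dd f v (x + c))) (at x)" for x
 using has_derivative_compose[of "%x. x + c" "%x. x" x UNIV f "%v. dd f v (x + c)"]
 C1_has_derivative[OF assms, of "x + c"] has_derivative_add_const[OF has_derivative_ident] by blast
 show "C1 (%x. f (x + c))"
 by (rule C1I[OF *]) (rule continuous_on_compose2[OF C1_dd_continuous[OF assms]], auto intro!: continuous_intros)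
 show "dd (%x. f (x + c)) v x = dd f v (x + c)" by (rule dd_eqI[OF *])
qed

lemma dd_eq_0_outside:
 assumes "closed K" "!!x. x \<notin> K ==> h x = 0" "x \<notin> K"
 shows "dd h v x = 0"
proof -
 have "(h has_derivative (%_. 0)) (at x)"
 proof (rule has_derivative_transform_within_open[of "%_. 0" _ x UNIV "- K"])
 show "open (- K)" using assms(1) by auto
 qed (use assms in auto)
 then show ?thesis by (rule dd_eqI)
qed

lemma supported_dd: assumes "supported D h" shows "supported D (dd h v)"
proof -
 obtain K where "compact K" "K \<subseteq> D" "\<forall>x. x \<notin> K \<longrightarrow> h x = 0" using assms by (auto simp: supported_def)
 then show ?thesis unfolding supported_def
 by (intro exI[of _ K]) (auto intro!: dd_eq_0_outside[of K] simp: compact_imp_closed)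
qed

lemma supported_mono: "supported D h ==> (!!x. h x = 0 ==> g x = 0) ==> supported D g"
 unfolding supported_def by blast

lemma supported_subset: "supported D h ==> D \<subseteq> D' ==> supported D' h"
 unfolding supported_def by blast

lemma supported_add:
 fixes f g :: "'a::t2_space => 'b::monoid_add"
 assumes "supported D f" "supported D g" shows "supported D (%x. f x + g x)"
proof -
 obtain K L where "compact K" "K \<subseteq> D" "\<forall>x. x \<notin> K \<longrightarrow> f x = 0" "compact L" "L \<subseteq> D" "\<forall>x. x \<notin> L \<longrightarrow> g x = 0"
 using assms by (auto simp: supported_def)
 then show ?thesis unfolding supported_def by (intro exI[of _ "K \<union> L"]) auto
qed

lemma supported_cball:
 fixes h :: "'a::real_normed_vector => 'b::zero"
 assumes "supported D h" obtains rh where "rh > 0" "!!x. x \<notin> cball 0 rh ==> h x = 0"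
proof -
 obtain K where K: "compact K" "\<forall>x. x \<notin> K \<longrightarrow> h x = 0" using assms by (auto simp: supported_def)
 obtain rh where "rh > 0" "\<forall>x\<in>K. norm x <= rh" using compact_imp_bounded[OF K(1)] bounded_pos by metis
 then show ?thesis using K that[of rh] by auto
qed

lemma supported_bounded:
 fixes h :: "'a::topological_space => 'b::real_normed_vector"
 assumes "continuous_on UNIV h" "supported D h" obtains B where "B > 0" "!!x. norm (h x) <= B"
proof -
 obtain K where K: "compact K" "\<forall>x. x \<notin> K \<longrightarrow> h x = 0" using assms(2) by (auto simp: supported_def)
 have "bounded (h ` K)"
 by (intro compact_imp_bounded compact_continuous_image K continuous_on_subset[OF assms(1)]) auto
 then obtain B where B: "B > 0" "!!x. x : K ==> norm (h x) <= B" by (auto simp: bounded_pos)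
 then have "norm (h x) <= B" for x using K by (cases "x : K") auto
 then show ?thesis using B that by blast
qed

lemma bounded_supported_integrable:
 fixes f :: "'a::euclidean_space => 'b::{banach, second_countable_topology}"
 assumes "f : borel_measurable borel" "!!x. norm (f x) <= B" "!!x. x \<notin> cball 0 rh ==> f x = 0"
 shows "integrable lborel f"
proof (rule Bochner_Integration.integrable_bound)
 have "emeasure lborel (cball 0 rh :: 'a set) < \<infinity>" by (rule emeasure_bounded_finite) simp
 then show "integrable lborel (%x::'a. B * indicator (cball 0 rh) x)"
 by (intro integrable_mult_right integrable_real_indicator) auto
 have "0 <= B" using assms(2)[of 0] norm_ge_zero order_trans by blast
 then show "AE x in lborel. norm (f x) <= norm (B * indicator (cball 0 rh) x)"
 using assms(2,3) by (auto simp: indicator_def)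
qed (use assms(1) in simp)

lemma supported_integrable:
 fixes f :: "'a::euclidean_space => 'b::{banach, second_countable_topology}"
 assumes "continuous_on UNIV f" "supported D f"
 shows "integrable lborel f"
proof -
 obtain B where "!!x. norm (f x) <= B" using supported_bounded[OF assms] by metis
 moreover obtain rh where "!!x. x \<notin> cball 0 rh ==> f x = 0" using supported_cball[OF assms(2)] by metis
 ultimately show ?thesis
 using bounded_supported_integrable[OF borel_measurable_continuous_onI[OF assms(1)]] by blast
qed

lemma integrable_shift:
 fixes f :: "'a::euclidean_space => 'b::{banach, second_countable_topology}"
 assumes "integrable lborel f" shows "integrable lborel (%x. f (x + c))"
proof -
 have "integrable (distr lborel borel ((+) c)) f" using assms by (simp add: lborel_distr_plus)
 then have "integrable lborel (%x. f (c + x))" by (rule integrable_distr[rotated]) simp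
 then show ?thesis by (simp add: add.commute)
qed

lemma integral_shift:
 fixes f :: "'a::euclidean_space => 'b::{banach, second_countable_topology}"
 assumes [measurable]: "f : borel_measurable borel" shows "(LBINT x. f (x + c)) = (LBINT x. f x)"
proof -
 have "(\<integral>x. f x \<partial>distr lborel borel ((+) c)) = (LBINT x. f (c + x))"
 by (rule integral_distr) auto
 then show ?thesis by (simp add: lborel_distr_plus add.commute)
qed

lemma C1_line: "C1 a ==> ((%t. a (x + t *\<^sub>R v)) has_vector_derivative dd a v (x + t *\<^sub>R v)) (at t within S)"
proof -
 assume a: "C1 a"
 have "((%t. x + t *\<^sub>R v) has_derivative (%t. t *\<^sub>R v)) (at t within S)"
 by (auto intro!: derivative_eq_intros)
 from has_derivative_compose[OF this C1_has_derivative[OF a]]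
 show ?thesis
 using linear_scale[OF C1_dd_linear[OF a]] by (simp add: has_vector_derivative_def)
qed

lemma has_vector_derivative_quotient:
 assumes "(ph has_vector_derivative d) (at 0)"
 shows "((%t. (ph t - ph 0) /\<^sub>R t) \<longlongrightarrow> d) (at 0)"
proof -
 have "((%h. norm (ph h - ph 0 - h *\<^sub>R d) / norm h) \<longlongrightarrow> 0) (at 0)"
 using assms by (simp add: has_vector_derivative_def has_derivative_at)
 then have "((%h. norm ((ph h - ph 0) /\<^sub>R h - d)) \<longlongrightarrow> 0) (at 0)"
 proof (rule Lim_transform_eventually)
 have "norm (ph h - ph 0 - h *\<^sub>R d) / norm h = norm ((ph h - ph 0) /\<^sub>R h - d)" if "h ~= 0" for h
 proof -
 have "(ph h - ph 0) /\<^sub>R h - d = (ph h - ph 0 - h *\<^sub>R d) /\<^sub>R h"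
 using that by (simp add: scaleR_diff_right)
 then show ?thesis by (simp add: divide_inverse mult.commute)
 qed
 then show "\<forall>\<^sub>F h in at 0. norm (ph h - ph 0 - h *\<^sub>R d) / norm h = norm ((ph h - ph 0) /\<^sub>R h - d)"
 by (auto simp: eventually_at intro!: exI[of _ 1])
 qed
 then show ?thesis by (simp add: tendsto_norm_zero_iff LIM_zero_iff)
qed

lemma C1_quotient_bound:
 assumes a: "C1 (a::'a::euclidean_space => 'b::real_normed_vector)"
 obtains B where "0 <= B" "!!x t. x : cball 0 rh ==> 0 <= t ==> t <= 1 ==> norm (a (x + t *\<^sub>R v) - a x) <= B * t"
proof -
 have "bounded (dd a v ` cball 0 (rh + norm v))"
 by (intro compact_imp_bounded compact_continuous_image C1_dd_continuous a) auto
 then obtain B where B: "B > 0" "!!x. x : cball 0 (rh + norm v) ==> norm (dd a v x) <= B" by (auto simp: bounded_pos)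
 have "norm (a (x + t *\<^sub>R v) - a x) <= B * t" if "x : cball 0 rh" "0 <= t" "t <= 1" for x t
 proof -
 have "norm (a (x + t *\<^sub>R v) - a (x + 0 *\<^sub>R v)) <= B * norm (t - 0)"
 proof (rule differentiable_bound[of "{0..t}" "%t. a (x + t *\<^sub>R v)" "%s h. h *\<^sub>R dd a v (x + s *\<^sub>R v)"])
 show "((%t. a (x + t *\<^sub>R v)) has_derivative (%h. h *\<^sub>R dd a v (x + s *\<^sub>R v))) (at s within {0..t})" for s
 using C1_line[OF a] by (simp add: has_vector_derivative_def)
 show "onorm (%h. h *\<^sub>R dd a v (x + s *\<^sub>R v)) <= B" if s: "s : {0..t}" for s
 proof (rule onorm_bound)
 have "norm (x + s *\<^sub>R v) <= norm x + s * norm v" using s by (metis norm_triangle_ineq norm_scaleR abs_of_nonneg atLeastAtMost_iff)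
 also have "... <= rh + 1 * norm v"
 using s \<open>t <= 1\<close> \<open>x : cball 0 rh\<close> by (intro add_mono mult_right_mono) auto
 finally have "norm (dd a v (x + s *\<^sub>R v)) <= B" by (intro B) auto
 then show "norm (h *\<^sub>R dd a v (x + s *\<^sub>R v)) <= B * norm h" for h
 by (simp add: mult.commute[of B] mult_left_mono)
 qed (use B in simp)
 qed (use that in auto)
 then show ?thesis using that by simp
 qed
 then show ?thesis using that[of B] B by simp
qed

text \<open>Dominated convergence: on the ball where c may be nonzero the difference quotients are
  bounded by the mean value inequality. Measurability of c is enough, so an indicator may serve as a
  cutoff.\<close>

lemma difference_quotient_integral:
 fixes a c :: "'a::euclidean_space => complex"
 assumes a: "C1 a" and c[measurable]: "c : borel_measurable borel" and Bc: "!!x. norm (c x) <= Bc"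
 and rh: "!!x. x \<notin> cball 0 rh ==> c x = 0"
 shows "(%n. LBINT x. (a (x + inverse (real (Suc n)) *\<^sub>R v) - a x) * of_nat (Suc n) * c x)
 \<longlonglongrightarrow> (LBINT x. dd a v x * c x)"
proof -
 obtain B where B: "0 <= B" "!!x t. x : cball 0 rh ==> 0 <= t ==> t <= 1 ==> norm (a (x + t *\<^sub>R v) - a x) <= B * t"
 using C1_quotient_bound[OF a] by metis
 have Bc0: "0 <= Bc" using Bc[of 0] norm_ge_zero order_trans by blast
 have [measurable]: "a : borel_measurable borel" "dd a v : borel_measurable borel"
 by (intro C1_measurable C1_dd_measurable a)+
 show ?thesis
 proof (rule integral_dominated_convergence)
 have "emeasure lborel (cball 0 rh :: 'a set) < \<infinity>" by (rule emeasure_bounded_finite) simp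
 then show "integrable lborel (%x::'a. B * Bc * indicator (cball 0 rh) x)"
 by (intro integrable_mult_right integrable_real_indicator) auto
 show "AE x in lborel. (%n. (a (x + inverse (real (Suc n)) *\<^sub>R v) - a x) * of_nat (Suc n) * c x) \<longlonglongrightarrow> dd a v x * c x"
 proof (rule AE_I2)
 fix x
 have "((%t. a (x + t *\<^sub>R v)) has_vector_derivative dd a v (x + 0 *\<^sub>R v)) (at 0)"
 by (rule C1_line[OF a])
 then have "((%t. (a (x + t *\<^sub>R v) - a x) /\<^sub>R t) \<longlongrightarrow> dd a v x) (at 0)"
 using has_vector_derivative_quotient by fastforce
 moreover have "filterlim (%n. inverse (real (Suc n))) (at 0) sequentially"
 unfolding filterlim_at using LIMSEQ_inverse_real_of_nat by auto
 ultimately have "(%n. (a (x + inverse (real (Suc n)) *\<^sub>R v) - a x) /\<^sub>R inverse (real (Suc n))) \<longlonglongrightarrow> dd a v x"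
 by (rule filterlim_compose)
 then have "(%n. (a (x + inverse (real (Suc n)) *\<^sub>R v) - a x) * of_nat (Suc n)) \<longlonglongrightarrow> dd a v x"
 by (simp add: scaleR_conv_of_real mult.commute)
 then show "(%n. (a (x + inverse (real (Suc n)) *\<^sub>R v) - a x) * of_nat (Suc n) * c x) \<longlonglongrightarrow> dd a v x * c x"
 by (intro tendsto_mult tendsto_const)
 qed
 show "AE x in lborel. norm ((a (x + inverse (real (Suc n)) *\<^sub>R v) - a x) * of_nat (Suc n) * c x) <= B * Bc * indicator (cball 0 rh) x" for n
 proof (rule AE_I2)
 fix x
 show "norm ((a (x + inverse (real (Suc n)) *\<^sub>R v) - a x) * of_nat (Suc n) * c x) <= B * Bc * indicator (cball 0 rh) x"
 proof (cases "x : cball 0 rh")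
 case True
 have "norm (a (x + inverse (real (Suc n)) *\<^sub>R v) - a x) <= B * inverse (real (Suc n))"
 using True by (intro B(2)) (auto simp: inverse_le_1_iff)
 then have "norm (a (x + inverse (real (Suc n)) *\<^sub>R v) - a x) * real (Suc n) <= B"
 by (simp add: divide_inverse[symmetric] pos_le_divide_eq del: of_nat_Suc)
 then have "norm (a (x + inverse (real (Suc n)) *\<^sub>R v) - a x) * real (Suc n) * norm (c x) <= B * Bc"
 using Bc B(1) by (intro mult_mono) auto
 then show ?thesis using True by (simp add: norm_mult del: of_nat_Suc)
 qed (use rh in simp)
 qed
 qed measurable
qed

text \<open>The integral of a difference quotient vanishes by translation invariance. The factor c
  is 1 on a ball containing all relevant translates of the support, so inserting it changes
  nothing.\<close>

lemma integral_dd_eq_0: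
 fixes h :: "'a::euclidean_space => complex"
 assumes h: "C1 h" "supported D h"
 shows "(LBINT x. dd h v x) = 0"
proof -
 obtain rh where rh: "rh > 0" "!!x. x \<notin> cball 0 rh ==> h x = 0" using supported_cball[OF h(2)] by metis
 define c :: "'a => complex" where "c = indicator (cball 0 (rh + norm v))"
 have [measurable]: "h : borel_measurable borel" by (rule C1_measurable[OF h(1)])
 have c: "c : borel_measurable borel" unfolding c_def
 by (rule borel_measurable_indicator) simp
 have "(%n. LBINT x. (h (x + inverse (real (Suc n)) *\<^sub>R v) - h x) * of_nat (Suc n) * c x)
 \<longlonglongrightarrow> (LBINT x. dd h v x * c x)"
 by (rule difference_quotient_integral[OF h(1) c, of 1 "rh + norm v"]) (auto simp: c_def indicator_def)
 moreover have "(LBINT x. (h (x + inverse (real (Suc n)) *\<^sub>R v) - h x) * of_nat (Suc n) * c x) = 0" for n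
 proof -
 have "h (x + inverse (real (Suc n)) *\<^sub>R v) * c x = h (x + inverse (real (Suc n)) *\<^sub>R v)" for x
 proof (cases "x : cball 0 (rh + norm v)")
 case False
 have "norm (inverse (real (Suc n)) *\<^sub>R v) <= norm v"
 by (simp add: inverse_le_1_iff mult_left_le_one_le)
 then have "x + inverse (real (Suc n)) *\<^sub>R v \<notin> cball 0 rh"
 using False norm_diff_ineq[of x "inverse (real (Suc n)) *\<^sub>R v"] by simp
 then show ?thesis using rh(2) by simp
 qed (simp add: c_def)
 moreover have "h x * c x = h x" for x
 using rh(2)[of x] by (cases "x : cball 0 rh") (auto simp: c_def indicator_def add_increasing2)
 moreover have "(h (x + inverse (real (Suc n)) *\<^sub>R v) - h x) * of_nat (Suc n) * c x
 = of_nat (Suc n) * (h (x + inverse (real (Suc n)) *\<^sub>R v) * c x - h x * c x)" for x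
 by (simp only: algebra_simps)
 ultimately have eq: "(h (x + inverse (real (Suc n)) *\<^sub>R v) - h x) * of_nat (Suc n) * c x
 = of_nat (Suc n) * (h (x + inverse (real (Suc n)) *\<^sub>R v) - h x)" for x
 by (simp only:)
 have hi: "integrable lborel h" by (rule supported_integrable[OF C1_continuous[OF h(1)] h(2)])
 show ?thesis unfolding eq
 using Bochner_Integration.integral_diff[OF integrable_shift[OF hi, of "inverse (real (Suc n)) *\<^sub>R v"] hi]
 by (simp add: integral_shift del: of_nat_Suc)
 qed
 ultimately have "(LBINT x. dd h v x * c x) = 0" by (simp only: LIMSEQ_const_iff)
 moreover have "dd h v x * c x = dd h v x" for x
 using dd_eq_0_outside[of "cball 0 rh" h x v] rh(2)
 by (cases "x : cball 0 rh") (auto simp: c_def indicator_def add_increasing2)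
 ultimately show ?thesis by simp
qed

lemma integral_by_parts:
 fixes a b :: "'a::euclidean_space => complex"
 assumes a: "C1 a" and b: "C1 b" "supported D b"
 shows "(LBINT x. dd a v x * b x) = - (LBINT x. a x * dd b v x)"
proof -
 have int: "integrable lborel (%x. dd a v x * b x)" "integrable lborel (%x. a x * dd b v x)"
 by (rule supported_integrable[OF continuous_on_mult[OF C1_dd_continuous[OF a] C1_continuous[OF b(1)]]
 supported_mono[OF b(2)]], simp)
 (rule supported_integrable[OF continuous_on_mult[OF C1_continuous[OF a] C1_dd_continuous[OF b(1)]]
 supported_mono[OF supported_dd[OF b(2), of v]]], simp)
 have "0 = (LBINT x. dd (%x. a x * b x) v x)"
 by (rule integral_dd_eq_0[symmetric, of _ D]) (auto intro: C1_mult a b supported_mono[OF b(2)])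
 also have "... = (LBINT x. a x * dd b v x) + (LBINT x. dd a v x * b x)"
 by (simp add: dd_mult[OF a b(1)] int)
 finally show ?thesis by (metis add.commute add_eq_0_iff)
qed

text \<open>A weak form of the symmetry of second derivatives, which only involves first derivatives.\<close>

lemma integral_dd_dd_commute:
 fixes a b :: "'a::euclidean_space => complex"
 assumes a: "C1 a" and b: "C1 b" "supported D b"
 shows "(LBINT x. dd a v x * dd b w x) = (LBINT x. dd a w x * dd b v x)"
proof -
 define t where "t n = inverse (real (Suc n))" for n
 have [measurable]: "a : borel_measurable borel" "b : borel_measurable borel"
 "dd a w : borel_measurable borel" "dd b w : borel_measurable borel"
 by (intro C1_measurable C1_dd_measurable a b)+
 obtain rh where rh: "rh > 0" "!!x. x \<notin> cball 0 rh ==> b x = 0" using supported_cball[OF b(2)] by metis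
 obtain B where B: "!!x. norm (dd b w x) <= B"
 using supported_bounded[OF C1_dd_continuous[OF b(1)] supported_dd[OF b(2)]] by metis
 have lim1: "(%n. LBINT x. (a (x + t n *\<^sub>R v) - a x) * of_nat (Suc n) * dd b w x) \<longlonglongrightarrow> (LBINT x. dd a v x * dd b w x)"
 unfolding t_def by (rule difference_quotient_integral[OF a _ B]) (auto intro!: dd_eq_0_outside[of "cball 0 rh"] rh)
 let ?rh = "rh + norm v"
 define c where "c x = dd a w x * indicator (cball 0 ?rh) x" for x
 have cm: "c : borel_measurable borel" unfolding c_def[abs_def]
 by (intro borel_measurable_times borel_measurable_indicator) auto
 have "bounded (dd a w ` cball 0 ?rh)"
 by (intro compact_imp_bounded compact_continuous_image C1_dd_continuous a) auto
 then obtain Ba where Ba: "Ba > 0" "!!x. x : cball 0 ?rh ==> norm (dd a w x) <= Ba" by (auto simp: bounded_pos)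
 have Bc: "norm (c x) <= Ba" for x using Ba by (cases "x : cball 0 ?rh") (auto simp: c_def)
 have lim2: "(%n. LBINT x. (b (x + t n *\<^sub>R (-v)) - b x) * of_nat (Suc n) * c x) \<longlonglongrightarrow> (LBINT x. dd b (-v) x * c x)"
 unfolding t_def by (rule difference_quotient_integral[OF b(1) cm Bc, of ?rh]) (auto simp: c_def)
 \<comment> \<open>Integration by parts in direction w followed by a translation: the difference
   quotient of a along v turns into one of b along -v, and only first derivatives of a and b
   occur.\<close>
 have eq: "(LBINT x. (a (x + t n *\<^sub>R v) - a x) * of_nat (Suc n) * dd b w x)
 = - (LBINT x. (b (x + t n *\<^sub>R (-v)) - b x) * of_nat (Suc n) * c x)" for n
 proof -
 define q where "q x = (a (x + t n *\<^sub>R v) - a x) * of_nat (Suc n)" for x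
 have qd: "C1 (%x. a (x + t n *\<^sub>R v) - a x)" by (rule C1_diff[OF C1_shift(1)[OF a] a])
 have q: "C1 q" unfolding q_def by (rule C1_mult[OF qd C1_const])
 have ddq: "dd q w x = (dd a w (x + t n *\<^sub>R v) - dd a w x) * of_nat (Suc n)" for x
 proof -
 have "dd q w x = (%x. a (x + t n *\<^sub>R v) - a x) x * dd (%x. of_nat (Suc n)) w x
 + dd (%x. a (x + t n *\<^sub>R v) - a x) w x * of_nat (Suc n)"
 unfolding q_def[abs_def] by (rule dd_mult[OF qd C1_const])
 moreover have "dd (%x. of_nat (Suc n) :: complex) w x = 0" by (rule dd_eqI) simp
 ultimately show ?thesis by (simp add: dd_diff[OF C1_shift(1)[OF a] a] C1_shift(2)[OF a])
 qed
 have tn: "norm (t n *\<^sub>R v) <= norm v" by (simp add: t_def inverse_le_1_iff mult_left_le_one_le)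
 have i1: "integrable lborel (%x. dd a w x * b x)"
 by (rule supported_integrable[OF continuous_on_mult[OF C1_dd_continuous[OF a] C1_continuous[OF b(1)]] supported_mono[OF b(2)]]) simp
 have bs: "C1 (%x. b (x + (- (t n *\<^sub>R v))))" by (rule C1_shift[OF b(1)])
 have zero: "b (x + (- (t n *\<^sub>R v))) = 0" if "x \<notin> cball 0 ?rh" for x
 using that tn norm_diff_ineq[of x "- (t n *\<^sub>R v)"] by (intro rh) auto
 have i2: "integrable lborel (%x. dd a w x * b (x + (- (t n *\<^sub>R v))))"
 by (rule supported_integrable[OF continuous_on_mult[OF C1_dd_continuous[OF a] C1_continuous[OF bs]], where D=UNIV])
 (use zero in \<open>simp add: supported_def, intro exI[of _ "cball 0 ?rh"], simp\<close>)
 have i3: "integrable lborel (%x. dd a w (x + t n *\<^sub>R v) * b x)"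
 using integrable_shift[OF i2, of "t n *\<^sub>R v"] by simp
 have "(LBINT x. q x * dd b w x) = - (LBINT x. dd q w x * b x)"
 using integral_by_parts[OF q b, of w] by simp
 also have "(LBINT x. dd q w x * b x) = (LBINT x. of_nat (Suc n) * (dd a w (x + t n *\<^sub>R v) * b x) - of_nat (Suc n) * (dd a w x * b x))"
 by (simp add: ddq algebra_simps)
 also have "... = of_nat (Suc n) * (LBINT x. dd a w (x + t n *\<^sub>R v) * b x) - of_nat (Suc n) * (LBINT x. dd a w x * b x)"
 by (subst Bochner_Integration.integral_diff[OF integrable_mult_right[OF i3] integrable_mult_right[OF i1]])
 (simp del: of_nat_Suc)
 also have "(LBINT x. dd a w (x + t n *\<^sub>R v) * b x) = (LBINT x. dd a w x * b (x + (- (t n *\<^sub>R v))))"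
 using integral_shift[of "%x. dd a w x * b (x + (- (t n *\<^sub>R v)))" "t n *\<^sub>R v"] by simp
 also have "of_nat (Suc n) * (LBINT x. dd a w x * b (x + (- (t n *\<^sub>R v)))) - of_nat (Suc n) * (LBINT x. dd a w x * b x)
 = (LBINT x. of_nat (Suc n) * (dd a w x * b (x + (- (t n *\<^sub>R v)))) - of_nat (Suc n) * (dd a w x * b x))"
 by (subst Bochner_Integration.integral_diff[OF integrable_mult_right[OF i2] integrable_mult_right[OF i1]])
 (simp del: of_nat_Suc)
 also have "... = (LBINT x. (b (x + t n *\<^sub>R (-v)) - b x) * of_nat (Suc n) * c x)"
 proof (rule Bochner_Integration.integral_cong[OF refl])
 fix x
 show "of_nat (Suc n) * (dd a w x * b (x + (- (t n *\<^sub>R v)))) - of_nat (Suc n) * (dd a w x * b x)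
 = (b (x + t n *\<^sub>R (-v)) - b x) * of_nat (Suc n) * c x"
 proof (cases "x : cball 0 ?rh")
 case False
 have "x \<notin> cball 0 rh" using False unfolding mem_cball dist_0_norm using norm_ge_zero[of v] by linarith
 then have "b x = 0" by (rule rh)
 then show ?thesis using zero[OF False] by (simp add: c_def)
 qed (simp add: c_def algebra_simps)
 qed
 finally show ?thesis by (simp add: q_def)
 qed
 have neg: "dd b (-v) x = - dd b v x" for x using linear_neg[OF C1_dd_linear[OF b(1)]] .
 have "dd b (-v) x * c x = - (dd a w x * dd b v x)" for x
 proof (cases "x : cball 0 ?rh")
 case False
 then have "x \<notin> cball 0 rh" unfolding mem_cball dist_0_norm using norm_ge_zero[of v] by linarith
 then have "dd b v x = 0" by (intro dd_eq_0_outside[of "cball 0 rh"] rh) auto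
 then show ?thesis by (simp add: neg)
 qed (simp add: c_def neg)
 then have "- (LBINT x. dd b (-v) x * c x) = (LBINT x. dd a w x * dd b v x)"
 by (simp only:) simp
 then have "(%n. LBINT x. (a (x + t n *\<^sub>R v) - a x) * of_nat (Suc n) * dd b w x) \<longlonglongrightarrow> (LBINT x. dd a w x * dd b v x)"
 using tendsto_minus[OF lim2] by (simp only: eq)
 then show ?thesis using LIMSEQ_unique lim1 by blast
qed

section \<open>Powers of the positive part\<close>

text \<open>For positive m these functions vanish on the negative half-line and have m - 1
  continuous derivatives, each a multiple of a lower power. They supply the smoothing kernel, the
  cutoffs and the growing weights.\<close>

definition pw :: "nat => real => real" where "pw m s = (max 0 s) ^ m"

lemma pw_nonneg [simp]: "0 <= pw m s" by (simp add: pw_def)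

lemma pw_eq_0: "s <= 0 ==> 0 < m ==> pw m s = 0" by (simp add: pw_def max_def)

lemma pw_pos: "0 < s ==> 0 < pw m s" by (simp add: pw_def)

lemma continuous_on_pw [continuous_intros]: "continuous_on S f ==> continuous_on S (%x. pw m (f x))"
 unfolding pw_def by (intro continuous_intros)

lemma pw_mult_arg: "0 < m ==> pw m s * s = pw (Suc m) s"
 by (cases "s <= 0") (auto simp: pw_def max_def)

lemma pw_has_derivative:
 assumes "0 < m" shows "(pw (Suc m) has_real_derivative real (Suc m) * pw m s) (at s)"
proof (cases "s = 0")
 case False
 show ?thesis
 proof (cases "0 < s")
 case True
 have "((%s. s ^ Suc m) has_real_derivative real (Suc m) * s ^ m) (at s)"
 using DERIV_pow[of "Suc m" s] by simp
 then have "(pw (Suc m) has_real_derivative real (Suc m) * s ^ m) (at s)"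
 by (rule DERIV_cong_ev[THEN iffD1, rotated -1, OF _ refl _ refl])
 (use True in \<open>auto simp: pw_def max_def eventually_nhds intro!: exI[of _ "{0<..}"]\<close>)
 then show ?thesis using True by (simp add: pw_def max_def)
 next
 case neg: False
 have "((%s. 0) has_real_derivative 0) (at s)" by simp
 then have "(pw (Suc m) has_real_derivative 0) (at s)"
 by (rule DERIV_cong_ev[THEN iffD1, rotated -1, OF _ refl _ refl])
 (use neg False in \<open>auto simp: pw_def max_def eventually_nhds intro!: exI[of _ "{..<0}"]\<close>)
 then show ?thesis using neg False assms by (simp add: pw_def max_def zero_power)
 qed
next
 case True
 have "((%h. (pw (Suc m) (0 + h) - pw (Suc m) 0) / h) \<longlongrightarrow> 0) (at 0)"
 proof (rule Lim_null_comparison)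
 have "norm ((pw (Suc m) (0 + h) - pw (Suc m) 0) / h) <= pw m h" for h
 by (cases "h <= 0") (auto simp: pw_def max_def)
 then show "\<forall>\<^sub>F h in at 0. norm ((pw (Suc m) (0 + h) - pw (Suc m) 0) / h) <= pw m h" by simp
 have "isCont (pw m) 0" using continuous_on_pw[OF continuous_on_id, of UNIV m]
 by (simp add: continuous_on_eq_continuous_at)
 then show "(pw m \<longlongrightarrow> 0) (at 0)" using assms by (simp add: isCont_def pw_def zero_power)
 qed
 then show ?thesis using True assms by (simp add: DERIV_def pw_def zero_power)
qed

lemma pw_compose_has_derivative:
 assumes "0 < m" "(f has_derivative f') (at x)"
 shows "((%x. pw (Suc m) (f x)) has_derivative (%h. real (Suc m) * pw m (f x) * f' h)) (at x)"
 using has_derivative_compose[OF assms(2) pw_has_derivative[OF assms(1), unfolded has_field_derivative_def]]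
 by (simp add: mult.commute)

section \<open>Mollification with a polynomial kernel\<close>

definition conv :: "('a::euclidean_space => real) => ('a => 'b::euclidean_space) => 'a => 'b"
 where "conv k f x = (LBINT y. k (x - y) *\<^sub>R f y)"

lemma supported_uniformly_continuous:
 fixes c :: "'a::euclidean_space => 'b::real_normed_vector"
 assumes c: "continuous_on UNIV c" "!!z. z \<notin> cball 0 rh ==> c z = 0" and e: "e > 0"
 obtains d where "d > 0" "!!z z'. norm (z - z') < d ==> norm (c z - c z') < e"
proof -
 have "uniformly_continuous_on (cball 0 (rh + 1)) c"
 by (rule compact_uniformly_continuous[OF continuous_on_subset[OF c(1)]]) auto
 then obtain d where d: "d > 0" "!!z z'. z : cball 0 (rh+1) ==> z' : cball 0 (rh+1) ==> dist z' z < d ==> dist (c z') (c z) < e"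
 using e unfolding uniformly_continuous_on_def by meson
 have "norm (c z - c z') < e" if "norm (z - z') < min d 1" for z z'
 proof (cases "z : cball 0 (rh+1) \<and> z' : cball 0 (rh+1)")
 case True
 then show ?thesis using d(2)[of z' z] that by (simp add: dist_norm)
 next
 case False
 have "norm z <= norm z' + norm (z - z')" "norm z' <= norm z + norm (z - z')"
 using norm_triangle_sub[of z z'] norm_triangle_sub[of z' z] by (auto simp: norm_minus_commute)
 then have "z \<notin> cball 0 rh" "z' \<notin> cball 0 rh" using False that by auto
 then show ?thesis using c(2) e by simp
 qed
 then show ?thesis using that[of "min d 1"] d by simp
qed

lemma conv_integrable:
 fixes c :: "'a::euclidean_space => real" and f :: "'a => 'b::euclidean_space"
 assumes c: "continuous_on UNIV c" "!!z. z \<notin> cball 0 rh ==> c z = 0" and f: "integrable lborel f"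
 shows "integrable lborel (%y. c (x - y) *\<^sub>R f y)"
proof -
 obtain B where B: "!!z. norm (c z) <= B"
 using supported_bounded[OF c(1), of UNIV] c(2) unfolding supported_def by (metis compact_cball subset_UNIV)
 have [measurable]: "c : borel_measurable borel" by (rule borel_measurable_continuous_onI[OF c(1)])
 have [measurable]: "f : borel_measurable borel" using f by auto
 show ?thesis
 proof (rule Bochner_Integration.integrable_bound)
 show "integrable lborel (%y. B *\<^sub>R f y)" using f by simp
 show "AE y in lborel. norm (c (x - y) *\<^sub>R f y) <= norm (B *\<^sub>R f y)"
 proof (rule AE_I2)
 fix y
 have "\<bar>c (x - y)\<bar> <= \<bar>B\<bar>" using order_trans[OF B abs_ge_self] by simp
 then show "norm (c (x - y) *\<^sub>R f y) <= norm (B *\<^sub>R f y)" by (simp add: mult_right_mono)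
 qed
 qed measurable
qed

lemma conv_continuous:
 fixes c :: "'a::euclidean_space => real" and f :: "'a => 'b::euclidean_space"
 assumes c: "continuous_on UNIV c" "!!z. z \<notin> cball 0 rh ==> c z = 0" and f: "integrable lborel f"
 shows "continuous_on UNIV (conv c f)"
 unfolding continuous_on_iff
proof (intro ballI allI impI)
 fix x and e :: real assume e: "e > 0"
 define F where "F = (LBINT y. norm (f y))"
 have F: "0 <= F" by (simp add: F_def)
 obtain d where d: "d > 0" "!!z z'. norm (z - z') < d ==> norm (c z - c z') < e / (F + 1)"
 using supported_uniformly_continuous[OF c, where e="e / (F + 1)"] e F by auto
 have "dist (conv c f x') (conv c f x) < e" if "dist x' x < d" for x'
 proof -
 have i: "integrable lborel (%y. c (x - y) *\<^sub>R f y)" for x by (rule conv_integrable[OF c f])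
 have "conv c f x' - conv c f x = (LBINT y. (c (x' - y) - c (x - y)) *\<^sub>R f y)"
 unfolding conv_def scaleR_diff_left by (rule Bochner_Integration.integral_diff[OF i i, symmetric])
 also have "norm ... <= (LBINT y. e / (F + 1) * norm (f y))"
 proof (rule Bochner_Integration.integral_norm_bound_integral)
 show "integrable lborel (%y. (c (x' - y) - c (x - y)) *\<^sub>R f y)"
 unfolding scaleR_diff_left by (intro Bochner_Integration.integrable_diff i)
 show "norm ((c (x' - y) - c (x - y)) *\<^sub>R f y) <= e / (F + 1) * norm (f y)" for y
 proof -
 have "\<bar>c (x' - y) - c (x - y)\<bar> <= e / (F + 1)"
 using d(2)[of "x' - y" "x - y"] that by (simp add: dist_norm)
 then show ?thesis unfolding norm_scaleR by (intro mult_right_mono) auto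
 qed
 qed (use f in simp)
 also have "... = e / (F + 1) * F" by (simp add: F_def)
 also have "... < e" using e F by (simp add: field_simps)
 finally show ?thesis by (simp add: dist_norm)
 qed
 then show "\<exists>d>0. \<forall>x'\<in>UNIV. dist x' x < d \<longrightarrow> dist (conv c f x') (conv c f x) < e" using d(1) by blast
qed

text \<open>The gradient g is continuous and vanishes outside a ball, hence is uniformly continuous.
  So the linearisation error of k is at most e |y - x| / (F + 1) uniformly in the variable of
  integration, F being the L1 norm of f.\<close>

lemma conv_has_derivative:
 fixes k :: "'a::euclidean_space => real" and f :: "'a => 'b::euclidean_space"
 assumes k: "!!z. (k has_derivative (%h. g z \<bullet> h)) (at z)" "!!z. z \<notin> cball 0 rh ==> k z = 0"
 and g: "continuous_on UNIV g" "!!z. z \<notin> cball 0 rh ==> g z = 0" and f: "integrable lborel f"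
 shows "(conv k f has_derivative (%h. conv (%z. g z \<bullet> h) f x)) (at x)"
 unfolding has_derivative_at_alt
proof (intro conjI allI impI)
 have kc: "continuous_on UNIV k" by (meson k(1) continuous_at_imp_continuous_on has_derivative_continuous)
 have ik: "integrable lborel (%y. k (x - y) *\<^sub>R f y)" for x by (rule conv_integrable[OF kc k(2) f])
 have gh: "continuous_on UNIV (%z. g z \<bullet> h)" for h by (intro continuous_intros g)
 have ig: "integrable lborel (%y. (g (x - y) \<bullet> h) *\<^sub>R f y)" for x h
 by (rule conv_integrable[OF gh _ f, of rh]) (use g(2) in auto)
 have "linear (%h. conv (%z. g z \<bullet> h) f x)"
 by (rule linearI) (simp_all add: conv_def inner_add_right scaleR_add_left ig Bochner_Integration.integral_add scaleR_scaleR[symmetric] del: scaleR_scaleR)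
 then show "bounded_linear (%h. conv (%z. g z \<bullet> h) f x)" by (simp add: linear_conv_bounded_linear)
 fix e :: real assume e: "e > 0"
 define F where "F = (LBINT y. norm (f y))"
 have F: "0 <= F" by (simp add: F_def)
 obtain d where d: "d > 0" "!!z z'. norm (z - z') < d ==> norm (g z - g z') < e / (F + 1)"
 using supported_uniformly_continuous[OF g, where e="e / (F + 1)"] e F by auto
 have "norm (conv k f y - conv k f x - conv (%z. g z \<bullet> (y - x)) f x) <= e * norm (y - x)" if y: "norm (y - x) < d" for y
 proof -
 have rem: "norm (k (y - u) - k (x - u) - g (x - u) \<bullet> (y - x)) <= norm (y - x) * (e / (F + 1))" for u
 proof -
 have "norm (k (y - u) - k (x - u) - g (x - u) \<bullet> ((y - u) - (x - u))) <= norm ((y - u) - (x - u)) * (e / (F + 1))"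
 proof (rule differentiable_bound_linearization[where S="ball (x - u) d" and f'="%z h. g z \<bullet> h" and ?x0.0="x - u"])
 show "(x - u) + t *\<^sub>R ((y - u) - (x - u)) : ball (x - u) d" if "t : {0..1}" for t
 proof -
 have "\<bar>t\<bar> * norm (y - x) <= 1 * norm (y - x)" using that by (intro mult_right_mono) auto
 then show ?thesis using y by (simp add: dist_norm)
 qed
 show "(k has_derivative (%h. g z \<bullet> h)) (at z within ball (x - u) d)" for z
 using k(1) has_derivative_at_withinI by blast
 show "onorm ((%h. g z \<bullet> h) - (%h. g (x - u) \<bullet> h)) <= e / (F + 1)" if "z : ball (x - u) d" for z
 unfolding fun_diff_def
 proof (rule onorm_bound)
 show "0 <= e / (F + 1)" using e F by simp
 fix h
 have "norm (g z \<bullet> h - g (x - u) \<bullet> h) <= norm (g z - g (x - u)) * norm h"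
 using Cauchy_Schwarz_ineq2[of "g z - g (x - u)" h] by (simp add: inner_diff_left)
 also have "... <= e / (F + 1) * norm h"
 using d(2)[of z "x - u"] that by (intro mult_right_mono) (auto simp: dist_norm norm_minus_commute)
 finally show "norm (g z \<bullet> h - g (x - u) \<bullet> h) <= e / (F + 1) * norm h" .
 qed
 qed (use d in auto)
 then show ?thesis by simp
 qed
 have eq: "conv k f y - conv k f x - conv (%z. g z \<bullet> (y - x)) f x
 = (LBINT u. (k (y - u) - k (x - u) - g (x - u) \<bullet> (y - x)) *\<^sub>R f u)"
 unfolding conv_def scaleR_diff_left
 by (simp only: Bochner_Integration.integral_diff[OF Bochner_Integration.integrable_diff[OF ik ik] ig] Bochner_Integration.integral_diff[OF ik ik])
 have "norm (LBINT u. (k (y - u) - k (x - u) - g (x - u) \<bullet> (y - x)) *\<^sub>R f u)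
 <= (LBINT u. norm (y - x) * (e / (F + 1)) * norm (f u))"
 proof (rule Bochner_Integration.integral_norm_bound_integral)
 show "integrable lborel (%u. (k (y - u) - k (x - u) - g (x - u) \<bullet> (y - x)) *\<^sub>R f u)"
 unfolding scaleR_diff_left by (intro Bochner_Integration.integrable_diff ik ig)
 show "norm ((k (y - u) - k (x - u) - g (x - u) \<bullet> (y - x)) *\<^sub>R f u) <= norm (y - x) * (e / (F + 1)) * norm (f u)" for u
 unfolding norm_scaleR real_norm_def[symmetric] by (intro mult_right_mono rem) simp
 qed (use f in simp)
 also have "... = norm (y - x) * (e * (F / (F + 1)))" by (simp add: F_def)
 also have "... <= norm (y - x) * (e * 1)" using e F by (intro mult_left_mono) auto
 finally show ?thesis by (simp add: eq mult.commute)
 qed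
 then show "\<exists>d>0. \<forall>y. norm (y - x) < d \<longrightarrow> norm (conv k f y - conv k f x - conv (%z. g z \<bullet> (y - x)) f x) <= e * norm (y - x)"
 using d(1) by blast
qed

text \<open>The parameter t is the square of the radius of the support, which makes the kernel a
  polynomial in t and z inside the ball. The third power provides two continuous derivatives, as the
  Levi form of a mollified weight requires.\<close>

definition ker :: "real => 'a::euclidean_space => real"
 where "ker t z = pw 3 (t - z \<bullet> z)"

text \<open>The gradient of \<open>ker t\<close>.\<close>

definition gker :: "real => 'a::euclidean_space => 'a"
 where "gker t z = (- 6 * pw 2 (t - z \<bullet> z)) *\<^sub>R z"

text \<open>The gradient of the derivative of \<open>ker t\<close> in direction v, that is, its
  Hessian applied to v.\<close>

definition hker :: "real => 'a::euclidean_space => 'a => 'a"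
 where "hker t v z = (- 6 * pw 2 (t - z \<bullet> z)) *\<^sub>R v + (24 * pw 1 (t - z \<bullet> z) * (z \<bullet> v)) *\<^sub>R z"

lemma ker_nonneg [simp]: "0 <= ker t z" by (simp add: ker_def)

lemma ker_minus_commute: "ker t (x - y) = ker t (y - x)"
 by (simp add: ker_def inner_diff_left inner_diff_right inner_commute algebra_simps)

lemma outside_sqrt: "z \<notin> cball 0 (sqrt t) ==> t - z \<bullet> z <= 0"
 by (simp add: not_le dot_square_norm) (metis less_eq_real_def norm_ge_zero power2_norm_eq_inner real_less_lsqrt linorder_not_le real_sqrt_le_iff real_sqrt_abs abs_norm_cancel)

lemma ker_eq_0: "z \<notin> cball 0 (sqrt t) ==> ker t z = 0"
 unfolding ker_def by (rule pw_eq_0[OF outside_sqrt]) auto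

lemma gker_eq_0: "z \<notin> cball 0 (sqrt t) ==> gker t z = 0"
 unfolding gker_def by (simp add: pw_eq_0[OF outside_sqrt] del: mem_cball)

lemma hker_eq_0: "z \<notin> cball 0 (sqrt t) ==> hker t v z = 0"
 unfolding hker_def by (simp add: pw_eq_0[OF outside_sqrt] del: mem_cball)

lemma inner_self_has_derivative: "((%z. t - z \<bullet> z) has_derivative (%h. - 2 * (z \<bullet> h))) (at z)"
 by (auto intro!: derivative_eq_intros simp: inner_commute)

lemma ker_has_derivative: "(ker t has_derivative (%h. gker t z \<bullet> h)) (at z)"
proof -
 have "((%z. pw (Suc 2) (t - z \<bullet> z)) has_derivative (%h. real (Suc 2) * pw 2 (t - z \<bullet> z) * (- 2 * (z \<bullet> h)))) (at z)"
 by (rule pw_compose_has_derivative[OF _ inner_self_has_derivative]) simp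
 then show ?thesis by (simp add: ker_def[abs_def] gker_def eval_nat_numeral algebra_simps)
qed

lemma gker_has_derivative: "((%z. gker t z \<bullet> v) has_derivative (%h. hker t v z \<bullet> h)) (at z)"
proof -
 have p: "((%z. pw (Suc 1) (t - z \<bullet> z)) has_derivative (%h. real (Suc 1) * pw 1 (t - z \<bullet> z) * (- 2 * (z \<bullet> h)))) (at z)"
 by (rule pw_compose_has_derivative[OF _ inner_self_has_derivative]) simp
 have "((%z. - 6 * (pw (Suc 1) (t - z \<bullet> z) * (z \<bullet> v))) has_derivative
 (%h. - 6 * (pw (Suc 1) (t - z \<bullet> z) * (h \<bullet> v) + (real (Suc 1) * pw 1 (t - z \<bullet> z) * (- 2 * (z \<bullet> h))) * (z \<bullet> v)))) (at z)"
 by (intro has_derivative_mult_right has_derivative_mult p has_derivative_inner_left has_derivative_ident)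
 then show ?thesis
 by (simp add: gker_def[abs_def] hker_def inner_add_left inner_commute[of v] eval_nat_numeral algebra_simps)
qed

lemma continuous_on_ker [continuous_intros]: "continuous_on S f ==> continuous_on S (%x. ker t (f x))"
 unfolding ker_def by (intro continuous_intros)

lemma continuous_on_gker [continuous_intros]: "continuous_on S f ==> continuous_on S (%x. gker t (f x))"
 unfolding gker_def by (intro continuous_intros)

lemma continuous_on_hker [continuous_intros]: "continuous_on S f ==> continuous_on S (%x. hker t v (f x))"
 unfolding hker_def by (intro continuous_intros)

lemma continuous_ker: "continuous_on UNIV (ker t)" using continuous_on_ker[OF continuous_on_id] by simp
lemma continuous_gker: "continuous_on UNIV (gker t)" using continuous_on_gker[OF continuous_on_id] by simp
lemma continuous_hker: "continuous_on UNIV (hker t v)" using continuous_on_hker[OF continuous_on_id] by simp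

lemma ker_measurable [measurable]: "ker t : borel_measurable borel"
 by (rule borel_measurable_continuous_onI[OF continuous_ker])

lemma ker_integrable: "integrable lborel (ker t)"
 by (rule supported_integrable[OF continuous_ker, of UNIV])
 (use ker_eq_0 in \<open>auto simp: supported_def simp del: mem_cball intro!: exI[of _ "cball 0 (sqrt t)"]\<close>)

lemma conv_ker_has_derivative:
 assumes "integrable lborel f"
 shows "(conv (ker t) f has_derivative (%h. conv (%z. gker t z \<bullet> h) f x)) (at x)"
 by (rule conv_has_derivative[OF ker_has_derivative ker_eq_0 continuous_gker gker_eq_0 assms])

lemma conv_gker_has_derivative:
 assumes "integrable lborel f"
 shows "(conv (%z. gker t z \<bullet> v) f has_derivative (%h. conv (%z. hker t v z \<bullet> h) f x)) (at x)"
 by (rule conv_has_derivative[OF gker_has_derivative _ continuous_hker hker_eq_0 assms, where rh="sqrt t"])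
 (simp add: gker_eq_0 del: mem_cball)

lemma conv_gker_continuous:
 assumes "integrable lborel f" shows "continuous_on UNIV (conv (%z. gker t z \<bullet> v) f)"
 by (rule conv_continuous[OF _ _ assms, where rh="sqrt t"])
 (auto intro!: continuous_intros simp: gker_eq_0 simp del: mem_cball)

lemma conv_hker_continuous:
 assumes "integrable lborel f" shows "continuous_on UNIV (conv (%z. hker t v z \<bullet> w) f)"
 by (rule conv_continuous[OF _ _ assms, where rh="sqrt t"])
 (auto intro!: continuous_intros simp: hker_eq_0 simp del: mem_cball)

lemma C1_conv_ker: "integrable lborel f ==> C1 (conv (ker t) f)"
 by (rule C1I[OF conv_ker_has_derivative conv_gker_continuous])

lemma dd_conv_ker: "integrable lborel f ==> dd (conv (ker t) f) v x = conv (%z. gker t z \<bullet> v) f x"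
 by (rule dd_eqI[OF conv_ker_has_derivative])

text \<open>The value is a plain real number, so a dummy argument of type \<open>itself\<close>
  names the space over which the kernel is integrated.\<close>

definition kmass :: "real => 'a::euclidean_space itself => real"
 where "kmass t _ = (LBINT z. ker t (z::'a))"

definition moll :: "real => ('a::euclidean_space => 'b::euclidean_space) => 'a => 'b"
 where "moll t f x = conv (ker t) f x /\<^sub>R kmass t TYPE('a)"

lemma kmass_pos: assumes "0 < t" shows "0 < kmass t TYPE('a::euclidean_space)"
proof -
 define c where "c = pw 3 (t / 2)"
 have c: "c > 0" using assms by (simp add: c_def pw_pos)
 have "0 < c * measure lborel (cball (0::'a) (sqrt (t/2)))"
 using c assms by (intro mult_pos_pos) (simp_all add: content_cball_pos)
 also have "... = (LBINT z. c * indicator (cball (0::'a) (sqrt (t/2))) z)" by simp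
 also have "... <= (LBINT z. ker t (z::'a))"
 proof (rule integral_mono[OF _ ker_integrable])
 have "emeasure lborel (cball (0::'a) (sqrt (t/2))) < \<infinity>" by (rule emeasure_bounded_finite) simp
 then show "integrable lborel (%z. c * indicator (cball (0::'a) (sqrt (t/2))) z)"
 by (intro integrable_mult_right integrable_real_indicator) auto
 show "c * indicator (cball 0 (sqrt (t/2))) z <= ker t z" for z :: 'a
 proof (cases "z : cball 0 (sqrt (t/2))")
 case True
 then have "(norm z)\<^sup>2 <= (sqrt (t/2))\<^sup>2" by (intro power_mono) auto
 then have "z \<bullet> z <= t / 2" using assms by (simp add: power2_norm_eq_inner)
 then show ?thesis using True assms by (auto simp: c_def ker_def pw_def intro!: power_mono)
 qed simp
 qed
 finally show ?thesis by (simp add: kmass_def)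
qed

lemma integral_ker_shift: "(LBINT y. ker t (x - y)) = kmass t TYPE('a)" for x :: "'a::euclidean_space"
proof -
 have "(LBINT y. ker t (x - y)) = (LBINT y. ker t (y + (- x)))"
 by (simp add: ker_minus_commute[of t x])
 then show ?thesis using integral_shift[of "ker t :: 'a => real" "- x"] by (simp add: kmass_def)
qed

lemma ker_shift_integrable: "integrable lborel (%y. ker t (x - y))"
proof -
 have "integrable lborel (%y. ker t (y + (- x)))" by (rule integrable_shift[OF ker_integrable])
 then show ?thesis by (simp add: ker_minus_commute[of t x])
qed

lemma conv_ker_integrable:
 fixes f :: "'a::euclidean_space => 'b::euclidean_space"
 shows "integrable lborel f ==> integrable lborel (%y. ker t (x - y) *\<^sub>R f y)"
 by (rule conv_integrable[OF continuous_ker ker_eq_0])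

lemma moll_close:
 fixes f :: "'a::euclidean_space => 'b::euclidean_space"
 assumes t: "0 < t" and f: "integrable lborel f" and e: "!!y. norm (x - y) <= sqrt t ==> norm (f y - c) <= e"
 shows "norm (moll t f x - c) <= e"
proof -
 let ?m = "kmass t TYPE('a)"
 have m: "?m > 0" by (rule kmass_pos[OF t])
 have i1: "integrable lborel (%y. ker t (x - y) *\<^sub>R f y)" by (rule conv_ker_integrable[OF f])
 have i2: "integrable lborel (%y. ker t (x - y) *\<^sub>R c)" by (intro integrable_scaleR_left ker_shift_integrable)
 have "?m *\<^sub>R (moll t f x - c) = (LBINT y. ker t (x - y) *\<^sub>R f y) - (LBINT y. ker t (x - y) *\<^sub>R c)"
 using m ker_shift_integrable[of t x] by (simp add: moll_def conv_def scaleR_diff_right integral_ker_shift)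
 also have "... = (LBINT y. ker t (x - y) *\<^sub>R (f y - c))"
 by (simp add: scaleR_diff_right i1 i2)
 finally have "norm (?m *\<^sub>R (moll t f x - c)) = norm (LBINT y. ker t (x - y) *\<^sub>R (f y - c))" by simp
 also have "... <= (LBINT y. ker t (x - y) * e)"
 proof (rule Bochner_Integration.integral_norm_bound_integral)
 show "integrable lborel (%y. ker t (x - y) *\<^sub>R (f y - c))"
 unfolding scaleR_diff_right by (intro Bochner_Integration.integrable_diff i1 i2)
 show "integrable lborel (%y. ker t (x - y) * e)" by (intro integrable_mult_left ker_shift_integrable)
 show "norm (ker t (x - y) *\<^sub>R (f y - c)) <= ker t (x - y) * e" for y
 proof (cases "x - y : cball 0 (sqrt t)")
 case True
 then show ?thesis using e[of y] by (simp add: mult_left_mono)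
 next
 case False
 then show ?thesis using ker_eq_0[OF False] by simp
 qed
 qed
 also have "... = ?m * e" by (simp add: integral_ker_shift)
 finally show ?thesis using m by simp
qed

lemma moll_diff:
 assumes "integrable lborel f" "integrable lborel g"
 shows "moll t (%x. f x - g x) x = moll t f x - moll t g x"
 unfolding moll_def conv_def
 by (simp add: scaleR_diff_right conv_ker_integrable assms)

lemma C1_moll: "integrable lborel f ==> C1 (moll t f)"
 unfolding moll_def[abs_def] by (rule C1_bounded_linear[OF bounded_linear_scaleR_right C1_conv_ker])

lemma dd_moll:
 fixes f :: "'a::euclidean_space => 'b::euclidean_space"
 shows "integrable lborel f ==> dd (moll t f) v x = conv (%z. gker t z \<bullet> v) f x /\<^sub>R kmass t TYPE('a)"
 unfolding moll_def[abs_def] by (simp add: dd_bounded_linear[OF bounded_linear_scaleR_right C1_conv_ker] dd_conv_ker)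

lemma moll_eq_0:
 assumes "!!y. norm (x - y) <= sqrt t ==> f y = 0" shows "moll t f x = 0"
proof -
 have "ker t (x - y) *\<^sub>R f y = 0" for y
 using assms[of y] ker_eq_0[of "x - y" t] by (cases "norm (x - y) <= sqrt t") auto
 then have "(%y. ker t (x - y) *\<^sub>R f y) = (%y. 0)" by (rule ext)
 then show ?thesis by (simp only: moll_def conv_def integral_zero scaleR_zero_right)
qed

text \<open>Jensen's inequality as the nonnegativity of a variance: the kernel mean of |f - c|^2
  with c = \<open>moll t f x\<close> is nonnegative, so |c|^2 is at most the mean of |f|^2.
  Integrating over x and exchanging the integrals gives the norm bound.\<close>

lemma moll_L2:
 fixes f :: "'a::euclidean_space => 'b::euclidean_space"
 assumes t: "0 < t" and f: "f : L2" "integrable lborel f"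
 shows "moll t f : L2" "L2_sq (moll t f) <= L2_sq f"
proof -
 let ?m = "kmass t TYPE('a)"
 have m: "?m > 0" by (rule kmass_pos[OF t])
 have [measurable]: "f : borel_measurable borel" by (rule L2_measurable[OF f(1)])
 have [measurable]: "moll t f : borel_measurable borel" by (rule C1_measurable[OF C1_moll[OF f(2)]])
 have i3: "integrable lborel (%y. ker t (x - y) * (norm (f y))\<^sup>2)" for x
 using conv_ker_integrable[OF L2_integrable[OF f(1)], of t x] by simp
 have pt: "?m * (norm (moll t f x))\<^sup>2 <= (LBINT y. ker t (x - y) * (norm (f y))\<^sup>2)" for x
 proof -
 define c where "c = moll t f x"
 have i1: "integrable lborel (%y. ker t (x - y) *\<^sub>R f y)" by (rule conv_ker_integrable[OF f(2)])
 have "0 <= (LBINT y. ker t (x - y) * (norm (f y - c))\<^sup>2)" by simp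
 also have "(%y. ker t (x - y) * (norm (f y - c))\<^sup>2) = (%y. ker t (x - y) * (norm (f y))\<^sup>2 - 2 * ((ker t (x - y) *\<^sub>R f y) \<bullet> c) + ker t (x - y) * (norm c)\<^sup>2)"
 by (simp add: power2_norm_eq_inner inner_diff_left inner_diff_right inner_commute algebra_simps)
 also have "(LBINT y. ker t (x - y) * (norm (f y))\<^sup>2 - 2 * ((ker t (x - y) *\<^sub>R f y) \<bullet> c) + ker t (x - y) * (norm c)\<^sup>2)
 = (LBINT y. ker t (x - y) * (norm (f y))\<^sup>2) - 2 * ((LBINT y. ker t (x - y) *\<^sub>R f y) \<bullet> c) + ?m * (norm c)\<^sup>2"
 using i1 i3 ker_shift_integrable[of t x]
 by (simp add: integral_ker_shift integrable_inner_left integral_inner_left del: inner_scaleR_left)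
 also have "(LBINT y. ker t (x - y) *\<^sub>R f y) = ?m *\<^sub>R c" using m by (simp add: c_def moll_def conv_def)
 finally show ?thesis by (simp add: c_def power2_norm_eq_inner)
 qed
 have "ennreal ?m * (\<integral>\<^sup>+x. ennreal ((norm (moll t f x))\<^sup>2) \<partial>lborel) = (\<integral>\<^sup>+x. ennreal (?m * (norm (moll t f x))\<^sup>2) \<partial>lborel)"
 using m by (subst nn_integral_cmult[symmetric]) (auto simp: ennreal_mult)
 also have "... <= (\<integral>\<^sup>+x. (\<integral>\<^sup>+y. ennreal (ker t (x - y) * (norm (f y))\<^sup>2) \<partial>lborel) \<partial>lborel)"
 by (rule nn_integral_mono, subst nn_integral_eq_integral[OF i3]) (auto intro!: ennreal_leI pt)
 also have "... = (\<integral>\<^sup>+y. (\<integral>\<^sup>+x. ennreal (ker t (x - y) * (norm (f y))\<^sup>2) \<partial>lborel) \<partial>lborel)"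
 by (rule lborel_pair.Fubini') measurable
 also have "... = (\<integral>\<^sup>+y. ennreal ?m * ennreal ((norm (f y))\<^sup>2) \<partial>lborel)"
 proof (rule nn_integral_cong)
 fix y :: 'a
 have "(\<integral>\<^sup>+x. ennreal (ker t (x - y) * (norm (f y))\<^sup>2) \<partial>lborel) = (\<integral>\<^sup>+x. ennreal (ker t (x - y)) \<partial>lborel) * ennreal ((norm (f y))\<^sup>2)"
 by (subst nn_integral_multc[symmetric]) (auto simp: ennreal_mult)
 also have "(\<integral>\<^sup>+x. ennreal (ker t (x - y)) \<partial>lborel) = ennreal ?m"
 using nn_integral_eq_integral[OF ker_shift_integrable[of t y]] integral_ker_shift[of t y]
 by (simp add: ker_minus_commute[of t y])
 finally show "(\<integral>\<^sup>+x. ennreal (ker t (x - y) * (norm (f y))\<^sup>2) \<partial>lborel) = ennreal ?m * ennreal ((norm (f y))\<^sup>2)" .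
 qed
 also have "... = ennreal ?m * (\<integral>\<^sup>+y. ennreal ((norm (f y))\<^sup>2) \<partial>lborel)"
 by (rule nn_integral_cmult) measurable
 also have "(\<integral>\<^sup>+y. ennreal ((norm (f y))\<^sup>2) \<partial>lborel) = ennreal (L2_sq f)"
 unfolding L2_sq_def by (rule nn_integral_eq_integral[OF L2_integrable[OF f(1)]]) simp
 finally have le: "(\<integral>\<^sup>+x. ennreal ((norm (moll t f x))\<^sup>2) \<partial>lborel) <= ennreal (L2_sq f)"
 using m by (simp add: ennreal_mult_le_mult_iff)
 have "integrable lborel (%x. (norm (moll t f x))\<^sup>2)"
 by (rule integrableI_nonneg) (use le in \<open>auto simp: top.extremum_strict le_less_trans\<close>)
 then show L: "moll t f : L2" by (simp add: L2_def)
 have "ennreal (L2_sq (moll t f)) <= ennreal (L2_sq f)"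
 using le nn_integral_eq_integral[OF L2_integrable[OF L]] by (simp add: L2_sq_def)
 then show "L2_sq (moll t f) <= L2_sq f" by (simp add: L2_sq_nonneg)
qed

text \<open>The radial retraction onto the ball of radius B.\<close>

definition trunc :: "real => 'b::real_normed_vector => 'b"
 where "trunc B y = (1 / max 1 (norm y / B)) *\<^sub>R y"

lemma trunc_continuous: "0 < B ==> continuous_on S (trunc B)"
 unfolding trunc_def by (intro continuous_intros) (auto simp: max_def)

lemma trunc_eq: "0 < B ==> norm y <= B ==> trunc B y = y"
 by (simp add: trunc_def max_def field_simps)

lemma norm_trunc_le: assumes "0 < B" shows "norm (trunc B y) <= B"
proof (cases "norm y <= B")
 case False
 then have "1 < norm y / B" using assms by (simp add: field_simps)
 then show ?thesis using False assms by (simp add: trunc_def max_def)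
qed (simp add: trunc_eq assms)

lemma norm_diff_trunc_le: assumes "0 < B" shows "norm (y - trunc B y) <= norm y"
proof -
 have "y - trunc B y = (1 - 1 / max 1 (norm y / B)) *\<^sub>R y" by (simp add: trunc_def scaleR_diff_left)
 moreover have "\<bar>1 - 1 / max 1 (norm y / B)\<bar> <= 1" by (auto simp: abs_le_iff field_simps max_def)
 ultimately show ?thesis by (simp add: mult_left_le_one_le)
qed

lemma L2_I:
 assumes "f : borel_measurable borel" "!!x. norm (f x) <= B" "!!x. x \<notin> cball 0 rh ==> f x = 0"
 shows "f : L2"
proof -
 have "0 <= B" using assms(2)[of 0] norm_ge_zero order_trans by blast
 have "integrable lborel (%x. (norm (f x))\<^sup>2)"
 proof (rule bounded_supported_integrable[of _ "B\<^sup>2" rh])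
 show "norm ((norm (f x))\<^sup>2) <= B\<^sup>2" for x using assms(2)[of x] by (simp add: power_mono)
 qed (use assms in auto)
 then show ?thesis using assms by (simp add: L2_def)
qed

lemma supported_continuous_L2:
 fixes f :: "'a::euclidean_space => 'b::euclidean_space"
 assumes "continuous_on UNIV f" "supported D f" shows "f : L2"
proof -
 obtain B where "!!x. norm (f x) <= B" using supported_bounded[OF assms] by metis
 moreover obtain rh where "!!x. x \<notin> cball 0 rh ==> f x = 0" using supported_cball[OF assms(2)] by metis
 ultimately show ?thesis using L2_I[OF borel_measurable_continuous_onI[OF assms(1)]] by blast
qed

lemma L2_supported_integrable:
 fixes f :: "'a::euclidean_space => 'b::euclidean_space"
 assumes "f : L2" "!!x. x \<notin> cball 0 rh ==> f x = 0"
 shows "integrable lborel f"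
proof (rule Bochner_Integration.integrable_bound)
 have "emeasure lborel (cball 0 rh :: 'a set) < \<infinity>" by (rule emeasure_bounded_finite) simp
 then show "integrable lborel (%x::'a. indicator (cball 0 rh) x + (norm (f x))\<^sup>2)"
 by (intro Bochner_Integration.integrable_add L2_integrable assms integrable_real_indicator) auto
 show "AE x in lborel. norm (f x) <= norm (indicator (cball 0 rh) x + (norm (f x))\<^sup>2)"
 proof (rule AE_I2)
 fix x
 have "norm (f x) <= 1 + (norm (f x))\<^sup>2"
 using sum_squares_bound[of "norm (f x)" 1] by (simp add: power2_eq_square) (smt (verit) norm_ge_zero)
 then show "norm (f x) <= norm (indicator (cball 0 rh) x + (norm (f x))\<^sup>2)"
 using assms(2)[of x] by (cases "x : cball 0 rh") (auto simp: indicator_def)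
 qed
qed (use L2_measurable[OF assms(1)] in simp)

lemma L2_sq_tendsto_0_dominated:
 fixes f :: "nat => 'a::euclidean_space => 'b::euclidean_space"
 assumes "!!n. f n : borel_measurable borel" "integrable lborel w"
 and "AE x in lborel. (%n. f n x) \<longlonglongrightarrow> 0" "!!n x. (norm (f n x))\<^sup>2 <= w x"
 shows "(%n. L2_sq (f n)) \<longlonglongrightarrow> 0"
proof -
 have [measurable]: "f n : borel_measurable borel" for n by (rule assms)
 have "(%n. LBINT x. (norm (f n x))\<^sup>2) \<longlonglongrightarrow> (\<integral>x. 0 \<partial>(lborel :: 'a measure))"
 proof (rule integral_dominated_convergence[OF _ _ assms(2)])
 show "AE x in lborel. (%n. (norm (f n x))\<^sup>2) \<longlonglongrightarrow> 0"
 using assms(3) by eventually_elim (auto intro!: tendsto_eq_intros)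
 qed (use assms(4) in auto)
 then show ?thesis by (simp add: L2_sq_def)
qed

text \<open>Truncation reduces the claim to bounded f. A measurable function is almost everywhere a
  limit of continuous ones; truncated at B and multiplied by a cutoff that is 1 on the given ball,
  these stay dominated.\<close>

lemma L2_continuous_approx:
 fixes f :: "'a::euclidean_space => 'b::euclidean_space"
 assumes f: "f : L2" "!!x. x \<notin> cball 0 rh ==> f x = 0" and e: "e > 0"
 shows "\<exists>g. continuous_on UNIV g \<and> (\<forall>x. x \<notin> cball 0 (rh + 1) \<longrightarrow> g x = 0) \<and> L2_sq (%x. f x - g x) < e"
proof -
 have [measurable]: "f : borel_measurable borel" by (rule L2_measurable[OF f(1)])
 have [measurable]: "trunc B : borel_measurable borel" if "0 < B" for B :: real
 by (rule borel_measurable_continuous_onI[OF trunc_continuous[OF that]])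
 have tm: "(%x. trunc (real (Suc n)) (f x)) : borel_measurable borel" for n
 by (rule measurable_compose[of f borel borel]) auto
 have "(%n. L2_sq (%x. f x - trunc (real (Suc n)) (f x))) \<longlonglongrightarrow> 0"
 proof (rule L2_sq_tendsto_0_dominated[OF _ L2_integrable[OF f(1)]])
 show "(%x. f x - trunc (real (Suc n)) (f x)) : borel_measurable borel" for n
 using tm by (intro borel_measurable_diff) auto
 show "AE x in lborel. (%n. f x - trunc (real (Suc n)) (f x)) \<longlonglongrightarrow> 0"
 proof (rule AE_I2)
 fix x
 obtain N :: nat where N: "norm (f x) <= real N" using real_arch_simple by blast
 have "\<forall>\<^sub>F n in sequentially. f x - trunc (real (Suc n)) (f x) = 0"
 using eventually_ge_at_top[of N] by eventually_elim (use N in \<open>auto simp: trunc_eq\<close>)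
 then show "(%n. f x - trunc (real (Suc n)) (f x)) \<longlonglongrightarrow> 0" by (rule tendsto_eventually)
 qed
 show "(norm (f x - trunc (real (Suc n)) (f x)))\<^sup>2 <= (norm (f x))\<^sup>2" for n x
 by (intro power_mono norm_diff_trunc_le) auto
 qed
 then have "\<forall>\<^sub>F n in sequentially. L2_sq (%x. f x - trunc (real (Suc n)) (f x)) < e / 4"
 using e by (intro order_tendstoD) auto
 then obtain n0 where n0: "L2_sq (%x. f x - trunc (real (Suc n0)) (f x)) < e / 4" by (auto simp: eventually_sequentially)
 define B where "B = real (Suc n0)"
 have B: "B > 0" by (simp add: B_def)
 define th where "th x = max 0 (min 1 (rh + 1 - norm x))" for x :: 'a
 have th: "continuous_on UNIV th" unfolding th_def by (intro continuous_intros)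
 have th0: "th x = 0" if "x \<notin> cball 0 (rh + 1)" for x using that by (auto simp: th_def)
 have th1: "th x = 1" if "x : cball 0 rh" for x using that by (auto simp: th_def)
 have thb: "0 <= th x" "th x <= 1" for x by (auto simp: th_def)
 have "f measurable_on UNIV"
 by (rule lebesgue_measurable_imp_measurable_on) (auto intro: measurable_completion)
 then obtain N g where N: "negligible N" and g: "!!n::nat. continuous_on UNIV (g n)"
 and lim: "!!x. x \<notin> N ==> (%n. g n x) \<longlonglongrightarrow> f x"
 unfolding measurable_on_def by auto
 define h where "h n x = th x *\<^sub>R trunc B (g n x)" for n x
 have hc: "continuous_on UNIV (h n)" for n
 unfolding h_def by (intro continuous_intros th continuous_on_compose2[OF trunc_continuous[OF B, of UNIV] g]) auto
 have h0: "h n x = 0" if "x \<notin> cball 0 (rh + 1)" for n x using th0[OF that] by (simp add: h_def)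
 have hb: "norm (h n x) <= B" for n x
 using mult_mono[OF thb(2)[of x] norm_trunc_le[OF B, of "g n x"]] thb by (simp add: h_def)
 have tL: "(%x. trunc B (f x)) : L2"
 by (rule L2_I[OF tm[of n0, folded B_def] norm_trunc_le[OF B], of rh]) (simp add: f(2) trunc_def)
 have hL: "h n : L2" for n
 by (rule L2_I[OF borel_measurable_continuous_onI[OF hc] hb h0])
 have "(%n. L2_sq (%x. trunc B (f x) - h n x)) \<longlonglongrightarrow> 0"
 proof (rule L2_sq_tendsto_0_dominated)
 show "(%x. trunc B (f x) - h n x) : borel_measurable borel" for n
 using L2_measurable[OF tL] L2_measurable[OF hL] by (intro borel_measurable_diff)
 have "emeasure lborel (cball 0 (rh+1) :: 'a set) < \<infinity>" by (rule emeasure_bounded_finite) simp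
 then show "integrable lborel (%x::'a. (2 * B)\<^sup>2 * indicator (cball 0 (rh + 1)) x)"
 by (intro integrable_mult_right integrable_real_indicator) auto
 show "(norm (trunc B (f x) - h n x))\<^sup>2 <= (2 * B)\<^sup>2 * indicator (cball 0 (rh + 1)) x" for n x
 proof (cases "x : cball 0 (rh + 1)")
 case True
 have "norm (trunc B (f x) - h n x) <= 2 * B"
 using norm_triangle_ineq4[of "trunc B (f x)" "h n x"] norm_trunc_le[OF B, of "f x"] hb[of n x] by linarith
 then have "(norm (trunc B (f x) - h n x))\<^sup>2 <= (2 * B)\<^sup>2" by (rule power_mono) simp
 then show ?thesis using True by simp
 next
 case False
 then have "f x = 0" by (intro f(2)) auto
 then show ?thesis using h0[OF False] by (simp add: trunc_def)
 qed
 have "AE x in lebesgue. x \<notin> N" using N by (simp add: negligible_iff_null_sets AE_not_in)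
 then have "AE x in lborel. x \<notin> N" by (simp add: AE_completion_iff)
 then show "AE x in lborel. (%n. trunc B (f x) - h n x) \<longlonglongrightarrow> 0"
 proof eventually_elim
 case (elim x)
 have "continuous_on UNIV (trunc B :: 'b => 'b)" by (rule trunc_continuous[OF B])
 then have "isCont (trunc B) (f x)" by (simp add: continuous_on_eq_continuous_at)
 then have "(%n. trunc B (g n x)) \<longlonglongrightarrow> trunc B (f x)" by (rule isCont_tendsto_compose) (rule lim[OF elim])
 then have "(%n. trunc B (f x) - th x *\<^sub>R trunc B (g n x)) \<longlonglongrightarrow> trunc B (f x) - th x *\<^sub>R trunc B (f x)"
 by (intro tendsto_intros)
 moreover have "th x *\<^sub>R trunc B (f x) = trunc B (f x)"
 using th1[of x] f(2)[of x] by (cases "x : cball 0 rh") (auto simp: trunc_def)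
 ultimately show ?case by (simp add: h_def)
 qed
 qed
 then have "\<forall>\<^sub>F n in sequentially. L2_sq (%x. trunc B (f x) - h n x) < e / 4"
 using e by (intro order_tendstoD) auto
 then obtain n where n: "L2_sq (%x. trunc B (f x) - h n x) < e / 4" by (auto simp: eventually_sequentially)
 have "L2_sq (%x. f x - h n x) = L2_sq (%x. (f x - trunc B (f x)) + (trunc B (f x) - h n x))" by simp
 also have "... <= 2 * L2_sq (%x. f x - trunc B (f x)) + 2 * L2_sq (%x. trunc B (f x) - h n x)"
 by (intro L2_sq_add_le L2_diff f tL hL)
 also have "... < e" using n0 n by (simp add: B_def)
 finally show ?thesis using hc h0 by blast
qed

text \<open>For continuous g of bounded support this is uniform continuity; the general case follows
  because mollification does not increase the norm. Using |a + b|^2 <= 2 |a|^2 + 2 |b|^2 twice turns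
  the tolerances e / 12 and e / (8 (V + 1)) into at most e / 2 each, V being the volume of a ball
  that carries the difference.\<close>

lemma moll_L2_tendsto:
 fixes f :: "'a::euclidean_space => 'b::euclidean_space"
 assumes f: "f : L2" "!!x. x \<notin> cball 0 rh ==> f x = 0"
 and t: "!!n. 0 < t n" "t \<longlonglongrightarrow> 0"
 shows "(%n. L2_sq (%x. moll (t n) f x - f x)) \<longlonglongrightarrow> 0"
proof (rule LIMSEQ_I)
 fix e :: real assume e: "e > 0"
 obtain g where g: "continuous_on UNIV g" "!!x. x \<notin> cball 0 (rh + 1) ==> g x = 0" "L2_sq (%x. f x - g x) < e / 12"
 using L2_continuous_approx[OF f, where e="e / 12"] e by auto
 have gs: "supported UNIV g" unfolding supported_def using g(2) by (intro exI[of _ "cball 0 (rh + 1)"]) auto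
 have gL: "g : L2" and gi: "integrable lborel g"
 using supported_continuous_L2[OF g(1) gs] supported_integrable[OF g(1) gs] by auto
 have fi: "integrable lborel f" by (rule L2_supported_integrable[OF f])
 define V where "V = measure lborel (cball (0::'a) (rh + 2))"
 have V: "0 <= V" by (simp add: V_def)
 define et where "et = sqrt (e / (8 * (V + 1)))"
 have et: "et > 0" "et\<^sup>2 = e / (8 * (V + 1))" using e V by (auto simp: et_def)
 obtain d where d: "d > 0" "!!z z'. norm (z - z') < d ==> norm (g z - g z') < et"
 using supported_uniformly_continuous[OF g(1,2) et(1)] by metis
 have "\<forall>\<^sub>F n in sequentially. t n < (min d 1)\<^sup>2" using t(2) d(1) by (intro order_tendstoD) auto
 then obtain N where N: "!!n. n \<ge> N ==> t n < (min d 1)\<^sup>2" by (auto simp: eventually_sequentially)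
 have "norm (L2_sq (%x. moll (t n) f x - f x) - 0) < e" if n: "n \<ge> N" for n
 proof -
 have s: "sqrt (t n) < min d 1" using N[OF n] d(1) by (intro real_less_lsqrt) auto
 have mL: "moll (t n) f : L2" "moll (t n) g : L2" using moll_L2[OF t(1)] f(1) fi gL gi by auto
 have close: "norm (moll (t n) g x - g x) <= et" for x
 proof (rule moll_close[OF t(1) gi])
 show "norm (g y - g x) <= et" if "norm (x - y) <= sqrt (t n)" for y
 using d(2)[of y x] that s by (simp add: norm_minus_commute)
 qed
 have zero: "moll (t n) g x - g x = 0" if x: "x \<notin> cball 0 (rh + 2)" for x
 proof -
 have "moll (t n) g x = 0"
 proof (rule moll_eq_0)
 fix y assume "norm (x - y) <= sqrt (t n)"
 moreover have "sqrt (t n) < 1" using s by (simp only: min_less_iff_conj)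
 ultimately have "norm (x - y) < 1" by linarith
 then have "y \<notin> cball 0 (rh + 1)" using x norm_triangle_sub[of x y] by simp
 then show "g y = 0" by (rule g(2))
 qed
 moreover have "g x = 0" using x by (intro g(2)) auto
 ultimately show ?thesis by simp
 qed
 have b2: "L2_sq (%x. moll (t n) g x - g x) <= et\<^sup>2 * V"
 proof -
 have fin: "emeasure lborel (cball 0 (rh+2) :: 'a set) < \<infinity>" by (rule emeasure_bounded_finite) simp
 have "L2_sq (%x. moll (t n) g x - g x) <= (LBINT x. et\<^sup>2 * indicator (cball (0::'a) (rh + 2)) x)"
 unfolding L2_sq_def
 proof (rule integral_mono)
 show "integrable lborel (%x. (norm (moll (t n) g x - g x))\<^sup>2)"
 by (rule L2_integrable[OF L2_diff[OF mL(2) gL]])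
 show "integrable lborel (%x::'a. et\<^sup>2 * indicator (cball 0 (rh + 2)) x)"
 using fin by (intro integrable_mult_right integrable_real_indicator) auto
 show "(norm (moll (t n) g x - g x))\<^sup>2 <= et\<^sup>2 * indicator (cball 0 (rh + 2)) x" for x
 using zero[of x] close[of x] by (cases "x : cball 0 (rh + 2)") (auto intro!: power_mono)
 qed
 then show ?thesis by (simp add: V_def)
 qed
 have b1: "L2_sq (%x. moll (t n) f x - moll (t n) g x) <= L2_sq (%x. f x - g x)"
 proof -
 have "L2_sq (moll (t n) (%x. f x - g x)) <= L2_sq (%x. f x - g x)"
 using f(1) fi gL gi by (intro moll_L2 t L2_diff Bochner_Integration.integrable_diff)
 moreover have "moll (t n) (%x. f x - g x) = (%x. moll (t n) f x - moll (t n) g x)"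
 by (rule ext) (rule moll_diff[OF fi gi])
 ultimately show ?thesis by simp
 qed
 have "L2_sq (%x. moll (t n) f x - f x) = L2_sq (%x. ((moll (t n) f x - moll (t n) g x) + (moll (t n) g x - g x)) + (g x - f x))"
 by simp
 also have "... <= 2 * L2_sq (%x. (moll (t n) f x - moll (t n) g x) + (moll (t n) g x - g x)) + 2 * L2_sq (%x. g x - f x)"
 by (intro L2_sq_add_le L2_add L2_diff mL f gL)
 also have "L2_sq (%x. (moll (t n) f x - moll (t n) g x) + (moll (t n) g x - g x))
 <= 2 * L2_sq (%x. moll (t n) f x - moll (t n) g x) + 2 * L2_sq (%x. moll (t n) g x - g x)"
 by (intro L2_sq_add_le L2_diff mL gL)
 also have "L2_sq (%x. g x - f x) = L2_sq (%x. f x - g x)" by (rule L2_sq_diff_commute)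
 finally have "L2_sq (%x. moll (t n) f x - f x) <= 6 * L2_sq (%x. f x - g x) + 4 * (et\<^sup>2 * V)"
 using b1 b2 by simp
 also have "et\<^sup>2 * V <= e / 8" using e V by (simp add: et(2) field_simps)
 finally show ?thesis using g(3) L2_sq_nonneg[of "%x. moll (t n) f x - f x"] by simp
 qed
 then show "\<exists>N. \<forall>n\<ge>N. norm (L2_sq (%x. moll (t n) f x - f x) - 0) < e" by blast
qed

section \<open>Wirtinger derivatives\<close>

text \<open>For v = \<open>axis j 1\<close> this is the classical derivative by the j-th complex
  coordinate, and \<open>dzb\<close> is the derivative by its conjugate.\<close>

definition dz :: "complex^'n => (complex^'n => complex) => complex^'n => complex"
 where "dz v a x = (dd a v x - \<i> * dd a (\<i> *s v) x) / 2"

definition dzb :: "complex^'n => (complex^'n => complex) => complex^'n => complex"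
 where "dzb v a x = (dd a v x + \<i> * dd a (\<i> *s v) x) / 2"

lemma C1_cnj: "C1 a ==> C1 (%x. cnj (a x))" by (rule C1_bounded_linear[OF bounded_linear_cnj])

lemma dzb_cnj: "C1 a ==> dzb v (%x. cnj (a x)) x = cnj (dz v a x)"
 by (simp add: dzb_def dz_def dd_bounded_linear[OF bounded_linear_cnj])

lemma dz_cnj: "C1 a ==> dz v (%x. cnj (a x)) x = cnj (dzb v a x)"
 by (simp add: dzb_def dz_def dd_bounded_linear[OF bounded_linear_cnj])

lemma dz_mult: "C1 a ==> C1 b ==> dz v (%x. a x * b x) x = a x * dz v b x + dz v a x * b x"
 by (simp add: dz_def dd_mult field_simps)

lemma dzb_mult: "C1 a ==> C1 b ==> dzb v (%x. a x * b x) x = a x * dzb v b x + dzb v a x * b x"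
 by (simp add: dzb_def dd_mult field_simps)

lemma dz_continuous: "C1 a ==> continuous_on S (dz v a)"
 unfolding dz_def[abs_def] by (intro continuous_intros C1_dd_continuous) auto

lemma dzb_continuous: "C1 a ==> continuous_on S (dzb v a)"
 unfolding dzb_def[abs_def] by (intro continuous_intros C1_dd_continuous) auto

lemma supported_dz: assumes "supported D a" shows "supported D (dz v a)"
proof -
 obtain K where "compact K" "K \<subseteq> D" "\<forall>x. x \<notin> K \<longrightarrow> a x = 0" using assms by (auto simp: supported_def)
 then show ?thesis unfolding supported_def dz_def
 by (intro exI[of _ K]) (auto simp: compact_imp_closed dd_eq_0_outside[of K])
qed

lemma supported_dzb: assumes "supported D a" shows "supported D (dzb v a)"
proof -
 obtain K where "compact K" "K \<subseteq> D" "\<forall>x. x \<notin> K \<longrightarrow> a x = 0" using assms by (auto simp: supported_def)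
 then show ?thesis unfolding supported_def dzb_def
 by (intro exI[of _ K]) (auto simp: compact_imp_closed dd_eq_0_outside[of K])
qed

lemma supported_mult_left: "supported D a ==> supported D (%x. c x * (a x :: complex))"
 by (rule supported_mono) auto

lemma supported_mult_right: "supported D a ==> supported D (%x. (a x :: complex) * c x)"
 by (rule supported_mono) auto

text \<open>Weights are given on D only. Once multiplied by a factor of compact support in D they
  become globally continuous, being 0 on the open complement of the compact set.\<close>

lemma local_continuous:
 fixes f :: "'a::t2_space => 'b::{topological_space, zero}"
 assumes "open D" "continuous_on D f" "supported D f"
 shows "continuous_on UNIV f"
proof -
 obtain K where K: "compact K" "K \<subseteq> D" "\<forall>x. x \<notin> K \<longrightarrow> f x = 0" using assms(3) by (auto simp: supported_def)
 have "continuous_on (- K) f" by (rule continuous_on_eq[of _ "%_. 0"]) (use K in auto)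
 moreover have "open (- K)" using K(1) compact_imp_closed by auto
 ultimately have "continuous_on (D \<union> - K) f" using assms by (intro continuous_on_open_Un)
 moreover have "D \<union> - K = UNIV" using K by auto
 ultimately show ?thesis by simp
qed

lemma local_integrable:
 fixes f :: "'a::euclidean_space => 'b::{banach, second_countable_topology}"
 assumes "open D" "continuous_on D f" "supported D f"
 shows "integrable lborel f"
 by (rule supported_integrable[OF local_continuous[OF assms] assms(3)])

lemma integral_dzb_by_parts:
 fixes a b :: "complex^'n => complex"
 assumes a: "C1 a" and b: "C1 b" "supported D b"
 shows "(LBINT x. dzb v a x * b x) = - (LBINT x. a x * dzb v b x)"
proof -
 have i1: "integrable lborel (%x. dd a v x * b x)" for v
 by (rule supported_integrable[OF continuous_on_mult[OF C1_dd_continuous[OF a] C1_continuous[OF b(1)]] supported_mult_left[OF b(2)]])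
 have i2: "integrable lborel (%x. a x * dd b v x)" for v
 by (rule supported_integrable[OF continuous_on_mult[OF C1_continuous[OF a] C1_dd_continuous[OF b(1)]] supported_mult_left[OF supported_dd[OF b(2)]]])
 have "(LBINT x. dzb v a x * b x) = (LBINT x. (1/2) * (dd a v x * b x) + (\<i>/2) * (dd a (\<i> *s v) x * b x))"
 by (rule Bochner_Integration.integral_cong) (auto simp: dzb_def field_simps)
 also have "... = (1/2) * (LBINT x. dd a v x * b x) + (\<i>/2) * (LBINT x. dd a (\<i> *s v) x * b x)"
 by (subst Bochner_Integration.integral_add[OF integrable_mult_right[OF i1] integrable_mult_right[OF i1]]) simp
 also have "... = - ((1/2) * (LBINT x. a x * dd b v x) + (\<i>/2) * (LBINT x. a x * dd b (\<i> *s v) x))"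
 by (simp add: integral_by_parts[OF a b])
 also have "(1/2) * (LBINT x. a x * dd b v x) + (\<i>/2) * (LBINT x. a x * dd b (\<i> *s v) x)
 = (LBINT x. (1/2) * (a x * dd b v x) + (\<i>/2) * (a x * dd b (\<i> *s v) x))"
 by (subst Bochner_Integration.integral_add[OF integrable_mult_right[OF i2] integrable_mult_right[OF i2]]) simp
 also have "... = (LBINT x. a x * dzb v b x)"
 by (rule Bochner_Integration.integral_cong) (auto simp: dzb_def field_simps)
 finally show ?thesis .
qed

text \<open>Expansion into four pairings of real directional derivatives reduces the claim to the
  weak symmetry of second derivatives.\<close>

lemma integral_dz_dzb_commute:
 fixes a b :: "complex^'n => complex"
 assumes a: "C1 a" and b: "C1 b" "supported D b"
 shows "(LBINT x. dz v a x * dzb w b x) = (LBINT x. dzb w a x * dz v b x)"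
proof -
 define J where "J p q = (LBINT x. dd a p x * dd b q x)" for p q
 have i: "integrable lborel (%x. dd a p x * dd b q x)" for p q
 by (rule supported_integrable[OF continuous_on_mult[OF C1_dd_continuous[OF a] C1_dd_continuous[OF b(1)]] supported_mult_left[OF supported_dd[OF b(2)]]])
 have four: "(LBINT x. (c1 * (dd a p1 x * dd b q1 x) + c2 * (dd a p2 x * dd b q2 x)) + (c3 * (dd a p3 x * dd b q3 x) + c4 * (dd a p4 x * dd b q4 x)))
 = c1 * J p1 q1 + c2 * J p2 q2 + (c3 * J p3 q3 + c4 * J p4 q4)" for c1 c2 c3 c4 p1 p2 p3 p4 q1 q2 q3 q4
 unfolding J_def
 by (simp add: Bochner_Integration.integral_add Bochner_Integration.integrable_add integrable_mult_right i)
 have "(LBINT x. dz v a x * dzb w b x) = (\<integral>x. (1/4 * (dd a v x * dd b w x) + \<i>/4 * (dd a v x * dd b (\<i> *s w) x)) +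
 ((-\<i>/4) * (dd a (\<i> *s v) x * dd b w x) + 1/4 * (dd a (\<i> *s v) x * dd b (\<i> *s w) x)) \<partial>lborel)"
 by (rule Bochner_Integration.integral_cong) (auto simp: dz_def dzb_def field_simps)
 also have "... = 1/4 * J v w + \<i>/4 * J v (\<i> *s w) + ((-\<i>/4) * J (\<i> *s v) w + 1/4 * J (\<i> *s v) (\<i> *s w))" by (rule four)
 also have "... = 1/4 * J w v + (-\<i>/4) * J w (\<i> *s v) + (\<i>/4 * J (\<i> *s w) v + 1/4 * J (\<i> *s w) (\<i> *s v))"
 proof -
 have Jc: "J p q = J q p" for p q unfolding J_def by (rule integral_dd_dd_commute[OF a b])
 show ?thesis
 unfolding Jc[of v w] Jc[of v "\<i> *s w"] Jc[of "\<i> *s v" w] Jc[of "\<i> *s v" "\<i> *s w"] by simp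
 qed
 also have "... = (\<integral>x. (1/4 * (dd a w x * dd b v x) + (-\<i>/4) * (dd a w x * dd b (\<i> *s v) x)) +
 (\<i>/4 * (dd a (\<i> *s w) x * dd b v x) + 1/4 * (dd a (\<i> *s w) x * dd b (\<i> *s v) x)) \<partial>lborel)"
 by (rule four[symmetric])
 also have "... = (LBINT x. dzb w a x * dz v b x)"
 by (rule Bochner_Integration.integral_cong) (auto simp: dz_def dzb_def field_simps)
 finally show ?thesis .
qed

section \<open>Locally defined weights, their Wirtinger derivatives and the Levi form\<close>

text \<open>The derivative is an argument, so that weights built by sums and compositions carry
  explicit formulas from which their Levi forms can be computed.\<close>

definition C1_on :: "'a::real_normed_vector set => ('a => 'b::real_normed_vector) => ('a => 'a => 'b) => bool"
 where "C1_on D q q1 \<longleftrightarrow> (\<forall>x\<in>D. (q has_derivative q1 x) (at x)) \<and> (\<forall>v. continuous_on D (%x. q1 x v))"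

lemma C1_on_continuous: "C1_on D q q1 ==> continuous_on D q"
 unfolding C1_on_def by (meson continuous_at_imp_continuous_on has_derivative_continuous)

lemma C1_local_mult:
 fixes q a :: "'a::real_normed_vector => complex"
 assumes D: "open D" and q: "C1_on D q q1" and a: "C1 a" "supported D a"
 shows "C1 (%x. q x * a x)" "supported D (%x. q x * a x)"
 "dd (%x. q x * a x) v x = q x * dd a v x + q1 x v * a x"
proof -
 obtain K where K: "compact K" "K \<subseteq> D" "\<forall>x. x \<notin> K \<longrightarrow> a x = 0" using a(2) by (auto simp: supported_def)
 have cK: "closed K" by (rule compact_imp_closed[OF K(1)])
 have der: "((%x. q x * a x) has_derivative (%v. q x * dd a v x + q1 x v * a x)) (at x)" for x
 proof (cases "x : D")
 case True
 then have "(q has_derivative q1 x) (at x)" using q by (simp add: C1_on_def)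
 then show ?thesis by (intro has_derivative_mult C1_has_derivative a)
 next
 case False
 then have x: "x \<notin> K" using K by blast
 have "((%x. q x * a x) has_derivative (%v. 0)) (at x)"
 proof (rule has_derivative_transform_within_open[of "%_. 0" _ x UNIV "- K"])
 show "open (- K)" using cK by auto
 qed (use x K in auto)
 moreover have "(%v. q x * dd a v x + q1 x v * a x) = (%v. 0)"
 using x K dd_eq_0_outside[OF cK, of a x] by auto
 ultimately show ?thesis by simp
 qed
 show "supported D (%x. q x * a x)" by (rule supported_mult_left[OF a(2)])
 show "dd (%x. q x * a x) v x = q x * dd a v x + q1 x v * a x" by (rule dd_eqI[OF der])
 show "C1 (%x. q x * a x)"
 proof (rule C1I[OF der])
 fix v
 show "continuous_on UNIV (%x. q x * dd a v x + q1 x v * a x)"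
 proof (rule local_continuous[OF D])
 show "continuous_on D (%x. q x * dd a v x + q1 x v * a x)"
 proof -
 have "continuous_on D (%x. q1 x v)" using q by (simp add: C1_on_def)
 then show ?thesis
 by (rule continuous_on_add[OF continuous_on_mult[OF C1_on_continuous[OF q] C1_dd_continuous[OF a(1)]]
 continuous_on_mult[OF _ C1_continuous[OF a(1)]]])
 qed
 show "supported D (%x. q x * dd a v x + q1 x v * a x)"
 by (intro supported_add supported_mult_left supported_dd a)
 qed
 qed
qed

definition C2_on :: "'a::real_normed_vector set => ('a => real) => ('a => 'a => real) => ('a => 'a => 'a => real) => bool"
 where "C2_on D q q1 q2 \<longleftrightarrow> (\<forall>x\<in>D. (q has_derivative q1 x) (at x)) \<and>
 (\<forall>v. C1_on D (%x. q1 x v) (%x w. q2 x v w))"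

lemma C2_on_C1_on: assumes "C2_on D q q1 q2" shows "C1_on D q q1"
proof -
 have "C1_on D (%x. q1 x v) (%x w. q2 x v w)" for v using assms by (simp add: C2_on_def)
 then have "continuous_on D (%x. q1 x v)" for v by (rule C1_on_continuous)
 then show ?thesis using assms by (simp add: C2_on_def C1_on_def)
qed

lemma C2_on_continuous:
 assumes "C2_on D q q1 q2"
 shows "continuous_on D q" "continuous_on D (%x. q1 x v)" "continuous_on D (%x. q2 x v w)"
proof -
 have c: "C1_on D (%x. q1 x v) (%x w. q2 x v w)" for v using assms by (simp add: C2_on_def)
 show 1: "continuous_on D (%x. q1 x v)" for v by (rule C1_on_continuous[OF c])
 show "continuous_on D (%x. q2 x v w)" using c by (simp add: C1_on_def)
 have "C1_on D q q1" using assms 1 by (simp add: C2_on_def C1_on_def)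
 then show "continuous_on D q" by (rule C1_on_continuous)
qed

lemma C2_on_linear1: "C2_on D q q1 q2 ==> x : D ==> linear (q1 x)"
 unfolding C2_on_def using has_derivative_bounded_linear bounded_linear.linear by blast

lemma C2_on_linear2: "C2_on D q q1 q2 ==> x : D ==> linear (q2 x v)"
 unfolding C2_on_def C1_on_def using has_derivative_bounded_linear bounded_linear.linear by blast

text \<open>Linearity in the direction of the first differentiation: \<open>q1 y\<close> is linear
  for every y in the open set D, and the derivative of such an identity in y is unique.\<close>

lemma C2_on_linear3:
 assumes D: "open D" and q: "C2_on D q q1 q2" and x: "x : D"
 shows "linear (%v. q2 x v w)"
proof -
 have der: "((%y. q1 y v) has_derivative q2 x v) (at x)" for v using q x by (auto simp: C2_on_def C1_on_def)
 have "q2 x (u + v) = (%w. q2 x u w + q2 x v w)" for u v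
 proof (rule has_derivative_unique[OF der])
 show "((%y. q1 y (u + v)) has_derivative (%w. q2 x u w + q2 x v w)) (at x)"
 by (rule has_derivative_transform_within_open[OF has_derivative_add[OF der[of u] der[of v]] D x])
 (use C2_on_linear1[OF q] in \<open>auto simp: linear_add\<close>)
 qed
 moreover have "q2 x (c *\<^sub>R v) = (%w. c * q2 x v w)" for c v
 proof (rule has_derivative_unique[OF der])
 show "((%y. q1 y (c *\<^sub>R v)) has_derivative (%w. c * q2 x v w)) (at x)"
 by (rule has_derivative_transform_within_open[OF has_derivative_mult_right[OF der[of v]] D x])
 (use C2_on_linear1[OF q] in \<open>auto simp: linear_scale\<close>)
 qed
 ultimately show ?thesis by (intro linearI) auto
qed

text \<open>The Levi form: the Hermitian form of the complex Hessian, evaluated at t. It is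
  normalised so that |x|^2 has Levi form |t|^2.\<close>

definition lev :: "('a => complex^'n => complex^'n => real) => 'a => complex^'n => real"
 where "lev q2 x t = (q2 x t t + q2 x (\<i> *s t) (\<i> *s t)) / 4"

text \<open>The derivative \<open>dz v\<close> of the weight, expressed by the given first
  derivative \<open>q1\<close>.\<close>

definition wz :: "('a => complex^'n => real) => complex^'n => 'a => complex"
 where "wz q1 v x = (of_real (q1 x v) - \<i> * of_real (q1 x (\<i> *s v))) / 2"

text \<open>The mixed derivative of the weight, \<open>dzb w\<close> of \<open>dz v\<close>; complex
  linear in v and conjugate linear in w.\<close>

definition wzz :: "('a => complex^'n => complex^'n => real) => complex^'n => complex^'n => 'a => complex"
 where "wzz q2 v w x = ((of_real (q2 x v w) - \<i> * of_real (q2 x (\<i> *s v) w))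
 + \<i> * (of_real (q2 x v (\<i> *s w)) - \<i> * of_real (q2 x (\<i> *s v) (\<i> *s w)))) / 4"

lemma C1_on_wz:
 assumes "C2_on D q q1 q2"
 shows "C1_on D (wz q1 v) (%x w. (of_real (q2 x v w) - \<i> * of_real (q2 x (\<i> *s v) w)) / 2)"
proof -
 have "((wz q1 v) has_derivative (%w. (of_real (q2 x v w) - \<i> * of_real (q2 x (\<i> *s v) w)) / 2)) (at x)" if "x : D" for x
 proof -
 have der: "((%y. complex_of_real (q1 y v)) has_derivative (%w. of_real (q2 x v w))) (at x)" for v
 using assms that by (intro has_derivative_of_real) (auto simp: C2_on_def C1_on_def)
 show ?thesis unfolding wz_def[abs_def]
 using has_derivative_mult_left[OF has_derivative_diff[OF der[of v] has_derivative_mult_right[OF der[of "\<i> *s v"], of \<i>]], of "1/2"]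
 by simp
 qed
 moreover have "continuous_on D (%x. (of_real (q2 x v w) - \<i> * complex_of_real (q2 x (\<i> *s v) w)) / 2)" for w
 using C2_on_continuous(3)[OF assms] by (intro continuous_intros) auto
 ultimately show ?thesis by (simp add: C1_on_def)
qed

lemma C1_on_exp:
 assumes "C1_on D q q1"
 shows "C1_on D (%x. complex_of_real (exp (- q x))) (%x v. of_real (- exp (- q x) * q1 x v))"
 unfolding C1_on_def
proof (intro conjI ballI allI)
 fix x assume "x : D"
 then have der: "(q has_derivative q1 x) (at x)" using assms by (simp add: C1_on_def)
 have "((%x. exp (- q x)) has_derivative (%v. exp (- q x) * (- q1 x v))) (at x)"
 by (rule DERIV_exp[THEN DERIV_compose_FDERIV, OF has_derivative_minus[OF der], THEN has_derivative_eq_rhs])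
 (simp add: mult.commute)
 then show "((%x. complex_of_real (exp (- q x))) has_derivative (%v. of_real (- exp (- q x) * q1 x v))) (at x)"
 using has_derivative_of_real by fastforce
next
 fix v
 show "continuous_on D (%x. complex_of_real (- exp (- q x) * q1 x v))"
 using assms C1_on_continuous[OF assms] by (intro continuous_intros) (auto simp: C1_on_def)
qed

section \<open>The Morrey--Kohn--Hoermander inequality for forms of compact support\<close>

text \<open>For the weight exp (- q), the operator \<open>dz v\<close> - \<open>wz q1 v\<close> is
  minus the formal adjoint of \<open>dzb v\<close>. Moving the adjoints across and commuting them
  with the conjugate derivatives leaves the mixed derivative of q as the commutator. The weight is
  hidden in b' = exp (- q) cnj b, so all integrations by parts are unweighted.\<close>

lemma dbar_commutator_identity:
 fixes a b :: "complex^'n => complex"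
 assumes D: "open D" and q: "C2_on D q q1 q2" and a: "C1 a" "supported D a" and b: "C1 b" "supported D b"
 shows "(LBINT x. (dz v a x - wz q1 v x * a x) * cnj (dz w b x - wz q1 w x * b x) * of_real (exp (- q x)))
 = (LBINT x. wzz q2 v w x * a x * cnj (b x) * of_real (exp (- q x)))
 + (LBINT x. dzb w a x * cnj (dzb v b x) * of_real (exp (- q x)))"
proof -
 define e where "e x = complex_of_real (exp (- q x))" for x
 define b' where "b' x = e x * cnj (b x)" for x
 define A where "A x = wz q1 v x * a x" for x
 have q': "C1_on D q q1" by (rule C2_on_C1_on[OF q])
 have e: "C1_on D e (%x v. of_real (- exp (- q x) * q1 x v))"
 unfolding e_def[abs_def] by (rule C1_on_exp[OF q'])
 have ec: "continuous_on D e" by (rule C1_on_continuous[OF e])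
 have bc: "C1 (%x. cnj (b x))" "supported D (%x. cnj (b x))"
 by (rule C1_cnj[OF b(1)], rule supported_mono[OF b(2)], simp)
 have b': "C1 b'" "supported D b'"
 "dd b' v x = e x * dd (%x. cnj (b x)) v x + of_real (- exp (- q x) * q1 x v) * cnj (b x)" for v x
 unfolding b'_def[abs_def] using C1_local_mult[OF D e bc] by auto
 have wzc: "continuous_on D (wz q1 v)" by (rule C1_on_continuous[OF C1_on_wz[OF q]])
 have A: "C1 A" "supported D A"
 "dd A w x = wz q1 v x * dd a w x + ((of_real (q2 x v w) - \<i> * of_real (q2 x (\<i> *s v) w)) / 2) * a x" for w x
 unfolding A_def[abs_def] using C1_local_mult[OF D C1_on_wz[OF q] a] by auto
 have dzb_b': "dzb w b' x = e x * cnj (dz w b x) - e x * cnj (wz q1 w x) * cnj (b x)" for w x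
 proof -
 have "dzb w b' x = e x * dzb w (%x. cnj (b x)) x - e x * cnj (wz q1 w x) * cnj (b x)"
 unfolding dzb_def b'(3) wz_def e_def by (simp add: field_simps)
 then show ?thesis by (simp add: dzb_cnj[OF b(1)])
 qed
 have dz_b': "dz v b' x = e x * cnj (dzb v b x) - e x * wz q1 v x * cnj (b x)" for x
 proof -
 have "dz v b' x = e x * dz v (%x. cnj (b x)) x - e x * wz q1 v x * cnj (b x)"
 unfolding dz_def b'(3) wz_def e_def by (simp add: field_simps)
 then show ?thesis by (simp add: dz_cnj[OF b(1)])
 qed
 have dzb_A: "dzb w A x = wz q1 v x * dzb w a x + wzz q2 v w x * a x" for x
 unfolding dzb_def A(3) wzz_def by (simp add: field_simps)
 have i1: "integrable lborel (%x. dz v a x * dzb w b' x)"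
 by (rule supported_integrable[OF continuous_on_mult[OF dz_continuous[OF a(1)] dzb_continuous[OF b'(1)]] supported_mult_right[OF supported_dz[OF a(2)]]])
 have i2: "integrable lborel (%x. A x * dzb w b' x)"
 by (rule supported_integrable[OF continuous_on_mult[OF C1_continuous[OF A(1)] dzb_continuous[OF b'(1)]] supported_mult_right[OF A(2)]])
 have i3: "integrable lborel (%x. dzb w a x * dz v b' x)"
 by (rule supported_integrable[OF continuous_on_mult[OF dzb_continuous[OF a(1)] dz_continuous[OF b'(1)]] supported_mult_right[OF supported_dzb[OF a(2)]]])
 have i4: "integrable lborel (%x. dzb w A x * b' x)"
 by (rule supported_integrable[OF continuous_on_mult[OF dzb_continuous[OF A(1)] C1_continuous[OF b'(1)]] supported_mult_left[OF b'(2)]])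
 have i6: "integrable lborel (%x. dzb w a x * cnj (dzb v b x) * e x)"
 proof (rule local_integrable[OF D])
 show "continuous_on D (%x. dzb w a x * cnj (dzb v b x) * e x)"
 by (intro continuous_intros dzb_continuous[OF a(1)] dzb_continuous[OF b(1)] ec)
 show "supported D (%x. dzb w a x * cnj (dzb v b x) * e x)"
 by (intro supported_mult_right supported_dzb a)
 qed
 have wzzc: "continuous_on D (wzz q2 v w)"
 unfolding wzz_def[abs_def] using C2_on_continuous(3)[OF q] by (intro continuous_intros) auto
 have i5: "integrable lborel (%x. wzz q2 v w x * a x * cnj (b x) * e x)"
 proof (rule local_integrable[OF D])
 show "continuous_on D (%x. wzz q2 v w x * a x * cnj (b x) * e x)"
 by (intro continuous_intros wzzc C1_continuous[OF a(1)] C1_continuous[OF b(1)] ec)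
 show "supported D (%x. wzz q2 v w x * a x * cnj (b x) * e x)"
 by (intro supported_mult_right supported_mult_left a)
 qed
 have "(LBINT x. (dz v a x - wz q1 v x * a x) * cnj (dz w b x - wz q1 w x * b x) * e x)
 = (LBINT x. dz v a x * dzb w b' x - A x * dzb w b' x)"
 by (rule Bochner_Integration.integral_cong) (auto simp: dzb_b' A_def algebra_simps)
 also have "... = (LBINT x. dz v a x * dzb w b' x) - (LBINT x. A x * dzb w b' x)"
 by (rule Bochner_Integration.integral_diff[OF i1 i2])
 also have "... = (LBINT x. dzb w a x * dz v b' x) + (LBINT x. dzb w A x * b' x)"
 using integral_dz_dzb_commute[OF a(1) b'(1,2)] integral_dzb_by_parts[OF A(1) b'(1,2)] by simp
 also have "... = (LBINT x. dzb w a x * dz v b' x + dzb w A x * b' x)"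
 by (rule Bochner_Integration.integral_add[OF i3 i4, symmetric])
 also have "... = (LBINT x. wzz q2 v w x * a x * cnj (b x) * e x + dzb w a x * cnj (dzb v b x) * e x)"
 by (rule Bochner_Integration.integral_cong) (auto simp: dz_b' dzb_A b'_def algebra_simps)
 also have "... = (LBINT x. wzz q2 v w x * a x * cnj (b x) * e x) + (LBINT x. dzb w a x * cnj (dzb v b x) * e x)"
 by (rule Bochner_Integration.integral_add[OF i5 i6])
 finally show ?thesis by (simp add: e_def)
qed

lemma vec_expansion: "(t::complex^'n) = (\<Sum>j\<in>UNIV. t $ j *s axis j 1)"
 by (simp add: vec_eq_iff axis_def if_distrib cong: if_cong)

lemma wzz_add_left:
 assumes "!!w. linear (%v. q2 x v w)" shows "wzz q2 (u + v) w x = wzz q2 u w x + wzz q2 v w x"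
proof -
 have "q2 x (u + v) w = q2 x u w + q2 x v w" for u v w using linear_add[OF assms] .
 then show ?thesis by (simp add: wzz_def vec.scale_right_distrib field_simps)
qed

lemma wzz_add_right: "(!!v. linear (q2 x v)) ==> wzz q2 v (u + w) x = wzz q2 v u x + wzz q2 v w x"
 by (simp add: wzz_def linear_add vec.scale_right_distrib field_simps)

lemma complex_scale_decomp: "c *s (v::complex^'n) = Re c *\<^sub>R v + Im c *\<^sub>R (\<i> *s v)"
 by (simp add: vec_eq_iff complex_eq_iff)

lemma wzz_scale_left:
 assumes "!!w. linear (%v. q2 x v w)" shows "wzz q2 (c *s v) w x = c * wzz q2 v w x"
proof -
 have 1: "q2 x (c *s v) w = Re c * q2 x v w + Im c * q2 x (\<i> *s v) w" for w
 unfolding complex_scale_decomp[of c v] using linear_add[OF assms[of w]] linear_scale[OF assms[of w]] by simp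
 have "\<i> *s (c *s v) = (-Im c) *\<^sub>R v + Re c *\<^sub>R (\<i> *s v)"
 by (simp add: vec_eq_iff complex_eq_iff)
 then have 2: "q2 x (\<i> *s (c *s v)) w = - Im c * q2 x v w + Re c * q2 x (\<i> *s v) w" for w
 using linear_add[OF assms[of w]] linear_scale[OF assms[of w]] by (simp only:) simp
 show ?thesis unfolding wzz_def 1 2 by (simp add: complex_eq_iff field_simps)
qed

lemma wzz_scale_right:
 assumes "!!v. linear (q2 x v)" shows "wzz q2 v (c *s w) x = cnj c * wzz q2 v w x"
proof -
 have 1: "q2 x v (c *s w) = Re c * q2 x v w + Im c * q2 x v (\<i> *s w)" for v
 unfolding complex_scale_decomp[of c w] using linear_add[OF assms[of v]] linear_scale[OF assms[of v]] by simp
 have "\<i> *s (c *s w) = (-Im c) *\<^sub>R w + Re c *\<^sub>R (\<i> *s w)"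
 by (simp add: vec_eq_iff complex_eq_iff)
 then have 2: "q2 x v (\<i> *s (c *s w)) = - Im c * q2 x v w + Re c * q2 x v (\<i> *s w)" for v
 using linear_add[OF assms[of v]] linear_scale[OF assms[of v]] by (simp only:) simp
 show ?thesis unfolding wzz_def 1 2 by (simp add: complex_eq_iff field_simps)
qed

lemma lev_expansion:
 fixes t :: "complex^'n"
 assumes l: "!!w. linear (%v. q2 x v w)" and r: "!!v. linear (q2 x v)"
 shows "Re (\<Sum>j\<in>UNIV. \<Sum>k\<in>UNIV. wzz q2 (axis j 1) (axis k 1) x * t $ j * cnj (t $ k)) = lev q2 x t"
proof -
 have z: "wzz q2 0 w x = 0" "wzz q2 v 0 x = 0" for v w
 using wzz_add_left[of q2 x 0 0 w] l wzz_add_right[of q2 x v 0 0] r by simp_all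
 have sl: "wzz q2 (\<Sum>j\<in>I. f j) w x = (\<Sum>j\<in>I. wzz q2 (f j) w x)" for I :: "'n set" and f w
 by (induction I rule: infinite_finite_induct) (simp_all add: z wzz_add_left l)
 have sr: "wzz q2 v (\<Sum>j\<in>I. f j) x = (\<Sum>j\<in>I. wzz q2 v (f j) x)" for I :: "'n set" and f v
 by (induction I rule: infinite_finite_induct) (simp_all add: z wzz_add_right r)
 have "wzz q2 t t x = wzz q2 (\<Sum>j\<in>UNIV. t $ j *s axis j 1) (\<Sum>k\<in>UNIV. t $ k *s axis k 1) x"
 using vec_expansion[of t] by simp
 also have "... = (\<Sum>j\<in>UNIV. \<Sum>k\<in>UNIV. wzz q2 (axis j 1) (axis k 1) x * t $ j * cnj (t $ k))"
 unfolding sl sr wzz_scale_left[of q2 x, OF l] wzz_scale_right[of q2 x, OF r]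
 by (simp add: sum_distrib_left mult_ac) (rule sum.swap)
 finally have "(\<Sum>j\<in>UNIV. \<Sum>k\<in>UNIV. wzz q2 (axis j 1) (axis k 1) x * t $ j * cnj (t $ k)) = wzz q2 t t x" ..
 moreover have "Re (wzz q2 t t x) = lev q2 x t" by (simp add: wzz_def lev_def)
 ultimately show ?thesis by (simp only:)
qed

lemma integral_Re_complex: "integrable M f ==> (\<integral>x. Re (f x) \<partial>M) = Re (\<integral>x. f x \<partial>M)"
 by (rule integral_bounded_linear[OF bounded_linear_Re])

text \<open>The Morrey--Kohn--Hoermander inequality.\<close>

lemma morrey_kohn_hormander:
 fixes g :: "complex^'n => complex^'n"
 assumes D: "open D" and q: "C2_on D q q1 q2" and g: "C1 g" "supported D g"
 shows "(LBINT x. indicator D x * (lev q2 x (g x) * exp (- q x)))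
 <= (LBINT x. (cmod (\<Sum>j\<in>UNIV. dz (axis j 1) (%x. g x $ j) x - wz q1 (axis j 1) x * g x $ j))\<^sup>2 * exp (- q x))
 + (\<Sum>j\<in>UNIV. \<Sum>k\<in>UNIV. LBINT x. (cmod (dzb (axis k 1) (%x. g x $ j) x - dzb (axis j 1) (%x. g x $ k) x))\<^sup>2 * exp (- q x)) / 2"
proof -
 define e where "e x = complex_of_real (exp (- q x))" for x
 have ec: "continuous_on D e"
 unfolding e_def[abs_def] by (rule C1_on_continuous[OF C1_on_exp[OF C2_on_C1_on[OF q]]])
 have er: "continuous_on D (%x. exp (- q x))" by (intro continuous_intros C2_on_continuous(1)[OF q])
 have gj: "C1 (%x. g x $ j)" "supported D (%x. g x $ j)" for j
 by (rule C1_bounded_linear[OF bounded_linear_vec_nth g(1)], rule supported_mono[OF g(2)], simp)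
 define X where "X j x = dz (axis j 1) (%x. g x $ j) x - wz q1 (axis j 1) x * g x $ j" for j x
 define Y where "Y k j x = dzb (axis k 1) (%x. g x $ j) x" for k j x
 have Xc: "continuous_on D (X j)" for j unfolding X_def[abs_def]
 by (intro continuous_intros dz_continuous[OF gj(1)] C1_continuous[OF gj(1)] C1_on_continuous[OF C1_on_wz[OF q]])
 have Xs: "supported D (X j)" for j
 proof -
 have "supported D (%x. dz (axis j 1) (%x. g x $ j) x + (- wz q1 (axis j 1) x) * g x $ j)"
 by (intro supported_add supported_dz supported_mult_left gj)
 then show ?thesis by (simp add: X_def[abs_def])
 qed
 have Yc: "continuous_on D (Y k j)" for k j unfolding Y_def[abs_def] by (rule dzb_continuous[OF gj(1)])
 have Ys: "supported D (Y k j)" for k j unfolding Y_def[abs_def] by (rule supported_dzb[OF gj(2)])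
 have wzzc: "continuous_on D (wzz q2 v w)" for v w
 unfolding wzz_def[abs_def] using C2_on_continuous(3)[OF q] by (intro continuous_intros) auto
 have iX: "integrable lborel (%x. X j x * cnj (X k x) * e x)" for j k
 by (rule local_integrable[OF D]) (intro continuous_intros Xc ec supported_mult_right Xs)+
 have iW: "integrable lborel (%x. wzz q2 (axis j 1) (axis k 1) x * g x $ j * cnj (g x $ k) * e x)" for j k
 by (rule local_integrable[OF D])
 (intro continuous_intros wzzc ec C1_continuous[OF gj(1)] supported_mult_right supported_mult_left gj)+
 have iY: "integrable lborel (%x. Y k j x * cnj (Y j k x) * e x)" for j k
 by (rule local_integrable[OF D]) (intro continuous_intros Yc ec supported_mult_right Ys)+
 have id: "(LBINT x. X j x * cnj (X k x) * e x) =
 (LBINT x. wzz q2 (axis j 1) (axis k 1) x * g x $ j * cnj (g x $ k) * e x) + (LBINT x. Y k j x * cnj (Y j k x) * e x)" for j k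
 using dbar_commutator_identity[OF D q gj gj, of "axis j 1" j "axis k 1" k] by (simp add: X_def Y_def e_def)
 have "(LBINT x. (cmod (\<Sum>j\<in>UNIV. X j x))\<^sup>2 * exp (- q x)) = (LBINT x. Re (\<Sum>j\<in>UNIV. \<Sum>k\<in>UNIV. X j x * cnj (X k x) * e x))"
 proof (rule Bochner_Integration.integral_cong[OF refl])
 fix x
 have "complex_of_real ((cmod (\<Sum>j\<in>UNIV. X j x))\<^sup>2 * exp (- q x)) = (\<Sum>j\<in>UNIV. X j x) * cnj (\<Sum>j\<in>UNIV. X j x) * e x"
 unfolding of_real_mult complex_norm_square e_def by simp
 also have "... = (\<Sum>j\<in>UNIV. \<Sum>k\<in>UNIV. X j x * cnj (X k x) * e x)"
 by (simp only: cnj_sum sum_product) (simp only: sum_distrib_right)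
 finally show "(cmod (\<Sum>j\<in>UNIV. X j x))\<^sup>2 * exp (- q x) = Re (\<Sum>j\<in>UNIV. \<Sum>k\<in>UNIV. X j x * cnj (X k x) * e x)"
 by (metis Re_complex_of_real)
 qed
 also have "... = Re (LBINT x. (\<Sum>j\<in>UNIV. \<Sum>k\<in>UNIV. X j x * cnj (X k x) * e x))"
 by (intro integral_Re_complex Bochner_Integration.integrable_sum iX)
 also have "(LBINT x. (\<Sum>j\<in>UNIV. \<Sum>k\<in>UNIV. X j x * cnj (X k x) * e x)) = (\<Sum>j\<in>UNIV. \<Sum>k\<in>UNIV. LBINT x. X j x * cnj (X k x) * e x)"
 by (simp add: Bochner_Integration.integral_sum Bochner_Integration.integrable_sum iX)
 also have "... = (\<Sum>j\<in>UNIV. \<Sum>k\<in>UNIV. LBINT x. wzz q2 (axis j 1) (axis k 1) x * g x $ j * cnj (g x $ k) * e x)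
 + (\<Sum>j\<in>UNIV. \<Sum>k\<in>UNIV. LBINT x. Y k j x * cnj (Y j k x) * e x)"
 by (simp add: id sum.distrib)
 also have "(\<Sum>j\<in>UNIV. \<Sum>k\<in>UNIV. LBINT x. wzz q2 (axis j 1) (axis k 1) x * g x $ j * cnj (g x $ k) * e x)
 = (LBINT x. (\<Sum>j\<in>UNIV. \<Sum>k\<in>UNIV. wzz q2 (axis j 1) (axis k 1) x * g x $ j * cnj (g x $ k) * e x))"
 by (simp add: Bochner_Integration.integral_sum Bochner_Integration.integrable_sum iW)
 also have "Re (... + (\<Sum>j\<in>UNIV. \<Sum>k\<in>UNIV. LBINT x. Y k j x * cnj (Y j k x) * e x))
 = (LBINT x. Re (\<Sum>j\<in>UNIV. \<Sum>k\<in>UNIV. wzz q2 (axis j 1) (axis k 1) x * g x $ j * cnj (g x $ k) * e x))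
 + (\<Sum>j\<in>UNIV. \<Sum>k\<in>UNIV. Re (LBINT x. Y k j x * cnj (Y j k x) * e x))"
 by (subst integral_Re_complex) (auto intro!: Bochner_Integration.integrable_sum iW)
 also have "(LBINT x. Re (\<Sum>j\<in>UNIV. \<Sum>k\<in>UNIV. wzz q2 (axis j 1) (axis k 1) x * g x $ j * cnj (g x $ k) * e x))
 = (LBINT x. indicator D x * (lev q2 x (g x) * exp (- q x)))"
 proof (rule Bochner_Integration.integral_cong[OF refl])
 fix x
 show "Re (\<Sum>j\<in>UNIV. \<Sum>k\<in>UNIV. wzz q2 (axis j 1) (axis k 1) x * g x $ j * cnj (g x $ k) * e x) = indicator D x * (lev q2 x (g x) * exp (- q x))"
 proof (cases "x : D")
 case True
 have "(\<Sum>j\<in>UNIV. \<Sum>k\<in>UNIV. wzz q2 (axis j 1) (axis k 1) x * g x $ j * cnj (g x $ k) * e x)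
 = (\<Sum>j\<in>UNIV. \<Sum>k\<in>UNIV. wzz q2 (axis j 1) (axis k 1) x * g x $ j * cnj (g x $ k)) * of_real (exp (- q x))"
 by (simp add: sum_distrib_right e_def)
 then show ?thesis
 using lev_expansion[of q2 x "g x"] C2_on_linear3[OF D q True] C2_on_linear2[OF q True] True by simp
 next
 case False
 then have "g x = 0" using g(2) by (auto simp: supported_def)
 then show ?thesis using False by simp
 qed
 qed
 finally have eq: "(LBINT x. (cmod (\<Sum>j\<in>UNIV. X j x))\<^sup>2 * exp (- q x)) = (LBINT x. indicator D x * (lev q2 x (g x) * exp (- q x)))
 + (\<Sum>j\<in>UNIV. \<Sum>k\<in>UNIV. Re (LBINT x. Y k j x * cnj (Y j k x) * e x))" .
 \<comment> \<open>From 2 Re (u cnj v) >= - |u - v|^2: only the antisymmetric differences, which are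
   the components of the \<partial>-bar derivative of the form, have to be controlled.\<close>
 have "- (LBINT x. (cmod (Y k j x - Y j k x))\<^sup>2 * exp (- q x)) / 2 <= Re (LBINT x. Y k j x * cnj (Y j k x) * e x)" for j k
 proof -
 have "(LBINT x. (- 1 / 2) * ((cmod (Y k j x - Y j k x))\<^sup>2 * exp (- q x))) <= (LBINT x. Re (Y k j x * cnj (Y j k x) * e x))"
 proof (rule integral_mono)
 have "supported D (%x. Y k j x + - Y j k x)"
 by (intro supported_add Ys supported_mono[OF Ys]) simp
 then have "supported D (%x. (cmod (Y k j x - Y j k x))\<^sup>2 * exp (- q x))"
 by (rule supported_mono) simp
 then have "integrable lborel (%x. (cmod (Y k j x - Y j k x))\<^sup>2 * exp (- q x))"
 by (intro local_integrable[OF D] continuous_intros Yc C2_on_continuous(1)[OF q])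
 then show "integrable lborel (%x. (- 1 / 2) * ((cmod (Y k j x - Y j k x))\<^sup>2 * exp (- q x)))"
 by (rule integrable_mult_right)
 show "integrable lborel (%x. Re (Y k j x * cnj (Y j k x) * e x))"
 by (rule integrable_bounded_linear[OF bounded_linear_Re iY])
 fix x
 have "(- 1 / 2) * (cmod (u - v))\<^sup>2 <= Re (u * cnj v)" for u v
 proof -
 have "(cmod (u - v))\<^sup>2 = (cmod u)\<^sup>2 + (cmod v)\<^sup>2 - 2 * Re (u * cnj v)"
 unfolding cmod_power2 by (simp add: power2_eq_square algebra_simps)
 moreover have "0 <= (cmod u)\<^sup>2" "0 <= (cmod v)\<^sup>2" by auto
 ultimately show ?thesis by linarith
 qed
 then have "(- 1 / 2) * (cmod (Y k j x - Y j k x))\<^sup>2 * exp (- q x) <= Re (Y k j x * cnj (Y j k x)) * exp (- q x)"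
 by (intro mult_right_mono) auto
 then show "(- 1 / 2) * ((cmod (Y k j x - Y j k x))\<^sup>2 * exp (- q x)) <= Re (Y k j x * cnj (Y j k x) * e x)"
 by (simp add: e_def algebra_simps)
 qed
 then show ?thesis unfolding integral_Re_complex[OF iY] by simp
 qed
 then have "(\<Sum>j\<in>UNIV. \<Sum>k\<in>UNIV. - (LBINT x. (cmod (Y k j x - Y j k x))\<^sup>2 * exp (- q x)) / 2)
 <= (\<Sum>j\<in>UNIV. \<Sum>k\<in>UNIV. Re (LBINT x. Y k j x * cnj (Y j k x) * e x))"
 by (intro sum_mono)
 then show ?thesis using eq
 by (simp add: X_def Y_def sum_negf sum_divide_distrib[symmetric])
qed

section \<open>Mean-square limits and the inequality for weakly differentiable forms\<close>

definition L2_lim :: "(nat => 'a::euclidean_space => 'b::euclidean_space) => ('a => 'b) => bool"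
 where "L2_lim X U \<longleftrightarrow> (\<forall>n. X n : L2) \<and> U : L2 \<and> (%n. L2_sq (%x. X n x - U x)) \<longlonglongrightarrow> 0"

lemma L2_lim_sq: "L2_lim X U ==> (%n. L2_sq (X n)) \<longlonglongrightarrow> L2_sq U"
 unfolding L2_lim_def by (intro L2_sq_tendsto) auto

lemma L2_sq_mono:
 assumes "f : L2" "g : borel_measurable borel" "!!x. norm (g x) <= C * norm (f x)"
 shows "g : L2" "L2_sq g <= C\<^sup>2 * L2_sq f"
proof -
 have le: "(norm (g x))\<^sup>2 <= C\<^sup>2 * (norm (f x))\<^sup>2" for x
 using power_mono[OF assms(3)[of x], of 2] by (simp add: power_mult_distrib)
 have i: "integrable lborel (%x. C\<^sup>2 * (norm (f x))\<^sup>2)" by (intro integrable_mult_right L2_integrable assms)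
 have "integrable lborel (%x. (norm (g x))\<^sup>2)"
 by (rule Bochner_Integration.integrable_bound[OF i]) (use assms(2) le in \<open>auto simp: abs_mult\<close>)
 then show g: "g : L2" using assms(2) by (simp add: L2_def)
 have "L2_sq g <= (LBINT x. C\<^sup>2 * (norm (f x))\<^sup>2)"
 unfolding L2_sq_def by (rule integral_mono[OF L2_integrable[OF g] i le])
 then show "L2_sq g <= C\<^sup>2 * L2_sq f" by (simp add: L2_sq_def)
qed

lemma L2_sq_tendsto_0I:
 assumes "!!n. L2_sq (F n) <= b n" "b \<longlonglongrightarrow> 0" shows "(%n. L2_sq (F n)) \<longlonglongrightarrow> 0"
 by (rule tendsto_sandwich[OF _ _ tendsto_const assms(2)]) (use assms(1) L2_sq_nonneg in \<open>auto intro!: always_eventually\<close>)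

lemma L2_lim_mono:
 assumes X: "L2_lim X U" and Y: "!!n. Y n : borel_measurable borel" "V : borel_measurable borel"
 and le: "!!n x. norm (Y n x) <= C * norm (X n x)" "!!x. norm (V x) <= C * norm (U x)"
 "!!n x. norm (Y n x - V x) <= C * norm (X n x - U x)"
 shows "L2_lim Y V"
proof -
 have XU: "X n : L2" "U : L2" "(%n. L2_sq (%x. X n x - U x)) \<longlonglongrightarrow> 0" for n using X by (auto simp: L2_lim_def)
 have YL: "Y n : L2" and VL: "V : L2" for n
 by (rule L2_sq_mono(1)[OF XU(1) Y(1) le(1)], rule L2_sq_mono(1)[OF XU(2) Y(2) le(2)])
 have b: "L2_sq (%x. Y n x - V x) <= C\<^sup>2 * L2_sq (%x. X n x - U x)" for n
 by (rule L2_sq_mono(2)[OF L2_diff[OF XU(1,2)] L2_measurable[OF L2_diff[OF YL VL]] le(3)])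
 have "(%n. C\<^sup>2 * L2_sq (%x. X n x - U x)) \<longlonglongrightarrow> C\<^sup>2 * 0" by (intro tendsto_intros XU(3))
 then have "(%n. L2_sq (%x. Y n x - V x)) \<longlonglongrightarrow> 0" by (intro L2_sq_tendsto_0I[OF b]) simp
 then show ?thesis using YL VL by (simp add: L2_lim_def)
qed

lemma L2_lim_add:
 assumes "L2_lim X U" "L2_lim Y V"
 shows "L2_lim (%n x. X n x + Y n x) (%x. U x + V x)"
proof -
 have XU: "X n : L2" "U : L2" "(%n. L2_sq (%x. X n x - U x)) \<longlonglongrightarrow> 0" for n using assms by (auto simp: L2_lim_def)
 have YV: "Y n : L2" "V : L2" "(%n. L2_sq (%x. Y n x - V x)) \<longlonglongrightarrow> 0" for n using assms by (auto simp: L2_lim_def)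
 have b: "L2_sq (%x. (X n x + Y n x) - (U x + V x)) <= 2 * L2_sq (%x. X n x - U x) + 2 * L2_sq (%x. Y n x - V x)" for n
 using L2_sq_add_le[OF L2_diff[OF XU(1,2)] L2_diff[OF YV(1,2)], of n n] by (simp add: algebra_simps)
 have "(%n. 2 * L2_sq (%x. X n x - U x) + 2 * L2_sq (%x. Y n x - V x)) \<longlonglongrightarrow> 2 * 0 + 2 * 0"
 by (intro tendsto_intros XU(3) YV(3))
 then have "(%n. L2_sq (%x. (X n x + Y n x) - (U x + V x))) \<longlonglongrightarrow> 0"
 by (intro L2_sq_tendsto_0I[OF b]) simp
 then show ?thesis using XU(1,2) YV(1,2) by (simp add: L2_lim_def L2_add)
qed

lemma L2_lim_zero: "L2_lim (%n x. 0) (%x. 0)" by (simp add: L2_lim_def L2_zero L2_sq_def)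

lemma L2_lim_sum: "(!!i. i : I ==> L2_lim (X i) (U i)) ==> L2_lim (%n x. \<Sum>i\<in>I. X i n x) (%x. \<Sum>i\<in>I. U i x)"
 by (induction I rule: infinite_finite_induct) (auto intro: L2_lim_zero L2_lim_add)

lemma L2_lim_mult:
 fixes X :: "nat => 'a::euclidean_space => complex"
 assumes X: "L2_lim X U" and m[measurable]: "m : borel_measurable borel" and B: "!!x. cmod (m x) <= B"
 shows "L2_lim (%n x. m x * X n x) (%x. m x * U x)"
proof (rule L2_lim_mono[OF X])
 have [measurable]: "X n : borel_measurable borel" "U : borel_measurable borel" for n
 using X by (auto simp: L2_lim_def dest: L2_measurable)
 show "(%x. m x * X n x) : borel_measurable borel" for n by measurable
 show "(%x. m x * U x) : borel_measurable borel" by measurable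
 have *: "norm (m x * u) <= B * norm u" for x u unfolding norm_mult by (intro mult_right_mono B) auto
 show "norm (m x * X n x) <= B * norm (X n x)" for n x by (rule *)
 show "norm (m x * U x) <= B * norm (U x)" for x by (rule *)
 show "norm (m x * X n x - m x * U x) <= B * norm (X n x - U x)" for n x
 using *[of x "X n x - U x"] by (simp add: right_diff_distrib)
qed

lemma L2_lim_scaleR:
 fixes X :: "nat => 'a::euclidean_space => 'b::euclidean_space"
 assumes X: "L2_lim X U" and m[measurable]: "m : borel_measurable borel" and B: "!!x. \<bar>m x\<bar> <= B"
 shows "L2_lim (%n x. m x *\<^sub>R X n x) (%x. m x *\<^sub>R U x)"
proof (rule L2_lim_mono[OF X])
 have [measurable]: "X n : borel_measurable borel" "U : borel_measurable borel" for n
 using X by (auto simp: L2_lim_def dest: L2_measurable)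
 show "(%x. m x *\<^sub>R X n x) : borel_measurable borel" for n by measurable
 show "(%x. m x *\<^sub>R U x) : borel_measurable borel" by measurable
 have *: "norm (m x *\<^sub>R u) <= B * norm u" for x and u :: 'b unfolding norm_scaleR by (intro mult_right_mono B) auto
 show "norm (m x *\<^sub>R X n x) <= B * norm (X n x)" for n x by (rule *)
 show "norm (m x *\<^sub>R U x) <= B * norm (U x)" for x by (rule *)
 show "norm (m x *\<^sub>R X n x - m x *\<^sub>R U x) <= B * norm (X n x - U x)" for n x
 using *[of x "X n x - U x"] by (simp add: scaleR_diff_right)
qed

lemma borel_measurable_vec_nth: "(f :: 'a => complex^'n) : borel_measurable M ==> (%x. f x $ j) : borel_measurable M"
 by (rule borel_measurable_continuous_on[of "%v. v $ j" f M]) (auto intro!: continuous_intros)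

lemma L2_lim_vec_nth:
 fixes X :: "nat => 'a::euclidean_space => complex^'n"
 assumes X: "L2_lim X U" shows "L2_lim (%n x. X n x $ j) (%x. U x $ j)"
proof (rule L2_lim_mono[OF X, of _ _ 1])
 show "(%x. X n x $ j) : borel_measurable borel" for n
 using X by (intro borel_measurable_vec_nth) (auto simp: L2_lim_def dest: L2_measurable)
 show "(%x. U x $ j) : borel_measurable borel"
 using X by (intro borel_measurable_vec_nth) (auto simp: L2_lim_def dest: L2_measurable)
 show "norm (X n x $ j) <= 1 * norm (X n x)" for n x using Finite_Cartesian_Product.norm_nth_le by simp
 show "norm (U x $ j) <= 1 * norm (U x)" for x using Finite_Cartesian_Product.norm_nth_le by simp
 show "norm (X n x $ j - U x $ j) <= 1 * norm (X n x - U x)" for n x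
 using Finite_Cartesian_Product.norm_nth_le[of "X n x - U x" j] by simp
qed

lemma L2_vec_nth: "(f :: 'a::euclidean_space => complex^'n) : L2 ==> (%x. f x $ j) : L2"
 by (rule L2_sq_mono(1)[of f _ 1])
 (auto intro: borel_measurable_vec_nth L2_measurable Finite_Cartesian_Product.norm_nth_le)

lemma moll_vec_nth:
 fixes g :: "'a::euclidean_space => complex^'n"
 assumes "integrable lborel g" shows "moll t g x $ j = moll t (%x. g x $ j) x"
proof -
 have "(LBINT y. ker t (x - y) *\<^sub>R g y) $ j = (LBINT y. (ker t (x - y) *\<^sub>R g y) $ j)"
 by (rule integral_bounded_linear[OF bounded_linear_vec_nth conv_ker_integrable[OF assms], symmetric])
 then show ?thesis by (simp add: moll_def conv_def)
qed

text \<open>The kernel as a test function of its second argument, centred at x. A derivative of a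
  mollification at x is, up to the mass, minus a pairing with a derivative of this test function; so
  weak equations for f become pointwise ones for \<open>moll t f\<close>.\<close>

definition kerc :: "real => complex^'n => complex^'n => complex"
 where "kerc t x y = of_real (ker t (x - y))"

lemma kerc_C1: "C1 (kerc t x)" "dd (kerc t x) v y = - of_real (gker t (x - y) \<bullet> v)"
proof -
 have der: "((%y. complex_of_real (ker t (x - y))) has_derivative (%h. of_real (gker t (x - y) \<bullet> (- h)))) (at y)" for y
 by (rule has_derivative_of_real[OF has_derivative_compose[OF _ ker_has_derivative]])
 (auto intro!: derivative_eq_intros)
 show "C1 (kerc t x)" unfolding kerc_def[abs_def]
 by (rule C1I[OF der]) (intro continuous_intros)
 show "dd (kerc t x) v y = - of_real (gker t (x - y) \<bullet> v)"
 unfolding kerc_def[abs_def] using dd_eqI[OF der] by simp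
qed

lemma kerc_supported: "cball x (sqrt t) \<subseteq> D ==> supported D (kerc t x)"
 unfolding supported_def kerc_def
 by (intro exI[of _ "cball x (sqrt t)"]) (auto intro!: ker_eq_0 simp: dist_norm norm_minus_commute)

lemma dd_moll_kerc:
 fixes f :: "complex^'n => complex"
 assumes "integrable lborel f"
 shows "dd (moll t f) v x = - (LBINT y. f y * dd (kerc t x) v y) / of_real (kmass t TYPE(complex^'n))"
 and "integrable lborel (%y. f y * dd (kerc t x) v y)"
proof -
 have i: "integrable lborel (%y. (gker t (x - y) \<bullet> v) *\<^sub>R f y)"
 by (rule conv_integrable[of "%z. gker t z \<bullet> v" "sqrt t", OF _ _ assms])
 (auto intro!: continuous_intros simp: gker_eq_0 simp del: mem_cball)
 have eq: "f y * dd (kerc t x) v y = - ((gker t (x - y) \<bullet> v) *\<^sub>R f y)" for y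
 by (simp add: kerc_C1(2) scaleR_conv_of_real)
 show "integrable lborel (%y. f y * dd (kerc t x) v y)" unfolding eq using i by simp
 show "dd (moll t f) v x = - (LBINT y. f y * dd (kerc t x) v y) / of_real (kmass t TYPE(complex^'n))"
 unfolding eq dd_moll[OF assms] conv_def by (simp add: scaleR_conv_of_real field_simps)
qed

lemma dz_moll:
 fixes f :: "complex^'n => complex"
 assumes "integrable lborel f"
 shows "dz v (moll t f) x = - (LBINT y. f y * dz v (kerc t x) y) / of_real (kmass t TYPE(complex^'n))"
 "integrable lborel (%y. f y * dz v (kerc t x) y)"
proof -
 have eq: "f y * dz v (kerc t x) y = 1/2 * (f y * dd (kerc t x) v y) - \<i>/2 * (f y * dd (kerc t x) (\<i> *s v) y)" for y
 by (simp add: dz_def field_simps)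
 note i = integrable_mult_right[OF dd_moll_kerc(2)[OF assms]]
 show "integrable lborel (%y. f y * dz v (kerc t x) y)" unfolding eq by (intro Bochner_Integration.integrable_diff i)
 have int: "(LBINT y. f y * dz v (kerc t x) y) = 1/2 * (LBINT y. f y * dd (kerc t x) v y) - \<i>/2 * (LBINT y. f y * dd (kerc t x) (\<i> *s v) y)"
 unfolding eq by (subst Bochner_Integration.integral_diff[OF i i]) simp
 show "dz v (moll t f) x = - (LBINT y. f y * dz v (kerc t x) y) / of_real (kmass t TYPE(complex^'n))"
 by (subst int) (simp add: dz_def dd_moll_kerc(1)[OF assms] add_divide_distrib diff_divide_distrib mult.commute)
qed

lemma dzb_moll:
 fixes f :: "complex^'n => complex"
 assumes "integrable lborel f"
 shows "dzb v (moll t f) x = - (LBINT y. f y * dzb v (kerc t x) y) / of_real (kmass t TYPE(complex^'n))"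
 "integrable lborel (%y. f y * dzb v (kerc t x) y)"
proof -
 have eq: "f y * dzb v (kerc t x) y = 1/2 * (f y * dd (kerc t x) v y) + \<i>/2 * (f y * dd (kerc t x) (\<i> *s v) y)" for y
 by (simp add: dzb_def field_simps)
 note i = integrable_mult_right[OF dd_moll_kerc(2)[OF assms]]
 show "integrable lborel (%y. f y * dzb v (kerc t x) y)" unfolding eq by (intro Bochner_Integration.integrable_add i)
 have int: "(LBINT y. f y * dzb v (kerc t x) y) = 1/2 * (LBINT y. f y * dd (kerc t x) v y) + \<i>/2 * (LBINT y. f y * dd (kerc t x) (\<i> *s v) y)"
 unfolding eq by (subst Bochner_Integration.integral_add[OF i i]) simp
 show "dzb v (moll t f) x = - (LBINT y. f y * dzb v (kerc t x) y) / of_real (kmass t TYPE(complex^'n))"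
 by (subst int) (simp add: dzb_def dd_moll_kerc(1)[OF assms] add_divide_distrib diff_divide_distrib mult.commute)
qed

lemma moll_kerc:
 fixes f :: "complex^'n => complex"
 shows "moll t f x = (LBINT y. f y * kerc t x y) / of_real (kmass t TYPE(complex^'n))"
 by (simp add: moll_def conv_def kerc_def scaleR_conv_of_real mult.commute divide_inverse)

lemma bounded_multiplier:
 fixes c :: "'a::euclidean_space => 'b::real_normed_vector"
 assumes "compact K" "continuous_on K c"
 obtains B where "!!x. norm (indicator K x *\<^sub>R c x) <= B" "(%x. indicator K x *\<^sub>R c x) : borel_measurable borel"
proof -
 have "bounded (c ` K)" by (intro compact_imp_bounded compact_continuous_image assms)
 then obtain B where B: "B > 0" "!!x. x : K ==> norm (c x) <= B" by (auto simp: bounded_pos)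
 have "norm (indicator K x *\<^sub>R c x) <= B" for x using B by (auto simp: indicator_def)
 moreover have "(%x. indicator K x *\<^sub>R c x) : borel_measurable borel"
 by (rule borel_measurable_continuous_on_indicator) (use assms in \<open>auto simp: compact_imp_closed\<close>)
 ultimately show ?thesis using that by blast
qed

text \<open>The Morrey--Kohn--Hoermander inequality for square integrable forms whose divergence \<open>s\<close> and
 exterior derivative \<open>b\<close> exist in the weak sense.\<close>

lemma morrey_kohn_hormander_weak:
 fixes g :: "complex^'n => complex^'n" and c :: "'n => complex^'n => complex"
 assumes D: "open D" and q: "C2_on D q q1 q2" and K: "compact K" "K \<subseteq> D"
 and g: "g : L2" "!!x. x \<notin> K ==> g x = 0"
 and s: "s : L2" "!!x. x \<notin> K ==> s x = 0"
 and b: "!!j k. b j k : L2" "!!j k x. x \<notin> K ==> b j k x = 0"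
 and div: "!!h. C1 h ==> (LBINT x. (\<Sum>j\<in>UNIV. g x $ j * dz (axis j 1) h x)) = - (LBINT x. s x * h x)"
 and curl: "!!h j k. C1 h ==> (LBINT x. g x $ k * dzb (axis j 1) h x - g x $ j * dzb (axis k 1) h x) = - (LBINT x. b j k x * h x)"
 and c: "!!j. continuous_on D (c j)"
 and lower: "!!x t. x : D ==> (norm t)\<^sup>2 + 3 * (cmod (\<Sum>j\<in>UNIV. c j x * t $ j))\<^sup>2 <= lev q2 x t"
 shows "L2_sq (%x. (indicator K x * exp (- q x / 2)) *\<^sub>R g x)
 + 3 * L2_sq (%x. (indicator K x * exp (- q x / 2)) *\<^sub>R (\<Sum>j\<in>UNIV. c j x * g x $ j))
 <= L2_sq (%x. (indicator K x * exp (- q x / 2)) *\<^sub>R (s x - (\<Sum>j\<in>UNIV. wz q1 (axis j 1) x * g x $ j)))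
 + (\<Sum>j\<in>UNIV. \<Sum>k\<in>UNIV. L2_sq (%x. (indicator K x * exp (- q x / 2)) *\<^sub>R b j k x)) / 2"
proof -
 obtain r where r: "r > 0" "(\<Union>x\<in>K. cball x r) \<subseteq> D"
 using compact_subset_open_imp_cball_epsilon_subset[OF K(1) D K(2)] by metis
 \<comment> \<open>Mollifications of functions that vanish outside K live on this r-neighbourhood of
   K, which is still a compact subset of D.\<close>
 define K' where "K' = {x + y |x y. x : K \<and> y : cball 0 r}"
 have K': "compact K'" unfolding K'_def by (rule compact_sums[OF K(1) compact_cball])
 have inK': "x : K'" if "y : K" "norm (x - y) <= r" for x y
 proof -
 have "x = y + (x - y)" "x - y : cball 0 r" using that by auto
 then show ?thesis using that(1) unfolding K'_def by blast
 qed
 have KK': "K \<subseteq> K'" using inK' r by (metis cancel_comm_monoid_add_class.diff_cancel less_imp_le norm_zero subsetI)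
 have K'D: "K' \<subseteq> D"
 proof
 fix y assume "y : K'"
 then obtain x u where "x : K" "u : cball 0 r" "y = x + u" by (auto simp: K'_def)
 then have "y : cball x r" by (simp add: dist_norm)
 then show "y : D" using r(2) \<open>x : K\<close> by blast
 qed
 obtain rh where "\<forall>x\<in>K. norm x <= rh" using compact_imp_bounded[OF K(1)] by (auto simp: bounded_iff)
 then have rh: "x \<notin> K" if "x \<notin> cball 0 rh" for x using that by auto
 define t where "t n = (r / real (Suc n))\<^sup>2" for n
 have t: "0 < t n" "sqrt (t n) <= r" for n
 proof -
 have "r / real (Suc n) <= r / 1" using r(1) by (intro divide_left_mono) auto
 then show "0 < t n" "sqrt (t n) <= r" using r(1) by (auto simp: t_def)
 qed
 have tlim: "t \<longlonglongrightarrow> 0"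
 proof -
 have "(%n. (r * inverse (real (Suc n)))\<^sup>2) \<longlonglongrightarrow> (r * 0)\<^sup>2" by (intro tendsto_intros LIMSEQ_inverse_real_of_nat)
 then show ?thesis by (simp add: t_def[abs_def] divide_inverse)
 qed
 have lim: "L2_lim (%n. moll (t n) f) f" if "f : L2" "!!x. x \<notin> K ==> f x = 0" for f :: "complex^'n => 'b::euclidean_space"
 unfolding L2_lim_def
 proof (intro conjI allI)
 have i: "integrable lborel f" by (rule L2_supported_integrable[OF that(1), of rh]) (use that(2) rh in blast)
 show "moll (t n) f : L2" for n by (rule moll_L2(1)[OF t(1) that(1) i])
 show "(%n. L2_sq (%x. moll (t n) f x - f x)) \<longlonglongrightarrow> 0"
 by (rule moll_L2_tendsto[OF that(1) _ t(1) tlim, of rh]) (use that(2) rh in blast)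
 qed (rule that(1))
 have int: "integrable lborel f" if "f : L2" "!!x. x \<notin> K ==> f x = 0" for f :: "complex^'n => 'b::euclidean_space"
 by (rule L2_supported_integrable[OF that(1), of rh]) (use that(2) rh in blast)
 have zero: "moll (t n) f x = 0" if "x \<notin> K'" "!!x. x \<notin> K ==> f x = 0" for n x and f :: "complex^'n => 'b::euclidean_space"
 by (rule moll_eq_0) (use that inK' t(2) order_trans in blast)
 have gi: "integrable lborel g" by (rule int[OF g])
 have gji: "integrable lborel (%x. g x $ j)" for j by (rule integrable_bounded_linear[OF bounded_linear_vec_nth gi])
 define G where "G n = moll (t n) g" for n
 have Gj: "(%x. G n x $ j) = moll (t n) (%x. g x $ j)" for n j by (rule ext) (simp add: G_def moll_vec_nth[OF gi])
 have GC1: "C1 (G n)" for n unfolding G_def by (rule C1_moll[OF gi])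
 have Gs: "supported D (G n)" for n
 unfolding supported_def by (rule exI[of _ K']) (use K' K'D zero[of _ g] g(2) in \<open>auto simp: G_def\<close>)
 \<comment> \<open>The weak equation is tested with the kernel centred at x, so mollification
   commutes with the divergence and, below, with the exterior derivative.\<close>
 have divG: "(\<Sum>j\<in>UNIV. dz (axis j 1) (%x. G n x $ j) x) = moll (t n) s x" for n x
 proof -
 have "(\<Sum>j\<in>UNIV. dz (axis j 1) (%x. G n x $ j) x)
 = - (\<Sum>j\<in>UNIV. LBINT y. g y $ j * dz (axis j 1) (kerc (t n) x) y) / of_real (kmass (t n) TYPE(complex^'n))"
 by (simp add: Gj dz_moll(1)[OF gji] sum_negf sum_divide_distrib)
 also have "(\<Sum>j\<in>UNIV. LBINT y. g y $ j * dz (axis j 1) (kerc (t n) x) y) = (LBINT y. (\<Sum>j\<in>UNIV. g y $ j * dz (axis j 1) (kerc (t n) x) y))"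
 by (rule Bochner_Integration.integral_sum[symmetric]) (rule dz_moll(2)[OF gji])
 also have "... = - (LBINT y. s y * kerc (t n) x y)" by (rule div[OF kerc_C1(1)])
 finally show ?thesis by (simp add: moll_kerc)
 qed
 have curlG: "dzb (axis j 1) (%x. G n x $ k) x - dzb (axis k 1) (%x. G n x $ j) x = moll (t n) (b j k) x" for n j k x
 proof -
 have "dzb (axis j 1) (%x. G n x $ k) x - dzb (axis k 1) (%x. G n x $ j) x
 = - ((LBINT y. g y $ k * dzb (axis j 1) (kerc (t n) x) y) - (LBINT y. g y $ j * dzb (axis k 1) (kerc (t n) x) y)) / of_real (kmass (t n) TYPE(complex^'n))"
 by (simp add: Gj dzb_moll(1)[OF gji] diff_divide_distrib)
 also have "(LBINT y. g y $ k * dzb (axis j 1) (kerc (t n) x) y) - (LBINT y. g y $ j * dzb (axis k 1) (kerc (t n) x) y)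
 = (LBINT y. g y $ k * dzb (axis j 1) (kerc (t n) x) y - g y $ j * dzb (axis k 1) (kerc (t n) x) y)"
 by (rule Bochner_Integration.integral_diff[symmetric]) (rule dzb_moll(2)[OF gji])+
 also have "... = - (LBINT y. b j k y * kerc (t n) x y)" by (rule curl[OF kerc_C1(1)])
 finally show ?thesis by (simp add: moll_kerc)
 qed
 \<comment> \<open>With this factor, weighted norms become plain ones. It and the coefficients
   \<open>c\<close> and \<open>wz\<close> are cut off to K' because they are bounded on compact
   subsets of D only.\<close>
 define m where "m x = indicator K' x * exp (- q x / 2)" for x
 have qc: "continuous_on D q" by (rule C2_on_continuous(1)[OF q])
 obtain Bm where Bm: "!!x. \<bar>m x\<bar> <= Bm" and mm: "m : borel_measurable borel"
 proof -
 have "continuous_on K' (%x. exp (- q x / 2))" by (intro continuous_intros continuous_on_subset[OF qc K'D]) auto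
 then obtain B where "!!x. norm (indicator K' x *\<^sub>R exp (- q x / 2)) <= B" "(%x. indicator K' x *\<^sub>R exp (- q x / 2)) : borel_measurable borel"
 by (rule bounded_multiplier[OF K']) blast
 then show ?thesis using that[of B] by (simp add: m_def[abs_def])
 qed
 define c' where "c' j x = indicator K' x *\<^sub>R c j x" for j x
 define w' where "w' j x = indicator K' x *\<^sub>R wz q1 (axis j 1) x" for j x
 have limc: "L2_lim (%n x. c' j x * G n x $ j) (%x. c' j x * g x $ j)" for j
 proof -
 obtain B where "!!x. norm (c' j x) <= B" "c' j : borel_measurable borel"
 using bounded_multiplier[OF K' continuous_on_subset[OF c K'D], of j] by (auto simp: c'_def[abs_def])
 then show ?thesis unfolding G_def by (intro L2_lim_mult L2_lim_vec_nth lim g)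
 qed
 have limw: "L2_lim (%n x. w' j x * G n x $ j) (%x. w' j x * g x $ j)" for j
 proof -
 have "continuous_on K' (wz q1 (axis j 1))"
 by (rule continuous_on_subset[OF C1_on_continuous[OF C1_on_wz[OF q]] K'D])
 then obtain B where "!!x. norm (w' j x) <= B" "w' j : borel_measurable borel"
 using bounded_multiplier[OF K', of "wz q1 (axis j 1)"] by (auto simp: w'_def[abs_def])
 then show ?thesis unfolding G_def by (intro L2_lim_mult L2_lim_vec_nth lim g)
 qed
 have l1: "L2_lim (%n x. m x *\<^sub>R G n x) (%x. m x *\<^sub>R g x)"
 unfolding G_def by (intro L2_lim_scaleR[OF _ mm Bm] lim g)
 have l2: "L2_lim (%n x. m x *\<^sub>R (\<Sum>j\<in>UNIV. c' j x * G n x $ j)) (%x. m x *\<^sub>R (\<Sum>j\<in>UNIV. c' j x * g x $ j))"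
 by (intro L2_lim_scaleR[OF _ mm Bm] L2_lim_sum limc)
 have lneg: "L2_lim (%n x. (-1) * (w' j x * G n x $ j)) (%x. (-1) * (w' j x * g x $ j))" for j
 by (rule L2_lim_mult[OF limw, of _ 1]) auto
 have l3: "L2_lim (%n x. m x *\<^sub>R (moll (t n) s x + (\<Sum>j\<in>UNIV. (-1) * (w' j x * G n x $ j)))) (%x. m x *\<^sub>R (s x + (\<Sum>j\<in>UNIV. (-1) * (w' j x * g x $ j))))"
 by (intro L2_lim_scaleR[OF _ mm Bm] L2_lim_add L2_lim_sum lneg lim s)
 have l4: "L2_lim (%n x. m x *\<^sub>R moll (t n) (b j k) x) (%x. m x *\<^sub>R b j k x)" for j k
 by (intro L2_lim_scaleR[OF _ mm Bm] lim b)
 have ineq: "L2_sq (%x. m x *\<^sub>R G n x) + 3 * L2_sq (%x. m x *\<^sub>R (\<Sum>j\<in>UNIV. c' j x * G n x $ j))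
 <= L2_sq (%x. m x *\<^sub>R (moll (t n) s x + (\<Sum>j\<in>UNIV. (-1) * (w' j x * G n x $ j))))
 + (\<Sum>j\<in>UNIV. \<Sum>k\<in>UNIV. L2_sq (%x. m x *\<^sub>R moll (t n) (b j k) x)) / 2" (is "?L <= ?R") for n
 proof -
 have msq: "(norm (m x *\<^sub>R u))\<^sup>2 = indicator K' x * ((norm u)\<^sup>2 * exp (- q x))" for x and u :: "'b::real_normed_vector"
 proof -
 have "(exp (- q x / 2))\<^sup>2 = exp (- q x)" by (simp add: power2_eq_square flip: exp_add)
 then show ?thesis by (auto simp: m_def indicator_def power_mult_distrib)
 qed
 have G0: "G n x = 0" if "x \<notin> K'" for x using zero[OF that, of g] g(2) by (simp add: G_def)
 have "?L = (LBINT x. (norm (m x *\<^sub>R G n x))\<^sup>2 + 3 * (norm (m x *\<^sub>R (\<Sum>j\<in>UNIV. c' j x * G n x $ j)))\<^sup>2)"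
 proof -
 have a: "(%x. m x *\<^sub>R G n x) : L2" "(%x. m x *\<^sub>R (\<Sum>j\<in>UNIV. c' j x * G n x $ j)) : L2"
 using l1 l2 unfolding L2_lim_def by auto
 show ?thesis unfolding L2_sq_def
 by (subst Bochner_Integration.integral_add[OF L2_integrable[OF a(1)] integrable_mult_right[OF L2_integrable[OF a(2)]]]) simp
 qed
 also have "... <= (LBINT x. indicator D x * (lev q2 x (G n x) * exp (- q x)))"
 proof (rule integral_mono)
 show "integrable lborel (%x. (norm (m x *\<^sub>R G n x))\<^sup>2 + 3 * (norm (m x *\<^sub>R (\<Sum>j\<in>UNIV. c' j x * G n x $ j)))\<^sup>2)"
 using l1 l2 unfolding L2_lim_def by (intro Bochner_Integration.integrable_add integrable_mult_right L2_integrable) auto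
 show "integrable lborel (%x. indicator D x * (lev q2 x (G n x) * exp (- q x)))"
 proof -
 have levc: "continuous_on D (%x. Re (\<Sum>j\<in>UNIV. \<Sum>k\<in>UNIV. wzz q2 (axis j 1) (axis k 1) x * G n x $ j * cnj (G n x $ k)) * exp (- q x))"
 proof -
 have "continuous_on D (wzz q2 v w)" for v w
 unfolding wzz_def[abs_def] using C2_on_continuous(3)[OF q] by (intro continuous_intros) auto
 then show ?thesis by (intro continuous_intros C1_continuous[OF GC1] qc)
 qed
 have "continuous_on D (%x. indicator D x * (lev q2 x (G n x) * exp (- q x)))"
 using levc by (rule continuous_on_eq)
 (use lev_expansion[of q2 _ "G n _"] C2_on_linear3[OF D q] C2_on_linear2[OF q] in auto)
 moreover have "supported D (%x. indicator D x * (lev q2 x (G n x) * exp (- q x)))"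
 unfolding supported_def
 proof (intro exI[of _ K'] conjI allI impI K' K'D)
 fix x assume x: "x \<notin> K'"
 have "lev q2 x 0 = 0" if "x : D"
 using C2_on_linear2[OF q that] by (simp add: lev_def linear_0)
 then show "indicator D x * (lev q2 x (G n x) * exp (- q x)) = 0" using G0[OF x] by (auto simp: indicator_def)
 qed
 ultimately show ?thesis by (rule local_integrable[OF D])
 qed
 fix x
 show "(norm (m x *\<^sub>R G n x))\<^sup>2 + 3 * (norm (m x *\<^sub>R (\<Sum>j\<in>UNIV. c' j x * G n x $ j)))\<^sup>2 <= indicator D x * (lev q2 x (G n x) * exp (- q x))"
 proof (cases "x : K'")
 case True
 then have xD: "x : D" using K'D by blast
 have "((norm (G n x))\<^sup>2 + 3 * (cmod (\<Sum>j\<in>UNIV. c j x * G n x $ j))\<^sup>2) * exp (- q x) <= lev q2 x (G n x) * exp (- q x)"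
 by (intro mult_right_mono lower[OF xD]) simp
 then show ?thesis unfolding msq using True xD by (simp add: c'_def algebra_simps)
 next
 case False
 have "0 <= lev q2 x 0" if "x : D" using C2_on_linear2[OF q that] by (simp add: lev_def linear_0)
 then show ?thesis unfolding msq using False G0[OF False] by (auto simp: indicator_def)
 qed
 qed
 also have "... <= (LBINT x. (cmod (\<Sum>j\<in>UNIV. dz (axis j 1) (%x. G n x $ j) x - wz q1 (axis j 1) x * G n x $ j))\<^sup>2 * exp (- q x))
 + (\<Sum>j\<in>UNIV. \<Sum>k\<in>UNIV. LBINT x. (cmod (dzb (axis k 1) (%x. G n x $ j) x - dzb (axis j 1) (%x. G n x $ k) x))\<^sup>2 * exp (- q x)) / 2"
 by (rule morrey_kohn_hormander[OF D q GC1 Gs])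
 also have "(LBINT x. (cmod (\<Sum>j\<in>UNIV. dz (axis j 1) (%x. G n x $ j) x - wz q1 (axis j 1) x * G n x $ j))\<^sup>2 * exp (- q x))
 = L2_sq (%x. m x *\<^sub>R (moll (t n) s x + (\<Sum>j\<in>UNIV. (-1) * (w' j x * G n x $ j))))"
 unfolding L2_sq_def msq
 proof (rule Bochner_Integration.integral_cong[OF refl])
 fix x
 show "(cmod (\<Sum>j\<in>UNIV. dz (axis j 1) (%x. G n x $ j) x - wz q1 (axis j 1) x * G n x $ j))\<^sup>2 * exp (- q x)
 = indicator K' x * ((norm (moll (t n) s x + (\<Sum>j\<in>UNIV. (-1) * (w' j x * G n x $ j))))\<^sup>2 * exp (- q x))"
 using G0[of x] zero[of x s n] s(2)
 by (cases "x : K'") (auto simp: sum_subtractf divG w'_def sum_negf)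
 qed
 also have "(\<Sum>j\<in>UNIV. \<Sum>k\<in>UNIV. LBINT x. (cmod (dzb (axis k 1) (%x. G n x $ j) x - dzb (axis j 1) (%x. G n x $ k) x))\<^sup>2 * exp (- q x))
 = (\<Sum>j\<in>UNIV. \<Sum>k\<in>UNIV. L2_sq (%x. m x *\<^sub>R moll (t n) (b k j) x))"
 unfolding curlG L2_sq_def msq
 proof (intro sum.cong[OF refl] Bochner_Integration.integral_cong[OF refl])
 fix j k x
 show "(cmod (moll (t n) (b k j) x))\<^sup>2 * exp (- q x) = indicator K' x * ((cmod (moll (t n) (b k j) x))\<^sup>2 * exp (- q x))"
 using zero[of x "b k j" n] b(2) by (cases "x : K'") auto
 qed
 also have "... = (\<Sum>j\<in>UNIV. \<Sum>k\<in>UNIV. L2_sq (%x. m x *\<^sub>R moll (t n) (b j k) x))"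
 by (rule sum.swap)
 finally show ?thesis .
 qed
 have fin: "L2_sq (%x. m x *\<^sub>R g x) + 3 * L2_sq (%x. m x *\<^sub>R (\<Sum>j\<in>UNIV. c' j x * g x $ j))
 <= L2_sq (%x. m x *\<^sub>R (s x + (\<Sum>j\<in>UNIV. (-1) * (w' j x * g x $ j))))
 + (\<Sum>j\<in>UNIV. \<Sum>k\<in>UNIV. L2_sq (%x. m x *\<^sub>R b j k x)) / 2"
 proof (rule LIMSEQ_le)
 show "(%n. L2_sq (%x. m x *\<^sub>R G n x) + 3 * L2_sq (%x. m x *\<^sub>R (\<Sum>j\<in>UNIV. c' j x * G n x $ j))) \<longlonglongrightarrow>
 L2_sq (%x. m x *\<^sub>R g x) + 3 * L2_sq (%x. m x *\<^sub>R (\<Sum>j\<in>UNIV. c' j x * g x $ j))"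
 by (intro tendsto_add tendsto_mult tendsto_const L2_lim_sq[OF l1] L2_lim_sq[OF l2])
 show "(%n. L2_sq (%x. m x *\<^sub>R (moll (t n) s x + (\<Sum>j\<in>UNIV. (-1) * (w' j x * G n x $ j))))
 + (\<Sum>j\<in>UNIV. \<Sum>k\<in>UNIV. L2_sq (%x. m x *\<^sub>R moll (t n) (b j k) x)) / 2) \<longlonglongrightarrow>
 L2_sq (%x. m x *\<^sub>R (s x + (\<Sum>j\<in>UNIV. (-1) * (w' j x * g x $ j))))
 + (\<Sum>j\<in>UNIV. \<Sum>k\<in>UNIV. L2_sq (%x. m x *\<^sub>R b j k x)) / 2"
 by (intro tendsto_add tendsto_divide tendsto_sum tendsto_const L2_lim_sq[OF l3] L2_lim_sq[OF l4]) simp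
 qed (use ineq in blast)
 have e1: "m x *\<^sub>R g x = (indicator K x * exp (- q x / 2)) *\<^sub>R g x"
 and e2: "m x *\<^sub>R (\<Sum>j\<in>UNIV. c' j x * g x $ j) = (indicator K x * exp (- q x / 2)) *\<^sub>R (\<Sum>j\<in>UNIV. c j x * g x $ j)"
 and e3: "m x *\<^sub>R (s x + (\<Sum>j\<in>UNIV. (-1) * (w' j x * g x $ j))) = (indicator K x * exp (- q x / 2)) *\<^sub>R (s x - (\<Sum>j\<in>UNIV. wz q1 (axis j 1) x * g x $ j))"
 and e4: "m x *\<^sub>R b j k x = (indicator K x * exp (- q x / 2)) *\<^sub>R b j k x" for x j k
 using KK' g(2)[of x] s(2)[of x] b(2)[of x]
 by (cases "x : K"; auto simp: m_def c'_def w'_def sum_negf indicator_def)+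
 show ?thesis using fin unfolding e1 e2 e3 e4 .
qed

section \<open>Orthogonal projection onto weakly closed forms\<close>

lemma L2_mult_continuous:
 fixes f m :: "'a::euclidean_space => complex"
 assumes f: "f : L2" and m: "continuous_on UNIV m" "supported D m"
 shows "(%x. m x * f x) : L2" "integrable lborel (%x. m x * f x)" "integrable lborel (%x. f x * m x)"
proof -
 obtain B where B: "!!x. norm (m x) <= B" using supported_bounded[OF m] by metis
 have [measurable]: "m : borel_measurable borel" "f : borel_measurable borel"
 by (rule borel_measurable_continuous_onI[OF m(1)], rule L2_measurable[OF f])
 show L: "(%x. m x * f x) : L2"
 proof (rule L2_sq_mono(1)[OF f])
 show "norm (m x * f x) <= B * norm (f x)" for x unfolding norm_mult by (intro mult_right_mono B) auto
 qed measurable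
 obtain rh where rh: "!!x. x \<notin> cball 0 rh ==> m x = 0" using supported_cball[OF m(2)] by metis
 show "integrable lborel (%x. m x * f x)"
 by (rule L2_supported_integrable[OF L, of rh]) (simp add: rh del: mem_cball)
 then show "integrable lborel (%x. f x * m x)" by (simp add: mult.commute)
qed

lemma integral_dzb_dzb_commute:
 fixes a b :: "complex^'n => complex"
 assumes a: "C1 a" and b: "C1 b" "supported D b"
 shows "(LBINT x. dzb v a x * dzb w b x) = (LBINT x. dzb w a x * dzb v b x)"
proof -
 define J where "J p q = (LBINT x. dd a p x * dd b q x)" for p q
 have i: "integrable lborel (%x. dd a p x * dd b q x)" for p q
 by (rule supported_integrable[OF continuous_on_mult[OF C1_dd_continuous[OF a] C1_dd_continuous[OF b(1)]] supported_mult_left[OF supported_dd[OF b(2)]]])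
 have four: "(LBINT x. (c1 * (dd a p1 x * dd b q1 x) + c2 * (dd a p2 x * dd b q2 x)) + (c3 * (dd a p3 x * dd b q3 x) + c4 * (dd a p4 x * dd b q4 x)))
 = c1 * J p1 q1 + c2 * J p2 q2 + (c3 * J p3 q3 + c4 * J p4 q4)" for c1 c2 c3 c4 p1 p2 p3 p4 q1 q2 q3 q4
 unfolding J_def
 by (simp add: Bochner_Integration.integral_add Bochner_Integration.integrable_add integrable_mult_right i)
 have ex: "(LBINT x. dzb v a x * dzb w b x) = 1/4 * J v w + \<i>/4 * J v (\<i> *s w) + (\<i>/4 * J (\<i> *s v) w + (-1/4) * J (\<i> *s v) (\<i> *s w))" for v w
 unfolding four[symmetric]
 by (rule Bochner_Integration.integral_cong) (auto simp: dzb_def field_simps)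
 have Jc: "J p q = J q p" for p q unfolding J_def by (rule integral_dd_dd_commute[OF a b])
 show ?thesis unfolding ex Jc[of v w] Jc[of v "\<i> *s w"] Jc[of "\<i> *s v" w] Jc[of "\<i> *s v" "\<i> *s w"] by simp
qed

lemma integral_dz_by_parts:
 fixes a b :: "complex^'n => complex"
 assumes a: "C1 a" and b: "C1 b" "supported D b"
 shows "(LBINT x. a x * dz v b x) = - (LBINT x. dz v a x * b x)"
proof -
 have ca: "C1 (%x. cnj (a x))" and cb: "C1 (%x. cnj (b x))" "supported D (%x. cnj (b x))"
 using a b by (auto intro: C1_cnj supported_mono)
 have A: "(LBINT x. cnj (p x) * cnj (q x)) = cnj (LBINT x. p x * q x)" for p q :: "complex^'n => complex"
 using Bochner_Integration.integral_cnj[of lborel "%x. p x * q x"] by (simp only: complex_cnj_mult)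
 have "(LBINT x. cnj (dz v a x) * cnj (b x)) = - (LBINT x. cnj (a x) * cnj (dz v b x))"
 using integral_dzb_by_parts[OF ca cb] by (simp add: dzb_cnj a b)
 then have "cnj (LBINT x. dz v a x * b x) = cnj (- (LBINT x. a x * dz v b x))"
 unfolding A by simp
 then show ?thesis unfolding complex_cnj_cancel_iff by simp
qed

lemma scaleR_vec_nth: "(c *\<^sub>R (v::complex^'n)) $ j = of_real c * v $ j"
 unfolding vector_scaleR_component by (rule scaleR_conv_of_real)

lemma dzb_cmult: "C1 h ==> dzb v (%x. c * h x) x = c * dzb v h x"
 using dd_bounded_linear[OF bounded_linear_mult_right, of h c] by (simp add: dzb_def algebra_simps)

lemma C1_cmult: "C1 (h :: 'a::real_normed_vector => complex) ==> C1 (%x. c * h x)"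
 by (rule C1_bounded_linear[OF bounded_linear_mult_right])

lemma inner_vec_complex: "(u::complex^'n) \<bullet> w = Re (\<Sum>j\<in>UNIV. u $ j * cnj (w $ j))"
 by (simp add: inner_vec_def inner_complex_def)

lemma inner_axis_complex: "(u::complex^'n) \<bullet> axis j c = Re (u $ j * cnj c)"
 by (simp add: inner_axis inner_complex_def)

lemma complex_eq_0_from_Re:
 assumes "Re z = 0" "Re (\<i> * z) = 0" shows "z = 0"
 using assms by (simp add: complex_eq_iff)

text \<open>Orthogonal projection onto the weakly \<open>\<partial>\<close>-bar closed forms. Instead of the weighted space
 with weight \<open>exp (- w)\<close> we use half densities, so that \<open>U\<close> lies in the unweighted space.\<close>

lemma closed_projection:
 fixes v G :: "complex^'n => complex^'n" and w :: "complex^'n => real"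
 assumes D: "open D" and w: "continuous_on D w"
 and v: "continuous_on UNIV v" "supported D v"
 and closed: "!!h j k. C1 h ==> supported D h ==>
 (LBINT x. v x $ k * dzb (axis j 1) h x - v x $ j * dzb (axis k 1) h x) = 0"
 and G: "C1 G" "supported D G"
 shows "\<exists>U\<in>L2. (LBINT x. v x \<bullet> G x) = L2_inner U (%x. exp (- w x / 2) *\<^sub>R v x) \<and>
 (\<forall>h. C1 h \<longrightarrow> supported D h \<longrightarrow> (LBINT x. (\<Sum>j\<in>UNIV. of_real (exp (- w x / 2)) * U x $ j * dz (axis j 1) h x))
 = - (LBINT x. (\<Sum>j\<in>UNIV. dz (axis j 1) (%x. G x $ j) x) * h x)) \<and>
 (\<forall>h j k. C1 h \<longrightarrow> supported D h \<longrightarrow>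
 (LBINT x. of_real (exp (w x / 2)) * (U x $ k * dzb (axis j 1) h x - U x $ j * dzb (axis k 1) h x)) = 0)"
proof -
 \<comment> \<open>Multiplication by E turns a form of the space with weight exp (- w) into a half
   density; multiplication by I turns it back.\<close>
 define E where "E x = exp (- w x / 2)" for x
 define I where "I x = exp (w x / 2)" for x
 have EI: "E x * I x = 1" for x by (simp add: E_def I_def flip: exp_add)
 have Ec: "continuous_on D E" and Ic: "continuous_on D I"
 unfolding E_def[abs_def] I_def[abs_def] by (intro continuous_intros w; simp)+
 define T where "T = {h :: complex^'n => complex. C1 h \<and> supported D h}"
 have mc: "continuous_on UNIV (%x. of_real (c x) * dzb u h x)" "supported D (%x. of_real (c x) * dzb u h x)"
 if "h : T" "continuous_on D c" for h u c
 proof -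
 show s: "supported D (%x. of_real (c x) * dzb u h x)"
 using that by (intro supported_mult_left supported_dzb) (simp add: T_def)
 show "continuous_on UNIV (%x. of_real (c x) * dzb u h x)"
 using that by (intro local_continuous[OF D _ s] continuous_intros dzb_continuous) (simp_all add: T_def)
 qed
 \<comment> \<open>Chosen so that the real inner product of u with it is the real part of the
   closedness test of I u against h. Weak closedness thus becomes orthogonality to a family of
   elements of \<open>L2\<close>.\<close>
 define W where "W h j k x = axis k (cnj (of_real (I x) * dzb (axis j 1) h x)) - axis j (cnj (of_real (I x) * dzb (axis k 1) h x))" for h j k x
 have WL: "W h j k : L2" if h: "h : T" for h j k
 proof -
 have ax: "continuous_on UNIV (%x. axis i (cnj (of_real (I x) * dzb (axis j 1) h x)) :: complex^'n)" for i j
 proof -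
 have "(axis i (cnj (of_real (I x) * dzb (axis j 1) h x)) :: complex^'n) = cnj (of_real (I x) * dzb (axis j 1) h x) *s axis i 1" for x
 by (simp add: vec_eq_iff axis_def)
 then show ?thesis
 by (simp only:) (rule continuous_on_vector_scalar_mult[OF continuous_on_cnj[OF mc(1)[OF h Ic]] continuous_on_const])
 qed
 have "continuous_on UNIV (W h j k)" unfolding W_def[abs_def] by (intro continuous_on_diff ax)
 moreover have "supported D (W h j k)"
 proof -
 have "supported D h" using h by (simp add: T_def)
 then obtain K where "compact K" "K \<subseteq> D" "\<forall>x. x \<notin> K \<longrightarrow> h x = 0" by (auto simp: supported_def)
 then show ?thesis unfolding supported_def W_def dzb_def
 by (intro exI[of _ K]) (auto simp: compact_imp_closed dd_eq_0_outside[of K] axis_def vec_eq_iff)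
 qed
 ultimately show ?thesis by (rule supported_continuous_L2)
 qed
 have int1: "integrable lborel (%x. of_real (c x) * (u x $ k * dzb (axis j 1) h x - u x $ j * dzb (axis k 1) h x))"
 if "u : L2" "h : T" "continuous_on D c" for u :: "complex^'n => complex^'n" and h j k c
 proof -
 have "integrable lborel (%x. u x $ k * (of_real (c x) * dzb (axis j 1) h x) - u x $ j * (of_real (c x) * dzb (axis k 1) h x))"
 by (intro Bochner_Integration.integrable_diff L2_mult_continuous(3)[OF L2_vec_nth[OF that(1)] mc[OF that(2,3)]])
 then show ?thesis by (simp add: algebra_simps)
 qed
 have Wid: "u \<bullet> W h j k x = Re (of_real (I x) * (u $ k * dzb (axis j 1) h x - u $ j * dzb (axis k 1) h x))" for u h j k x
 by (simp add: W_def inner_diff_right inner_axis_complex algebra_simps)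
 define N where "N = {u : L2. \<forall>h\<in>T. \<forall>j k. L2_inner u (W h j k) = 0}"
 have inN: "u : N \<longleftrightarrow> u : L2 \<and> (\<forall>h\<in>T. \<forall>j k. (LBINT x. of_real (I x) * (u x $ k * dzb (axis j 1) h x - u x $ j * dzb (axis k 1) h x)) = 0)"
 (is "_ \<longleftrightarrow> _ \<and> (\<forall>h\<in>T. \<forall>j k. ?c u h j k = 0)") for u
 proof -
 have re: "L2_inner u (W h j k) = Re (?c u h j k)" if "u : L2" "h : T" for h j k
 unfolding L2_inner_def Wid by (rule integral_Re_complex[OF int1[OF that Ic]])
 have "?c u h j k = 0" if u: "u : L2" "\<forall>h\<in>T. \<forall>j k. L2_inner u (W h j k) = 0" and h: "h : T" for h j k
 proof (rule complex_eq_0_from_Re)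
 show "Re (?c u h j k) = 0" using re[OF u(1) h] u(2) h by simp
 \<comment> \<open>Testing with \<i> h in place of h supplies the imaginary part.\<close>
 have ih: "(%x. \<i> * h x) : T" using h by (auto simp: T_def intro: C1_cmult supported_mult_left)
 have h1: "C1 h" using h by (simp add: T_def)
 have "?c u (%x. \<i> * h x) j k = (LBINT x. \<i> * (of_real (I x) * (u x $ k * dzb (axis j 1) h x - u x $ j * dzb (axis k 1) h x)))"
 by (simp add: dzb_cmult[OF h1] algebra_simps)
 also have "... = \<i> * ?c u h j k" by simp
 finally show "Re (\<i> * ?c u h j k) = 0" using re[OF u(1) ih, of j k] u(2) ih by simp
 qed
 then show ?thesis using re unfolding N_def by auto
 qed
 \<comment> \<open>U will be the projection of f onto N. As E v lies in N, the pairing of G with v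
   is kept. As E times the \<partial>-bar derivative of any test function lies in N, the weak
   divergence is kept as well.\<close>
 define f where "f x = I x *\<^sub>R G x" for x
 have fL: "f : L2"
 proof (rule supported_continuous_L2)
 show s: "supported D f" unfolding f_def by (rule supported_mono[OF G(2)]) simp
 show "continuous_on UNIV f"
 by (rule local_continuous[OF D _ s]) (unfold f_def[abs_def], rule continuous_on_scaleR[OF Ic C1_continuous[OF G(1)]])
 qed
 have "\<exists>U s. U : L2 \<and> L2_sq U <= L2_sq f \<and> (\<forall>m\<in>N. L2_inner U m = L2_inner f m) \<and>
 (\<forall>n::nat. s n : N) \<and> (%n. L2_sq (%x. s n x - U x)) \<longlonglongrightarrow> 0"
 proof (rule L2_riesz[where l="L2_inner f" and M=N])
 show "N \<subseteq> L2" by (auto simp: N_def)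
 show "N ~= {}" using L2_zero by (auto simp: N_def L2_inner_def)
 show "(%x. u x + u' x) : N" if "u : N" "u' : N" for u u'
 using that by (auto simp: N_def L2_add L2_inner_add_left WL)
 show "(%x. c *\<^sub>R u x) : N" if "u : N" for c u
 using that by (auto simp: N_def L2_scaleR L2_inner_scaleR_left)
 show "L2_inner f (%x. u x + u' x) = L2_inner f u + L2_inner f u'" if "u : N" "u' : N" for u u'
 using that fL L2_inner_add_left[of u u' f] by (simp add: N_def L2_inner_commute[of f])
 show "L2_inner f (%x. c *\<^sub>R u x) = c * L2_inner f u" for c u
 using L2_inner_scaleR_left[of c u f] by (simp add: L2_inner_commute[of f])
 show "(L2_inner f u)\<^sup>2 <= L2_sq f * L2_sq u" if "u : N" for u
 using that fL by (intro L2_Cauchy_Schwarz) (auto simp: N_def)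
 qed (rule L2_sq_nonneg)
 then obtain U s where U: "U : L2" "!!m. m : N ==> L2_inner U m = L2_inner f m"
 and s: "!!n::nat. s n : N" "(%n. L2_sq (%x. s n x - U x)) \<longlonglongrightarrow> 0" by blast
 have UN: "U : N"
 proof -
 have "L2_inner U (W h j k) = 0" if h: "h : T" for h j k
 proof -
 have "(%n. L2_inner (s n) (W h j k)) \<longlonglongrightarrow> L2_inner U (W h j k)"
 using s U(1) WL[OF h] by (intro L2_inner_tendsto) (auto simp: N_def)
 moreover have "L2_inner (s n) (W h j k) = 0" for n using s(1)[of n] h by (simp add: N_def)
 ultimately show ?thesis by (simp add: LIMSEQ_const_iff)
 qed
 then show ?thesis using U(1) by (simp add: N_def)
 qed
 have vL: "(%x. E x *\<^sub>R v x) : L2"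
 proof (rule supported_continuous_L2)
 show s: "supported D (%x. E x *\<^sub>R v x)" by (rule supported_mono[OF v(2)]) simp
 show "continuous_on UNIV (%x. E x *\<^sub>R v x)"
 by (rule local_continuous[OF D _ s]) (intro continuous_intros Ec continuous_on_subset[OF v(1)], auto)
 qed
 have vN: "(%x. E x *\<^sub>R v x) : N"
 proof -
 have "(LBINT x. of_real (I x) * ((E x *\<^sub>R v x) $ k * dzb (axis j 1) h x - (E x *\<^sub>R v x) $ j * dzb (axis k 1) h x)) = 0"
 if "h : T" for h j k
 proof -
 have "of_real (I x) * ((E x *\<^sub>R v x) $ k * dzb (axis j 1) h x - (E x *\<^sub>R v x) $ j * dzb (axis k 1) h x)
 = v x $ k * dzb (axis j 1) h x - v x $ j * dzb (axis k 1) h x" for x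
 proof -
 have "of_real (I x) * ((E x *\<^sub>R v x) $ k * dzb (axis j 1) h x - (E x *\<^sub>R v x) $ j * dzb (axis k 1) h x)
 = of_real (E x * I x) * (v x $ k * dzb (axis j 1) h x - v x $ j * dzb (axis k 1) h x)"
 by (simp add: scaleR_vec_nth algebra_simps del: vector_scaleR_component)
 then show ?thesis by (simp add: EI)
 qed
 then show ?thesis using closed[of h k j] that by (simp add: T_def)
 qed
 then show ?thesis using vL inN by blast
 qed
 have vG: "(LBINT x. v x \<bullet> G x) = L2_inner U (%x. E x *\<^sub>R v x)"
 proof -
 have "L2_inner U (%x. E x *\<^sub>R v x) = L2_inner f (%x. E x *\<^sub>R v x)" by (rule U(2)[OF vN])
 also have "... = (LBINT x. v x \<bullet> G x)"
 unfolding L2_inner_def f_def using EI by (simp add: inner_commute mult.commute mult.left_commute flip: mult.assoc)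
 finally show ?thesis by simp
 qed
 \<comment> \<open>The \<partial>-bar derivative of a function is closed; for test functions this is
   the weak symmetry of conjugate derivatives.\<close>
 have dN: "(%x. \<chi> j. of_real (E x) * dzb (axis j 1) h x) : N" (is "?d h : N") if h: "h : T" for h
 proof -
 have L: "?d h : L2"
 proof (rule supported_continuous_L2)
 show "continuous_on UNIV (?d h)" by (intro continuous_on_vec_lambda mc[OF h Ec])
 have "supported D h" using h by (simp add: T_def)
 then obtain K where "compact K" "K \<subseteq> D" "\<forall>x. x \<notin> K \<longrightarrow> h x = 0" by (auto simp: supported_def)
 then show "supported D (?d h)" unfolding supported_def dzb_def
 by (intro exI[of _ K]) (auto simp: compact_imp_closed dd_eq_0_outside[of K] vec_eq_iff)
 qed
 have "(LBINT x. of_real (I x) * (?d h x $ k * dzb (axis j 1) h' x - ?d h x $ j * dzb (axis k 1) h' x)) = 0"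
 if h': "h' : T" for h' j k
 proof -
 have hh: "C1 h" "supported D h" "C1 h'" "supported D h'" using h h' by (auto simp: T_def)
 have "of_real (I x) * (?d h x $ k * dzb (axis j 1) h' x - ?d h x $ j * dzb (axis k 1) h' x)
 = dzb (axis k 1) h x * dzb (axis j 1) h' x - dzb (axis j 1) h x * dzb (axis k 1) h' x" for x
 proof -
 have "of_real (I x) * (?d h x $ k * dzb (axis j 1) h' x - ?d h x $ j * dzb (axis k 1) h' x)
 = of_real (E x * I x) * (dzb (axis k 1) h x * dzb (axis j 1) h' x - dzb (axis j 1) h x * dzb (axis k 1) h' x)"
 by (simp add: algebra_simps)
 then show ?thesis by (simp add: EI)
 qed
 moreover have i: "integrable lborel (%x. dzb p h x * dzb q h' x)" for p q
 by (rule supported_integrable[OF continuous_on_mult[OF dzb_continuous[OF hh(1)] dzb_continuous[OF hh(3)]] supported_mult_right[OF supported_dzb[OF hh(2)]]])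
 ultimately show ?thesis
 using integral_dzb_dzb_commute[OF hh(1,3,4), of "axis k 1" "axis j 1"] by (simp add: Bochner_Integration.integral_diff[OF i i])
 qed
 then show ?thesis using L inN by blast
 qed
 have div: "(LBINT x. (\<Sum>j\<in>UNIV. of_real (E x) * U x $ j * dz (axis j 1) h x))
 = - (LBINT x. (\<Sum>j\<in>UNIV. dz (axis j 1) (%x. G x $ j) x) * h x)" if h: "C1 h" "supported D h" for h
 proof -
 define g where "g x = cnj (h x)" for x
 have g: "g : T" unfolding T_def g_def using h by (auto intro: C1_cnj supported_mono)
 have hg: "dz u h x = cnj (dzb u g x)" for u x
 unfolding g_def[abs_def] by (simp add: dzb_cnj[OF h(1)])
 define S where "S u h = (LBINT x. (\<Sum>j\<in>UNIV. u x $ j * cnj (of_real (E x) * dzb (axis j 1) h x)))" for u :: "complex^'n => complex^'n" and h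
 have Si: "integrable lborel (%x. \<Sum>j\<in>UNIV. u x $ j * cnj (of_real (E x) * dzb (axis j 1) h x))" if "u : L2" "h : T" for u :: "complex^'n => complex^'n" and h
 proof (intro Bochner_Integration.integrable_sum L2_mult_continuous(3)[OF L2_vec_nth[OF that(1)]])
 fix j
 show "continuous_on UNIV (%x. cnj (of_real (E x) * dzb (axis j 1) h x))"
 by (intro continuous_intros mc(1)[OF that(2) Ec])
 show "supported D (%x. cnj (of_real (E x) * dzb (axis j 1) h x))"
 by (rule supported_mono[OF mc(2)[OF that(2) Ec]]) simp
 qed
 have SR: "L2_inner u (%x. \<chi> j. of_real (E x) * dzb (axis j 1) h x) = Re (S u h)" if "u : L2" "h : T" for u h
 unfolding L2_inner_def S_def inner_vec_complex by (simp only: vec_lambda_beta) (rule integral_Re_complex[OF Si[OF that]])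
 have eq: "Re (S U h) = Re (S f h)" if "h : T" for h
 using U(2)[OF dN[OF that]] SR[OF U(1) that] SR[OF fL that] by simp
 have ig: "(%x. \<i> * g x) : T" using g by (auto simp: T_def intro: C1_cmult supported_mult_left)
 have "S u (%x. \<i> * g x) = - \<i> * S u g" for u
 proof -
 have g1: "C1 g" using g by (simp add: T_def)
 have "S u (%x. \<i> * g x) = (LBINT x. - \<i> * (\<Sum>j\<in>UNIV. u x $ j * cnj (of_real (E x) * dzb (axis j 1) g x)))"
 unfolding S_def by (simp add: dzb_cmult[OF g1] sum_distrib_left algebra_simps)
 then show ?thesis unfolding S_def by simp
 qed
 then have "Im (S U g) = Im (S f g)" using eq[OF ig] by simp
 then have SS: "S U g = S f g" using eq[OF g] by (simp add: complex_eq_iff)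
 have "(LBINT x. (\<Sum>j\<in>UNIV. of_real (E x) * U x $ j * dz (axis j 1) h x)) = S U g"
 unfolding S_def hg by (simp add: algebra_simps)
 also have "... = S f g" by (rule SS)
 also have "... = (LBINT x. (\<Sum>j\<in>UNIV. G x $ j * dz (axis j 1) h x))"
 proof -
 have "f x $ j * cnj (of_real (E x) * dzb (axis j 1) g x) = G x $ j * dz (axis j 1) h x" for x j
 proof -
 have "f x $ j * cnj (of_real (E x) * dzb (axis j 1) g x) = of_real (E x * I x) * (G x $ j * dz (axis j 1) h x)"
 unfolding f_def hg by (simp add: scaleR_vec_nth algebra_simps del: vector_scaleR_component)
 then show ?thesis by (simp add: EI)
 qed
 then show ?thesis unfolding S_def by (simp only:)
 qed
 also have "... = (\<Sum>j\<in>UNIV. LBINT x. G x $ j * dz (axis j 1) h x)"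
 proof (rule Bochner_Integration.integral_sum)
 show "integrable lborel (%x. G x $ j * dz (axis j 1) h x)" for j
 by (rule supported_integrable[OF continuous_on_mult[OF C1_continuous dz_continuous[OF h(1)]] supported_mult_left[OF supported_dz[OF h(2)]]])
 (rule C1_bounded_linear[OF bounded_linear_vec_nth G(1)])
 qed
 also have "... = (\<Sum>j\<in>UNIV. - (LBINT x. dz (axis j 1) (%x. G x $ j) x * h x))"
 by (intro sum.cong refl integral_dz_by_parts[OF _ h] C1_bounded_linear[OF bounded_linear_vec_nth G(1)])
 also have "... = - (LBINT x. (\<Sum>j\<in>UNIV. dz (axis j 1) (%x. G x $ j) x * h x))"
 proof -
 have "integrable lborel (%x. dz (axis j 1) (%x. G x $ j) x * h x)" for j
 by (rule supported_integrable[OF continuous_on_mult[OF dz_continuous C1_continuous[OF h(1)]] supported_mult_left[OF h(2)]])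
 (rule C1_bounded_linear[OF bounded_linear_vec_nth G(1)])
 then show ?thesis by (simp add: Bochner_Integration.integral_sum sum_negf)
 qed
 finally show ?thesis by (simp add: sum_distrib_right)
 qed
 have "\<forall>h j k. C1 h \<longrightarrow> supported D h \<longrightarrow>
 (LBINT x. of_real (I x) * (U x $ k * dzb (axis j 1) h x - U x $ j * dzb (axis k 1) h x)) = 0"
 using UN inN[of U] by (simp add: T_def)
 then show ?thesis using U(1) vG div unfolding E_def I_def by blast
qed

section \<open>The estimate for a form that is cut off\<close>

lemma C1_extend:
 fixes q :: "'a::real_normed_vector => complex"
 assumes D: "open D" and q: "C1_on D q q1" and K: "compact K" "K \<subseteq> D" "!!x. x : D ==> x \<notin> K ==> q x = 0"
 shows "C1 (%x. if x : D then q x else 0)" "supported D (%x. if x : D then q x else 0)"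
 "x : D ==> dd (%x. if x : D then q x else 0) v x = q1 x v"
proof -
 let ?Q = "%x. if x : D then q x else 0"
 have inD: "(?Q has_derivative q1 x) (at x)" if x: "x : D" for x
 by (rule has_derivative_transform_within_open[OF _ D x]) (use q x in \<open>auto simp: C1_on_def\<close>)
 show s: "supported D ?Q" unfolding supported_def using K by (intro exI[of _ K]) auto
 show dq: "x : D ==> dd ?Q v x = q1 x v" for x v by (rule dd_eqI[OF inD])
 have out: "(?Q has_derivative (%_. 0)) (at x)" if x: "x \<notin> K" for x
 proof (rule has_derivative_transform_within_open[of "%_. 0" _ x UNIV "- K"])
 show "open (- K)" using K(1) compact_imp_closed by auto
 qed (use x K in auto)
 have der: "(?Q has_derivative (%v. dd ?Q v x)) (at x)" for x
 proof (cases "x : D")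
 case True
 then have "(%v. dd ?Q v x) = q1 x" by (intro ext dq)
 then show ?thesis using inD[OF True] by simp
 next
 case False
 then have "x \<notin> K" using K by blast
 then have "(%v. dd ?Q v x) = (%_. 0)" by (intro ext dd_eqI[OF out])
 then show ?thesis using out[OF \<open>x \<notin> K\<close>] by simp
 qed
 show "C1 ?Q"
 proof (rule C1I[OF der])
 fix v
 have "continuous_on D (%x. q1 x v)" using q by (simp add: C1_on_def)
 then have "continuous_on D (%x. dd ?Q v x)" by (rule continuous_on_eq) (simp add: dq)
 then show "continuous_on UNIV (%x. dd ?Q v x)"
 by (rule local_continuous[OF D]) (rule supported_dd[OF s])
 qed
qed

lemma wz_expansion:
 fixes t :: "complex^'n"
 assumes l: "linear (q1 x)"
 shows "(\<Sum>j\<in>UNIV. wz q1 (axis j 1) x * t $ j) = wz q1 t x"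
proof -
 have add: "wz q1 (u + v) x = wz q1 u x + wz q1 v x" for u v
 using linear_add[OF l] by (simp add: wz_def vec.scale_right_distrib field_simps)
 have sc: "wz q1 (c *s v) x = c * wz q1 v x" for c v
 proof -
 have 1: "q1 x (c *s v) = Re c * q1 x v + Im c * q1 x (\<i> *s v)"
 unfolding complex_scale_decomp[of c v] using linear_add[OF l] linear_scale[OF l] by simp
 have "\<i> *s (c *s v) = (-Im c) *\<^sub>R v + Re c *\<^sub>R (\<i> *s v)" by (simp add: vec_eq_iff complex_eq_iff)
 then have 2: "q1 x (\<i> *s (c *s v)) = - Im c * q1 x v + Re c * q1 x (\<i> *s v)"
 using linear_add[OF l] linear_scale[OF l] by (simp only:) simp
 show ?thesis unfolding wz_def 1 2 by (simp add: complex_eq_iff field_simps)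
 qed
 have z: "wz q1 0 x = 0" using add[of 0 0] by simp
 have sm: "wz q1 (\<Sum>j\<in>I. f j) x = (\<Sum>j\<in>I. wz q1 (f j) x)" for I :: "'n set" and f
 by (induction I rule: infinite_finite_induct) (simp_all add: z add)
 have "wz q1 t x = wz q1 (\<Sum>j\<in>UNIV. t $ j *s axis j 1) x" using vec_expansion[of t] by simp
 also have "... = (\<Sum>j\<in>UNIV. wz q1 (axis j 1) x * t $ j)" unfolding sm sc by (simp add: mult.commute)
 finally show ?thesis by simp
qed

lemma cmod_wz_sq: "(cmod (wz q1 t x))\<^sup>2 = ((q1 x t)\<^sup>2 + (q1 x (\<i> *s t))\<^sup>2) / 4"
 unfolding wz_def cmod_power2 by (simp add: power2_eq_square field_simps)

lemma norm_sum3_sq: "(norm (a + b + c :: 'b::real_inner))\<^sup>2 <= 3 * ((norm a)\<^sup>2 + (norm b)\<^sup>2 + (norm c)\<^sup>2)"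
proof -
 have "0 <= (norm (a - b))\<^sup>2 + (norm (b - c))\<^sup>2 + (norm (a - c))\<^sup>2" by simp
 then show ?thesis
 by (simp add: power2_norm_eq_inner inner_add_left inner_add_right inner_diff_left inner_diff_right inner_commute)
qed

lemma L2_sq_add3_le:
 assumes "f : L2" "g : L2" "h : L2"
 shows "L2_sq (%x. f x + g x + h x) <= 3 * (L2_sq f + L2_sq g + L2_sq h)"
proof -
 have "L2_sq (%x. f x + g x + h x) <= (LBINT x. 3 * ((norm (f x))\<^sup>2 + (norm (g x))\<^sup>2 + (norm (h x))\<^sup>2))"
 unfolding L2_sq_def
 by (rule integral_mono) (intro L2_integrable L2_add assms norm_sum3_sq integrable_mult_right Bochner_Integration.integrable_add)+
 also have "... = 3 * (L2_sq f + L2_sq g + L2_sq h)"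
 unfolding L2_sq_def using assms by (simp add: L2_integrable)
 finally show ?thesis .
qed

lemma cmod_sum_sq_le: "(cmod (\<Sum>j\<in>UNIV. a j * (u::complex^'n) $ j))\<^sup>2 <= (\<Sum>j\<in>UNIV. (cmod (a j))\<^sup>2) * (norm u)\<^sup>2"
proof -
 have "cmod (\<Sum>j\<in>UNIV. a j * u $ j) <= (\<Sum>j\<in>UNIV. cmod (a j) * cmod (u $ j))"
 by (rule order_trans[OF norm_sum]) (simp add: norm_mult)
 then have "(cmod (\<Sum>j\<in>UNIV. a j * u $ j))\<^sup>2 <= (\<Sum>j\<in>UNIV. cmod (a j) * cmod (u $ j))\<^sup>2"
 by (rule power_mono) simp
 also have "... <= (\<Sum>j\<in>UNIV. (cmod (a j))\<^sup>2) * (\<Sum>j\<in>UNIV. (cmod (u $ j))\<^sup>2)"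
 by (rule Cauchy_Schwarz_ineq_sum)
 also have "(\<Sum>j\<in>UNIV. (cmod (u $ j))\<^sup>2) = (norm u)\<^sup>2"
 by (simp add: norm_vec_def L2_set_def sum_nonneg)
 finally show ?thesis .
qed

lemma sum_wedge_sq_le:
 "(\<Sum>j\<in>UNIV. \<Sum>k\<in>UNIV. (cmod (a j * (u::complex^'n) $ k - a k * u $ j))\<^sup>2) <= 4 * ((\<Sum>j\<in>UNIV. (cmod (a j))\<^sup>2) * (norm u)\<^sup>2)"
proof -
 have n: "(norm u)\<^sup>2 = (\<Sum>j\<in>UNIV. (cmod (u $ j))\<^sup>2)" by (simp add: norm_vec_def L2_set_def sum_nonneg)
 have "(cmod (p - q))\<^sup>2 <= 2 * (cmod p)\<^sup>2 + 2 * (cmod q)\<^sup>2" for p q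
 proof -
 have "0 <= (cmod (p + q))\<^sup>2" by simp
 then show ?thesis unfolding cmod_power2 by (simp add: power2_eq_square algebra_simps)
 qed
 then have "(\<Sum>j\<in>UNIV. \<Sum>k\<in>UNIV. (cmod (a j * u $ k - a k * u $ j))\<^sup>2) <= (\<Sum>j\<in>UNIV. \<Sum>k\<in>UNIV. 2 * (cmod (a j * u $ k))\<^sup>2 + 2 * (cmod (a k * u $ j))\<^sup>2)"
 by (intro sum_mono)
 also have "... = 2 * (\<Sum>j\<in>UNIV. \<Sum>k\<in>UNIV. (cmod (a j))\<^sup>2 * (cmod (u $ k))\<^sup>2) + 2 * (\<Sum>j\<in>UNIV. \<Sum>k\<in>UNIV. (cmod (a k))\<^sup>2 * (cmod (u $ j))\<^sup>2)"
 by (simp add: sum.distrib sum_distrib_left norm_mult power_mult_distrib)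
 also have "(\<Sum>j\<in>UNIV. \<Sum>k\<in>UNIV. (cmod (a k))\<^sup>2 * (cmod (u $ j))\<^sup>2) = (\<Sum>j\<in>UNIV. \<Sum>k\<in>UNIV. (cmod (a j))\<^sup>2 * (cmod (u $ k))\<^sup>2)"
 by (rule sum.swap)
 also have "(\<Sum>j\<in>UNIV. \<Sum>k\<in>UNIV. (cmod (a j))\<^sup>2 * (cmod (u $ k))\<^sup>2) = (\<Sum>j\<in>UNIV. (cmod (a j))\<^sup>2) * (norm u)\<^sup>2"
 by (simp add: n sum_product)
 finally show ?thesis by (simp add: mult.commute)
qed

lemma eq_minus_add_if: "a + b = - y ==> a = - (y + (b::'a::ab_group_add))"
 by (metis add_diff_cancel minus_add_distrib diff_conv_add_uminus)

text \<open>The weak inequality with weight f is applied to g = chi exp (w / 2) U, w = f - p, for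
  which exp (- f / 2) |g| = |chi| exp (- p / 2) |U|. The weighted divergence of g splits into the
  data P, a term B from the gradient of chi and a term C from the gradient of p. By |a + b + c|^2 <=
  3 (|a|^2 + |b|^2 + |c|^2) the last costs 3 |C|^2, which is what \<open>lower\<close> provides on
  the left. B accounts for 3 times the integral over A and the exterior derivative for 4 / 2 times
  it, whence the factor 5.\<close>

lemma cutoff_estimate:
 fixes U :: "complex^'n => complex^'n" and s chi :: "complex^'n => complex"
 assumes D: "open D" and f: "C2_on D f f1 f2" and p: "C2_on D p p1 p2"
 and lower: "!!x t. x : D ==> (norm t)\<^sup>2 + 3 * (cmod (\<Sum>j\<in>UNIV. wz p1 (axis j 1) x * t $ j))\<^sup>2 <= lev f2 x t"
 and chi: "C1 chi" and K: "compact K" "K \<subseteq> D" "!!x. x \<notin> K ==> chi x = 0"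
 and U: "U : L2" and s: "continuous_on UNIV s" "supported D s"
 and div: "!!h. C1 h ==> supported D h ==>
 (LBINT x. (\<Sum>j\<in>UNIV. of_real (exp (- (f x - p x) / 2)) * U x $ j * dz (axis j 1) h x)) = - (LBINT x. s x * h x)"
 and curl: "!!h j k. C1 h ==> supported D h ==>
 (LBINT x. of_real (exp ((f x - p x) / 2)) * (U x $ k * dzb (axis j 1) h x - U x $ j * dzb (axis k 1) h x)) = 0"
 and A: "A : sets borel"
 and bd: "!!x. x : D ==> (\<Sum>j\<in>UNIV. (cmod (dz (axis j 1) chi x))\<^sup>2) <= exp (p x) * indicator A x"
 "!!x. x : D ==> (\<Sum>j\<in>UNIV. (cmod (dzb (axis j 1) chi x))\<^sup>2) <= exp (p x) * indicator A x"
 shows "L2_sq (%x. (cmod (chi x) * exp (- p x / 2)) *\<^sub>R U x)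
 <= 3 * L2_sq (%x. chi x * of_real (exp (f x / 2 - p x)) * s x) + 5 * (LBINT x. indicator A x * (norm (U x))\<^sup>2)"
proof -
 define w where "w x = f x - p x" for x
 define I where "I x = complex_of_real (exp (w x / 2))" for x
 have fc: "continuous_on D f" and pc: "continuous_on D p" by (rule C2_on_continuous(1)[OF f], rule C2_on_continuous(1)[OF p])
 have wc: "continuous_on D w" unfolding w_def by (intro continuous_intros fc pc)
 have Ic: "continuous_on D I" unfolding I_def by (intro continuous_intros wc) auto
 have chis: "supported D chi" unfolding supported_def using K by blast
 have wzfc: "continuous_on D (wz f1 v)" and wzpc: "continuous_on D (wz p1 v)" for v
 by (rule C1_on_continuous[OF C1_on_wz[OF f]], rule C1_on_continuous[OF C1_on_wz[OF p]])
 have dchi0: "dz v chi x = 0" "dzb v chi x = 0" if "x \<notin> K" for v x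
 using dd_eq_0_outside[of K chi x] K that by (auto simp: dz_def dzb_def compact_imp_closed)
 have locK: "continuous_on UNIV m" "supported D m" if "continuous_on D m" "!!x. x \<notin> K ==> m x = 0" for m :: "complex^'n => complex"
 proof -
 show m: "supported D m" unfolding supported_def using K that by blast
 show "continuous_on UNIV m" by (rule local_continuous[OF D that(1) m])
 qed
 have Um: "(%x. m x * U x $ j) : L2" "integrable lborel (%x. m x * U x $ j)"
 if "continuous_on D m" "!!x. x \<notin> K ==> m x = 0" for m j
 using L2_mult_continuous(1,2)[OF L2_vec_nth[OF U, of j] locK[of m, OF that]] by auto
 define g where "g x = (\<chi> j. chi x * I x * U x $ j)" for x
 have chiI: "continuous_on D (%x. chi x * I x)" by (intro continuous_intros C1_continuous[OF chi] Ic)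
 define S0 where "S0 x = chi x * of_real (exp (w x)) * s x" for x
 define Aj where "Aj j x = (dz (axis j 1) chi x + chi x * (wz f1 (axis j 1) x - wz p1 (axis j 1) x)) * I x" for j x
 have Ajc: "continuous_on D (Aj j)" for j unfolding Aj_def[abs_def]
 by (intro continuous_intros C1_continuous[OF chi] dz_continuous[OF chi] Ic wzfc wzpc)
 have Aj0: "Aj j x = 0" if "x \<notin> K" for j x using that K(3) dchi0 by (simp add: Aj_def)
 define sg where "sg x = S0 x + (\<Sum>j\<in>UNIV. Aj j x * U x $ j)" for x
 define b where "b j k x = (dzb (axis j 1) chi x * U x $ k - dzb (axis k 1) chi x * U x $ j) * I x" for j k x
 have S0c: "continuous_on D S0" unfolding S0_def[abs_def]
 by (intro continuous_intros C1_continuous[OF chi] continuous_on_subset[OF s(1)] wc) auto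
 have S00: "S0 x = 0" if "x \<notin> K" for x using that K(3) by (simp add: S0_def)
 have S0L: "S0 : L2" by (rule supported_continuous_L2[OF locK[OF S0c S00]])
 have sumL: "(%x. \<Sum>j\<in>J. F j x) : L2" if "!!j. F j : L2" for F :: "'n => complex^'n => complex" and J
 by (induction J rule: infinite_finite_induct) (auto intro: L2_add L2_zero that)
 have gL: "g : L2"
 proof -
 have gj: "(%x. chi x * I x * U x $ j) : L2" for j by (rule Um(1)[OF chiI]) (simp add: K(3))
 have "(%x. (norm (g x))\<^sup>2) = (%x. \<Sum>j\<in>UNIV. (cmod (chi x * I x * U x $ j))\<^sup>2)"
 by (simp add: g_def norm_vec_def L2_set_def sum_nonneg)
 moreover have "g : borel_measurable borel"
 unfolding borel_measurable_euclidean_space[of g]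
 proof
 fix i :: "complex^'n" assume "i : Basis"
 then obtain j c where i: "i = axis j c" by (auto simp: Basis_vec_def)
 have [measurable]: "(%x. chi x * I x * U x $ j) : borel_measurable borel" by (rule L2_measurable[OF gj])
 show "(%x. g x \<bullet> i) : borel_measurable borel" unfolding i inner_axis g_def vec_lambda_beta by measurable
 qed
 ultimately show ?thesis unfolding L2_def using gj by (simp add: L2_def)
 qed
 have g0: "g x = 0" if "x \<notin> K" for x using K(3)[OF that] by (simp add: g_def vec_eq_iff)
 have sgL: "sg : L2" unfolding sg_def[abs_def] by (intro L2_add S0L sumL Um(1) Ajc Aj0)
 have sg0: "sg x = 0" if "x \<notin> K" for x using S00[OF that] Aj0[OF that] by (simp add: sg_def)
 have bL: "b j k : L2" for j k
 proof -
 have d: "(%x. (dzb (axis i 1) chi x * I x) * U x $ l) : L2" for i l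
 by (rule Um(1)) (auto intro!: continuous_intros dzb_continuous[OF chi] Ic simp: dchi0)
 have "(%x. (dzb (axis j 1) chi x * I x) * U x $ k - (dzb (axis k 1) chi x * I x) * U x $ j) : L2" by (rule L2_diff[OF d d])
 then show ?thesis by (simp add: b_def[abs_def] algebra_simps)
 qed
 have b0: "b j k x = 0" if "x \<notin> K" for j k x using dchi0[OF that] by (simp add: b_def)
 have divg: "(LBINT x. (\<Sum>j\<in>UNIV. g x $ j * dz (axis j 1) h x)) = - (LBINT x. sg x * h x)" if h: "C1 h" for h
 proof -
 have ch: "C1 (%x. chi x * h x)" "supported D (%x. chi x * h x)"
 by (rule C1_mult[OF chi h], rule supported_mult_right[OF chis])
 have nw: "C1_on D (%x. - w x) (%x v. - (f1 x v - p1 x v))"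
 using C2_on_C1_on[OF f] C2_on_C1_on[OF p] unfolding C1_on_def w_def
 by (auto intro!: has_derivative_minus has_derivative_diff continuous_intros)
 note ew = C1_on_exp[OF nw, simplified]
 \<comment> \<open>The test function for the equation of U: the factor exp (w) turns the exp (- w /
   2) of that equation into the exp (w / 2) contained in g.\<close>
 define a where "a x = complex_of_real (exp (w x)) * (chi x * h x)" for x
 have a: "C1 a" "supported D a" "dd a v x = of_real (exp (w x)) * dd (%x. chi x * h x) v x + of_real (exp (w x) * (f1 x v - p1 x v)) * (chi x * h x)" for v x
 unfolding a_def[abs_def] using C1_local_mult[OF D ew ch] by (auto simp: algebra_simps)
 have dza: "dz (axis j 1) a x = of_real (exp (w x)) * (chi x * dz (axis j 1) h x + h x * dz (axis j 1) chi x)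
 + of_real (exp (w x)) * (wz f1 (axis j 1) x - wz p1 (axis j 1) x) * chi x * h x" for j x
 proof -
 have "dz (axis j 1) a x = of_real (exp (w x)) * dz (axis j 1) (%x. chi x * h x) x
 + of_real (exp (w x)) * (wz f1 (axis j 1) x - wz p1 (axis j 1) x) * (chi x * h x)"
 unfolding dz_def a(3) wz_def by (simp add: field_simps)
 then show ?thesis by (simp add: dz_mult[OF chi h] algebra_simps)
 qed
 have EI: "of_real (exp (- w x / 2)) * of_real (exp (w x)) = I x" for x
 unfolding I_def of_real_mult[symmetric] by (simp flip: exp_add)
 have pt: "of_real (exp (- w x / 2)) * U x $ j * dz (axis j 1) a x = g x $ j * dz (axis j 1) h x + Aj j x * U x $ j * h x" for j x
 proof -
 have "of_real (exp (- w x / 2)) * U x $ j * dz (axis j 1) a x = (of_real (exp (- w x / 2)) * of_real (exp (w x))) * U x $ j *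
 ((chi x * dz (axis j 1) h x + h x * dz (axis j 1) chi x) + (wz f1 (axis j 1) x - wz p1 (axis j 1) x) * chi x * h x)"
 unfolding dza by (simp add: algebra_simps)
 then show ?thesis unfolding EI by (simp add: g_def Aj_def algebra_simps)
 qed
 have i1: "integrable lborel (%x. g x $ j * dz (axis j 1) h x)" for j
 proof -
 have "integrable lborel (%x. (chi x * I x * dz (axis j 1) h x) * U x $ j)"
 by (rule Um(2)) (auto intro!: continuous_on_mult chiI dz_continuous[OF h] simp: K(3))
 then show ?thesis by (simp add: g_def algebra_simps)
 qed
 have i2: "integrable lborel (%x. Aj j x * U x $ j * h x)" for j
 proof -
 have "integrable lborel (%x. (Aj j x * h x) * U x $ j)"
 by (rule Um(2)) (auto intro!: continuous_on_mult Ajc C1_continuous[OF h] simp: Aj0)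
 then show ?thesis by (simp add: algebra_simps)
 qed
 have i3: "integrable lborel (%x. S0 x * h x)"
 by (rule supported_integrable[OF continuous_on_mult[OF locK(1)[OF S0c S00] C1_continuous[OF h]] supported_mult_right[OF locK(2)[OF S0c S00]]])
 have "(LBINT x. (\<Sum>j\<in>UNIV. g x $ j * dz (axis j 1) h x)) + (LBINT x. (\<Sum>j\<in>UNIV. Aj j x * U x $ j * h x))
 = (LBINT x. (\<Sum>j\<in>UNIV. g x $ j * dz (axis j 1) h x) + (\<Sum>j\<in>UNIV. Aj j x * U x $ j * h x))"
 by (rule Bochner_Integration.integral_add[symmetric]) (intro Bochner_Integration.integrable_sum i1 i2)+
 also have "... = (LBINT x. (\<Sum>j\<in>UNIV. of_real (exp (- w x / 2)) * U x $ j * dz (axis j 1) a x))"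
 unfolding pt sum.distrib ..
 also have "... = - (LBINT x. s x * a x)" unfolding w_def by (rule div[OF a(1,2)])
 also have "(%x. s x * a x) = (%x. S0 x * h x)" by (simp add: a_def S0_def fun_eq_iff algebra_simps)
 finally have "(LBINT x. (\<Sum>j\<in>UNIV. g x $ j * dz (axis j 1) h x)) = - ((LBINT x. S0 x * h x) + (LBINT x. (\<Sum>j\<in>UNIV. Aj j x * U x $ j * h x)))"
 by (rule eq_minus_add_if)
 also have "(LBINT x. S0 x * h x) + (LBINT x. (\<Sum>j\<in>UNIV. Aj j x * U x $ j * h x))
 = (LBINT x. S0 x * h x + (\<Sum>j\<in>UNIV. Aj j x * U x $ j * h x))"
 by (rule Bochner_Integration.integral_add[symmetric]) (intro i3 Bochner_Integration.integrable_sum i2)+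
 also have "(%x. S0 x * h x + (\<Sum>j\<in>UNIV. Aj j x * U x $ j * h x)) = (%x. sg x * h x)"
 by (simp add: sg_def fun_eq_iff distrib_right sum_distrib_right)
 finally show ?thesis .
 qed
 have curlg: "(LBINT x. g x $ k * dzb (axis j 1) h x - g x $ j * dzb (axis k 1) h x) = - (LBINT x. b j k x * h x)"
 if h: "C1 h" for h j k
 proof -
 define a where "a x = chi x * h x" for x
 have a: "C1 a" "supported D a" unfolding a_def[abs_def]
 by (rule C1_mult[OF chi h], rule supported_mult_right[OF chis])
 have dzba: "dzb v a x = chi x * dzb v h x + dzb v chi x * h x" for v x
 unfolding a_def[abs_def] by (rule dzb_mult[OF chi h])
 have pt: "of_real (exp (w x / 2)) * (U x $ k * dzb (axis j 1) a x - U x $ j * dzb (axis k 1) a x)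
 = (g x $ k * dzb (axis j 1) h x - g x $ j * dzb (axis k 1) h x) + b j k x * h x" for x
 by (simp add: dzba g_def b_def I_def algebra_simps)
 have i1: "integrable lborel (%x. g x $ l * dzb (axis i 1) h x)" for i l
 proof -
 have "integrable lborel (%x. (chi x * I x * dzb (axis i 1) h x) * U x $ l)"
 by (rule Um(2)) (auto intro!: continuous_on_mult chiI dzb_continuous[OF h] simp: K(3))
 then show ?thesis by (simp add: g_def algebra_simps)
 qed
 have i2: "integrable lborel (%x. b j k x * h x)"
 proof -
 have d: "integrable lborel (%x. (dzb (axis i 1) chi x * I x * h x) * U x $ l)" for i l
 by (rule Um(2)) (auto intro!: continuous_intros dzb_continuous[OF chi] Ic C1_continuous[OF h] simp: dchi0)
 show ?thesis using Bochner_Integration.integrable_diff[OF d d, of j k k j] by (simp add: b_def algebra_simps)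
 qed
 have "(LBINT x. g x $ k * dzb (axis j 1) h x - g x $ j * dzb (axis k 1) h x) + (LBINT x. b j k x * h x)
 = (LBINT x. (g x $ k * dzb (axis j 1) h x - g x $ j * dzb (axis k 1) h x) + b j k x * h x)"
 by (rule Bochner_Integration.integral_add[symmetric]) (intro Bochner_Integration.integrable_diff i1 i2)+
 also have "... = 0" unfolding pt[symmetric] w_def by (rule curl[OF a])
 finally show ?thesis by (simp add: eq_neg_iff_add_eq_0)
 qed
 have main: "L2_sq (%x. (indicator K x * exp (- f x / 2)) *\<^sub>R g x)
 + 3 * L2_sq (%x. (indicator K x * exp (- f x / 2)) *\<^sub>R (\<Sum>j\<in>UNIV. wz p1 (axis j 1) x * g x $ j))
 <= L2_sq (%x. (indicator K x * exp (- f x / 2)) *\<^sub>R (sg x - (\<Sum>j\<in>UNIV. wz f1 (axis j 1) x * g x $ j)))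
 + (\<Sum>j\<in>UNIV. \<Sum>k\<in>UNIV. L2_sq (%x. (indicator K x * exp (- f x / 2)) *\<^sub>R b j k x)) / 2"
 by (rule morrey_kohn_hormander_weak[OF D f K(1,2) gL g0 sgL sg0 bL b0 divg curlg wzpc lower])
 define m where "m x = indicator K x * exp (- f x / 2)" for x
 define P where "P x = chi x * of_real (exp (f x / 2 - p x)) * s x" for x
 define B where "B x = (\<Sum>j\<in>UNIV. (dz (axis j 1) chi x * of_real (exp (- p x / 2))) * U x $ j)" for x
 define C where "C x = m x *\<^sub>R (\<Sum>j\<in>UNIV. wz p1 (axis j 1) x * g x $ j)" for x
 have ee: "exp (- f x / 2) * exp (w x) = exp (f x / 2 - p x)" "exp (- f x / 2) * exp (w x / 2) = exp (- p x / 2)" for x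
 by (simp_all add: w_def field_simps flip: exp_add)
 \<comment> \<open>Subtracting the derivative of f cancels its contribution to \<open>Aj\<close>;
   the gradients of chi and of p remain.\<close>
 have decomp: "m x *\<^sub>R (sg x - (\<Sum>j\<in>UNIV. wz f1 (axis j 1) x * g x $ j)) = P x + B x + (- 1) *\<^sub>R C x" for x
 proof (cases "x : K")
 case True
 have "sg x - (\<Sum>j\<in>UNIV. wz f1 (axis j 1) x * g x $ j) = S0 x + (\<Sum>j\<in>UNIV. dz (axis j 1) chi x * I x * U x $ j) - (\<Sum>j\<in>UNIV. wz p1 (axis j 1) x * g x $ j)"
 by (simp add: sg_def Aj_def g_def sum_subtractf[symmetric] sum.distrib[symmetric] algebra_simps)
 moreover have "exp (- f x / 2) *\<^sub>R S0 x = P x"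
 unfolding S0_def P_def scaleR_conv_of_real ee(1)[symmetric] of_real_mult by (simp add: algebra_simps)
 moreover have "exp (- f x / 2) *\<^sub>R (\<Sum>j\<in>UNIV. dz (axis j 1) chi x * I x * U x $ j) = B x"
 unfolding B_def I_def scaleR_conv_of_real ee(2)[symmetric] of_real_mult sum_distrib_left by (simp add: algebra_simps)
 ultimately show ?thesis using True by (simp add: m_def C_def scaleR_add_right scaleR_diff_right)
 next
 case False
 then show ?thesis by (simp add: m_def P_def B_def C_def K(3) dchi0)
 qed
 have PL: "P : L2"
 proof (rule supported_continuous_L2[OF locK, of P])
 have "continuous_on D P" unfolding P_def[abs_def]
 by (intro continuous_intros C1_continuous[OF chi] continuous_on_subset[OF s(1)] fc pc) auto
 then show "continuous_on D P" "continuous_on D P" by auto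
 qed (simp_all add: P_def K(3))
 have BL: "B : L2" unfolding B_def[abs_def]
 by (intro sumL Um(1)) (auto intro!: continuous_intros dz_continuous[OF chi] pc simp: dchi0)
 have CL: "C : L2"
 proof -
 have "C x = (\<Sum>j\<in>UNIV. (chi x * wz p1 (axis j 1) x * of_real (exp (- p x / 2))) * U x $ j)" for x
 proof (cases "x : K")
 case True
 show ?thesis unfolding C_def g_def I_def scaleR_conv_of_real ee(2)[symmetric] of_real_mult sum_distrib_left
 using True by (simp add: m_def algebra_simps)
 qed (simp add: C_def m_def K(3))
 moreover have "(%x. \<Sum>j\<in>UNIV. (chi x * wz p1 (axis j 1) x * of_real (exp (- p x / 2))) * U x $ j) : L2"
 by (intro sumL Um(1)) (auto intro!: continuous_intros C1_continuous[OF chi] pc wzpc simp: K(3))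
 ultimately show ?thesis by (metis (no_types, lifting) ext)
 qed
 have UA: "integrable lborel (%x. indicator A x * (norm (U x))\<^sup>2)"
 by (rule Bochner_Integration.integrable_bound[OF L2_integrable[OF U]])
 (use A L2_measurable[OF U] in \<open>auto simp: indicator_def\<close>)
 have "L2_sq (%x. m x *\<^sub>R (sg x - (\<Sum>j\<in>UNIV. wz f1 (axis j 1) x * g x $ j))) <= 3 * (L2_sq P + L2_sq B + L2_sq (%x. (- 1) *\<^sub>R C x))"
 unfolding decomp by (rule L2_sq_add3_le[OF PL BL L2_scaleR[OF CL]])
 also have "L2_sq (%x. (- 1) *\<^sub>R C x) = L2_sq C" using L2_sq_scaleR[of "-1" C] by simp
 finally have r1: "L2_sq (%x. m x *\<^sub>R (sg x - (\<Sum>j\<in>UNIV. wz f1 (axis j 1) x * g x $ j))) <= 3 * (L2_sq P + L2_sq B + L2_sq C)" .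
 have r2: "L2_sq B <= (LBINT x. indicator A x * (norm (U x))\<^sup>2)"
 unfolding L2_sq_def
 proof (rule integral_mono[OF L2_integrable[OF BL] UA])
 fix x
 show "(cmod (B x))\<^sup>2 <= indicator A x * (norm (U x))\<^sup>2"
 proof (cases "x : K")
 case True
 then have xD: "x : D" using K(2) by blast
 have "(cmod (B x))\<^sup>2 <= (\<Sum>j\<in>UNIV. (cmod (dz (axis j 1) chi x * of_real (exp (- p x / 2))))\<^sup>2) * (norm (U x))\<^sup>2"
 unfolding B_def by (rule cmod_sum_sq_le)
 also have "(\<Sum>j\<in>UNIV. (cmod (dz (axis j 1) chi x * of_real (exp (- p x / 2))))\<^sup>2) = exp (- p x) * (\<Sum>j\<in>UNIV. (cmod (dz (axis j 1) chi x))\<^sup>2)"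
 proof -
 have "(exp (- p x / 2))\<^sup>2 = exp (- p x)" by (simp add: power2_eq_square flip: exp_add)
 then show ?thesis by (simp add: norm_mult power_mult_distrib sum_distrib_left mult.commute)
 qed
 also have "... * (norm (U x))\<^sup>2 <= (exp (- p x) * (exp (p x) * indicator A x)) * (norm (U x))\<^sup>2"
 by (intro mult_right_mono mult_left_mono bd(1)[OF xD]) auto
 also have "exp (- p x) * (exp (p x) * indicator A x) = indicator A x" by (simp add: mult.assoc[symmetric] flip: exp_add)
 finally show ?thesis .
 next
 case False
 then show ?thesis by (simp add: B_def dchi0)
 qed
 qed
 have mb: "(%x. m x *\<^sub>R b j k x) : L2" for j k
 proof -
 have d: "(%x. (dzb (axis i 1) chi x * of_real (exp (- p x / 2))) * U x $ l) : L2" for i l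
 by (rule Um(1)) (auto intro!: continuous_intros dzb_continuous[OF chi] pc simp: dchi0)
 have eq: "m x *\<^sub>R b j k x = (dzb (axis j 1) chi x * of_real (exp (- p x / 2))) * U x $ k - (dzb (axis k 1) chi x * of_real (exp (- p x / 2))) * U x $ j" for x
 proof (cases "x : K")
 case True
 show ?thesis unfolding b_def I_def scaleR_conv_of_real ee(2)[symmetric] of_real_mult
 using True by (simp add: m_def algebra_simps)
 qed (simp add: m_def dchi0)
 show ?thesis unfolding eq by (rule L2_diff[OF d d])
 qed
 have r3: "(\<Sum>j\<in>UNIV. \<Sum>k\<in>UNIV. L2_sq (%x. m x *\<^sub>R b j k x)) <= 4 * (LBINT x. indicator A x * (norm (U x))\<^sup>2)"
 proof -
 have "(\<Sum>j\<in>UNIV. \<Sum>k\<in>UNIV. L2_sq (%x. m x *\<^sub>R b j k x)) = (LBINT x. (\<Sum>j\<in>UNIV. \<Sum>k\<in>UNIV. (cmod (m x *\<^sub>R b j k x))\<^sup>2))"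
 unfolding L2_sq_def
 by (simp only: Bochner_Integration.integral_sum Bochner_Integration.integrable_sum L2_integrable[OF mb])
 also have "... <= (LBINT x. 4 * (indicator A x * (norm (U x))\<^sup>2))"
 proof (rule integral_mono)
 show "integrable lborel (%x. \<Sum>j\<in>UNIV. \<Sum>k\<in>UNIV. (cmod (m x *\<^sub>R b j k x))\<^sup>2)"
 by (intro Bochner_Integration.integrable_sum L2_integrable[OF mb])
 show "integrable lborel (%x. 4 * (indicator A x * (norm (U x))\<^sup>2))" by (intro integrable_mult_right UA)
 fix x
 show "(\<Sum>j\<in>UNIV. \<Sum>k\<in>UNIV. (cmod (m x *\<^sub>R b j k x))\<^sup>2) <= 4 * (indicator A x * (norm (U x))\<^sup>2)"
 proof (cases "x : K")
 case True
 then have xD: "x : D" using K(2) by blast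
 have e2: "(m x * exp (w x / 2))\<^sup>2 = exp (- p x)"
 proof -
 have "m x * exp (w x / 2) = exp (- p x / 2)" using True ee(2)[of x] by (simp add: m_def)
 then show ?thesis by (simp add: power2_eq_square flip: exp_add)
 qed
 have "(cmod (m x *\<^sub>R b j k x))\<^sup>2 = exp (- p x) * (cmod (dzb (axis j 1) chi x * U x $ k - dzb (axis k 1) chi x * U x $ j))\<^sup>2" for j k
 unfolding b_def I_def e2[symmetric] by (simp add: norm_mult power_mult_distrib)
 then have "(\<Sum>j\<in>UNIV. \<Sum>k\<in>UNIV. (cmod (m x *\<^sub>R b j k x))\<^sup>2)
 = exp (- p x) * (\<Sum>j\<in>UNIV. \<Sum>k\<in>UNIV. (cmod (dzb (axis j 1) chi x * U x $ k - dzb (axis k 1) chi x * U x $ j))\<^sup>2)"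
 by (simp add: sum_distrib_left)
 also have "... <= exp (- p x) * (4 * ((\<Sum>j\<in>UNIV. (cmod (dzb (axis j 1) chi x))\<^sup>2) * (norm (U x))\<^sup>2))"
 by (intro mult_left_mono sum_wedge_sq_le) simp
 also have "... <= exp (- p x) * (4 * ((exp (p x) * indicator A x) * (norm (U x))\<^sup>2))"
 by (intro mult_left_mono mult_right_mono bd(2)[OF xD]) auto
 also have "... = 4 * (indicator A x * (norm (U x))\<^sup>2)" by (simp add: exp_minus field_simps)
 finally show ?thesis .
 next
 case False
 then show ?thesis by (simp add: m_def)
 qed
 qed
 finally show ?thesis by simp
 qed
 have l1: "L2_sq (%x. m x *\<^sub>R g x) = L2_sq (%x. (cmod (chi x) * exp (- p x / 2)) *\<^sub>R U x)"
 proof -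
 have "norm (m x *\<^sub>R g x) = norm ((cmod (chi x) * exp (- p x / 2)) *\<^sub>R U x)" for x
 proof (cases "x : K")
 case True
 have "g x = (chi x * I x) *s U x" by (simp add: g_def vec_eq_iff)
 then have "norm (m x *\<^sub>R g x) = exp (- f x / 2) * exp (w x / 2) * (cmod (chi x) * norm (U x))"
 using True by (simp add: m_def I_def norm_vector_scalar_mult norm_mult)
 then show ?thesis unfolding ee(2) by simp
 qed (simp add: m_def K(3))
 then show ?thesis by (simp add: L2_sq_def)
 qed
 show ?thesis
 using main r1 r2 r3 l1 L2_sq_nonneg[of C] unfolding m_def[symmetric] C_def[symmetric] P_def[symmetric]
 by (simp add: C_def[abs_def] P_def[abs_def] m_def[abs_def])
qed

section \<open>The basic estimate: weights and cutoffs along an exhaustion\<close>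

definition divz :: "(complex^'n => complex^'n) => complex^'n => complex"
 where "divz G x = (\<Sum>j\<in>UNIV. dz (axis j 1) (%x. G x $ j) x)"

lemma C2_on_compose:
 assumes q: "C2_on D q q1 q2"
 and k: "!!x. x : D ==> (k has_real_derivative k1 (q x)) (at (q x))"
 "!!x. x : D ==> (k1 has_real_derivative k2 (q x)) (at (q x))" "continuous_on (q ` D) k2"
 shows "C2_on D (%x. k (q x)) (%x v. k1 (q x) * q1 x v) (%x v w. k1 (q x) * q2 x v w + k2 (q x) * q1 x w * q1 x v)"
proof -
 have qd: "(q has_derivative q1 x) (at x)" "((%x. q1 x v) has_derivative q2 x v) (at x)" if "x : D" for x v
 using q that by (auto simp: C2_on_def C1_on_def)
 have d: "((%x. k (q x)) has_derivative (%v. k1 (q x) * q1 x v)) (at x)"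
 "((%x. k1 (q x)) has_derivative (%v. k2 (q x) * q1 x v)) (at x)" if "x : D" for x
 using DERIV_compose_FDERIV[OF k(1) qd(1)] DERIV_compose_FDERIV[OF k(2) qd(1)] that by (auto simp: mult.commute)
 have c1: "continuous_on D (%x. k1 (q x))"
 by (rule continuous_at_imp_continuous_on) (use d(2) has_derivative_continuous in blast)
 have c2: "continuous_on D (%x. k2 (q x))"
 using continuous_on_compose[OF C2_on_continuous(1)[OF q] k(3)] by (simp add: o_def)
 show ?thesis unfolding C2_on_def C1_on_def
 by (intro conjI ballI allI d(1) has_derivative_mult d(2) qd(2) continuous_intros c1 c2 C2_on_continuous[OF q])
qed

lemma lev_compose:
 "lev (%x v w. k1 (q x) * q2 x v w + k2 (q x) * q1 x w * q1 x v) x t = k1 (q x) * lev q2 x t + k2 (q x) * (cmod (wz q1 t x))\<^sup>2"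
 unfolding cmod_wz_sq lev_def by (simp add: power2_eq_square field_simps)

lemma C2_on_add:
 "C2_on D p p1 p2 ==> C2_on D q q1 q2 ==> C2_on D (%x. p x + q x) (%x v. p1 x v + q1 x v) (%x v w. p2 x v w + q2 x v w)"
 unfolding C2_on_def C1_on_def by (auto intro!: has_derivative_add continuous_intros)

lemma lev_add: "lev (%x v w. p2 x v w + q2 x v w) x t = lev p2 x t + lev q2 x t"
 by (simp add: lev_def field_simps)

lemma C2_on_affine:
 "C2_on D q q1 q2 ==> C2_on D (%x. c * q x + b) (%x v. c * q1 x v) (%x v w. c * q2 x v w)"
 unfolding C2_on_def C1_on_def by (auto intro!: derivative_eq_intros continuous_intros)

lemma lev_affine: "lev (%x v w. c * q2 x v w) x t = c * lev q2 x t"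
 by (simp add: lev_def field_simps)

lemma C2_on_subset: "C2_on D q q1 q2 ==> S \<subseteq> D ==> C2_on S q q1 q2"
 unfolding C2_on_def C1_on_def using continuous_on_subset by blast

lemma wz_scale: "wz (%x v. c x * q1 x v) t x = of_real (c x) * wz q1 t x"
 by (simp add: wz_def field_simps)

lemma pw_DERIV: "0 < m ==> (f has_real_derivative f') (at s) ==> ((%s. pw (Suc m) (f s)) has_real_derivative real (Suc m) * pw m (f s) * f') (at s)"
 using DERIV_chain2[OF pw_has_derivative] .

text \<open>This cutoff is 1 for s <= nu and 0 for s >= nu + 1, and its first derivative is
  continuous.\<close>

lemma DERIV_cutoff:
 "((%s. pw 2 (1 - pw 2 (s - nu))) has_real_derivative - 4 * pw 1 (1 - pw 2 (s - nu)) * pw 1 (s - nu)) (at s)"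
proof -
 have "((%s. pw (Suc 1) (1 - pw (Suc 1) (s - nu))) has_real_derivative
 real (Suc 1) * pw 1 (1 - pw (Suc 1) (s - nu)) * (0 - real (Suc 1) * pw 1 (s - nu) * (1 - 0))) (at s)"
 by (intro pw_DERIV DERIV_diff DERIV_const DERIV_ident) auto
 then show ?thesis by (simp add: numeral_2_eq_2 mult.assoc)
qed

lemma cutoff_deriv_le: "(- 4 * pw 1 (1 - pw 2 s) * pw 1 s)\<^sup>2 <= 16 * indicator {0..} s"
proof (cases "0 <= s \<and> s <= 1")
 case True
 then have "s\<^sup>2 <= 1" "0 <= s" "s <= 1" by (auto simp: power_le_one)
 then have "(1 - s\<^sup>2) * s <= 1 * 1" "0 <= (1 - s\<^sup>2) * s" by (intro mult_mono mult_nonneg_nonneg; simp)+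
 then have le: "((1 - s\<^sup>2) * s)\<^sup>2 <= 1" by (simp add: power_le_one)
 have "- 4 * pw 1 (1 - pw 2 s) * pw 1 s = - 4 * ((1 - s\<^sup>2) * s)" using True by (simp add: pw_def power_le_one algebra_simps)
 then have "(- 4 * pw 1 (1 - pw 2 s) * pw 1 s)\<^sup>2 = 16 * ((1 - s\<^sup>2) * s)\<^sup>2" by (simp only:) (simp add: power_mult_distrib)
 then show ?thesis using True le by simp
next
 case False
 then have "pw 1 s = 0 \<or> 1 <= pw 2 s" by (auto simp: pw_def one_le_power)
 then have "- 4 * pw 1 (1 - pw 2 s) * pw 1 s = 0" by (auto simp: pw_eq_0)
 then show ?thesis by (simp only:) simp
qed

text \<open>Here 16 bounds the squared derivative of the cutoff and M^2 (1 + s)^4 the squared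
  gradient of the exhaustion. The fourth power of 1 + s <= exp (s^3) uses 4 in the exponent, and 16
  M^2 <= exp (16 M^2 s^3) uses the rest.\<close>

lemma exp_cube_bound:
 assumes "1 <= (s::real)" shows "16 * (M\<^sup>2 * (1 + s) ^ 4) <= exp ((4 + 16 * M\<^sup>2) * pw 3 s)"
proof -
 have s: "pw 3 s = s ^ 3" "s <= s ^ 3" "1 <= s ^ 3" using assms by (auto simp: pw_def intro!: self_le_power)
 have "1 + s <= 1 + s ^ 3" using s by simp
 also have "... <= exp (s ^ 3)" by (rule exp_ge_add_one_self)
 finally have "(1 + s) ^ 4 <= exp (s ^ 3) ^ 4" using assms by (intro power_mono) auto
 moreover have "exp (s ^ 3) ^ 4 = exp (4 * s ^ 3)" by (metis exp_of_nat_mult of_nat_numeral)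
 moreover have "16 * M\<^sup>2 <= exp (16 * M\<^sup>2 * s ^ 3)"
 proof -
 have "16 * M\<^sup>2 * 1 <= 16 * M\<^sup>2 * s ^ 3" by (intro mult_left_mono s) auto
 also have "... <= exp (16 * M\<^sup>2 * s ^ 3)" using exp_ge_add_one_self[of "16 * M\<^sup>2 * s ^ 3"] by linarith
 finally show ?thesis by simp
 qed
 ultimately have "(16 * M\<^sup>2) * (1 + s) ^ 4 <= exp (16 * M\<^sup>2 * s ^ 3) * exp (4 * s ^ 3)"
 using assms by (intro mult_mono) auto
 also have "... = exp ((4 + 16 * M\<^sup>2) * pw 3 s)" unfolding s(1) exp_add[symmetric] by (simp add: algebra_simps)
 finally show ?thesis by (simp add: mult.assoc)
qed

text \<open>The weight \<open>k\<^sup>2 (ta\<^sup>+)\<^sup>6\<close> is convex enough to absorb the gradient of \<open>k (ta\<^sup>+)\<^sup>3\<close>, which in turn dominates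
 the gradients of cutoff functions of \<open>ta\<close>. Both vanish where the data live.\<close>

lemma dbar_basic_estimate_exhausted:
 fixes v G :: "complex^'n => complex^'n"
 assumes D: "open D" and ta: "C2_on D ta ta1 ta2" "!!x t. x : D ==> 0 <= lev ta2 x t"
 and cpt: "!!c. compact {x\<in>D. ta x <= c}"
 and grad: "!!x. x : D ==> 1 <= ta x ==> (\<Sum>j\<in>UNIV. (cmod (wz ta1 (axis j 1) x))\<^sup>2) <= M\<^sup>2 * (1 + ta x) ^ 4"
 and f: "C2_on D f f1 f2" "!!x t. x : D ==> (norm t)\<^sup>2 <= lev f2 x t"
 and v: "continuous_on UNIV v" "!!x. x \<notin> {x\<in>D. ta x <= 0} ==> v x = 0"
 and closed: "!!h j k. C1 h ==> supported D h ==>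
 (LBINT x. v x $ k * dzb (axis j 1) h x - v x $ j * dzb (axis k 1) h x) = 0"
 and G: "C1 G" "!!x. x \<notin> {x\<in>D. ta x <= 0} ==> G x = 0"
 shows "(LBINT x. v x \<bullet> G x)\<^sup>2 <= 3 * L2_sq (%x. exp (f x / 2) *\<^sub>R divz G x) * L2_sq (%x. exp (- f x / 2) *\<^sub>R v x)"
proof -
 define B where "B = {x\<in>D. ta x <= 0}"
 \<comment> \<open>The constant of \<open>exp_cube_bound\<close>: exp (ps) then dominates the
   squared gradient of every cutoff along ta used below.\<close>
 define k where "k = 4 + 16 * M\<^sup>2"
 define ps where "ps x = k * pw 3 (ta x)" for x
 define ph where "ph x = f x + k\<^sup>2 * pw 6 (ta x)" for x
 define w where "w x = ph x - ps x" for x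
 have cB: "compact B" and BD: "B \<subseteq> D" unfolding B_def by (rule cpt) auto
 have tc: "continuous_on D ta" by (rule C2_on_continuous(1)[OF ta(1)])
 have vs: "supported D v" and Gs: "supported D G" unfolding supported_def using cB BD v G by (auto simp: B_def)
 have "C2_on D ps (%x v. (k * (3 * pw 2 (ta x))) * ta1 x v) (%x v w. (k * (3 * pw 2 (ta x))) * ta2 x v w + (k * (3 * (2 * pw 1 (ta x)))) * ta1 x w * ta1 x v)"
 unfolding ps_def[abs_def]
 proof (rule C2_on_compose[OF ta(1), of "%s. k * pw 3 s" "%s. k * (3 * pw 2 s)" "%s. k * (3 * (2 * pw 1 s))"])
 show "((%s. k * pw 3 s) has_real_derivative k * (3 * pw 2 s)) (at s)"
 "((%s. k * (3 * pw 2 s)) has_real_derivative k * (3 * (2 * pw 1 s))) (at s)" for s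
 using DERIV_cmult[OF pw_has_derivative[of 2 s], of k] DERIV_cmult[OF DERIV_cmult[OF pw_has_derivative[of 1 s], of 3], of k]
 by (simp_all add: numeral_3_eq_3 numeral_2_eq_2)
 qed (intro continuous_intros)
 note Cps = this
 define ps1 where "ps1 x v = (k * (3 * pw 2 (ta x))) * ta1 x v" for x v
 have "C2_on D (%x. k\<^sup>2 * pw 6 (ta x)) (%x v. (k\<^sup>2 * (6 * pw 5 (ta x))) * ta1 x v)
 (%x v w. (k\<^sup>2 * (6 * pw 5 (ta x))) * ta2 x v w + (k\<^sup>2 * (6 * (5 * pw 4 (ta x)))) * ta1 x w * ta1 x v)"
 proof (rule C2_on_compose[OF ta(1), of "%s. k\<^sup>2 * pw 6 s" "%s. k\<^sup>2 * (6 * pw 5 s)" "%s. k\<^sup>2 * (6 * (5 * pw 4 s))"])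
 show "((%s. k\<^sup>2 * pw 6 s) has_real_derivative k\<^sup>2 * (6 * pw 5 s)) (at s)"
 "((%s. k\<^sup>2 * (6 * pw 5 s)) has_real_derivative k\<^sup>2 * (6 * (5 * pw 4 s))) (at s)" for s
 using DERIV_cmult[OF pw_has_derivative[of 5 s], of "k\<^sup>2"] DERIV_cmult[OF DERIV_cmult[OF pw_has_derivative[of 4 s], of 6], of "k\<^sup>2"] by simp_all
 qed (intro continuous_intros)
 note Cph = C2_on_add[OF f(1) this, folded ph_def]
 define ph2 where "ph2 x v w = f2 x v w + ((k\<^sup>2 * (6 * pw 5 (ta x))) * ta2 x v w + (k\<^sup>2 * (6 * (5 * pw 4 (ta x)))) * ta1 x w * ta1 x v)" for x v w
 have lower: "(norm t)\<^sup>2 + 3 * (cmod (\<Sum>j\<in>UNIV. wz ps1 (axis j 1) x * t $ j))\<^sup>2 <= lev ph2 x t" if x: "x : D" for x t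
 proof -
 have l: "linear (ps1 x)" unfolding ps1_def using C2_on_linear1[OF Cps x] .
 \<comment> \<open>The gradient of ps has to be absorbed three times, that is 3 * 9 X = 27 X, and
   the second derivative of k^2 (ta^+)^6 offers 6 * 5 X = 30 X. This is the reason for the sixth
   power and for the factor k^2.\<close>
 define X where "X = k\<^sup>2 * pw 4 (ta x) * (cmod (wz ta1 t x))\<^sup>2"
 have "(cmod (\<Sum>j\<in>UNIV. wz ps1 (axis j 1) x * t $ j))\<^sup>2 = 9 * X" unfolding X_def
 unfolding wz_expansion[of ps1 x t, OF l] unfolding ps1_def[abs_def] wz_scale[of "%x. k * (3 * pw 2 (ta x))"]
 by (simp add: norm_mult norm_power power_mult_distrib pw_def flip: power_mult)
 moreover have "lev ph2 x t = lev f2 x t + ((k\<^sup>2 * (6 * pw 5 (ta x))) * lev ta2 x t + (k\<^sup>2 * (6 * (5 * pw 4 (ta x)))) * (cmod (wz ta1 t x))\<^sup>2)"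
 unfolding ph2_def[abs_def] lev_add
 by (simp only: lev_compose[of "%s. k\<^sup>2 * (6 * pw 5 s)" ta ta2 "%s. k\<^sup>2 * (6 * (5 * pw 4 s))" ta1, unfolded lev_add])
 moreover have "0 <= (k\<^sup>2 * (6 * pw 5 (ta x))) * lev ta2 x t" by (intro mult_nonneg_nonneg ta(2) x) auto
 moreover have "0 <= X" "(k\<^sup>2 * (6 * (5 * pw 4 (ta x)))) * (cmod (wz ta1 t x))\<^sup>2 = 30 * X" by (simp_all add: X_def)
 ultimately show ?thesis using f(2)[OF x, of t] by linarith
 qed
 have psc: "continuous_on D ps" and wc: "continuous_on D w"
 unfolding w_def[abs_def] by (intro continuous_intros C2_on_continuous(1)[OF Cps] C2_on_continuous(1)[OF Cph])+
 have onB: "ps x = 0" "ph x = f x" "w x = f x" if "x : B" for x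
 using that by (auto simp: B_def ps_def ph_def w_def pw_eq_0)
 obtain U where U: "U : L2" and rep: "(LBINT x. v x \<bullet> G x) = L2_inner U (%x. exp (- w x / 2) *\<^sub>R v x)"
 and div: "!!h. C1 h ==> supported D h ==>
 (LBINT x. (\<Sum>j\<in>UNIV. of_real (exp (- (ph x - ps x) / 2)) * U x $ j * dz (axis j 1) h x)) = - (LBINT x. divz G x * h x)"
 and curl: "!!h j k. C1 h ==> supported D h ==>
 (LBINT x. of_real (exp ((ph x - ps x) / 2)) * (U x $ k * dzb (axis j 1) h x - U x $ j * dzb (axis k 1) h x)) = 0"
 using closed_projection[OF D wc v(1) vs closed G(1) Gs] unfolding divz_def w_def by blast
 have [measurable]: "U : borel_measurable borel" "B : sets borel"
 by (rule L2_measurable[OF U], rule borel_compact[OF cB])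
 have Gj: "C1 (%x. G x $ j)" for j by (rule C1_bounded_linear[OF bounded_linear_vec_nth G(1)])
 have sB: "divz G x = 0" if "x \<notin> B" for x
 proof -
 have "dd (%x. G x $ j) u x = 0" for j u
 by (rule dd_eq_0_outside[OF compact_imp_closed[OF cB]]) (use G(2) that in \<open>auto simp: B_def\<close>)
 then show ?thesis by (simp add: divz_def dz_def)
 qed
 have sc: "continuous_on UNIV (divz G)" unfolding divz_def[abs_def] by (intro continuous_intros dz_continuous Gj)
 have ss: "supported D (divz G)" unfolding supported_def using cB BD sB by blast
 \<comment> \<open>Only the part of U over B pairs with v, and both extra weights vanish
   there.\<close>
 define V where "V x = indicator B x *\<^sub>R U x" for x
 define A where "A n = {x\<in>D. real n + 1 <= ta x}" for n
 have A: "A n : sets borel" for n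
 proof -
 have "A n = D - (D \<inter> ta -` {..<real n + 1})" by (auto simp: A_def)
 moreover have "open (D \<inter> ta -` {..<real n + 1})" by (rule continuous_open_preimage[OF tc D open_lessThan])
 ultimately show ?thesis using D by auto
 qed
 have VL: "V : L2" unfolding V_def by (rule L2_sq_mono(1)[OF U, of _ 1]) (auto simp: indicator_def)
 have bound: "L2_sq V <= 3 * L2_sq (%x. exp (f x / 2) *\<^sub>R divz G x) + 5 * (LBINT x. indicator (A n) x * (norm (U x))\<^sup>2)" for n
 proof -
 define nu where "nu = real n + 1"
 define th where "th s = pw 2 (1 - pw 2 (s - nu))" for s
 define th' where "th' s = - 4 * pw 1 (1 - pw 2 (s - nu)) * pw 1 (s - nu)" for s
 define K where "K = {x\<in>D. ta x <= nu + 1}"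
 define q where "q x = complex_of_real (th (ta x))" for x
 define chi where "chi x = (if x : D then q x else 0)" for x
 have cK: "compact K" and KD: "K \<subseteq> D" unfolding K_def by (rule cpt) auto
 have q: "C1_on D q (%x v. of_real (th' (ta x) * ta1 x v))" unfolding C1_on_def
 proof (intro conjI ballI allI)
 fix x assume "x : D"
 then have td: "(ta has_derivative ta1 x) (at x)" using ta(1) by (simp add: C2_on_def)
 show "(q has_derivative (%v. of_real (th' (ta x) * ta1 x v))) (at x)" unfolding q_def
 using has_derivative_of_real[OF DERIV_compose_FDERIV[OF DERIV_cutoff td]]
 by (simp add: th_def th'_def mult.commute)
 next
 show "continuous_on D (%x. complex_of_real (th' (ta x) * ta1 x v))" for v
 unfolding th'_def by (intro continuous_intros tc C2_on_continuous(2)[OF ta(1)])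
 qed
 have q0: "q x = 0" if "x : D" "x \<notin> K" for x
 proof -
 have "1 < ta x - nu" using that by (auto simp: K_def)
 then have "1 <= pw 2 (ta x - nu)" by (simp add: pw_def one_le_power)
 then show ?thesis by (simp add: q_def th_def pw_eq_0)
 qed
 have chi: "C1 chi" "!!x u. x : D ==> dd chi u x = of_real (th' (ta x) * ta1 x u)"
 unfolding chi_def[abs_def] using C1_extend[OF D q cK KD q0] by blast+
 have chi0: "chi x = 0" if "x \<notin> K" for x using q0[of x] that KD by (auto simp: chi_def)
 have dchi: "dz u chi x = of_real (th' (ta x)) * wz ta1 u x" "dzb u chi x = of_real (th' (ta x)) * cnj (wz ta1 u x)" if "x : D" for u x
 unfolding dz_def dzb_def wz_def using chi(2)[OF that] by (auto simp: field_simps)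
 have th01: "0 <= th s" "th s <= 1" for s by (auto simp: th_def pw_def intro!: power_le_one)
 have gb: "(th' (ta x))\<^sup>2 * (\<Sum>j\<in>UNIV. (cmod (wz ta1 (axis j 1) x))\<^sup>2) <= exp (ps x) * indicator (A n) x" if x: "x : D" for x
 proof (cases "nu <= ta x")
 case True
 then have 1: "1 <= ta x" by (simp add: nu_def)
 have "(th' (ta x))\<^sup>2 <= 16" using cutoff_deriv_le[of "ta x - nu"] True by (simp add: th'_def)
 then have "(th' (ta x))\<^sup>2 * (\<Sum>j\<in>UNIV. (cmod (wz ta1 (axis j 1) x))\<^sup>2) <= 16 * (M\<^sup>2 * (1 + ta x) ^ 4)"
 by (intro mult_mono grad[OF x 1]) (auto intro: sum_nonneg)
 also have "... <= exp (ps x)" unfolding ps_def k_def by (rule exp_cube_bound[OF 1])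
 finally show ?thesis using True x by (simp add: A_def nu_def)
 next
 case False
 then have "th' (ta x) = 0" by (simp add: th'_def pw_eq_0)
 then show ?thesis by simp
 qed
 have est: "L2_sq (%x. (cmod (chi x) * exp (- ps x / 2)) *\<^sub>R U x)
 <= 3 * L2_sq (%x. chi x * of_real (exp (ph x / 2 - ps x)) * divz G x) + 5 * (LBINT x. indicator (A n) x * (norm (U x))\<^sup>2)"
 proof (rule cutoff_estimate[OF D Cph[folded ph2_def] Cps[folded ps1_def] lower chi(1) cK KD chi0 U sc ss div curl A])
 fix x assume x: "x : D"
 show "(\<Sum>j\<in>UNIV. (cmod (dz (axis j 1) chi x))\<^sup>2) <= exp (ps x) * indicator (A n) x"
 "(\<Sum>j\<in>UNIV. (cmod (dzb (axis j 1) chi x))\<^sup>2) <= exp (ps x) * indicator (A n) x"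
 using gb[OF x] by (simp_all add: dchi x norm_mult power_mult_distrib sum_distrib_left)
 qed
 have chi1: "chi x = 1" if "x : B" for x
 using that by (simp add: B_def chi_def q_def th_def nu_def pw_eq_0) (simp add: pw_def)
 define m where "m x = cmod (chi x) * exp (- ps x / 2)" for x
 have mc: "continuous_on UNIV m"
 proof (rule local_continuous[OF D])
 show "continuous_on D m" unfolding m_def[abs_def] by (intro continuous_intros C1_continuous[OF chi(1)] psc) auto
 show "supported D m" unfolding supported_def m_def using cK KD chi0 by (intro exI[of _ K]) auto
 qed
 have [measurable]: "m : borel_measurable borel" by (rule borel_measurable_continuous_onI[OF mc])
 have m1: "\<bar>m x\<bar> <= 1" for x
 proof -
 have "cmod (chi x) <= 1" using th01 by (simp add: chi_def q_def)
 moreover have "exp (- ps x / 2) <= 1" by (simp add: ps_def k_def)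
 ultimately have "cmod (chi x) * exp (- ps x / 2) <= 1 * 1" by (intro mult_mono) auto
 then show ?thesis by (simp add: m_def)
 qed
 have mL: "(%x. m x *\<^sub>R U x) : L2"
 by (rule L2_sq_mono(1)[OF U, of _ 1]) (auto intro!: mult_left_le_one_le simp: m1)
 have "L2_sq V <= 1\<^sup>2 * L2_sq (%x. m x *\<^sub>R U x)"
 by (rule L2_sq_mono(2)[OF mL]) (auto simp: L2_measurable[OF VL], auto simp: V_def indicator_def m_def chi1 onB)
 moreover have "(%x. chi x * of_real (exp (ph x / 2 - ps x)) * divz G x) = (%x. exp (f x / 2) *\<^sub>R divz G x)"
 proof
 show "chi x * of_real (exp (ph x / 2 - ps x)) * divz G x = exp (f x / 2) *\<^sub>R divz G x" for x
 by (cases "x : B") (simp_all add: chi1 onB sB scaleR_conv_of_real)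
 qed
 ultimately show ?thesis using est unfolding m_def by simp
 qed
 \<comment> \<open>The sets A n, outside which the gradients of the cutoffs vanish, leave every
   point eventually; since U is square integrable, the cutoff error tends to 0.\<close>
 have "(%n. LBINT x. indicator (A n) x * (norm (U x))\<^sup>2) \<longlonglongrightarrow> (\<integral>x. 0 \<partial>(lborel :: (complex^'n) measure))"
 proof (rule integral_dominated_convergence[where w="%x. (norm (U x))\<^sup>2"])
 show "(%x. indicator (A n) x * (norm (U x))\<^sup>2) : borel_measurable lborel" for n using A[of n] by measurable
 show "AE x in lborel. (%n. indicator (A n) x * (norm (U x))\<^sup>2) \<longlonglongrightarrow> 0"
 proof (rule AE_I2)
 fix x
 obtain N where N: "ta x < real N" using reals_Archimedean2 by blast
 have "\<forall>\<^sub>F n in sequentially. indicator (A n) x * (norm (U x))\<^sup>2 = 0"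
 by (rule eventually_sequentiallyI[of N]) (use N in \<open>auto simp: A_def\<close>)
 then show "(%n. indicator (A n) x * (norm (U x))\<^sup>2) \<longlonglongrightarrow> 0" by (rule tendsto_eventually)
 qed
 qed (use L2_integrable[OF U] in \<open>auto simp: indicator_def\<close>)
 then have "(%n. 3 * L2_sq (%x. exp (f x / 2) *\<^sub>R divz G x) + 5 * (LBINT x. indicator (A n) x * (norm (U x))\<^sup>2))
 \<longlonglongrightarrow> 3 * L2_sq (%x. exp (f x / 2) *\<^sub>R divz G x) + 5 * 0"
 by (intro tendsto_intros) simp
 then have Vb: "L2_sq V <= 3 * L2_sq (%x. exp (f x / 2) *\<^sub>R divz G x)"
 using LIMSEQ_le_const[of _ _ "L2_sq V"] bound by fastforce
 have "continuous_on UNIV (%x. exp (- f x / 2) *\<^sub>R v x)"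
 by (rule local_continuous[OF D]) (auto intro!: continuous_intros continuous_on_subset[OF v(1)] C2_on_continuous(1)[OF f(1)] supported_mono[OF vs])
 then have vL: "(%x. exp (- f x / 2) *\<^sub>R v x) : L2"
 by (rule supported_continuous_L2) (rule supported_mono[OF vs], simp)
 have "(LBINT x. v x \<bullet> G x) = L2_inner V (%x. exp (- f x / 2) *\<^sub>R v x)"
 unfolding rep L2_inner_def
 proof (rule Bochner_Integration.integral_cong[OF refl])
 show "U x \<bullet> (exp (- w x / 2) *\<^sub>R v x) = V x \<bullet> (exp (- f x / 2) *\<^sub>R v x)" for x
 using v(2)[of x] by (cases "x : B") (auto simp: V_def onB B_def)
 qed
 then have "(LBINT x. v x \<bullet> G x)\<^sup>2 <= L2_sq V * L2_sq (%x. exp (- f x / 2) *\<^sub>R v x)"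
 using L2_Cauchy_Schwarz[OF VL vL] by simp
 also have "... <= 3 * L2_sq (%x. exp (f x / 2) *\<^sub>R divz G x) * L2_sq (%x. exp (- f x / 2) *\<^sub>R v x)"
 by (intro mult_right_mono Vb L2_sq_nonneg)
 finally show ?thesis .
qed

lemma dbar_basic_estimate:
 fixes v G :: "complex^'n => complex^'n"
 assumes D: "open D" and p: "C2_on D p p1 p2" "!!x t. x : D ==> 0 <= lev p2 x t" "!!x. x : D ==> p x < 1"
 and cpt: "!!c. c < 1 ==> compact {x\<in>D. p x <= c}"
 and grad: "!!x. x : D ==> (\<Sum>j\<in>UNIV. (cmod (wz p1 (axis j 1) x))\<^sup>2) <= M\<^sup>2"
 and f: "C2_on D f f1 f2" "!!x t. x : D ==> (norm t)\<^sup>2 <= lev f2 x t"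
 and v: "continuous_on UNIV v" "!!x. x \<notin> {x\<in>D. p x <= 0} ==> v x = 0"
 and closed: "!!h j k. C1 h ==> supported D h ==>
 (LBINT x. v x $ k * dzb (axis j 1) h x - v x $ j * dzb (axis k 1) h x) = 0"
 and G: "C1 G" "!!x. x \<notin> {x\<in>D. p x <= 0} ==> G x = 0"
 shows "(LBINT x. v x \<bullet> G x)\<^sup>2 <= 3 * L2_sq (%x. exp (f x / 2) *\<^sub>R divz G x) * L2_sq (%x. exp (- f x / 2) *\<^sub>R v x)"
proof -
 define ta where "ta x = 1 / (1 - p x) - 1" for x
 have pos: "0 < 1 - p x" if "x : D" for x using p(3)[OF that] by simp
 have C: "C2_on D ta (%x v. (1 / (1 - p x)\<^sup>2) * p1 x v)
 (%x v w. (1 / (1 - p x)\<^sup>2) * p2 x v w + (2 / (1 - p x) ^ 3) * p1 x w * p1 x v)"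
 unfolding ta_def[abs_def]
 proof (rule C2_on_compose[OF p(1), of "%s. 1 / (1 - s) - 1" "%s. 1 / (1 - s)\<^sup>2" "%s. 2 / (1 - s) ^ 3"])
 fix x assume x: "x : D"
 show "((%s. 1 / (1 - s) - 1) has_real_derivative 1 / (1 - p x)\<^sup>2) (at (p x))"
 using pos[OF x] by (auto intro!: derivative_eq_intros simp: power2_eq_square)
 show "((%s. 1 / (1 - s)\<^sup>2) has_real_derivative 2 / (1 - p x) ^ 3) (at (p x))"
 proof -
 have "(2 * y) / ((y * y) * (y * y)) = 2 / (y * y * y)" if "y ~= 0" for y :: real using that by (simp add: field_simps)
 from this[of "1 - p x"] show ?thesis
 using pos[OF x] by (auto intro!: derivative_eq_intros simp: power2_eq_square power3_eq_cube)
 qed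
 qed (use pos in \<open>force intro!: continuous_intros\<close>)
 have le: "ta x <= c \<longleftrightarrow> p x <= 1 - 1 / (c + 1)" if "x : D" "-1 < c" for x c
 using pos[OF that(1)] that(2) by (simp add: ta_def field_simps)
 have le0: "{x\<in>D. ta x <= 0} = {x\<in>D. p x <= 0}" using le[of _ 0] by auto
 show ?thesis
 proof (rule dbar_basic_estimate_exhausted[OF D C _ _ _ f v(1) _ closed G(1)])
 show "0 <= lev (%x v w. (1 / (1 - p x)\<^sup>2) * p2 x v w + (2 / (1 - p x) ^ 3) * p1 x w * p1 x v) x t" if "x : D" for x t
 unfolding lev_compose[of "%s. 1 / (1 - s)\<^sup>2" p p2 "%s. 2 / (1 - s) ^ 3" p1]
 using pos[OF that] p(2)[OF that] by (intro add_nonneg_nonneg mult_nonneg_nonneg) auto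
 show "compact {x\<in>D. ta x <= c}" for c
 proof (cases "-1 < c")
 case True
 then have "{x\<in>D. ta x <= c} = {x\<in>D. p x <= 1 - 1 / (c + 1)}" using le by auto
 then show ?thesis using cpt[of "1 - 1 / (c + 1)"] True by simp
 next
 case False
 have "-1 < ta x" if "x : D" for x using divide_pos_pos[OF zero_less_one pos[OF that]] by (simp add: ta_def)
 then have "{x\<in>D. ta x <= c} = {}" using False by force
 then show ?thesis by (simp only: compact_empty)
 qed
 show "(\<Sum>j\<in>UNIV. (cmod (wz (%x v. (1 / (1 - p x)\<^sup>2) * p1 x v) (axis j 1) x))\<^sup>2) <= M\<^sup>2 * (1 + ta x) ^ 4" if x: "x : D" for x
 proof -
 have "(\<Sum>j\<in>UNIV. (cmod (wz (%x v. (1 / (1 - p x)\<^sup>2) * p1 x v) (axis j 1) x))\<^sup>2)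
 = (1 + ta x) ^ 4 * (\<Sum>j\<in>UNIV. (cmod (wz p1 (axis j 1) x))\<^sup>2)"
 unfolding wz_scale[of "%x. 1 / (1 - p x)\<^sup>2"]
 by (simp add: norm_mult norm_divide norm_power power_mult_distrib power_divide sum_distrib_left ta_def flip: power_mult of_real_power)
 also have "... <= (1 + ta x) ^ 4 * M\<^sup>2" by (intro mult_left_mono grad[OF x]) auto
 finally show ?thesis by (simp add: mult.commute)
 qed
 qed (use le0 v(2) G(2) in auto)
qed

section \<open>Model weights and the Levi form of mollified functions\<close>

lemma C2_on_sq: "C2_on D (%x. (x - a) \<bullet> (x - a)) (%x v. 2 * ((x - a) \<bullet> v)) (%x v w. 2 * (w \<bullet> v))"
 unfolding C2_on_def C1_on_def
 by (auto intro!: derivative_eq_intros continuous_intros simp: inner_commute)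

lemma norm_i_scale: "norm (\<i> *s (t::complex^'n)) = norm t"
 by (simp add: norm_vector_scalar_mult)

lemma lev_sq: "lev (%x v w. 2 * (w \<bullet> v)) x t = (norm t)\<^sup>2"
 by (simp add: lev_def dot_square_norm norm_i_scale)

lemma inner_i_scale_self: "t \<bullet> (\<i> *s (t::complex^'n)) = 0"
 unfolding inner_vec_complex Re_sum by (rule sum.neutral) simp

text \<open>Bessel's inequality for t and \<i> t, which are orthogonal and of equal norm; y is the
  residual of z, multiplied by T to avoid divisions.\<close>

lemma bessel_i: "(z \<bullet> t)\<^sup>2 + (z \<bullet> (\<i> *s t))\<^sup>2 <= (norm (z::complex^'n))\<^sup>2 * (norm t)\<^sup>2"
proof (cases "t = 0")
 case False
 define T where "T = t \<bullet> t"
 have T: "0 < T" using False by (simp add: T_def)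
 have ii: "(\<i> *s t) \<bullet> (\<i> *s t) = T" by (simp add: T_def dot_square_norm norm_i_scale)
 define \<alpha> \<beta> where "\<alpha> = z \<bullet> t" and "\<beta> = z \<bullet> (\<i> *s t)"
 define y where "y = T *\<^sub>R z - \<alpha> *\<^sub>R t - \<beta> *\<^sub>R (\<i> *s t)"
 have "y \<bullet> y = T * (T * (z \<bullet> z) - \<alpha>\<^sup>2 - \<beta>\<^sup>2)"
 using inner_i_scale_self[of t] ii
 by (simp add: y_def inner_diff_left inner_diff_right inner_commute[of t z] inner_commute[of "\<i> *s t" z] inner_commute[of "\<i> *s t" t]
 \<alpha>_def[symmetric] \<beta>_def[symmetric] T_def[symmetric] power2_eq_square algebra_simps)
 then have "0 <= T * (T * (z \<bullet> z) - \<alpha>\<^sup>2 - \<beta>\<^sup>2)" by (metis inner_ge_zero)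
 then have "0 <= T * (z \<bullet> z) - \<alpha>\<^sup>2 - \<beta>\<^sup>2" using T by (simp add: zero_le_mult_iff)
 then show ?thesis by (simp add: T_def \<alpha>_def \<beta>_def power2_norm_eq_inner mult.commute)
qed (simp add: inner_vec_def)

text \<open>A regularised logarithmic pole. In its Levi form the negative second derivative of ln is
  outweighed by the Levi form of |x - a|^2, by Bessel's inequality.\<close>

lemma ln_sq_C2:
 fixes a :: "complex^'n"
 assumes "0 < et"
 obtains q1 q2 where "C2_on UNIV (%x. ln ((x - a) \<bullet> (x - a) + et)) q1 q2" "!!x t. 0 <= lev q2 x t"
proof -
 have pos: "0 < (x - a) \<bullet> (x - a) + et" for x using inner_ge_zero[of "x - a"] assms by linarith
 have "C2_on UNIV (%x. ln ((x - a) \<bullet> (x - a) + et))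
 (%x v. (1 / ((x - a) \<bullet> (x - a) + et)) * (2 * ((x - a) \<bullet> v)))
 (%x v w. (1 / ((x - a) \<bullet> (x - a) + et)) * (2 * (w \<bullet> v)) + (- 1 / ((x - a) \<bullet> (x - a) + et)\<^sup>2) * (2 * ((x - a) \<bullet> w)) * (2 * ((x - a) \<bullet> v)))"
 proof (rule C2_on_compose[where k="%s. ln (s + et)" and ?k1.0="%s. 1 / (s + et)" and ?k2.0="%s. - 1 / (s + et)\<^sup>2", OF C2_on_sq[of UNIV a]])
 show "((%s. ln (s + et)) has_real_derivative 1 / ((x - a) \<bullet> (x - a) + et)) (at ((x - a) \<bullet> (x - a)))" for x
 using pos[of x] by (auto intro!: derivative_eq_intros)
 show "((%s. 1 / (s + et)) has_real_derivative - 1 / ((x - a) \<bullet> (x - a) + et)\<^sup>2) (at ((x - a) \<bullet> (x - a)))" for x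
 using pos[of x] by (auto intro!: derivative_eq_intros simp: power2_eq_square)
 have "(x - a) \<bullet> (x - a) + et ~= 0" for x using pos[of x] by simp
 then show "continuous_on (range (%x. (x - a) \<bullet> (x - a))) (%s. - 1 / (s + et)\<^sup>2)"
 by (intro continuous_intros) auto
 qed
 moreover have "0 <= lev (%x v w. (1 / ((x - a) \<bullet> (x - a) + et)) * (2 * (w \<bullet> v)) + (- 1 / ((x - a) \<bullet> (x - a) + et)\<^sup>2) * (2 * ((x - a) \<bullet> w)) * (2 * ((x - a) \<bullet> v))) x t" for x t
 proof -
 let ?Q = "(x - a) \<bullet> (x - a) + et"
 have "(cmod (wz (%x v. 2 * ((x - a) \<bullet> v)) t x))\<^sup>2 = ((x - a) \<bullet> t)\<^sup>2 + ((x - a) \<bullet> (\<i> *s t))\<^sup>2"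
 unfolding cmod_wz_sq by (simp add: power_mult_distrib)
 also have "... <= (norm (x - a))\<^sup>2 * (norm t)\<^sup>2" by (rule bessel_i)
 also have "... <= ?Q * (norm t)\<^sup>2" using assms by (intro mult_right_mono) (auto simp: power2_norm_eq_inner)
 finally have "(cmod (wz (%x v. 2 * ((x - a) \<bullet> v)) t x))\<^sup>2 / ?Q\<^sup>2 <= ?Q * (norm t)\<^sup>2 / ?Q\<^sup>2"
 by (rule divide_right_mono) simp
 also have "... = (1 / ?Q) * (norm t)\<^sup>2" using pos[of x] by (simp add: power2_eq_square)
 finally show ?thesis
 unfolding lev_compose[of "%s. 1 / (s + et)" "%x. (x - a) \<bullet> (x - a)" "%x v w. 2 * (w \<bullet> v)" "%s. - 1 / (s + et)\<^sup>2" "%x v. 2 * ((x - a) \<bullet> v)"] lev_sq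
 by simp
 qed
 ultimately show ?thesis by (rule that)
qed

lemma C2_on_moll:
 fixes P :: "'a::euclidean_space => real"
 assumes "integrable lborel P"
 shows "C2_on UNIV (moll t P) (%x v. conv (%z. gker t z \<bullet> v) P x /\<^sub>R kmass t TYPE('a)) (%x v w. conv (%z. hker t v z \<bullet> w) P x /\<^sub>R kmass t TYPE('a))"
 unfolding C2_on_def C1_on_def moll_def[abs_def]
 by (intro conjI ballI allI has_derivative_scaleR_right conv_ker_has_derivative conv_gker_has_derivative conv_hker_continuous continuous_intros assms)

text \<open>Averaging the second-order Taylor expansion over a circle of radius r removes the linear
  and mixed terms and adds r^2 times the Levi form to q x, so a negative Levi form would contradict
  the submean inequality for small r.\<close>

lemma lev_nonneg_submean:
 fixes x t :: "complex^'n"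
 assumes q: "C2_on UNIV q q1 q2" and r0: "0 < r0"
 and sub: "!!r. 0 < r ==> r < r0 ==> 2 * pi * q x <= integral {0..2*pi} (%th. q (x + (of_real r * cis th) *s t))"
 shows "0 <= lev q2 x t"
proof -
 define u where "u = \<i> *s t"
 define om where "om th = cos th *\<^sub>R t + sin th *\<^sub>R u" for th
 define N where "N = norm t + norm u + 1"
 have N: "0 < N" and omN: "norm (om th) <= N" for th
 proof -
 show "0 < N" by (simp add: N_def add_nonneg_pos)
 have "norm (om th) <= \<bar>cos th\<bar> * norm t + \<bar>sin th\<bar> * norm u" unfolding om_def by (rule order_trans[OF norm_triangle_ineq]) simp
 also have "... <= 1 * norm t + 1 * norm u" by (intro add_mono mult_right_mono) auto
 finally show "norm (om th) <= N" by (simp add: N_def)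
 qed
 have cis: "(of_real r * cis th) *s t = r *\<^sub>R om th" for r th
 by (simp add: om_def u_def vec_eq_iff complex_eq_iff algebra_simps)
 have qd: "(q has_derivative q1 y) (at y)" "((%y. q1 y v) has_derivative q2 y v) (at y)" for y v
 using q by (auto simp: C2_on_def C1_on_def)
 have l2: "linear (q2 y v)" "linear (%v. q2 y v w)" "linear (q1 y)" for y v w
 using C2_on_linear1[OF q] C2_on_linear2[OF q] C2_on_linear3[OF open_UNIV q] by auto
 have ex: "q2 y (om th) (om th) = q2 y t t * (cos th)\<^sup>2 + q2 y u u * (sin th)\<^sup>2 + (q2 y t u + q2 y u t) * (sin th * cos th)" for y th
 unfolding om_def linear_add[OF l2(1)] linear_add[OF l2(2)] linear_scale[OF l2(1)] linear_scale[OF l2(2)]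
 by (simp add: power2_eq_square algebra_simps)
 define a b c where "a = q2 x t t" and "b = q2 x u u" and "c = q2 x t u + q2 x u t"
 have key: "0 <= a + b + 8 * e" if e: "0 < e" for e
 proof -
 have "continuous_on UNIV (%y. q2 y v w)" for v w by (rule C2_on_continuous(3)[OF q])
 then have "\<exists>d>0. \<forall>y. dist y x < d \<longrightarrow> \<bar>q2 y v w - q2 x v w\<bar> < e" for v w
 unfolding continuous_on_iff using e by (auto simp: dist_real_def)
 then obtain d where d: "!!v w. 0 < d v w" "!!v w y. dist y x < d v w ==> \<bar>q2 y v w - q2 x v w\<bar> < e" by metis
 define de where "de = min (min (d t t) (d u u)) (min (d t u) (d u t))"
 have de: "0 < de" using d by (simp add: de_def)
 define r where "r = min (r0 / 2) (de / (2 * N))"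
 have r: "0 < r" "r < r0" "r * N < de"
 proof -
 show "0 < r" "r < r0" using r0 de N by (auto simp: r_def)
 have "r * N <= de / (2 * N) * N" using N by (intro mult_right_mono) (auto simp: r_def)
 then show "r * N < de" using N de by simp
 qed
 \<comment> \<open>A majorant of q on the circle: the four second derivatives at the intermediate
   point are replaced by those at x, at a cost of at most e each.\<close>
 define F where "F th = q x + r * (q1 x t * cos th + q1 x u * sin th) + r\<^sup>2 / 2 * (a * (cos th)\<^sup>2 + b * (sin th)\<^sup>2 + c * (sin th * cos th) + 4 * e)" for th
 have le: "q (x + r *\<^sub>R om th) <= F th" for th
 proof -
 define D where "D m s = (if m = 0 then q (x + s *\<^sub>R om th) else if m = 1 then q1 (x + s *\<^sub>R om th) (om th) else q2 (x + s *\<^sub>R om th) (om th) (om th))" for m :: nat and s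
 have pd: "((%s. x + s *\<^sub>R om th) has_derivative (%h. h *\<^sub>R om th)) (at s)" for s :: real by (auto intro!: derivative_eq_intros)
 have "(D m has_real_derivative D (Suc m) s) (at s)" if "m < 2" for m s
 proof -
 have "m = 0 \<or> m = 1" using that by auto
 moreover have "((%s. q (x + s *\<^sub>R om th)) has_real_derivative q1 (x + s *\<^sub>R om th) (om th)) (at s)"
 using has_derivative_compose[OF pd qd(1)] unfolding has_field_derivative_def
 by (simp add: linear_scale[OF l2(3)] mult_commute_abs)
 moreover have "((%s. q1 (x + s *\<^sub>R om th) (om th)) has_real_derivative q2 (x + s *\<^sub>R om th) (om th) (om th)) (at s)"
 using has_derivative_compose[OF pd qd(2)] unfolding has_field_derivative_def
 by (simp add: linear_scale[OF l2(1)] mult_commute_abs)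
 ultimately show ?thesis by (auto simp: D_def[abs_def])
 qed
 then obtain s where s: "0 < s" "s <= r" and eq: "D 0 r = (\<Sum>m<2. D m 0 / fact m * r ^ m) + D 2 s / fact 2 * r ^ 2"
 using Maclaurin2[of r D "D 0" 2] r(1) by blast
 define y where "y = x + s *\<^sub>R om th"
 have "norm (s *\<^sub>R om th) <= r * N" using s omN[of th] by (auto intro!: mult_mono)
 then have y: "dist y x < de" using r(3) by (simp add: y_def dist_norm)
 have df: "\<bar>q2 y t t - a\<bar> < e" "\<bar>q2 y u u - b\<bar> < e" "\<bar>q2 y t u - q2 x t u\<bar> < e" "\<bar>q2 y u t - q2 x u t\<bar> < e"
 using y unfolding a_def b_def de_def by (auto intro!: d(2))
 have pr: "(q2 y v w - p) * z <= e" if "\<bar>q2 y v w - p\<bar> < e" "\<bar>z\<bar> <= 1" for v w p z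
 proof -
 have "(q2 y v w - p) * z <= \<bar>q2 y v w - p\<bar> * \<bar>z\<bar>" by (metis abs_ge_self abs_mult)
 also have "... <= e * 1" using that by (intro mult_mono) auto
 finally show ?thesis by simp
 qed
 have sc: "\<bar>sin th * cos th\<bar> <= 1" unfolding abs_mult by (intro mult_le_one) auto
 have "q2 y (om th) (om th) <= a * (cos th)\<^sup>2 + b * (sin th)\<^sup>2 + c * (sin th * cos th) + 4 * e"
 using pr[OF df(1), of "(cos th)\<^sup>2"] pr[OF df(2), of "(sin th)\<^sup>2"] pr[OF df(3) sc] pr[OF df(4) sc]
 unfolding ex c_def by (simp add: abs_square_le_1 algebra_simps)
 then have "r\<^sup>2 / 2 * q2 y (om th) (om th) <= r\<^sup>2 / 2 * (a * (cos th)\<^sup>2 + b * (sin th)\<^sup>2 + c * (sin th * cos th) + 4 * e)"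
 by (intro mult_left_mono) auto
 moreover have "q (x + r *\<^sub>R om th) = q x + r * q1 x (om th) + r\<^sup>2 / 2 * q2 y (om th) (om th)"
 using eq by (simp add: D_def numeral_2_eq_2 y_def mult.commute)
 moreover have "q1 x (om th) = q1 x t * cos th + q1 x u * sin th"
 unfolding om_def linear_add[OF l2(3)] linear_scale[OF l2(3)] by simp
 ultimately show ?thesis by (simp add: F_def)
 qed
 define H where "H th = q x * th + r * (q1 x t * sin th - q1 x u * cos th) + r\<^sup>2 / 2 * (a * ((th + sin th * cos th) / 2) + b * ((th - sin th * cos th) / 2) + c * ((sin th)\<^sup>2 / 2) + 4 * e * th)" for th
 have "(H has_real_derivative F th) (at th)" for th
 proof -
 have "(H has_real_derivative q x + r * (q1 x t * cos th + q1 x u * sin th) + r\<^sup>2 / 2 * (a * ((1 + (cos th * cos th - sin th * sin th)) / 2) + b * ((1 - (cos th * cos th - sin th * sin th)) / 2) + c * (sin th * cos th) + 4 * e)) (at th)"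
 unfolding H_def[abs_def] by (auto intro!: derivative_eq_intros simp: field_simps power2_eq_square)
 moreover have "(1 + (cos th * cos th - sin th * sin th)) / 2 = (cos th)\<^sup>2" "(1 - (cos th * cos th - sin th * sin th)) / 2 = (sin th)\<^sup>2"
 using sin_cos_squared_add[of th] by (auto simp: power2_eq_square)
 ultimately show ?thesis by (simp only: F_def)
 qed
 then have "(F has_integral (H (2 * pi) - H 0)) {0..2*pi}"
 by (intro fundamental_theorem_of_calculus) (auto simp flip: has_real_derivative_iff_has_vector_derivative intro: has_field_derivative_at_within)
 moreover have "(%th. q (x + (of_real r * cis th) *s t)) integrable_on {0..2*pi}" unfolding cis om_def
 by (intro integrable_continuous_real continuous_on_compose2[OF C2_on_continuous(1)[OF q]] continuous_intros) auto
 ultimately have "integral {0..2*pi} (%th. q (x + (of_real r * cis th) *s t)) <= H (2 * pi) - H 0"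
 using has_integral_le[OF integrable_integral] le unfolding cis by blast
 then have "2 * pi * q x <= H (2 * pi) - H 0" using sub[OF r(1,2)] by linarith
 then have "0 <= (r\<^sup>2 / 2 * pi) * (a + b + 8 * e)" by (simp add: H_def algebra_simps)
 moreover have "0 < r\<^sup>2 / 2 * pi" using r(1) by simp
 ultimately show ?thesis using mult_pos_neg[of "r\<^sup>2 / 2 * pi" "a + b + 8 * e"] by linarith
 qed
 have "- (a + b) <= 0 + e" if "0 < e" for e using key[of "e / 8"] that by simp
 then have "- (a + b) <= 0" by (rule field_le_epsilon)
 then show ?thesis by (simp add: lev_def a_def b_def u_def)
qed

lemma integral_supported_cbox:
 fixes f :: "'a::euclidean_space => real"
 assumes "continuous_on UNIV f" "!!y. y \<notin> cbox a b ==> f y = 0"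
 shows "(LBINT y. f y) = integral (cbox a b) f"
proof -
 have "integrable lborel f" by (rule supported_integrable[OF assms(1), of UNIV]) (use assms(2) in \<open>auto simp: supported_def intro: exI[of _ "cbox a b"]\<close>)
 then have "(LBINT y. f y) = integral UNIV f" by (rule integral_lborel[symmetric])
 also have "... = integral UNIV (%y. if y : cbox a b then f y else 0)"
 by (rule arg_cong[of _ _ "integral UNIV"]) (use assms(2) in auto)
 also have "... = integral (cbox a b) f" by (rule integral_restrict_UNIV)
 finally show ?thesis .
qed

text \<open>Submean inequalities survive averaging with a nonnegative kernel, by exchanging the two
  integrals. They are demanded only within distance sqrt t of x and for small circles, since a
  truncated exhaustion satisfies them only locally.\<close>

lemma lev_moll_nonneg:
 fixes P :: "complex^'n => real"
 assumes P: "continuous_on UNIV P" "supported S P" and t: "0 < t" and r0: "0 < r0"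
 and sub: "!!y r. y : cball x (sqrt t) ==> 0 < r ==> r < r0 ==> 2 * pi * P y <= integral {0..2*pi} (%th. P (y + (of_real r * cis th) *s v))"
 shows "0 <= lev (%x v w. conv (%z. hker t v z \<bullet> w) P x /\<^sub>R kmass t TYPE(complex^'n)) x v"
proof (rule lev_nonneg_submean[OF C2_on_moll r0])
 show Pi: "integrable lborel P" by (rule supported_integrable[OF P])
 fix r assume r: "0 < r" "r < r0"
 let ?m = "kmass t TYPE(complex^'n)"
 define w where "w th = (of_real r * cis th) *s v" for th
 have wc: "continuous_on A (%x. w (g x))" if "continuous_on A g" for A :: "'b::topological_space set" and g
 unfolding w_def vec_eq_iff by (intro continuous_on_vec_lambda continuous_intros that continuous_on_compose2[OF continuous_on_cis])
 obtain a b where ab: "cball x (sqrt t) \<subseteq> cbox a b" using bounded_subset_cbox_symmetric[OF bounded_cball] by metis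
 have k0: "ker t (x - y) = 0" if "y \<notin> cbox a b" for y
 proof -
 have "y \<notin> cball x (sqrt t)" using that ab by blast
 then show ?thesis by (intro ker_eq_0) (simp add: dist_norm norm_minus_commute)
 qed
 have Pc: "continuous_on A (%x. P (g x))" if "continuous_on A g" for A :: "'b::topological_space set" and g
 by (rule continuous_on_compose2[OF P(1) that]) auto
 have cv: "conv (ker t) P (x + c) = integral (cbox a b) (%y. ker t (x - y) * P (y + c))" for c
 proof -
 have m: "(%y. ker t (x + c - y) * P y) : borel_measurable borel"
 by (intro borel_measurable_continuous_onI continuous_intros P(1))
 have "conv (ker t) P (x + c) = (LBINT y. ker t (x - y) * P (y + c))"
 unfolding conv_def using integral_shift[OF m, of c] by (simp add: algebra_simps)
 also have "... = integral (cbox a b) (%y. ker t (x - y) * P (y + c))"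
 by (rule integral_supported_cbox) (auto intro!: continuous_intros Pc simp: k0)
 finally show ?thesis .
 qed
 have jc: "continuous_on (cbox (a, 0) (b, 2 * pi)) (%(y, th). ker t (x - y) * P (y + w th))"
 unfolding split_beta by (intro continuous_intros Pc wc)
 have "2 * pi * conv (ker t) P x = integral (cbox a b) (%y. 2 * pi * (ker t (x - y) * P y))"
 using cv[of 0] by simp
 also have "... <= integral (cbox a b) (%y. integral {0..2*pi} (%th. ker t (x - y) * P (y + w th)))"
 proof (rule integral_le)
 show "(%y. 2 * pi * (ker t (x - y) * P y)) integrable_on cbox a b"
 by (intro integrable_continuous continuous_intros continuous_on_subset[OF P(1)]) auto
 show "(%y. integral {0..2*pi} (%th. ker t (x - y) * P (y + w th))) integrable_on cbox a b"
 using integral_continuous_on_param[of "cbox a b" 0 "2 * pi" "%y th. ker t (x - y) * P (y + w th)"] jc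
 by (intro integrable_continuous) (simp add: cbox_Pair_eq)
 fix y
 show "2 * pi * (ker t (x - y) * P y) <= integral {0..2*pi} (%th. ker t (x - y) * P (y + w th))"
 proof (cases "y : cball x (sqrt t)")
 case True
 have "ker t (x - y) * (2 * pi * P y) <= ker t (x - y) * integral {0..2*pi} (%th. P (y + w th))"
 unfolding w_def by (intro mult_left_mono sub True r) simp
 then show ?thesis by (simp add: algebra_simps)
 next
 case False
 then have "ker t (x - y) = 0" by (intro ker_eq_0) (simp add: dist_norm norm_minus_commute)
 then show ?thesis by simp
 qed
 qed
 also have "... = integral {0..2*pi} (%th. integral (cbox a b) (%y. ker t (x - y) * P (y + w th)))"
 using integral_swap_continuous[OF jc] by simp
 also have "... = integral {0..2*pi} (%th. conv (ker t) P (x + w th))" unfolding cv ..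
 finally have "(2 * pi * conv (ker t) P x) /\<^sub>R ?m <= (integral {0..2*pi} (%th. conv (ker t) P (x + w th))) /\<^sub>R ?m"
 by (intro scaleR_left_mono) (simp_all add: kmass_pos[OF t] less_imp_le)
 then show "2 * pi * moll t P x <= integral {0..2*pi} (%th. moll t P (x + (of_real r * cis th) *s v))"
 unfolding moll_def w_def by (simp add: algebra_simps)
qed

lemma divz_add:
 assumes "C1 F" "C1 G" shows "divz (%x. F x + G x) x = divz F x + divz G x"
proof -
 have c: "C1 (%x. F x $ j)" "C1 (%x. G x $ j)" for j
 using assms by (auto intro: C1_bounded_linear[OF bounded_linear_vec_nth])
 have "dz u (%x. F x $ j + G x $ j) x = dz u (%x. F x $ j) x + dz u (%x. G x $ j) x" for u j
 by (simp add: dz_def dd_add[OF c] algebra_simps add_divide_distrib diff_divide_distrib)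
 then show ?thesis by (simp only: divz_def vector_add_component sum.distrib)
qed

lemma divz_scaleR: assumes "C1 F" shows "divz (%x. c *\<^sub>R F x) x = c *\<^sub>R divz F x"
proof -
 have c: "C1 (%x. F x $ j)" for j using assms by (rule C1_bounded_linear[OF bounded_linear_vec_nth])
 have "dz u (%x. c *\<^sub>R F x $ j) x = c *\<^sub>R dz u (%x. F x $ j) x" for u j
 unfolding dz_def dd_bounded_linear[OF bounded_linear_scaleR_right c] by (simp add: scaleR_conv_of_real algebra_simps)
 then show ?thesis by (simp only: divz_def vector_scaleR_component scaleR_sum_right)
qed

lemma divz_continuous: "C1 G ==> continuous_on S (divz G)"
 unfolding divz_def[abs_def] by (intro continuous_intros dz_continuous C1_bounded_linear[OF bounded_linear_vec_nth])

lemma divz_eq_0: assumes "closed K" "!!x. x \<notin> K ==> G x = 0" "x \<notin> K" shows "divz G x = 0"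
proof -
 have "dd (%x. G x $ j) u x = 0" for j u by (rule dd_eq_0_outside[OF assms(1) _ assms(3)]) (simp add: assms(2))
 then show ?thesis by (simp add: divz_def dz_def)
qed

lemma supported_divz: assumes "supported D G" shows "supported D (divz G)"
proof -
 obtain K where "compact K" "K \<subseteq> D" "\<forall>x. x \<notin> K \<longrightarrow> G x = 0" using assms by (auto simp: supported_def)
 then show ?thesis unfolding supported_def by (intro exI[of _ K]) (auto simp: compact_imp_closed divz_eq_0[of K])
qed

section \<open>The \<partial>-bar equation with a continuous plurisubharmonic weight\<close>

text \<open>An abstract continuous plurisubharmonic exhaustion function. As P is continuous and
  real, plurisubharmonicity is recorded by ordinary integrals over circles bounding discs inside
  Om.\<close>

locale psh_exhaustion =
 fixes Om :: "(complex^'n) set" and P :: "complex^'n => real"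
 assumes open_domain: "open Om" and P_continuous: "continuous_on Om P"
 and sublevel_compact: "!!c. compact {x\<in>Om. P x <= c}"
 and submean: "!!y v r. 0 < r ==> (!!s. cmod s <= r ==> y + s *s v : Om) ==>
 2 * pi * P y <= integral {0..2*pi} (%th. P (y + (of_real r * cis th) *s v))"
begin

text \<open>P is multiplied by a cutoff of its own values, which leaves it unchanged where P < c0 +
  4, and then mollified. On D the mollification p has a nonnegative Levi form, p - c0 < 1 exhausts
  D, and the data live where p - c0 <= 0. So the basic estimate holds for the weight N p + g, and |p
  - P| <= e on the supports changes each of the two squared norms by a factor of at most exp (N
  e).\<close>

lemma mollified_estimate:
 fixes v G :: "complex^'n => complex^'n"
 assumes g: "C2_on UNIV g g1 g2" "!!x t. (norm t)\<^sup>2 <= lev g2 x t" and N: "0 <= N"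
 and v: "continuous_on UNIV v" "supported Om v"
 and closed: "!!h j k. C1 h ==> supported Om h ==>
 (LBINT x. v x $ k * dzb (axis j 1) h x - v x $ j * dzb (axis k 1) h x) = 0"
 and G: "C1 G" "supported Om G" and e: "0 < e" "e <= 1/2"
 shows "(LBINT x. v x \<bullet> G x)\<^sup>2 <= exp (2 * N * e) *
 (3 * L2_sq (%x. exp ((N * P x + g x) / 2) *\<^sub>R divz G x) * L2_sq (%x. exp (- (N * P x + g x) / 2) *\<^sub>R v x))"
proof -
 obtain Kv where Kv: "compact Kv" "Kv \<subseteq> Om" "!!x. x \<notin> Kv ==> v x = 0" using v(2) by (auto simp: supported_def)
 obtain Kg where Kg: "compact Kg" "Kg \<subseteq> Om" "!!x. x \<notin> Kg ==> G x = 0" using G(2) by (auto simp: supported_def)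
 define S where "S = Kv \<union> Kg"
 have S: "compact S" "S \<subseteq> Om" using Kv Kg by (auto simp: S_def)
 have "bounded (P ` S)" by (intro compact_imp_bounded compact_continuous_image continuous_on_subset[OF P_continuous] S)
 then obtain b where b: "!!x. x : S ==> \<bar>P x\<bar> <= b" by (auto simp: bounded_iff)
 \<comment> \<open>The levels leave room for the error e <= 1/2 and for small displacements: the
   data lie below c0 - 1, D lies where p < c0 + 1, K2 reaches up to c0 + 3, and P is untouched below
   c0 + 4.\<close>
 define c0 where "c0 = b + 1"
 have PS: "P x <= c0 - 1" if "x : S" for x using b[OF that] by (simp add: c0_def)
 define P0 where "P0 x = (if x : Om then P x * max 0 (min 1 (c0 + 5 - P x)) else 0)" for x
 define O4 where "O4 = {x\<in>Om. P x < c0 + 4}"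
 have P0eq: "P0 x = P x" if "x : O4" for x using that by (simp add: P0_def O4_def)
 have P0s: "supported Om P0" unfolding supported_def
 by (intro exI[of _ "{x\<in>Om. P x <= c0 + 5}"]) (use sublevel_compact in \<open>auto simp: P0_def\<close>)
 have P0c: "continuous_on UNIV P0"
 proof (rule local_continuous[OF open_domain _ P0s])
 show "continuous_on Om P0"
 by (rule continuous_on_eq[of _ "%x. P x * max 0 (min 1 (c0 + 5 - P x))"]) (auto intro!: continuous_intros P_continuous simp: P0_def)
 qed
 have P0i: "integrable lborel P0" by (rule supported_integrable[OF P0c P0s])
 obtain rh where rh: "!!x. x \<notin> cball 0 rh ==> P0 x = 0" using supported_cball[OF P0s] by metis
 obtain d1 where d1: "d1 > 0" "!!z z'. norm (z - z') < d1 ==> norm (P0 z - P0 z') < e"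
 using supported_uniformly_continuous[OF P0c rh e(1)] by metis
 define K2 where "K2 = {x\<in>Om. P x <= c0 + 3}"
 have K2: "compact K2" "K2 \<subseteq> O4" using sublevel_compact by (auto simp: K2_def O4_def)
 have opn: "open {x\<in>Om. P x < c}" for c
 using continuous_open_preimage[OF P_continuous open_domain open_lessThan, of c] by (simp add: vimage_def Int_def)
 obtain de where de: "de > 0" "(\<Union>x\<in>K2. ball x de) \<subseteq> O4"
 using compact_subset_open_imp_ball_epsilon_subset[OF K2(1) opn[of "c0 + 4"]] K2(2) by (auto simp: O4_def)
 \<comment> \<open>With sqrt t at most a third of both margins, mollification changes P0 by at most
   e, and a shift by sqrt t followed by one of less than de / 3 stays where P0 = P.\<close>
 define t where "t = (min d1 de / 3)\<^sup>2"
 have t: "0 < t" "sqrt t < d1" "sqrt t <= de / 3" using d1(1) de(1) by (auto simp: t_def)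
 define p where "p = moll t P0"
 define p1 where "p1 x v = conv (%z. gker t z \<bullet> v) P0 x /\<^sub>R kmass t TYPE(complex^'n)" for x v
 define p2 where "p2 x v w = conv (%z. hker t v z \<bullet> w) P0 x /\<^sub>R kmass t TYPE(complex^'n)" for x v w
 have p: "C2_on UNIV p p1 p2" unfolding p_def p1_def p2_def by (rule C2_on_moll[OF P0i])
 have near: "\<bar>p x - P0 x\<bar> <= e" for x
 unfolding p_def real_norm_def[symmetric]
 proof (rule moll_close[OF t(1) P0i])
 fix y assume "norm (x - y) <= sqrt t"
 then have "norm (y - x) < d1" using t(2) by (simp add: norm_minus_commute)
 then show "norm (P0 y - P0 x) <= e" using d1(2) less_imp_le by blast
 qed
 define D where "D = {x\<in>Om. P x < c0 + 3} \<inter> {x. p x < c0 + 1}"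
 have pc: "continuous_on UNIV p" by (rule C2_on_continuous(1)[OF p])
 have D: "open D" unfolding D_def by (intro open_Int opn open_Collect_less pc continuous_on_const)
 have DK: "D \<subseteq> K2" "D \<subseteq> Om" by (auto simp: D_def K2_def)
 have lp: "0 <= lev p2 x w" if x: "x : D" for x w
 unfolding p2_def
 proof (rule lev_moll_nonneg[OF P0c P0s t(1)])
 show "0 < de / (3 * (norm w + 1))" using de(1) by (intro divide_pos_pos) (auto intro: add_nonneg_pos)
 fix y r assume y: "y : cball x (sqrt t)" and r: "0 < r" "r < de / (3 * (norm w + 1))"
 have "0 < 3 * (norm w + 1)" by (simp add: add_nonneg_pos)
 then have "r * (norm w + 1) < de / 3" using r(2) by (simp add: pos_less_divide_eq algebra_simps)
 then have rw: "r * norm w < de / 3" using r(1) by (simp add: algebra_simps)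
 have inO: "y + s *s w : O4" if "cmod s <= r" for s
 proof -
 have "cmod s * norm w <= r * norm w" using that by (intro mult_right_mono) auto
 then have "norm (s *s w) < de / 3" using rw by (simp add: norm_vector_scalar_mult)
 moreover have "norm (x - (y + s *s w)) <= norm (x - y) + norm (s *s w)" using norm_triangle_ineq4[of "x - y" "s *s w"] by (simp add: algebra_simps)
 moreover have "norm (x - y) <= de / 3" using y t(3) by (simp add: dist_norm)
 ultimately have "y + s *s w : ball x de" using de(1) by (simp add: dist_norm)
 then show ?thesis using de(2) x DK by blast
 qed
 have "y : O4" using inO[of 0] r by simp
 moreover have "2 * pi * P y <= integral {0..2*pi} (%th. P (y + (of_real r * cis th) *s w))"
 by (rule submean[OF r(1)]) (use inO in \<open>auto simp: O4_def\<close>)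
 moreover have "P0 (y + (of_real r * cis th) *s w) = P (y + (of_real r * cis th) *s w)" for th
 by (rule P0eq, rule inO) (use r in \<open>simp add: norm_mult\<close>)
 ultimately show "2 * pi * P0 y <= integral {0..2*pi} (%th. P0 (y + (of_real r * cis th) *s w))" by (simp add: P0eq)
 qed
 have cpt: "compact {x\<in>D. 1 * p x + - c0 <= c}" if c: "c < 1" for c
 proof -
 have "x : D" if x: "x : K2" "p x <= c0 + c" for x
 proof -
 have "P x = P0 x" using x K2 by (intro P0eq[symmetric]) auto
 then have "P x <= c0 + c + 1/2" using near[of x] x e by (simp add: abs_le_iff)
 then show ?thesis using x c by (simp add: D_def K2_def)
 qed
 then have "{x\<in>D. 1 * p x + - c0 <= c} = K2 \<inter> {x. p x <= c0 + c}" using DK by auto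
 moreover have "closed {x. p x <= c0 + c}" by (intro closed_Collect_le pc continuous_on_const)
 ultimately show ?thesis using K2(1) by (simp add: compact_Int_closed)
 qed
 have "bounded ((%x. \<Sum>j\<in>UNIV. (cmod (wz (%x v. 1 * p1 x v) (axis j 1) x))\<^sup>2) ` K2)"
 unfolding wz_def
 by (intro compact_imp_bounded compact_continuous_image K2 continuous_intros continuous_on_subset[OF C2_on_continuous(2)[OF p]]) auto
 then obtain B where B: "0 < B" "!!x. x : K2 ==> norm (\<Sum>j\<in>UNIV. (cmod (wz (%x v. 1 * p1 x v) (axis j 1) x))\<^sup>2) <= B"
 by (auto simp: bounded_pos)
 have inB: "x : {x\<in>D. 1 * p x + - c0 <= 0}" if x: "x : S" for x
 proof -
 have x': "x : Om" "P x <= c0 - 1" using x S PS by auto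
 then have "P x = P0 x" by (intro P0eq[symmetric]) (simp add: O4_def)
 then show ?thesis using near[of x] e x' by (auto simp: abs_le_iff D_def)
 qed
 define f where "f x = (N * p x + 0) + g x" for x
 note f = C2_on_add[OF C2_on_affine[OF p, of N 0] g(1), folded f_def]
 have est: "(LBINT x. v x \<bullet> G x)\<^sup>2 <= 3 * L2_sq (%x. exp (f x / 2) *\<^sub>R divz G x) * L2_sq (%x. exp (- f x / 2) *\<^sub>R v x)"
 proof (rule dbar_basic_estimate[OF D C2_on_subset[OF C2_on_affine[OF p, of 1 "- c0"] subset_UNIV] _ _ cpt _ C2_on_subset[OF f subset_UNIV] _ v(1) _ _ G(1), where M="sqrt B"])
 show "0 <= lev (%x v w. 1 * p2 x v w) x w" if "x : D" for x w using lp[OF that] by simp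
 show "1 * p x + - c0 < 1" if "x : D" for x using that by (simp add: D_def)
 show "(\<Sum>j\<in>UNIV. (cmod (wz (%x v. 1 * p1 x v) (axis j 1) x))\<^sup>2) <= (sqrt B)\<^sup>2" if "x : D" for x
 using B(1) B(2)[of x] DK that by auto
 show "(norm w)\<^sup>2 <= lev (%x v w. N * p2 x v w + g2 x v w) x w" if "x : D" for x w
 unfolding lev_add lev_affine using g(2)[of w x] mult_nonneg_nonneg[OF N lp[OF that, of w]] by linarith
 show "v x = 0" "G x = 0" if "x \<notin> {x\<in>D. 1 * p x + - c0 <= 0}" for x
 using inB that Kv(3) Kg(3) by (auto simp: S_def)
 show "(LBINT x. v x $ k * dzb (axis j 1) h x - v x $ j * dzb (axis k 1) h x) = 0" if "C1 h" "supported D h" for h j k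
 by (rule closed[OF that(1) supported_subset[OF that(2) DK(2)]])
 qed auto
 have fP: "\<bar>f x - (N * P x + g x)\<bar> <= N * e" if "x : S" for x
 proof -
 have "P x = P0 x" using that S PS[OF that] by (intro P0eq[symmetric]) (auto simp: O4_def)
 then have "f x - (N * P x + g x) = N * (p x - P0 x)" by (simp add: f_def algebra_simps)
 then show ?thesis using mult_left_mono[OF near N] N by (simp add: abs_mult)
 qed
 have aux: "\<bar>u - w\<bar> <= k ==> exp (u / 2) <= exp (k / 2) * exp (w / 2)" "\<bar>u - w\<bar> <= k ==> exp (- u / 2) <= exp (k / 2) * exp (- w / 2)" for u w k :: real
 unfolding exp_add[symmetric] by (simp_all add: abs_le_iff field_simps)
 note ex = aux[OF fP]
 have Phc: "continuous_on Om (%x. N * P x + g x)" and fc: "continuous_on A f" for A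
 unfolding f_def[abs_def]
 by (intro continuous_intros P_continuous continuous_on_subset[OF C2_on_continuous(1)[OF g(1)]] continuous_on_subset[OF pc] subset_UNIV)+
 have dG0: "divz G x = 0" if "x \<notin> Kg" for x by (rule divz_eq_0[OF compact_imp_closed[OF Kg(1)]]) (use Kg that in auto)
 have loc: "(%x. exp (a x) *\<^sub>R m x) : L2" if "continuous_on Om a" "continuous_on UNIV m" "supported Om m"
 for a and m :: "complex^'n => 'b::euclidean_space"
 proof -
 have s: "supported Om (%x. exp (a x) *\<^sub>R m x)" by (rule supported_mono[OF that(3)]) simp
 show ?thesis
 by (rule supported_continuous_L2[OF local_continuous[OF open_domain _ s] s]) (intro continuous_intros that(1) continuous_on_subset[OF that(2)], simp)
 qed
 have sq: "(exp (N * e / 2))\<^sup>2 = exp (N * e)" by (simp add: power2_eq_square flip: exp_add)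
 have L1: "L2_sq (%x. exp (f x / 2) *\<^sub>R divz G x) <= exp (N * e) * L2_sq (%x. exp ((N * P x + g x) / 2) *\<^sub>R divz G x)"
 unfolding sq[symmetric]
 proof (rule L2_sq_mono(2))
 show "(%x. exp ((N * P x + g x) / 2) *\<^sub>R divz G x) : L2"
 by (intro loc continuous_on_divide Phc continuous_on_const divz_continuous G(1) supported_divz G(2)) simp
 show "(%x. exp (f x / 2) *\<^sub>R divz G x) : borel_measurable borel"
 by (intro borel_measurable_continuous_onI continuous_intros fc divz_continuous G(1)) simp
 show "norm (exp (f x / 2) *\<^sub>R divz G x) <= exp (N * e / 2) * norm (exp ((N * P x + g x) / 2) *\<^sub>R divz G x)" for x
 using ex(1)[of x] dG0[of x] by (cases "x : Kg") (auto simp: S_def mult.assoc[symmetric] intro!: mult_right_mono)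
 qed
 have L2: "L2_sq (%x. exp (- f x / 2) *\<^sub>R v x) <= exp (N * e) * L2_sq (%x. exp (- (N * P x + g x) / 2) *\<^sub>R v x)"
 unfolding sq[symmetric]
 proof (rule L2_sq_mono(2))
 show "(%x. exp (- (N * P x + g x) / 2) *\<^sub>R v x) : L2"
 by (intro loc continuous_on_divide continuous_on_minus Phc continuous_on_const v) simp
 show "(%x. exp (- f x / 2) *\<^sub>R v x) : borel_measurable borel"
 by (intro borel_measurable_continuous_onI continuous_intros fc v(1)) simp
 show "norm (exp (- f x / 2) *\<^sub>R v x) <= exp (N * e / 2) * norm (exp (- (N * P x + g x) / 2) *\<^sub>R v x)" for x
 using ex(2)[of x] Kv(3)[of x] by (cases "x : Kv") (auto simp: S_def mult.assoc[symmetric] intro!: mult_right_mono)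
 qed
 have "3 * L2_sq (%x. exp (f x / 2) *\<^sub>R divz G x) * L2_sq (%x. exp (- f x / 2) *\<^sub>R v x)
 <= 3 * (exp (N * e) * L2_sq (%x. exp ((N * P x + g x) / 2) *\<^sub>R divz G x)) * (exp (N * e) * L2_sq (%x. exp (- (N * P x + g x) / 2) *\<^sub>R v x))"
 by (intro mult_mono L1 L2 order_refl mult_nonneg_nonneg L2_sq_nonneg) auto
 moreover have "exp (2 * N * e) = exp (N * e) * exp (N * e)" unfolding exp_add[symmetric] by (simp add: algebra_simps)
 ultimately show ?thesis using est by (simp add: mult_ac)
qed

text \<open>The data are fixed and both sides are free of the smoothing except for the factor exp (2
  N e), so e tends to 0.\<close>

lemma dbar_estimate:
 fixes v G :: "complex^'n => complex^'n"
 assumes g: "C2_on UNIV g g1 g2" "!!x t. (norm t)\<^sup>2 <= lev g2 x t" and N: "0 <= N"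
 and v: "continuous_on UNIV v" "supported Om v"
 and closed: "!!h j k. C1 h ==> supported Om h ==>
 (LBINT x. v x $ k * dzb (axis j 1) h x - v x $ j * dzb (axis k 1) h x) = 0"
 and G: "C1 G" "supported Om G"
 shows "(LBINT x. v x \<bullet> G x)\<^sup>2 <=
 3 * L2_sq (%x. exp ((N * P x + g x) / 2) *\<^sub>R divz G x) * L2_sq (%x. exp (- (N * P x + g x) / 2) *\<^sub>R v x)" (is "?A <= ?B")
proof (rule LIMSEQ_le_const)
 have "(%n. exp (2 * N * inverse (real (Suc (Suc n)))) * ?B) \<longlonglongrightarrow> exp (2 * N * 0) * ?B"
 by (intro tendsto_intros LIMSEQ_Suc[OF LIMSEQ_inverse_real_of_nat])
 then show "(%n. exp (2 * N * inverse (real (Suc (Suc n)))) * ?B) \<longlonglongrightarrow> ?B" by simp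
 show "\<exists>M. \<forall>n\<ge>M. ?A <= exp (2 * N * inverse (real (Suc (Suc n)))) * ?B"
 by (intro exI allI impI mollified_estimate[OF g N v closed G]) (auto simp: field_simps)
qed

text \<open>Duality. By the estimate, the pairing with v is a bounded functional of the weighted
  divergence of the test field. Its Riesz representative W, multiplied back by the weight, solves
  the equation weakly.\<close>

lemma dbar_solution:
 fixes v :: "complex^'n => complex^'n"
 assumes g: "C2_on UNIV g g1 g2" "!!x t. (norm t)\<^sup>2 <= lev g2 x t" and N: "0 <= N"
 and v: "continuous_on UNIV v" "supported Om v"
 and closed: "!!h j k. C1 h ==> supported Om h ==>
 (LBINT x. v x $ k * dzb (axis j 1) h x - v x $ j * dzb (axis k 1) h x) = 0"
 obtains W :: "complex^'n => complex" where "W : L2" "L2_sq W <= 3 * L2_sq (%x. exp (- (N * P x + g x) / 2) *\<^sub>R v x)"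
 "!!h j. C1 h ==> supported Om h ==>
 (LBINT x. v x $ j * h x) = - (LBINT x. of_real (exp ((N * P x + g x) / 2)) * W x * dzb (axis j 1) h x)"
proof -
 define E where "E x = exp ((N * P x + g x) / 2)" for x
 define C where "C = 3 * L2_sq (%x. exp (- (N * P x + g x) / 2) *\<^sub>R v x)"
 define T where "T = {G :: complex^'n => complex^'n. C1 G \<and> supported Om G}"
 define mm where "mm G = (%x. E x *\<^sub>R divz G x)" for G
 define b where "b G = (LBINT x. v x \<bullet> G x)" for G
 \<comment> \<open>Defined on weighted divergences through an arbitrary preimage; by the estimate,
   fields with equal divergence have equal pairings with v, so the choice does not matter.\<close>
 define l where "l m = - b (SOME G. G : T \<and> mm G = m)" for m
 have Ec: "continuous_on Om E" unfolding E_def[abs_def]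
 by (intro continuous_intros P_continuous continuous_on_subset[OF C2_on_continuous(1)[OF g(1)]]) auto
 have Eloc: "continuous_on UNIV (%x. of_real (E x) * m x)" "supported Om (%x. of_real (E x) * m x)"
 if "continuous_on UNIV m" "supported Om m" for m :: "complex^'n => complex"
 proof -
 show s: "supported Om (%x. of_real (E x) * m x)" by (rule supported_mult_left[OF that(2)])
 show "continuous_on UNIV (%x. of_real (E x) * m x)"
 by (rule local_continuous[OF open_domain _ s]) (intro continuous_intros Ec continuous_on_subset[OF that(1)], simp)
 qed
 have mL: "mm G : L2" if "G : T" for G
 unfolding mm_def scaleR_conv_of_real using that
 by (intro supported_continuous_L2[OF Eloc] divz_continuous supported_divz) (auto simp: T_def)
 have vG: "integrable lborel (%x. v x \<bullet> G x)" if "G : T" for G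
 by (rule supported_integrable[OF continuous_on_inner[OF v(1) C1_continuous] supported_mono[OF v(2)]]) (use that in \<open>auto simp: T_def\<close>)
 have badd: "b (%x. F x + G x) = b F + b G" and bsc: "b (%x. c *\<^sub>R F x) = c * b F" if "F : T" "G : T" for F G c
 unfolding b_def inner_add_right using that by (simp_all add: vG)
 have Tadd: "(%x. F x + G x) : T" and Tsc: "(%x. c *\<^sub>R F x) : T" if "F : T" "G : T" for F G c
 using that C1_add[of F G] supported_add[of Om F G] C1_bounded_linear[OF bounded_linear_scaleR_right, of F c]
 supported_mono[of Om F "%x. c *\<^sub>R F x"] by (simp_all add: T_def)
 have madd: "mm (%x. F x + G x) = (%x. mm F x + mm G x)" and msc: "mm (%x. c *\<^sub>R F x) = (%x. c *\<^sub>R mm F x)" if "F : T" "G : T" for F G c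
 using that by (auto simp: T_def mm_def divz_add divz_scaleR scaleR_add_right)
 have est: "(b G)\<^sup>2 <= C * L2_sq (mm G)" if "G : T" for G
 using dbar_estimate[OF g N v closed, of G] that unfolding b_def C_def mm_def E_def T_def by (simp add: mult_ac)
 have l: "l (mm G) = - b G" if G: "G : T" for G
 proof -
 define F where "F = (SOME F. F : T \<and> mm F = mm G)"
 have F: "F : T" "mm F = mm G" using someI_ex[of "%F. F : T \<and> mm F = mm G"] G unfolding F_def by blast+
 have n: "(%x. (-1) *\<^sub>R G x) : T" by (rule Tsc[OF G G])
 have "mm (%x. F x + (-1) *\<^sub>R G x) = (%x. 0)" unfolding madd[OF F(1) n] msc[OF G G] F(2) by auto
 then have "(b (%x. F x + (-1) *\<^sub>R G x))\<^sup>2 <= 0" using est[OF Tadd[OF F(1) n]] by (simp add: L2_sq_def)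
 then have "b F + (-1) * b G = 0" unfolding badd[OF F(1) n] bsc[OF G G] by simp
 then show ?thesis by (simp add: l_def F_def)
 qed
 have z: "(%x. 0) : T" by (auto simp: T_def C1_const supported_def)
 have "\<exists>W s. W : L2 \<and> L2_sq W <= C \<and> (\<forall>m\<in>mm ` T. L2_inner W m = l m) \<and> (\<forall>n::nat. s n : mm ` T) \<and> (%n. L2_sq (%x. s n x - W x)) \<longlonglongrightarrow> 0"
 proof (rule L2_riesz)
 show "mm ` T \<subseteq> L2" "mm ` T ~= {}" using mL z by auto
 fix f k assume "f : mm ` T" "k : mm ` T"
 then obtain F K where F: "F : T" "f = mm F" "K : T" "k = mm K" by auto
 show "(%x. f x + k x) : mm ` T" unfolding F madd[OF F(1,3), symmetric] by (intro imageI Tadd F)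
 show "l (%x. f x + k x) = l f + l k" unfolding F madd[OF F(1,3), symmetric] l[OF Tadd[OF F(1,3)]] l[OF F(1)] l[OF F(3)] badd[OF F(1,3)] by simp
 next
 fix c f assume "f : mm ` T"
 then obtain F where F: "F : T" "f = mm F" by auto
 show "(%x. c *\<^sub>R f x) : mm ` T" unfolding F msc[OF F(1,1), symmetric] by (intro imageI Tsc[OF F(1,1)])
 show "l (%x. c *\<^sub>R f x) = c * l f" unfolding F msc[OF F(1,1), symmetric] l[OF Tsc[OF F(1,1)]] l[OF F(1)] bsc[OF F(1,1)] by simp
 show "(l f)\<^sup>2 <= C * L2_sq f" unfolding F l[OF F(1)] using est[OF F(1)] by simp
 qed (simp add: C_def L2_sq_nonneg)
 then obtain W where W: "W : L2" "L2_sq W <= C" "!!G. G : T ==> L2_inner W (mm G) = - b G" using l by force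
 show ?thesis
 proof (rule that[OF W(1)])
 show "L2_sq W <= 3 * L2_sq (%x. exp (- (N * P x + g x) / 2) *\<^sub>R v x)" using W(2) by (simp add: C_def)
 fix h :: "complex^'n => complex" and j assume h: "C1 h" "supported Om h"
 have vi: "integrable lborel (%x. v x $ j * h x)" if "C1 h" "supported Om h" for h
 by (rule supported_integrable[OF continuous_on_mult[OF continuous_on_component[OF v(1)] C1_continuous[OF that(1)]] supported_mult_left[OF that(2)]])
 have wi: "integrable lborel (%x. of_real (E x) * W x * dzb (axis j 1) h x)" if "C1 h" "supported Om h" for h
 using L2_mult_continuous(2)[OF W(1) Eloc[OF dzb_continuous[OF that(1)] supported_dzb[OF that(2)]]]
 by (simp add: mult_ac)
 define Z where "Z h = (LBINT x. v x $ j * h x) + (LBINT x. of_real (E x) * W x * dzb (axis j 1) h x)" for h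
 have Re0: "Re (Z h) = 0" if h: "C1 h" "supported Om h" for h
 proof -
 \<comment> \<open>A field with the single component cnj h: its divergence is the conjugate of
   \<open>dzb (axis j 1) h\<close>, and the real inner products become real parts of complex
   pairings.\<close>
 define G where "G x = (axis j (cnj (h x)) :: complex^'n)" for x
 have ac: "(axis j c :: complex^'n) = c *s axis j 1" for c :: complex by (simp add: vec_eq_iff axis_def)
 have na: "norm (axis j c :: complex^'n) = cmod c" for c :: complex unfolding ac[of c] norm_vector_scalar_mult by simp
 have bl: "bounded_linear (%c::complex. axis j (cnj c) :: complex^'n)"
 by (rule bounded_linear_intro[of _ 1]) (simp_all add: na, simp_all add: vec_eq_iff axis_def)
 have "(axis j 0 :: complex^'n) = 0" by (simp add: vec_eq_iff axis_def)
 then have G: "G : T" unfolding T_def G_def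
 using C1_bounded_linear[OF bl h(1)] supported_mono[OF h(2), of "%x. axis j (cnj (h x)) :: complex^'n"] by simp
 have "(%x. G x $ i) = (if i = j then (%x. cnj (h x)) else (%x. 0))" for i by (auto simp: G_def axis_def)
 moreover have "dz u (%x. 0) x = 0" for u x
 using dd_eqI[of "%_. 0::complex" "%_. 0" x] by (simp add: dz_def)
 ultimately have "divz G x = (\<Sum>i\<in>UNIV. if i = j then cnj (dzb (axis j 1) h x) else 0)" for x
 unfolding divz_def by (intro sum.cong) (auto simp: dz_cnj[OF h(1)])
 then have dG: "divz G x = cnj (dzb (axis j 1) h x)" for x by simp
 have "b G = (LBINT x. Re (v x $ j * h x))" by (simp add: b_def G_def inner_axis_complex)
 moreover have "L2_inner W (mm G) = (LBINT x. Re (of_real (E x) * W x * dzb (axis j 1) h x))"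
 unfolding L2_inner_def mm_def dG by (rule Bochner_Integration.integral_cong) (auto simp: inner_complex_def algebra_simps)
 ultimately show ?thesis using W(3)[OF G] unfolding integral_Re_complex[OF vi[OF h]] integral_Re_complex[OF wi[OF h]] by (simp add: Z_def)
 qed
 have ih: "C1 (%x. \<i> * h x)" "supported Om (%x. \<i> * h x)" by (rule C1_cmult[OF h(1)], rule supported_mult_left[OF h(2)])
 have "Z (%x. \<i> * h x) = (LBINT x. \<i> * (v x $ j * h x)) + (LBINT x. \<i> * (of_real (E x) * W x * dzb (axis j 1) h x))"
 unfolding Z_def by (simp add: dzb_cmult[OF h(1)] mult_ac)
 also have "... = \<i> * Z h" unfolding Z_def by (simp add: distrib_left)
 finally have "Z h = 0" using complex_eq_0_from_Re[OF Re0[OF h]] Re0[OF ih] by simp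
 then show "(LBINT x. v x $ j * h x) = - (LBINT x. of_real (exp ((N * P x + g x) / 2)) * W x * dzb (axis j 1) h x)"
 by (simp add: Z_def E_def eq_neg_iff_add_eq_0)
 qed
qed

end

section \<open>Weyl's lemma for the \<partial>-bar operator\<close>

lemma dzb_kerc:
 fixes x :: "complex^'n"
 shows "dzb (axis j 1) (kerc t x) y = of_real (3 * pw 2 (t - (x - y) \<bullet> (x - y))) * (x - y) $ j"
proof -
 have "\<i> *s (axis j 1 :: complex^'n) = axis j \<i>" by (simp add: vec_eq_iff axis_def)
 moreover define q where "q = pw 2 (t - (x - y) \<bullet> (x - y))"
 ultimately show ?thesis unfolding dzb_def kerc_C1(2) gker_def q_def[symmetric]
 by (simp add: inner_axis_complex complex_eq_iff field_simps)
qed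

text \<open>One third of the derivative of \<open>ker t z\<close> in t, and also the scalar factor
  in its gradient.\<close>

definition ker2 :: "real => 'a::euclidean_space => real" where "ker2 t z = pw 2 (t - z \<bullet> z)"

lemma ker2_eq_0: "z \<notin> cball 0 (sqrt t) ==> ker2 t z = 0"
 unfolding ker2_def by (rule pw_eq_0[OF outside_sqrt]) auto

lemma ker2_conv_integrable:
 fixes f :: "'a::euclidean_space => 'b::euclidean_space"
 assumes "integrable lborel f" shows "integrable lborel (%y. ker2 t (x - y) *\<^sub>R f y)"
proof -
 have "continuous_on UNIV (ker2 t :: 'a => real)" unfolding ker2_def[abs_def] by (intro continuous_intros)
 then show ?thesis by (rule conv_integrable[OF _ ker2_eq_0 assms])
qed

text \<open>Testing with \<open>cnj (y - x)\<^sub>j (t - |x - y|\<^sup>2)\<^sup>3\<close> gives an Euler type equation in \<open>t\<close> for the unnormalised means.\<close>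

lemma weakly_holomorphic_means:
 fixes f :: "complex^'n => complex"
 assumes f: "integrable lborel f"
 and weak: "!!h j. C1 h ==> supported D h ==> (LBINT y. f y * dzb (axis j 1) h y) = 0" and D: "cball x (sqrt t) \<subseteq> D"
 shows "(real CARD('n) + 3) *\<^sub>R conv (ker t) f x = (3 * t) *\<^sub>R conv (ker2 t) f x"
proof -
 define c where "c j y = cnj ((y - x) $ j)" for j y
 define H where "H j y = c j y * kerc t x y" for j y
 have "((%y. y - x) has_derivative (%v. v)) (at y)" for y by (auto intro!: derivative_eq_intros)
 then have cd: "(c j has_derivative (%v. cnj (v $ j))) (at y)" for j y unfolding c_def[abs_def]
 by (rule bounded_linear.has_derivative[OF bounded_linear_compose[OF bounded_linear_cnj bounded_linear_vec_nth]])
 have c1: "C1 (c j)" for j by (rule C1I[OF cd]) (rule continuous_on_const)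
 have dc: "dzb (axis j 1) (c j) y = 1" for j y
 unfolding dzb_def dd_eqI[OF cd] by (simp add: axis_def)
 have H: "C1 (H j)" "supported D (H j)" for j
 unfolding H_def[abs_def] by (intro C1_mult c1 kerc_C1, intro supported_mult_left kerc_supported D)
 have dH: "(\<Sum>j\<in>UNIV. dzb (axis j 1) (H j) y) = of_real ((real CARD('n) + 3) * ker t (x - y) - 3 * t * ker2 t (x - y))" for y
 proof -
 have s: "(\<Sum>j\<in>UNIV. c j y * (x - y) $ j) = - of_real ((x - y) \<bullet> (x - y))"
 proof -
 have "c j y * (x - y) $ j = - ((x - y) $ j * cnj ((x - y) $ j))" for j by (simp add: c_def algebra_simps)
 moreover have "(\<Sum>j\<in>UNIV. (x - y) $ j * cnj ((x - y) $ j)) = of_real (\<Sum>j\<in>UNIV. (cmod ((x - y) $ j))\<^sup>2)"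
 by (simp only: complex_norm_square[symmetric] of_real_sum)
 moreover then have "(x - y) \<bullet> (x - y) = (\<Sum>j\<in>UNIV. (cmod ((x - y) $ j))\<^sup>2)"
 by (simp only: inner_vec_complex Re_complex_of_real)
 ultimately show ?thesis by (simp only: sum_negf)
 qed
 have "dzb (axis j 1) (H j) y = kerc t x y + of_real (3 * ker2 t (x - y)) * (c j y * (x - y) $ j)" for j
 unfolding H_def[abs_def] dzb_mult[OF c1 kerc_C1(1)] dzb_kerc dc ker2_def by simp
 then have "(\<Sum>j\<in>UNIV. dzb (axis j 1) (H j) y) = of_real (real CARD('n) * ker t (x - y) - 3 * (ker2 t (x - y) * ((x - y) \<bullet> (x - y))))"
 by (simp add: sum.distrib sum_distrib_left[symmetric] s[unfolded vector_minus_component] kerc_def)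
 \<comment> \<open>Writing |x - y|^2 as t - (t - |x - y|^2) raises \<open>ker2\<close> to
   \<open>ker\<close>. This yields the summand 3, while the dimension comes from differentiating the
   conjugate coordinates.\<close>
 moreover have "ker2 t (x - y) * ((x - y) \<bullet> (x - y)) = t * ker2 t (x - y) - ker t (x - y)"
 using pw_mult_arg[of 2 "t - (x - y) \<bullet> (x - y)"] by (simp add: ker2_def ker_def algebra_simps)
 ultimately show ?thesis by (simp only:) (simp add: algebra_simps)
 qed
 have i: "integrable lborel (%y. f y * dzb (axis j 1) (H j) y)" for j
 proof -
 have "f : borel_measurable borel" using borel_measurable_integrable[OF f] by simp
 moreover have "continuous_on UNIV (dzb (axis j 1) (H j))" by (rule dzb_continuous[OF H(1)])
 moreover obtain B where "!!y. norm (dzb (axis j 1) (H j) y) <= B"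
 using supported_bounded[OF dzb_continuous[OF H(1)] supported_dzb[OF H(2)]] by metis
 ultimately have "integrable lborel (%y. dzb (axis j 1) (H j) y * f y)"
 by (intro Bochner_Integration.integrable_bound[OF integrable_mult_right[OF integrable_norm[OF f], of B]])
 (auto simp: norm_mult borel_measurable_continuous_onI abs_mult intro!: borel_measurable_times mult_right_mono order_trans[OF _ abs_ge_self])
 then show ?thesis by (simp add: mult.commute)
 qed
 have "0 = (\<Sum>j\<in>UNIV. LBINT y. f y * dzb (axis j 1) (H j) y)" using weak[OF H] by simp
 also have "... = (LBINT y. (\<Sum>j\<in>UNIV. f y * dzb (axis j 1) (H j) y))"
 by (rule Bochner_Integration.integral_sum[symmetric]) (rule i)
 also have "... = (LBINT y. (real CARD('n) + 3) *\<^sub>R (ker t (x - y) *\<^sub>R f y) - (3 * t) *\<^sub>R (ker2 t (x - y) *\<^sub>R f y))"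
 by (rule Bochner_Integration.integral_cong) (simp_all only: sum_distrib_left[symmetric] dH, simp add: scaleR_conv_of_real algebra_simps)
 also have "... = (real CARD('n) + 3) *\<^sub>R conv (ker t) f x - (3 * t) *\<^sub>R conv (ker2 t) f x"
 unfolding conv_def using conv_ker_integrable[OF f] ker2_conv_integrable[OF f]
 by (simp only: Bochner_Integration.integral_diff integrable_scaleR_right integral_scaleR_right)
 finally show ?thesis by simp
qed

text \<open>The error has to be uniform for all s <= T, because s = t - |x - y|^2 is unbounded
  below. The cases are given by the signs of s and s + h.\<close>

lemma pw_taylor:
 assumes "s <= T" "0 <= T" "\<bar>h\<bar> <= 1"
 shows "\<bar>pw 3 (s + h) - pw 3 s - 3 * h * pw 2 s\<bar> <= 5 * (T + 1) * h\<^sup>2"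
proof -
 have le: "\<bar>u * h\<^sup>2\<bar> <= 5 * (T + 1) * h\<^sup>2" if "\<bar>u\<bar> <= 5 * (T + 1)" for u
 using mult_right_mono[OF that, of "h\<^sup>2"] by (simp add: abs_mult)
 consider "0 <= s" "0 <= s + h" | "0 <= s" "s + h < 0" | "s < 0" by linarith
 then show ?thesis
 proof cases
 case 1
 then have "pw 3 (s + h) - pw 3 s - 3 * h * pw 2 s = (3 * s + h) * h\<^sup>2"
 by (simp add: pw_def power2_eq_square power3_eq_cube algebra_simps)
 then show ?thesis using le[of "3 * s + h"] 1 assms by (simp only:) (simp add: abs_le_iff)
 next
 case 2
 then have s2: "s\<^sup>2 <= h\<^sup>2" by (intro abs_le_square_iff[THEN iffD1]) auto
 have "pw 3 (s + h) - pw 3 s - 3 * h * pw 2 s = - (s + 3 * h) * s\<^sup>2"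
 using 2 by (simp add: pw_def power2_eq_square power3_eq_cube algebra_simps)
 then have "\<bar>pw 3 (s + h) - pw 3 s - 3 * h * pw 2 s\<bar> = \<bar>- (s + 3 * h)\<bar> * s\<^sup>2" by (simp only: abs_mult abs_power2)
 also have "... <= 5 * (T + 1) * h\<^sup>2" using 2 assms by (intro mult_mono s2) (auto simp: abs_le_iff)
 finally show ?thesis .
 next
 case 3
 then have "max 0 (s + h) <= \<bar>h\<bar>" by auto
 then have "(max 0 (s + h)) ^ 3 <= \<bar>h\<bar> ^ 3" by (rule power_mono) simp
 also have "... = \<bar>h\<bar> * h\<^sup>2" by (simp add: power3_eq_cube power2_eq_square flip: abs_mult)
 also have "... <= 5 * (T + 1) * h\<^sup>2" using assms by (intro mult_right_mono) auto
 finally show ?thesis using 3 by (simp add: pw_def max_def split: if_splits)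
 qed
qed

lemma conv_ker_deriv_radius:
 fixes f :: "'a::euclidean_space => 'b::euclidean_space"
 assumes f: "integrable lborel f" and t: "0 <= t"
 shows "((%t. conv (ker t) f x) has_vector_derivative 3 *\<^sub>R conv (ker2 t) f x) (at t)"
 unfolding has_vector_derivative_def has_derivative_at_alt
proof (intro conjI allI impI)
 show "bounded_linear (%h. h *\<^sub>R 3 *\<^sub>R conv (ker2 t) f x)" by (rule bounded_linear_scaleR_left)
 fix e :: real assume e: "0 < e"
 define I where "I = 5 * (t + 1) * (LBINT y. norm (f y))"
 have I: "0 <= I" using t by (simp add: I_def)
 have main: "norm (conv (ker (t + h)) f x - conv (ker t) f x - h *\<^sub>R 3 *\<^sub>R conv (ker2 t) f x) <= I * h\<^sup>2" if h: "\<bar>h\<bar> <= 1" for h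
 proof -
 note i = conv_ker_integrable[OF f, of "t + h" x] conv_ker_integrable[OF f, of t x] ker2_conv_integrable[OF f, of t x]
 define k where "k y = ker (t + h) (x - y) - ker t (x - y) - 3 * h * ker2 t (x - y)" for y
 have "conv (ker (t + h)) f x - conv (ker t) f x - h *\<^sub>R 3 *\<^sub>R conv (ker2 t) f x
 = (LBINT y. ker (t + h) (x - y) *\<^sub>R f y - ker t (x - y) *\<^sub>R f y - h *\<^sub>R 3 *\<^sub>R (ker2 t (x - y) *\<^sub>R f y))"
 unfolding conv_def using i
 by (simp only: Bochner_Integration.integral_diff Bochner_Integration.integrable_diff integrable_scaleR_right integral_scaleR_right)
 also have "... = (LBINT y. k y *\<^sub>R f y)"
 by (rule Bochner_Integration.integral_cong) (simp_all add: k_def algebra_simps)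
 finally have eq: "conv (ker (t + h)) f x - conv (ker t) f x - h *\<^sub>R 3 *\<^sub>R conv (ker2 t) f x = (LBINT y. k y *\<^sub>R f y)" .
 have ki: "integrable lborel (%y. k y *\<^sub>R f y)"
 using Bochner_Integration.integrable_diff[OF Bochner_Integration.integrable_diff[OF i(1,2)] integrable_scaleR_right[OF i(3), of "3 * h"]]
 by (simp add: k_def scaleR_diff_left)
 have "\<bar>k y\<bar> <= 5 * (t + 1) * h\<^sup>2" for y
 proof -
 define q where "q = (x - y) \<bullet> (x - y)"
 have "0 <= q" by (simp add: q_def)
 then show ?thesis using pw_taylor[of "t - q" t h] t h
 by (simp add: k_def ker_def ker2_def q_def[symmetric] diff_add_eq)
 qed
 then have "norm (k y *\<^sub>R f y) <= 5 * (t + 1) * h\<^sup>2 * norm (f y)" for y by (simp add: mult_right_mono)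
 moreover have "integrable lborel (%y. 5 * (t + 1) * h\<^sup>2 * norm (f y))" by (intro integrable_mult_right integrable_norm f)
 ultimately have "norm (LBINT y. k y *\<^sub>R f y) <= (LBINT y. 5 * (t + 1) * h\<^sup>2 * norm (f y))"
 by (intro Bochner_Integration.integral_norm_bound_integral ki) auto
 then show ?thesis unfolding eq by (simp add: I_def mult_ac)
 qed
 show "\<exists>d>0. \<forall>y. norm (y - t) < d \<longrightarrow> norm (conv (ker y) f x - conv (ker t) f x - (y - t) *\<^sub>R 3 *\<^sub>R conv (ker2 t) f x) <= e * norm (y - t)"
 proof (intro exI conjI allI impI)
 show "0 < min 1 (e / (I + 1))" using e I by simp
 fix y assume y: "norm (y - t) < min 1 (e / (I + 1))"
 then have "\<bar>y - t\<bar> * (I + 1) <= e" using I by (simp add: pos_less_divide_eq)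
 then have "I * \<bar>y - t\<bar> <= e" using I by (simp add: algebra_simps)
 then have "I * \<bar>y - t\<bar> * \<bar>y - t\<bar> <= e * \<bar>y - t\<bar>" by (rule mult_right_mono) simp
 then show "norm (conv (ker y) f x - conv (ker t) f x - (y - t) *\<^sub>R 3 *\<^sub>R conv (ker2 t) f x) <= e * norm (y - t)"
 using main[of "y - t"] y by (simp add: power2_eq_square mult.assoc)
 qed
qed

text \<open>The unnormalised mean a (ta) satisfies ta a' = (n + 3) a by the Euler type equation, so
  a (ta) / ta^(n + 3) is constant.\<close>

lemma conv_ker_scaling:
 fixes f :: "complex^'n => complex"
 assumes f: "integrable lborel f"
 and weak: "!!h j. C1 h ==> supported D h ==> (LBINT y. f y * dzb (axis j 1) h y) = 0"
 and D: "cball x (sqrt t) \<subseteq> D" and st: "0 < s" "s <= t"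
 shows "(1 / s) ^ (CARD('n) + 3) *\<^sub>R conv (ker s) f x = (1 / t) ^ (CARD('n) + 3) *\<^sub>R conv (ker t) f x"
proof -
 define m where "m = CARD('n) + 2"
 define a where "a ta = conv (ker ta) f x" for ta
 have der: "((%ta. (1 / ta) ^ Suc m *\<^sub>R a ta) has_vector_derivative 0) (at ta within {s..t})" if ta: "ta : {s..t}" for ta
 proof -
 have p: "0 < ta" using ta st by auto
 have "cball x (sqrt ta) \<subseteq> D" by (rule order_trans[OF subset_cball D]) (use ta in simp)
 from weakly_holomorphic_means[OF f weak this] have "real (Suc m) *\<^sub>R a ta = ta *\<^sub>R (3 *\<^sub>R conv (ker2 ta) f x)"
 by (simp add: a_def m_def mult.commute add_ac)
 then have eq: "3 *\<^sub>R conv (ker2 ta) f x = (real (Suc m) / ta) *\<^sub>R a ta" using p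
 by (metis divide_inverse_commute nonzero_inverse_eq_divide scaleR_scaleR scaleR_one less_irrefl left_inverse inverse_eq_divide)
 have "(a has_vector_derivative 3 *\<^sub>R conv (ker2 ta) f x) (at ta)" unfolding a_def using p by (intro conv_ker_deriv_radius[OF f]) simp
 moreover have "((%ta. (1 / ta) ^ Suc m) has_real_derivative real (Suc m) * (1 / ta) ^ m * (- 1 / ta\<^sup>2)) (at ta)"
 proof -
 have "((%ta. 1 / ta) has_real_derivative - 1 / ta\<^sup>2) (at ta)"
 using p by (auto intro!: derivative_eq_intros simp: power2_eq_square)
 from DERIV_power_Suc[OF this, of m] show ?thesis by (simp add: algebra_simps add_divide_distrib)
 qed
 ultimately have "((%ta. (1 / ta) ^ Suc m *\<^sub>R a ta) has_vector_derivative
 (1 / ta) ^ Suc m *\<^sub>R ((real (Suc m) / ta) *\<^sub>R a ta) + (real (Suc m) * (1 / ta) ^ m * (- 1 / ta\<^sup>2)) *\<^sub>R a ta) (at ta)"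
 unfolding eq by (intro has_vector_derivative_scaleR)
 moreover have "(1 / ta) ^ Suc m *\<^sub>R ((real (Suc m) / ta) *\<^sub>R a ta) + (real (Suc m) * (1 / ta) ^ m * (- 1 / ta\<^sup>2)) *\<^sub>R a ta
 = ((1 / ta) ^ Suc m * (real (Suc m) / ta) + real (Suc m) * (1 / ta) ^ m * (- 1 / ta\<^sup>2)) *\<^sub>R a ta"
 by (simp only: scaleR_scaleR scaleR_add_left)
 moreover have "(1 / ta) ^ Suc m * (real (Suc m) / ta) + real (Suc m) * (1 / ta) ^ m * (- 1 / ta\<^sup>2) = 0"
 by (simp add: power2_eq_square)
 ultimately have "((%ta. (1 / ta) ^ Suc m *\<^sub>R a ta) has_vector_derivative 0) (at ta)" by (simp only: scaleR_zero_left)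
 then show ?thesis by (rule has_vector_derivative_at_within)
 qed
 obtain c where "!!ta. ta : {s..t} ==> (1 / ta) ^ Suc m *\<^sub>R a ta = c"
 using has_vector_derivative_zero_constant[OF convex_closed_interval der] unfolding is_interval_cc by (metis convex_real_interval(5))
 then have "(1 / s) ^ Suc m *\<^sub>R a s = (1 / t) ^ Suc m *\<^sub>R a t" using st by (metis atLeastAtMost_iff order_refl)
 then show ?thesis by (simp only: a_def m_def add_Suc_right[symmetric]) (simp add: numeral_3_eq_3 numeral_2_eq_2)
qed

text \<open>The scaling law also applies to the constant 1 on the ball, whose means are the kernel
  masses; the same power of the radius cancels in the quotient.\<close>

lemma moll_indep:
 fixes f :: "complex^'n => complex"
 assumes f: "integrable lborel f"
 and weak: "!!h j. C1 h ==> supported D h ==> (LBINT y. f y * dzb (axis j 1) h y) = 0"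
 and D: "cball x (sqrt t) \<subseteq> D" and st: "0 < s" "s <= t"
 shows "moll s f x = moll t f x"
proof -
 let ?K = "cball x (sqrt t)"
 define one where "one y = (if y : ?K then 1 else 0 :: complex)" for y
 have "integrable lborel (indicator ?K :: complex^'n => real)"
 by (rule integrable_real_indicator[OF _ emeasure_bounded_finite]) auto
 from integrable_scaleR_left[OF this, of "1::complex"] have one: "integrable lborel one"
 by (rule Bochner_Integration.integrable_cong[THEN iffD1, rotated 2]) (auto simp: one_def indicator_def)
 have w1: "(LBINT y. one y * dzb (axis j 1) h y) = 0" if h: "C1 h" "supported ?K h" for h j
 proof -
 obtain L where L: "compact L" "L \<subseteq> ?K" "\<forall>y. y \<notin> L \<longrightarrow> h y = 0" using h(2) by (auto simp: supported_def)
 have "dzb (axis j 1) h y = 0" if "y \<notin> ?K" for y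
 proof -
 have "y \<notin> L" using that L(2) by blast
 then show ?thesis using L dd_eq_0_outside[of L h y] by (simp add: dzb_def compact_imp_closed)
 qed
 then have "(%y. one y * dzb (axis j 1) h y) = (%y. 1 * dzb (axis j 1) h y)" by (auto simp: one_def)
 moreover have "dzb u (%_. 1) y = 0" for u and y :: "complex^'n" using dd_eqI[of "%_. 1::complex" "%_. 0" y] by (simp add: dzb_def)
 ultimately show ?thesis using integral_dzb_by_parts[OF C1_const[of 1] h, of "axis j 1"] by simp
 qed
 have k: "conv (ker ta) one x = of_real (kmass ta TYPE(complex^'n))" if "ta <= t" for ta
 proof -
 have "ker ta (x - y) *\<^sub>R one y = of_real (ker ta (x - y))" for y
 proof (cases "y : ?K")
 case False
 moreover have "sqrt ta <= sqrt t" by (rule real_sqrt_le_mono[OF that])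
 ultimately have "sqrt ta < dist x y" unfolding mem_cball by linarith
 then have "x - y \<notin> cball 0 (sqrt ta)" by (simp add: dist_norm norm_minus_commute)
 then show ?thesis by (simp add: ker_eq_0)
 qed (simp add: one_def scaleR_conv_of_real)
 then show ?thesis using integral_ker_shift[of ta x] by (simp add: conv_def)
 qed
 define A B where "A = (1 / s) ^ (CARD('n) + 3)" and "B = (1 / t) ^ (CARD('n) + 3)"
 have AB: "0 < A" "0 < B" using st by (auto simp: A_def B_def)
 have "A *\<^sub>R conv (ker s) f x = B *\<^sub>R conv (ker t) f x" unfolding A_def B_def by (rule conv_ker_scaling[OF f weak D st])
 moreover have "A *\<^sub>R conv (ker s) one x = B *\<^sub>R conv (ker t) one x" unfolding A_def B_def by (rule conv_ker_scaling[OF one w1 order_refl st])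
 then have "complex_of_real (A * kmass s TYPE(complex^'n)) = of_real (B * kmass t TYPE(complex^'n))"
 using st by (simp add: k scaleR_conv_of_real)
 then have "A * kmass s TYPE(complex^'n) = B * kmass t TYPE(complex^'n)" unfolding of_real_eq_iff .
 moreover have "moll ta f x = (c *\<^sub>R conv (ker ta) f x) /\<^sub>R (c * kmass ta TYPE(complex^'n))" if "0 < c" for c ta
 using that by (simp add: moll_def)
 ultimately show ?thesis using AB by metis
qed

text \<open>The means over small balls agree for all radii and so define F without a limit. Near a
  point F is a mollification with fixed radius, hence C1, and its \<partial>-bar derivative is a
  pairing of w with the derivative of a test function, which is 0.\<close>

lemma weyl_lemma:
 fixes w :: "complex^'n => complex"
 assumes Om: "open Om" and int: "!!K. compact K ==> K \<subseteq> Om ==> integrable lborel (%x. indicator K x *\<^sub>R w x)"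
 and weak: "!!h j. C1 h ==> supported Om h ==> (LBINT y. w y * dzb (axis j 1) h y) = 0"
 obtains F where "F holomorphic_on_Cn Om" "!!x t. 0 < t ==> cball x (sqrt t) \<subseteq> Om ==> F x = moll t w x"
proof -
 define f where "f K y = indicator K y *\<^sub>R w y" for K y
 have loc: "moll t w x = moll t (f K) x" if "cball x (sqrt t) \<subseteq> K" for t x K
 proof -
 have "ker t (x - y) *\<^sub>R w y = ker t (x - y) *\<^sub>R f K y" for y
 proof (cases "y : K")
 case False
 then have "y \<notin> cball x (sqrt t)" using that by blast
 then have "ker t (x - y) = 0" by (intro ker_eq_0) (simp add: dist_norm norm_minus_commute)
 then show ?thesis by simp
 qed (simp add: f_def)
 then have "(%y. ker t (x - y) *\<^sub>R w y) = (%y. ker t (x - y) *\<^sub>R f K y)" by (rule ext)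
 then show ?thesis by (simp only: moll_def conv_def)
 qed
 have weakK: "(LBINT y. f K y * dzb (axis j 1) h y) = 0" if K: "compact K" "K \<subseteq> Om" and h: "C1 h" "supported K h" for K h j
 proof -
 obtain L where L: "compact L" "L \<subseteq> K" "\<forall>y. y \<notin> L \<longrightarrow> h y = 0" using h(2) by (auto simp: supported_def)
 have "dzb (axis j 1) h y = 0" if "y \<notin> K" for y
 proof -
 have "y \<notin> L" using that L(2) by blast
 then show ?thesis using L dd_eq_0_outside[of L h y] by (simp add: dzb_def compact_imp_closed)
 qed
 then have "(%y. f K y * dzb (axis j 1) h y) = (%y. w y * dzb (axis j 1) h y)" by (auto simp: f_def indicator_def)
 then show ?thesis using weak[OF h(1) supported_subset[OF h(2) K(2)]] by simp
 qed
 have indep: "moll s w x = moll t w x" if "0 < s" "s <= t" "cball x (sqrt t) \<subseteq> Om" for s t x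
 proof -
 let ?K = "cball x (sqrt t)"
 have "cball x (sqrt s) \<subseteq> ?K" by (rule subset_cball[OF real_sqrt_le_mono[OF that(2)]])
 then have "moll s w x = moll s (f ?K) x" "moll t w x = moll t (f ?K) x" by (simp_all add: loc)
 moreover have "integrable lborel (f ?K)" unfolding f_def[abs_def] by (rule int[OF compact_cball that(3)])
 then have "moll s (f ?K) x = moll t (f ?K) x"
 by (rule moll_indep[OF _ weakK[OF compact_cball that(3)] order_refl that(1,2)])
 ultimately show ?thesis by simp
 qed
 have "\<exists>t>0. cball x (sqrt t) \<subseteq> Om" if "x : Om" for x
 proof -
 obtain e where "e > 0" "cball x e \<subseteq> Om" using open_contains_cball_eq[OF Om] \<open>x : Om\<close> by blast
 then show ?thesis by (intro exI[of _ "e\<^sup>2"]) auto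
 qed
 then obtain ta where ta: "!!x. x : Om ==> 0 < ta x" "!!x. x : Om ==> cball x (sqrt (ta x)) \<subseteq> Om" by metis
 define F where "F x = moll (ta x) w x" for x
 have F: "F x = moll t w x" if t: "0 < t" "cball x (sqrt t) \<subseteq> Om" for x t
 proof -
 have x: "x : Om" using t centre_in_cball[of x "sqrt t"] by (auto simp del: centre_in_cball)
 show ?thesis unfolding F_def
 proof (cases "t <= ta x")
 case True
 show "moll (ta x) w x = moll t w x" by (rule indep[OF t(1) True ta(2)[OF x], symmetric])
 next
 case False
 then show "moll (ta x) w x = moll t w x" by (intro indep[OF ta(1)[OF x] _ t(2)]) simp
 qed
 qed
 have "F holomorphic_on_Cn Om" unfolding holomorphic_on_Cn_def
 proof
 fix x0 assume "x0 : Om"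
 then obtain e where e: "e > 0" "cball x0 e \<subseteq> Om" using open_contains_cball_eq[OF Om] by blast
 define r where "r = e / 2"
 define g where "g = f (cball x0 e)"
 have r: "0 < r" "sqrt (r\<^sup>2) = r" using e by (auto simp: r_def)
 have cb: "cball x r \<subseteq> cball x0 e" if "x : ball x0 r" for x
 proof
 fix y assume "y : cball x r"
 then show "y : cball x0 e" using that dist_triangle[of x0 y x] unfolding mem_cball mem_ball r_def by linarith
 qed
 have gi: "integrable lborel g" unfolding g_def f_def[abs_def] by (rule int[OF compact_cball e(2)])
 have FG: "F x = moll (r\<^sup>2) g x" if "x : ball x0 r" for x
 unfolding g_def using loc[of x "r\<^sup>2" "cball x0 e"] F[of "r\<^sup>2" x] r cb[OF that] e(2) by auto
 define L where "L v = dd (moll (r\<^sup>2) g) v x0" for v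
 have "(moll (r\<^sup>2) g has_derivative L) (at x0)" unfolding L_def by (rule C1_has_derivative[OF C1_moll[OF gi]])
 then have FL: "(F has_derivative L) (at x0)"
 by (rule has_derivative_transform_within_open[OF _ open_ball[of x0 r]]) (use r FG in auto)
 have "supported (cball x0 e) (kerc (r\<^sup>2) x0)" using cb[of x0] r by (intro kerc_supported) auto
 then have "(LBINT y. g y * dzb (axis j 1) (kerc (r\<^sup>2) x0) y) = 0" for j
 unfolding g_def by (rule weakK[OF compact_cball e(2) kerc_C1(1)])
 then have d0: "dzb (axis j 1) (moll (r\<^sup>2) g) x0 = 0" for j unfolding dzb_moll(1)[OF gi] by simp
 then have Li: "L (\<i> *s axis j 1) = \<i> * L (axis j 1)" for j
 proof -
 have "L (axis j 1) + \<i> * L (\<i> *s axis j 1) = 0" using d0[of j] by (simp add: dzb_def L_def)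
 then have "\<i> * (L (axis j 1) + \<i> * L (\<i> *s axis j 1)) = 0" by simp
 then show ?thesis by (simp add: algebra_simps)
 qed
 have lin: "linear L" unfolding L_def by (rule C1_dd_linear[OF C1_moll[OF gi]])
 have La: "L (c *s axis j 1) = c * L (axis j 1)" for c j
 unfolding complex_scale_decomp[of c "axis j 1"] linear_add[OF lin] linear_scale[OF lin] Li
 by (simp add: scaleR_conv_of_real complex_eq_iff)
 have Lv: "L v = (\<Sum>j\<in>UNIV. v $ j * L (axis j 1))" for v
 proof -
 have "L v = L (\<Sum>j\<in>UNIV. v $ j *s axis j 1)" using vec_expansion[of v] by simp
 also have "... = (\<Sum>j\<in>UNIV. v $ j * L (axis j 1))" unfolding linear_sum[OF lin] La ..
 finally show ?thesis .
 qed
 have Lc: "L (c *s u) = c * L u" for c u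
 unfolding Lv[of "c *s u"] Lv[of u] by (simp add: sum_distrib_left mult.assoc)
 have "Vector_Spaces.linear (*s) (*) L" unfolding clinear_iff using linear_add[OF lin] Lc by blast
 then show "\<exists>f'. (F has_derivative f') (at x0) \<and> Vector_Spaces.linear (*s) (*) f'" using FL by blast
 qed
 then show ?thesis using F by (rule that)
qed

text \<open>Cauchy-Schwarz for the kernel times exp (Ph / 2) against W. One factor of the squared
  kernel is bounded by its maximum t^3, the other integrates to the mass and cancels one of the two
  masses of the normalisation.\<close>

lemma moll_exp_bound:
 fixes W w :: "complex^'n => complex"
 assumes W: "W : L2" and t: "0 < t" and Ph: "continuous_on (cball x (sqrt t)) Ph" "!!y. y : cball x (sqrt t) ==> Ph y <= b"
 and w: "!!y. y : cball x (sqrt t) ==> w y = k - of_real (exp (Ph y / 2)) * W y"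
 shows "(cmod (moll t w x - k))\<^sup>2 <= t ^ 3 * exp b / kmass t TYPE(complex^'n) * L2_sq W"
proof -
 let ?B = "cball x (sqrt t)" and ?m = "kmass t TYPE(complex^'n)"
 have m: "0 < ?m" by (rule kmass_pos[OF t])
 define q where "q y = indicator ?B y *\<^sub>R (ker t (x - y) * exp (Ph y / 2))" for y
 have c: "continuous_on ?B (%y. ker t (x - y) * exp (Ph y / 2))" by (intro continuous_intros Ph(1)) auto
 obtain C where C: "!!y. norm (q y) <= C" "q : borel_measurable borel"
 unfolding q_def[abs_def] by (rule bounded_multiplier[OF compact_cball c]) blast
 obtain rh where "?B \<subseteq> ball 0 rh" using bounded_subset_ballD[OF bounded_cball] by blast
 then have "?B \<subseteq> cball 0 rh" using ball_subset_cball by blast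
 then have qL: "q : L2" by (intro L2_I[OF C(2,1), of rh]) (auto simp: q_def indicator_def simp del: mem_cball)
 have k0: "ker t (x - y) = 0" if "y \<notin> ?B" for y
 by (rule ker_eq_0) (use that in \<open>simp add: dist_norm norm_minus_commute\<close>)
 have "(q y)\<^sup>2 <= t ^ 3 * exp b * ker t (x - y)" for y
 proof (cases "y : ?B")
 case True
 have "ker t (x - y) <= t ^ 3" unfolding ker_def pw_def using t by (intro power_mono) auto
 moreover have "exp (Ph y) <= exp b" using Ph(2)[OF True] by simp
 ultimately have "ker t (x - y) * exp (Ph y) <= t ^ 3 * exp b" using t by (intro mult_mono) auto
 then have "ker t (x - y) * exp (Ph y) * ker t (x - y) <= t ^ 3 * exp b * ker t (x - y)" by (rule mult_right_mono) simp
 moreover have "(exp (Ph y / 2))\<^sup>2 = exp (Ph y)" by (simp add: power2_eq_square flip: exp_add)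
 ultimately show ?thesis using True by (simp add: q_def power_mult_distrib) (simp add: power2_eq_square mult_ac)
 qed (use t in \<open>simp add: q_def\<close>)
 then have "L2_sq q <= (LBINT y. t ^ 3 * exp b * ker t (x - y))"
 unfolding L2_sq_def using L2_integrable[OF qL]
 by (intro Bochner_Integration.integral_mono integrable_mult_right ker_shift_integrable) auto
 then have q2: "L2_sq q <= t ^ 3 * exp b * ?m" by (simp add: integral_ker_shift)
 have nW: "(%y. norm (W y)) : L2" using W by (auto simp: L2_def)
 have nq: "(%y. norm (q y)) : L2" using qL by (auto simp: L2_def)
 have qW: "integrable lborel (%y. q y *\<^sub>R W y)"
 proof (rule Bochner_Integration.integrable_bound[OF L2_inner_integrable[OF nq nW]])
 show "(%y. q y *\<^sub>R W y) : borel_measurable lborel" using C(2) L2_measurable[OF W] by measurable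
 qed simp
 have "conv (ker t) w x = (LBINT y. ker t (x - y) *\<^sub>R k - q y *\<^sub>R W y)" unfolding conv_def
 proof (rule Bochner_Integration.integral_cong[OF refl])
 show "ker t (x - y) *\<^sub>R w y = ker t (x - y) *\<^sub>R k - q y *\<^sub>R W y" for y
 using k0[of y] w[of y] by (cases "y : ?B") (auto simp: q_def scaleR_conv_of_real algebra_simps)
 qed
 also have "... = ?m *\<^sub>R k - (LBINT y. q y *\<^sub>R W y)"
 using integral_ker_shift[of t x] by (simp add: Bochner_Integration.integral_diff integrable_scaleR_left ker_shift_integrable qW)
 finally have "moll t w x - k = (- (LBINT y. q y *\<^sub>R W y)) /\<^sub>R ?m"
 using m by (simp add: moll_def scaleR_diff_right)
 then have "(cmod (moll t w x - k))\<^sup>2 = (cmod (LBINT y. q y *\<^sub>R W y))\<^sup>2 / ?m\<^sup>2"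
 using m by (simp add: power_mult_distrib power_divide divide_inverse power_inverse mult.commute)
 also have "(cmod (LBINT y. q y *\<^sub>R W y))\<^sup>2 <= (L2_inner (%y. norm (q y)) (%y. norm (W y)))\<^sup>2"
 unfolding L2_inner_def by (intro power_mono Bochner_Integration.integral_norm_bound_integral qW L2_inner_integrable nq nW) auto
 also have "... <= L2_sq (%y. norm (q y)) * L2_sq (%y. norm (W y))" by (rule L2_Cauchy_Schwarz[OF nq nW])
 also have "... = L2_sq q * L2_sq W" by (simp add: L2_sq_def)
 also have "... <= t ^ 3 * exp b * ?m * L2_sq W" by (intro mult_right_mono q2 L2_sq_nonneg)
 finally show ?thesis using m by (simp add: divide_right_mono power2_eq_square)
qed

text \<open>The one-variable cutoff is applied to the affine function of |x - a|^2 that takes r1^2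
  to 0 and r2^2 to 1.\<close>

lemma ball_cutoff:
 fixes a :: "complex^'n"
 assumes r: "0 < r1" "r1 < r2"
 obtains chi :: "complex^'n => complex" where "C1 chi" "!!x. dist a x <= r1 ==> chi x = 1" "!!x. r2 <= dist a x ==> chi x = 0"
 "!!v x. dist a x <= r1 \<or> r2 <= dist a x ==> dzb v chi x = 0"
proof -
 define \<mu> where "\<mu> = 1 / (r2\<^sup>2 - r1\<^sup>2)"
 have "r1\<^sup>2 < r2\<^sup>2" using r by (intro power_strict_mono) auto
 then have l: "0 < \<mu>" "\<mu> * (r2\<^sup>2 - r1\<^sup>2) = 1" by (auto simp: \<mu>_def)
 define L where "L x = \<mu> * ((x - a) \<bullet> (x - a) - r1\<^sup>2)" for x
 define th' where "th' s = - 4 * pw 1 (1 - pw 2 (s - 0)) * pw 1 (s - 0)" for s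
 define chi where "chi x = complex_of_real (pw 2 (1 - pw 2 (L x - 0)))" for x
 have sq: "(x - a) \<bullet> (x - a) = (dist a x)\<^sup>2" for x by (simp add: dist_norm norm_minus_commute power2_norm_eq_inner[symmetric])
 have Ld: "(L has_derivative (%v. \<mu> * (2 * ((x - a) \<bullet> v)))) (at x)" for x
 unfolding L_def[abs_def] by (auto intro!: derivative_eq_intros simp: inner_commute)
 have Lc: "continuous_on S L" for S unfolding L_def[abs_def] by (intro continuous_intros)
 have d: "(chi has_derivative (%v. of_real (th' (L x) * (\<mu> * (2 * ((x - a) \<bullet> v)))))) (at x)" for x
 using has_derivative_of_real[OF DERIV_compose_FDERIV[OF DERIV_cutoff[of 0] Ld]] by (simp add: chi_def[abs_def] th'_def mult.commute)
 have c1: "C1 chi" by (rule C1I[OF d]) (unfold th'_def, intro continuous_intros Lc)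
 have L0: "L x <= 0" if "dist a x <= r1" for x
 unfolding L_def sq using l(1) power_mono[OF that, of 2] by (simp add: mult_le_0_iff)
 have L1: "1 <= L x" if "r2 <= dist a x" for x
 proof -
 have "\<mu> * (r2\<^sup>2 - r1\<^sup>2) <= L x" unfolding L_def sq using l(1) r power_mono[OF that, of 2] by (intro mult_left_mono) auto
 then show ?thesis using l(2) by simp
 qed
 have p1: "1 <= pw 2 (L x)" if "r2 <= dist a x" for x using L1[OF that] by (simp add: pw_def one_le_power)
 have z: "th' (L x) = 0" if "dist a x <= r1 \<or> r2 <= dist a x" for x
 using that L0[of x] p1[of x] by (auto simp: th'_def pw_eq_0)
 show ?thesis
 proof (rule that[OF c1])
 show "chi x = 1" if "dist a x <= r1" for x using L0[OF that] by (simp add: chi_def pw_eq_0) (simp add: pw_def)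
 show "chi x = 0" if "r2 <= dist a x" for x using p1[OF that] by (simp add: chi_def pw_eq_0)
 show "dzb v chi x = 0" if "dist a x <= r1 \<or> r2 <= dist a x" for v x
 unfolding dzb_def dd_eqI[OF d] z[OF that] by simp
 qed
qed

section \<open>Peak functions and compactness of holomorphic hulls\<close>

context psh_exhaustion
begin

text \<open>For a large multiple \<open>N\<close> of \<open>P\<close>, with an approximate logarithmic pole at \<open>a\<close>, the correction of a cutoff
 function at \<open>a\<close> is small both near \<open>a\<close> and where \<open>P\<close> is smaller than \<open>P a\<close>.\<close>

lemma peak_function:
 assumes a: "a : Om" and K: "compact K" "K \<subseteq> Om" and d0: "0 < de0" and PK: "!!x. x : K ==> P x <= P a - 3 * de0"
 obtains F where "F holomorphic_on_Cn Om" "cmod (F a - 1) <= 1/4" "!!x. x : K ==> cmod (F x) <= 1/4"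
proof -
 have opn: "open {x\<in>Om. P x < c}" for c
 using continuous_open_preimage[OF P_continuous open_domain open_lessThan, of c] by (simp add: vimage_def Int_def)
 have opg: "open {x\<in>Om. c < P x}" for c
 using continuous_open_preimage[OF P_continuous open_domain open_greaterThan, of c] by (simp add: vimage_def Int_def)
 have "open ({x\<in>Om. P x < P a + de0} \<inter> {x\<in>Om. P a - de0 < P x})" by (intro open_Int opn opg)
 moreover have "a : {x\<in>Om. P x < P a + de0} \<inter> {x\<in>Om. P a - de0 < P x}" using a d0 by simp
 ultimately obtain r2 where r2: "0 < r2" "cball a r2 \<subseteq> {x\<in>Om. P x < P a + de0} \<inter> {x\<in>Om. P a - de0 < P x}"
 unfolding open_contains_cball by blast
 define r1 where "r1 = r2 / 2"
 have r1: "0 < r1" "r1 < r2" using r2 by (auto simp: r1_def)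
 obtain chi :: "complex^'n => complex" where chi: "C1 chi" "!!x. dist a x <= r1 ==> chi x = 1" "!!x. r2 <= dist a x ==> chi x = 0"
 "!!v x. dist a x <= r1 \<or> r2 <= dist a x ==> dzb v chi x = 0"
 using ball_cutoff[OF r1] by metis
 have chis: "supported Om chi" unfolding supported_def
 by (intro exI[of _ "cball a r2"]) (use r2 chi(3) in \<open>auto simp: not_le\<close>)
 \<comment> \<open>The \<partial>-bar derivative of chi, supported in the annulus between r1 and r2;
   a weak solution for this datum corrects chi to a holomorphic function.\<close>
 define v where "v x = (\<chi> j. dzb (axis j 1) chi x)" for x
 have vj: "v x $ j = dzb (axis j 1) chi x" for x j by (simp add: v_def)
 have vc: "continuous_on UNIV v" unfolding v_def by (intro continuous_on_vec_lambda dzb_continuous[OF chi(1), unfolded eta_contract_eq])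
 have v0: "v x = 0" if "dist a x <= r1 \<or> r2 <= dist a x" for x using chi(4)[OF that] by (simp add: vec_eq_iff vj)
 have vs: "supported Om v" unfolding supported_def
 by (intro exI[of _ "cball a r2"]) (use r2 v0 in \<open>auto simp: not_le\<close>)
 have closed: "(LBINT x. v x $ k * dzb (axis j 1) h x - v x $ j * dzb (axis k 1) h x) = 0"
 if h: "C1 h" "supported Om h" for h j k
 proof -
 have i: "integrable lborel (%x. dzb u chi x * dzb u' h x)" for u u'
 by (rule supported_integrable[OF continuous_on_mult[OF dzb_continuous[OF chi(1)] dzb_continuous[OF h(1)]] supported_mult_left[OF supported_dzb[OF h(2)]]])
 show ?thesis unfolding vj using integral_dzb_dzb_commute[OF chi(1) h, of "axis k 1" "axis j 1"]
 by (simp add: Bochner_Integration.integral_diff[OF i i])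
 qed
 define Q where "Q = {x\<in>Om. P x < P a - 2 * de0}"
 have KQ: "K \<subseteq> Q" using K(2) PK d0 by (force simp: Q_def)
 obtain de where de: "de > 0" "(\<Union>x\<in>K. ball x de) \<subseteq> Q"
 using compact_subset_open_imp_ball_epsilon_subset[OF K(1) opn[of "P a - 2 * de0"]] KQ by (auto simp: Q_def)
 define S where "S = {x\<in>Om. P x <= P a + de0}"
 have "bounded S" unfolding S_def by (rule compact_imp_bounded[OF sublevel_compact])
 then obtain R0 where R0: "0 < R0" "!!x. x : S ==> norm x <= R0" by (auto simp: bounded_pos)
 define R where "R = R0 + norm a"
 have R: "x \<bullet> x <= R\<^sup>2" "(x - a) \<bullet> (x - a) <= R\<^sup>2" if "x : S" for x
 proof -
 have "norm x <= R" "norm (x - a) <= R" using R0(2)[OF that] norm_triangle_ineq4[of x a] norm_ge_zero[of a] unfolding R_def by linarith+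
 then show "x \<bullet> x <= R\<^sup>2" "(x - a) \<bullet> (x - a) <= R\<^sup>2" unfolding power2_norm_eq_inner[symmetric] by (auto intro: power_mono)
 qed
 define ll where "ll = ln (R\<^sup>2 + 1) - ln (r1\<^sup>2)"
 \<comment> \<open>So small that over S the logarithmic term is at most its value c ln (r1^2) at the
   inner radius plus de0 / 2.\<close>
 define c where "c = de0 / (2 * (\<bar>ll\<bar> + 1))"
 have c: "0 < c" "c * ln (R\<^sup>2 + 1) <= c * ln (r1\<^sup>2) + de0 / 2"
 proof -
 show "0 < c" using d0 by (simp add: c_def)
 then have "c * ll <= c * (\<bar>ll\<bar> + 1)" by (intro mult_left_mono) auto
 also have "... = de0 / 2"
 proof -
 have "de0 / (2 * y) * y = de0 / 2" if "y ~= 0" for y :: real using that by simp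
 moreover have "\<bar>ll\<bar> + 1 ~= 0" using abs_ge_zero[of ll] by linarith
 ultimately show ?thesis unfolding c_def by blast
 qed
 finally show "c * ln (R\<^sup>2 + 1) <= c * ln (r1\<^sup>2) + de0 / 2" by (simp add: ll_def algebra_simps)
 qed
 \<comment> \<open>So small that the pole lowers the logarithmic term near a by 5 de0 / 2: there P
   may exceed P a - de0 by 2 de0, and de0 / 2 has to remain.\<close>
 define et where "et = min 1 (r1\<^sup>2 / 2 * exp (- (5 * de0 / (2 * c))))"
 have et: "0 < et" "et <= 1" "et <= r1\<^sup>2" "c * ln (2 * et) <= c * ln (r1\<^sup>2) - 5 * de0 / 2"
 proof -
 show "0 < et" "et <= 1" using r1 by (auto simp: et_def)
 have e1: "exp (- (5 * de0 / (2 * c))) <= 1" using d0 c by simp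
 have "et <= r1\<^sup>2 / 2 * exp (- (5 * de0 / (2 * c)))" by (simp add: et_def)
 also have "... <= r1\<^sup>2 / 2 * 1" by (intro mult_left_mono e1) simp
 also have "... <= r1\<^sup>2" by simp
 finally show "et <= r1\<^sup>2" .
 have "2 * et <= r1\<^sup>2 * exp (- (5 * de0 / (2 * c)))" by (simp add: et_def)
 then have "ln (2 * et) <= ln (r1\<^sup>2 * exp (- (5 * de0 / (2 * c))))" using \<open>0 < et\<close> by (intro ln_mono) auto
 also have "... = ln (r1\<^sup>2) - 5 * de0 / (2 * c)" using r1 by (simp add: ln_mult)
 finally have "c * ln (2 * et) <= c * (ln (r1\<^sup>2) - 5 * de0 / (2 * c))" using c by (intro mult_left_mono) auto
 then show "c * ln (2 * et) <= c * ln (r1\<^sup>2) - 5 * de0 / 2" using c by (simp add: right_diff_distrib)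
 qed
 \<comment> \<open>A lower bound of p where v does not vanish, while p <= m - de0 / 2 both near a
   and over Q. After multiplication by N this gap makes the correction small.\<close>
 define m where "m = P a - de0 + c * ln (r1\<^sup>2)"
 define p where "p x = P x + c * ln ((x - a) \<bullet> (x - a) + et)" for x
 have pos: "0 < (x - a) \<bullet> (x - a) + et" for x using et(1) inner_ge_zero[of "x - a"] by linarith
 have lnle: "c * ln ((x - a) \<bullet> (x - a) + et) <= c * ln u" if "(x - a) \<bullet> (x - a) + et <= u" for x u
 using c pos[of x] that by (intro mult_left_mono ln_mono) auto
 have dsq: "(dist a x)\<^sup>2 = (x - a) \<bullet> (x - a)" for x
 unfolding power2_norm_eq_inner[symmetric] dist_norm norm_minus_commute[of a x] ..
 have p_ann: "m <= p x" if "v x ~= 0" for x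
 proof -
 have "\<not> (dist a x <= r1 \<or> r2 <= dist a x)" using v0[of x] that by blast
 then have x: "r1 <= dist a x" "x : cball a r2" by auto
 have "r1\<^sup>2 <= (x - a) \<bullet> (x - a) + et"
 using power_mono[OF x(1), of 2] r1 et(1) unfolding dsq by linarith
 then have "c * ln (r1\<^sup>2) <= c * ln ((x - a) \<bullet> (x - a) + et)" using c r1 by (intro mult_left_mono ln_mono) auto
 then show ?thesis using x(2) r2(2) by (auto simp: p_def m_def)
 qed
 have p_a: "p x <= m - de0 / 2" "x : S" if "x : cball a (sqrt et)" for x
 proof -
 have "sqrt et <= r1" using real_sqrt_le_mono[OF et(3)] r1 by simp
 then have x: "x : cball a r2" using that r1 by auto
 have "dist a x ^ 2 <= (sqrt et)\<^sup>2" using that by (intro power_mono) auto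
 then have "(x - a) \<bullet> (x - a) <= et" using et(1) unfolding dsq by simp
 then have "c * ln ((x - a) \<bullet> (x - a) + et) <= c * ln (2 * et)" by (intro lnle) simp
 then show "p x <= m - de0 / 2" "x : S" using x r2(2) et(4) by (auto simp: p_def m_def S_def)
 qed
 have p_Q: "p x <= m - de0 / 2" "x : S" if "x : Q" for x
 proof -
 show "x : S" using that d0 by (auto simp: Q_def S_def)
 then have "c * ln ((x - a) \<bullet> (x - a) + et) <= c * ln (R\<^sup>2 + 1)" using R(2) et(2) by (intro lnle) force
 then show "p x <= m - de0 / 2" using that c(2) by (auto simp: p_def m_def Q_def)
 qed
 define V where "V = L2_sq v"
 define C where "C t = 3 * t ^ 3 * exp (R\<^sup>2) * V / kmass t TYPE(complex^'n)" for t
 have C0: "0 <= C t" if "0 < t" for t using kmass_pos[OF that, where 'a="complex^'n"] that by (auto simp: C_def V_def L2_sq_nonneg)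
 define tK where "tK = (de / 2)\<^sup>2"
 have tK: "0 < tK" "sqrt tK = de / 2" using de(1) by (auto simp: tK_def)
 \<comment> \<open>From exp (s) >= s alone, 16 C t <= N de0 / 2 <= exp (N de0 / 2) for both radii;
   16 is the inverse square of the tolerance 1/4.\<close>
 define N where "N = 32 * (C et + C tK) / de0"
 have N: "0 <= N" using C0 et(1) tK(1) d0 by (simp add: N_def)
 have small: "C t * exp (- (N * de0 / 2)) <= (1/4)\<^sup>2" if "t = et \<or> t = tK" for t
 proof -
 have le: "C t <= C et + C tK" using that C0 et(1) tK(1) by auto
 have "16 * C t <= N * de0 / 2" using le d0 by (simp add: N_def)
 also have "... <= exp (N * de0 / 2)" using exp_ge_add_one_self[of "N * de0 / 2"] by linarith
 finally show ?thesis by (simp add: exp_minus field_simps power2_eq_square)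
 qed
 obtain q1 q2 where ln2: "C2_on UNIV (%x. ln ((x - a) \<bullet> (x - a) + et)) q1 q2" "!!x t. 0 <= lev q2 x t" by (rule ln_sq_C2[OF et(1), of a]) blast
 define g where "g x = ((N * c) * ln ((x - a) \<bullet> (x - a) + et) + 0) + (x - 0) \<bullet> (x - 0)" for x
 note gC = C2_on_add[OF C2_on_affine[OF ln2(1), of "N * c" 0] C2_on_sq[of UNIV 0], folded g_def]
 have glev: "(norm t)\<^sup>2 <= lev (%x v w. (N * c) * q2 x v w + 2 * (w \<bullet> v)) x t" for x t
 unfolding lev_add lev_affine[of "N * c"] lev_sq using mult_nonneg_nonneg[OF _ ln2(2)[of x t], of "N * c"] N c by simp
 define Ph where "Ph x = N * P x + g x" for x
 have Php: "Ph x = N * p x + x \<bullet> x" for x by (simp add: Ph_def g_def p_def algebra_simps)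
 have Phc: "continuous_on Om Ph" unfolding Ph_def[abs_def]
 by (intro continuous_intros P_continuous continuous_on_subset[OF C2_on_continuous(1)[OF gC]]) auto
 obtain W :: "complex^'n => complex" where W: "W : L2" "L2_sq W <= 3 * L2_sq (%x. exp (- Ph x / 2) *\<^sub>R v x)"
 "!!h j. C1 h ==> supported Om h ==> (LBINT x. v x $ j * h x) = - (LBINT x. of_real (exp (Ph x / 2)) * W x * dzb (axis j 1) h x)"
 unfolding Ph_def using dbar_solution[OF gC glev N vc vs closed] by blast
 have vL: "v : L2" by (rule supported_continuous_L2[OF vc vs])
 have WV: "L2_sq W <= 3 * (exp (- (N * m)) * V)"
 proof -
 have s: "supported Om (%x. exp (- Ph x / 2) *\<^sub>R v x)" by (rule supported_mono[OF vs]) simp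
 have "L2_sq (%x. exp (- Ph x / 2) *\<^sub>R v x) <= (exp (- (N * m) / 2))\<^sup>2 * L2_sq v"
 proof (rule L2_sq_mono(2)[OF vL])
 show "(%x. exp (- Ph x / 2) *\<^sub>R v x) : borel_measurable borel"
 by (intro borel_measurable_continuous_onI local_continuous[OF open_domain _ s] continuous_intros Phc continuous_on_subset[OF vc]) auto
 fix x
 show "norm (exp (- Ph x / 2) *\<^sub>R v x) <= exp (- (N * m) / 2) * norm (v x)"
 proof (cases "v x = 0")
 case False
 have "N * m <= N * p x + x \<bullet> x" using mult_left_mono[OF p_ann[OF False] N] by (simp add: add_increasing2)
 then show ?thesis unfolding Php by (simp add: mult_right_mono)
 qed simp
 qed
 moreover have "(exp (- (N * m) / 2))\<^sup>2 = exp (- (N * m))" by (simp add: power2_eq_square flip: exp_add)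
 ultimately show ?thesis using W(2) by (simp add: V_def)
 qed
 define w where "w x = chi x - of_real (exp (Ph x / 2)) * W x" for x
 have int: "integrable lborel (%x. indicator L x *\<^sub>R w x)" if L: "compact L" "L \<subseteq> Om" for L
 proof -
 have ec: "continuous_on L (%x. exp (Ph x / 2))" using continuous_on_subset[OF Phc L(2)] by (intro continuous_intros) auto
 obtain B where B: "!!x. norm (indicator L x *\<^sub>R exp (Ph x / 2)) <= B" "(%x. indicator L x *\<^sub>R exp (Ph x / 2)) : borel_measurable borel"
 by (rule bounded_multiplier[OF L(1) ec]) blast
 have [measurable]: "W : borel_measurable borel" "chi : borel_measurable borel" "L : sets borel"
 using L2_measurable[OF W(1)] C1_measurable[OF chi(1)] borel_compact[OF L(1)] by auto
 have 1: "(%x. (indicator L x *\<^sub>R exp (Ph x / 2)) *\<^sub>R W x) : L2"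
 by (rule L2_sq_mono(1)[OF W(1), of _ B]) (use B in \<open>auto simp: borel_measurable_scaleR intro!: mult_right_mono\<close>)
 have 2: "(%x. indicator L x *\<^sub>R chi x) : L2"
 by (rule L2_sq_mono(1)[OF supported_continuous_L2[OF C1_continuous[OF chi(1)] chis], of _ 1]) (auto simp: indicator_def)
 obtain rh where "L \<subseteq> ball 0 rh" using bounded_subset_ballD[OF compact_imp_bounded[OF L(1)]] by blast
 then have rh: "L \<subseteq> cball 0 rh" using ball_subset_cball by blast
 have eq: "indicator L x *\<^sub>R w x = indicator L x *\<^sub>R chi x - (indicator L x *\<^sub>R exp (Ph x / 2)) *\<^sub>R W x" for x
 by (simp add: w_def scaleR_conv_of_real algebra_simps)
 show ?thesis
 by (rule L2_supported_integrable[of _ rh]) (unfold eq, rule L2_diff[OF 2 1], use rh in \<open>auto simp: indicator_def simp del: mem_cball\<close>)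
 qed
 have weak: "(LBINT x. w x * dzb (axis j 1) h x) = 0" if h: "C1 h" "supported Om h" for h j
 proof -
 let ?d = "dzb (axis j 1) h"
 have i1: "integrable lborel (%x. chi x * ?d x)"
 by (rule supported_integrable[OF continuous_on_mult[OF C1_continuous[OF chi(1)] dzb_continuous[OF h(1)]] supported_mult_left[OF supported_dzb[OF h(2)]]])
 have s: "supported Om (%x. of_real (exp (Ph x / 2)) * ?d x)" by (rule supported_mult_left[OF supported_dzb[OF h(2)]])
 have "continuous_on UNIV (%x. of_real (exp (Ph x / 2)) * ?d x)"
 by (rule local_continuous[OF open_domain _ s]) (intro continuous_intros Phc dzb_continuous[OF h(1), unfolded eta_contract_eq], auto)
 from L2_mult_continuous(2)[OF W(1) this s] have i2: "integrable lborel (%x. of_real (exp (Ph x / 2)) * W x * ?d x)" by (simp add: mult_ac)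
 have "(LBINT x. w x * ?d x) = (LBINT x. chi x * ?d x) - (LBINT x. of_real (exp (Ph x / 2)) * W x * ?d x)"
 unfolding Bochner_Integration.integral_diff[OF i1 i2, symmetric] by (simp add: w_def left_diff_distrib)
 then show ?thesis using W(3)[OF h, of j] integral_dzb_by_parts[OF chi(1) h, of "axis j 1"] by (simp add: vj)
 qed
 obtain F where F: "F holomorphic_on_Cn Om" "!!x t. 0 < t ==> cball x (sqrt t) \<subseteq> Om ==> F x = moll t w x"
 by (rule weyl_lemma[OF open_domain, of w], erule (1) int, erule (1) weak, blast)
 \<comment> \<open>One estimate serves both ends: k = 1 with radius sqrt et at a, and k = 0 with
   radius de / 2 at the points of K.\<close>
 have close: "cmod (F x - k) <= 1/4"
 if t: "t = et \<or> t = tK" and B: "!!y. y : cball x (sqrt t) ==> p y <= m - de0 / 2 \<and> y : S \<and> chi y = k" for x t k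
 proof -
 have t0: "0 < t" using t et(1) tK(1) by auto
 have sub: "cball x (sqrt t) \<subseteq> Om" using B by (auto simp: S_def)
 have "(cmod (moll t w x - k))\<^sup>2 <= t ^ 3 * exp (N * (m - de0 / 2) + R\<^sup>2) / kmass t TYPE(complex^'n) * L2_sq W"
 proof (rule moll_exp_bound[OF W(1) t0 continuous_on_subset[OF Phc sub]])
 fix y assume y: "y : cball x (sqrt t)"
 show "Ph y <= N * (m - de0 / 2) + R\<^sup>2" unfolding Php using B[OF y] R(1)[of y] N by (intro add_mono mult_left_mono) auto
 show "w y = k - of_real (exp (Ph y / 2)) * W y" using B[OF y] by (simp add: w_def)
 qed
 also have "... <= t ^ 3 * exp (N * (m - de0 / 2) + R\<^sup>2) / kmass t TYPE(complex^'n) * (3 * (exp (- (N * m)) * V))"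
 using t0 kmass_pos[OF t0, where 'a="complex^'n"] by (intro mult_left_mono WV) auto
 also have "... = C t * exp (- (N * de0 / 2))"
 proof -
 have "exp (N * (m - de0 / 2) + R\<^sup>2) * exp (- (N * m)) = exp (R\<^sup>2) * exp (- (N * de0 / 2))"
 unfolding exp_add[symmetric] by (simp add: algebra_simps)
 then show ?thesis unfolding C_def by (simp add: field_simps)
 qed
 also have "... <= (1/4)\<^sup>2" by (rule small[OF t])
 finally have "cmod (moll t w x - k) <= 1/4" by (rule power2_le_imp_le) simp
 then show ?thesis using F(2)[OF t0 sub] by simp
 qed
 show ?thesis
 proof (rule that[OF F(1)])
 have "sqrt et <= r1" using real_sqrt_le_mono[OF et(3)] r1 by simp
 then show "cmod (F a - 1) <= 1/4" by (intro close[of et]) (use p_a chi(2) in force)+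
 fix x assume x: "x : K"
 have "cmod (F x - 0) <= 1/4"
 proof (rule close[of tK])
 fix y assume "y : cball x (sqrt tK)"
 then have "y : ball x de" using de(1) by (simp add: tK)
 then have y: "y : Q" using de(2) x by blast
 then have "y \<notin> cball a r2" using r2(2) d0 by (force simp: Q_def)
 then show "p y <= m - de0 / 2 \<and> y : S \<and> chi y = 0" using p_Q[OF y] chi(3)[of y] by simp
 qed simp
 then show "cmod (F x) <= 1/4" by simp
 qed
qed

text \<open>Peak functions keep out of the hull every point where P exceeds its maximum on K. So the
  hull lies in a compact sublevel set, where it is cut out by closed conditions; for empty K the
  hull is empty.\<close>

lemma hull_compact:
 assumes K: "compact K" "K \<subseteq> Om"
 shows "compact (holomorphic_hull Om K)"
proof -
 have out: "z \<notin> holomorphic_hull Om K" if z: "z : Om" and d: "0 < de0" "!!x. x : K ==> P x <= P z - 3 * de0" for z de0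
 proof -
 obtain F where F: "F holomorphic_on_Cn Om" "cmod (F z - 1) <= 1/4" "!!x. x : K ==> cmod (F x) <= 1/4"
 using peak_function[OF z K d] by metis
 have "1 - cmod (F z) <= 1/4" using F(2) norm_triangle_ineq2[of 1 "F z"] by (simp add: norm_minus_commute)
 then have "ereal (1/4) < ereal (cmod (F z))" by simp
 moreover have "(SUP w\<in>K. ereal (cmod (F w))) <= ereal (1/4)" by (rule SUP_least) (simp only: ereal_less_eq F(3))
 ultimately have "\<not> ereal (cmod (F z)) <= (SUP w\<in>K. ereal (cmod (F w)))" unfolding not_le by (rule le_less_trans[rotated])
 then show ?thesis using F(1) by (auto simp: holomorphic_hull_def)
 qed
 obtain M where M: "!!z. z : holomorphic_hull Om K ==> P z <= M"
 proof (cases "K = {}")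
 case True
 then have "holomorphic_hull Om K = {}" using out[of _ 1] by (auto simp: holomorphic_hull_def)
 then show ?thesis using that by simp
 next
 case False
 obtain x0 where x0: "x0 : K" "!!x. x : K ==> P x <= P x0"
 using continuous_attains_sup[OF K(1) False continuous_on_subset[OF P_continuous K(2)]] by blast
 show ?thesis
 proof (rule that[of "P x0"], rule ccontr)
 fix z assume z: "z : holomorphic_hull Om K" "\<not> P z <= P x0"
 have "z \<notin> holomorphic_hull Om K"
 by (rule out[of _ "(P z - P x0) / 3"]) (use z x0(2) in \<open>auto simp: holomorphic_hull_def field_simps\<close>)
 then show False using z by simp
 qed
 qed
 define S where "S = {x\<in>Om. P x <= M}"
 have S: "compact S" "S \<subseteq> Om" using sublevel_compact by (auto simp: S_def)
 define q where "q f = (SUP w\<in>K. ereal (cmod (f w)))" for f :: "complex^'n => complex"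
 have "closed (S \<inter> (%z. ereal (cmod (f z))) -` {..q f})" if "f holomorphic_on_Cn Om" for f
 by (intro continuous_closed_preimage continuous_on_ereal continuous_on_norm compact_imp_closed[OF S(1)] closed_atMost
 continuous_on_subset[OF holomorphic_on_Cn_imp_continuous_on[OF that] S(2)])
 then have "closed (\<Inter>f\<in>{f. f holomorphic_on_Cn Om}. S \<inter> (%z. ereal (cmod (f z))) -` {..q f})" by (intro closed_INT) auto
 then have "compact (S \<inter> (\<Inter>f\<in>{f. f holomorphic_on_Cn Om}. S \<inter> (%z. ereal (cmod (f z))) -` {..q f}))" by (rule compact_Int_closed[OF S(1)])
 moreover have "holomorphic_hull Om K = S \<inter> (\<Inter>f\<in>{f. f holomorphic_on_Cn Om}. S \<inter> (%z. ereal (cmod (f z))) -` {..q f})"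
 using M by (auto simp: holomorphic_hull_def S_def q_def)
 ultimately show ?thesis by simp
qed

end

section \<open>From plurisubharmonicity of - ln d to holomorphic convexity\<close>

text \<open>The integrand is at least |y|^2 plus a term linear in the circle variable, whose mean is
  0.\<close>

lemma norm_sq_circle_mean:
 fixes y v :: "complex^'n"
 shows "2 * pi * (y \<bullet> y) <= integral {0..2*pi} (%th. (y + (of_real r * cis th) *s v) \<bullet> (y + (of_real r * cis th) *s v))"
proof -
 define H where "H th = (y \<bullet> y) * th + 2 * r * ((y \<bullet> v) * sin th - (y \<bullet> (\<i> *s v)) * cos th)" for th
 have w: "(of_real r * cis th) *s v = (r * cos th) *\<^sub>R v + (r * sin th) *\<^sub>R (\<i> *s v)" for th
 by (simp add: vec_eq_iff complex_eq_iff)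
 have "(H has_real_derivative (y \<bullet> y) + 2 * r * ((y \<bullet> v) * cos th + (y \<bullet> (\<i> *s v)) * sin th)) (at th)" for th
 unfolding H_def[abs_def] by (auto intro!: derivative_eq_intros)
 then have "((%th. (y \<bullet> y) + 2 * r * ((y \<bullet> v) * cos th + (y \<bullet> (\<i> *s v)) * sin th)) has_integral (H (2 * pi) - H 0)) {0..2*pi}"
 by (intro fundamental_theorem_of_calculus) (auto simp flip: has_real_derivative_iff_has_vector_derivative intro: has_field_derivative_at_within)
 moreover have "(%th. (y + (of_real r * cis th) *s v) \<bullet> (y + (of_real r * cis th) *s v)) integrable_on {0..2*pi}"
 unfolding w by (intro integrable_continuous_real continuous_intros)
 moreover have "(y \<bullet> y) + 2 * r * ((y \<bullet> v) * cos th + (y \<bullet> (\<i> *s v)) * sin th) <= (y + (of_real r * cis th) *s v) \<bullet> (y + (of_real r * cis th) *s v)" for th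
 proof -
 let ?w = "(of_real r * cis th) *s v"
 have "y \<bullet> ?w = r * ((y \<bullet> v) * cos th + (y \<bullet> (\<i> *s v)) * sin th)" unfolding w by (simp add: inner_add_right algebra_simps)
 moreover have "0 <= ?w \<bullet> ?w" by simp
 ultimately show ?thesis by (simp add: inner_add_left inner_add_right inner_commute[of ?w y])
 qed
 ultimately have "H (2 * pi) - H 0 <= integral {0..2*pi} (%th. (y + (of_real r * cis th) *s v) \<bullet> (y + (of_real r * cis th) *s v))"
 using has_integral_le[OF _ integrable_integral] by blast
 then show ?thesis by (simp add: H_def mult_ac)
qed

text \<open>The summand |x|^2 makes sublevel sets compact for unbounded Om too. P <= c means d >=
  exp (|x|^2 - c) > 0, a closed condition that excludes the frontier; and ln d grows at most
  linearly, d being at most the distance to a fixed frontier point, so |x|^2 keeps the set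
  bounded.\<close>

theorem plurisubharmonic_imp_holomorphically_convex:
 fixes Om :: "(complex^'n) set"
 assumes dom: "is_domain Om" and nU: "Om ~= UNIV"
 and psh: "plurisubharmonic_on Om (%z. ereal (- ln (boundary_dist Om z)))"
 shows "holomorphically_convex Om"
proof -
 have Om: "open Om" using dom by (simp add: is_domain_def)
 have fr: "frontier Om ~= {}" by (rule frontier_domain_nonempty[OF dom nU])
 let ?d = "boundary_dist Om"
 have dp: "0 < ?d x" if "x : Om" for x by (rule boundary_dist_pos[OF Om fr that])
 define P where "P x = - ln (?d x) + x \<bullet> x" for x
 have lc: "continuous_on Om (%x. - ln (?d x))" by (intro continuous_intros) (use dp in force)
 interpret psh_exhaustion Om P
 proof
 show "open Om" by (rule Om)
 show "continuous_on Om P" unfolding P_def[abs_def] by (intro continuous_on_add lc continuous_intros)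
 show "compact {x\<in>Om. P x <= c}" for c
 proof -
 have iff: "P x <= c \<longleftrightarrow> exp (x \<bullet> x - c) <= ?d x" if "x : Om" for x
 using dp[OF that] ln_ge_iff[of "?d x" "x \<bullet> x - c"] by (auto simp: P_def)
 have "{x\<in>Om. P x <= c} = closure Om \<inter> {x. exp (x \<bullet> x - c) <= ?d x}"
 proof (intro set_eqI iffI)
 fix x assume x: "x : closure Om \<inter> {x. exp (x \<bullet> x - c) <= ?d x}"
 then have "0 < ?d x" using exp_gt_zero[of "x \<bullet> x - c"] by (auto simp del: exp_gt_zero)
 then have "x \<notin> frontier Om" by (auto simp: boundary_dist_def)
 then have "x : Om" using x Om by (auto simp: frontier_def interior_open)
 then show "x : {x\<in>Om. P x <= c}" using x iff by auto
 qed (use iff closure_subset in auto)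
 moreover have "closed {x. exp (x \<bullet> x - c) <= ?d x}" by (intro closed_Collect_le continuous_intros)
 ultimately have cl: "closed {x\<in>Om. P x <= c}" by (simp add: closed_Int)
 obtain b where b: "b : frontier Om" using fr by blast
 have "norm x <= 1 + (\<bar>c\<bar> + norm b)" if x: "x : Om" "P x <= c" for x
 proof (rule ccontr)
 assume n: "\<not> norm x <= 1 + (\<bar>c\<bar> + norm b)"
 have "?d x <= dist x b" unfolding boundary_dist_def by (rule infdist_le[OF b])
 also have "... <= norm x + norm b" unfolding dist_norm by (rule norm_triangle_ineq4)
 finally have "ln (?d x) <= norm x + norm b" using ln_le_minus_one[OF dp[OF x(1)]] by linarith
 then have "norm x * norm x <= c + norm x + norm b" using x(2) by (simp add: P_def dot_square_norm power2_eq_square)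
 moreover have "norm x * (1 + (\<bar>c\<bar> + norm b)) <= norm x * norm x" using n by (intro mult_left_mono) auto
 moreover have "\<bar>c\<bar> + norm b < norm x * (\<bar>c\<bar> + norm b) \<or> \<bar>c\<bar> + norm b = 0"
 proof -
 have "1 < norm x" using n norm_ge_zero[of b] by linarith
 have "\<bar>c\<bar> + norm b < norm x * (\<bar>c\<bar> + norm b)" if "0 < \<bar>c\<bar> + norm b"
 using mult_strict_right_mono[OF \<open>1 < norm x\<close> that] by simp
 moreover have "0 <= \<bar>c\<bar> + norm b" by simp
 ultimately show ?thesis unfolding le_less by metis
 qed
 moreover have "norm x * (1 + (\<bar>c\<bar> + norm b)) < norm x * norm x" using n norm_ge_zero[of b] by (intro mult_strict_left_mono) linarith+
 ultimately show False using abs_ge_self[of c] by (auto simp: distrib_left)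
 qed
 then have "bounded {x\<in>Om. P x <= c}" by (auto simp: bounded_iff)
 then show ?thesis using cl by (simp add: compact_eq_bounded_closed)
 qed
 fix y v :: "complex^'n" and r :: real
 assume r: "0 < r" and sub: "!!s. cmod s <= r ==> y + s *s v : Om"
 define u where "u ta = - ln (?d (y + ta *s v))" for ta
 have line: "continuous_on A (%ta. y + ta *s v)" for A
 by (intro continuous_intros)
 have uc: "continuous_on (sphere 0 r) u" unfolding u_def
 by (rule continuous_on_compose2[OF lc line]) (use sub in auto)
 have "subharmonic_on {ta. y + ta *s v : Om} (%ta. ereal (u ta))" using psh by (auto simp: plurisubharmonic_on_def u_def)
 moreover have "cball 0 r \<subseteq> {ta. y + ta *s v : Om}" using sub by auto
 ultimately have "ereal (u 0) <= circle_mean (%ta. ereal (u ta)) 0 r" using r by (auto simp: subharmonic_on_def)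
 then have 1: "2 * pi * u 0 <= integral {0..2*pi} (%th. u (of_real r * cis th))"
 unfolding circle_mean_real[OF uc r] by (simp add: field_simps)
 have "continuous_on {0..2*pi} (%th. u (of_real r * cis th))" using circle_param_continuous[OF uc r] by simp
 then have i1: "(%th. u (of_real r * cis th)) integrable_on {0..2*pi}" by (rule integrable_continuous_real)
 have i2: "(%th. (y + (of_real r * cis th) *s v) \<bullet> (y + (of_real r * cis th) *s v)) integrable_on {0..2*pi}"
 by (intro integrable_continuous_real continuous_on_inner continuous_on_compose2[OF line[of UNIV]] continuous_intros) auto
 have "integral {0..2*pi} (%th. P (y + (of_real r * cis th) *s v)) = integral {0..2*pi} (%th. u (of_real r * cis th))
 + integral {0..2*pi} (%th. (y + (of_real r * cis th) *s v) \<bullet> (y + (of_real r * cis th) *s v))"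
 unfolding P_def u_def[symmetric] by (rule Henstock_Kurzweil_Integration.integral_add[OF i1 i2])
 then show "2 * pi * P y <= integral {0..2*pi} (%th. P (y + (of_real r * cis th) *s v))"
 using 1 norm_sq_circle_mean[of y r v] by (simp add: P_def u_def distrib_left right_diff_distrib)
 qed
 show ?thesis using dom hull_compact by (simp add: holomorphically_convex_def)
qed

theorem theorem0p2:
  fixes \<Omega> :: "(complex ^ 'n) set"
  assumes "is_domain \<Omega>" and "\<Omega> \<noteq> UNIV"
  shows "(domain_of_holomorphy \<Omega> \<longleftrightarrow>
            plurisubharmonic_on \<Omega> (\<lambda>z. ereal (- ln (boundary_dist \<Omega> z)))) \<and>
         (holomorphically_convex \<Omega> \<longleftrightarrow>
            plurisubharmonic_on \<Omega> (\<lambda>z. ereal (- ln (boundary_dist \<Omega> z))))"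
  using domain_of_holomorphy_imp_plurisubharmonic[of \<Omega>] plurisubharmonic_imp_holomorphically_convex[OF assms]
    holomorphically_convex_imp_domain_of_holomorphy[of \<Omega>] assms by blast

end
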